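(* Fix $\alpha,K,M_0,M>0$. For all sufficiently large $n$, the center--outer dyadic peeling estimator $\hat\Sigma_{\mathcal G,\mathrm F}$ described in the context is $\rho$-zCDP and $$ \sup_{P\in\mathcal P_\alpha^{\mathcal G}}\frac1d\,\mathbb E_P\|\hat\Sigma_{\mathcal G,\mathrm F}-\Sigma(P)\|_F^2\;\lesssim_{\log}\;\Bigl(n^{-\frac{2\alpha+1}{2\alpha+2}}\wedge\frac dn\Bigr)+\Bigl(\bigl(\tfrac d{\rho n^2}\bigr)^{\frac{2\alpha+1}{2\alpha+3}}\wedge\frac{d^3}{\rho n^2}\Bigr). $$
   Context: Norms and notation: $\|\cdot\|_F$ Frobenius norm, $a\wedge b=\min(a,b)$, $a\vee b=\max(a,b)$. $\|X\|_{\psi_2}=\sup_{\|v\|_2=1}\inf\{t>0:\mathbb E e^{\langle X,v\rangle^2/t^2}\le2\}$. $\chi_R(z)=z\min\{1,R/\|z\|_2\}$, $\chi_R(0)=0$ (for vectors and scalars). $A[B]$ is $A$ with entries outside $B$ set to zero. $\Pi_{M_0}$ is the spectral projection of a symmetric matrix that clips its eigenvalues to $[0,M_0]$. Privacy. Datasets are adjacent if they differ in one observation. For $\lambda>1$, $D_\lambda(P\|Q)=\frac1{\lambda-1}\log\int(\frac{dP}{dQ})^\lambda dQ$. A randomized algorithm $A$ is $\rho$-zCDP if $D_\lambda(A(S)\|A(S'))\le\rho\lambda$ for all adjacent $S,S'$ and all $\lambda\in(1,\infty)$. The exponential mechanism over a finite candidate set with privacy parameter $\varepsilon$ and scores of replacement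 sensitivity at most $\Delta$ selects a candidate with probability proportional to $\exp(\varepsilon\cdot\mathrm{score}/(2\Delta))$; below $\Delta=2L/n$. All randomizations are fresh. Model and class. Data are i.i.d. with mean $0$ (standing assumption). $\mathcal G_\alpha(M_0,M)$: $d\times d$ covariance matrices with $0\preceq\Sigma\preceq M_0I_d$ and $\max_j\sum_{i:|i-j|>k}|\Sigma_{ij}|\le Mk^{-\alpha}$ for all $k\ge1$. $\mathcal P^{\mathcal G}_\alpha$: (mean-zero) distributions $P$ on $\mathbb R^d$ with $\|X\|_{\psi_2}\le K$ and covariance $\Sigma(P)\in\mathcal G_\alpha(M_0,M)$. Regime. Sequences $(n,d,\rho)$, $n\to\infty$, with $d\gtrsim\log n$, $0<\rho\lesssim1$ (fixed upper bound), $d/(\rho n^2)\to0$. $a\lesssim_{\log}b$ means $a\le C\log^A(edn/\rho)\,b$ with $C,A$ not depending on $n,d,\rho$ (they may depend on $\alpha,K,M_0,M$ and the regime constants). Blocks. For the center size $k_0$ below, the data are padded with deterministic zero coordinates so that $d=2^Jk_0$ (the estimate of the original $\Sigma$ being the corresponding principal submatrix). For $k\in\{k_0,2k_0,\dots\}$: $N_k=d/k$, $I_{k,\ell}=\{1+(\ell-1)k,\dots,\ell k\}$, $B_{k;\ell,r}=I_{k,\ell}\times I_{k,\ell+r}$, $\mathcal B_k=\{B_{k;2\ell-1,2},B_{k;2\ell-1,3},B_{k;2\ell,2}:1\le\ell<N_{2k}\}$. $J(k_0)=1\vee(\log_2(d/k_0)-1)$. Below, $C,C_1,C_{\mathcal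 G}$ denote suitable sufficiently large fixed constants ($C_{\mathcal G}$ depends only on $(M,M_0)$); $L=CK^2\log n$. $\mathsf{DPCovBlock}(X,B;\rho_B,R)$, $B=I\times J$: return $\frac1n\sum_i\chi_R(X_{i,I})\chi_R(X_{i,J})^\top+\sigma_BM_B$, $\sigma_B^2=18R^4/(\rho_Bn^2)$, $M_B$ the $B$-block of a symmetric $d\times d$ matrix with i.i.d. $N(0,1)$ upper triangular entries. Peeling release (block $B=I\times J$ of side $k$, radius $a$, budget $\rho_B$): choose $r\in\arg\min_{1\le r\le k}\{a^2/r+r/n+kr^2/(\rho_Bn^2)\}$. Set $\widetilde A_{uv}=\frac1n\sum_i\chi_L(X_{i,I(u)}X_{i,J(v)})$ for $u,v\in[k]$, where $I(u)$, $J(v)$ are the $u$-th and $v$-th elements of $I$, $J$. Starting with all $k^2$ coordinates available, perform $kr$ successive exponential-mechanism selections (without replacement) with score $|\widetilde A_{uv}|$ and privacy parameter $\sqrt{\rho_B/(kr)}$; let $\hat S$ be the selected set. Return the matrix with entries $\widetilde A_{uv}+G_{uv}$ on $\hat S$, $G_{uv}$ i.i.d. $N(0,4L^2kr/(\rho_Bn^2))$, and zero elsewhere. The estimator. Choose $k_0\ge1$ with (up to constant factors) $k_0\asymp\frac d2\wedge n^{1/(2\alpha+2)}\wedge(\frac d{\rho n^2})^{-1/(2\alpha+3)}$, and put $k_+=d/2$. (1) Center: with $R_0=K\sqrt{C_1(k_0+\log n)}$, set $\hat\Sigma[B_{k_0;\ell,r}]=\mathsf{DPCovBlock}(X,B_{k_0;\ell,r};(\rho/4)/(2N_{k_0}),R_0)$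 for $r\in\{0,1\}$, $\ell+r\le N_{k_0}$; all other entries start at zero. (2) For each $k\in\{k_0,2k_0,\dots\}$ with $k<k_+$, let $\rho_k=\rho/(4J(k_0)N_{2k})$ and, for each $B\in\mathcal B_k$, let $\hat\Sigma[B]$ be the peeling release with budget $\rho_k$ and radius $a=C_{\mathcal G}k^{-\alpha}$. (3) Fill the lower triangular part by symmetry and return $\hat\Sigma_{\mathcal G,\mathrm F}=\Pi_{M_0}(\hat\Sigma)$. *)

theory Defs
  imports "HOL-Probability.Probability"
begin

text \<open>Since the dimension varies, vectors and matrices are functions on \<open>{1..d}\<close> and
  \<open>{1..d} \<times> {1..d}\<close>; coordinates, observations and blocks are numbered from 1. A data set \<open>X\<close>
  consists of observations \<open>X i\<close> with coordinates \<open>X i j\<close>. A randomized algorithm is given by the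
  law of its output as a function of the data set.\<close>

abbreviation idx :: "nat \<Rightarrow> (nat \<times> nat) set" where
  "idx d \<equiv> {1..d} \<times> {1..d}"

definition vec_space :: "nat \<Rightarrow> (nat \<Rightarrow> real) measure" where
  "vec_space d = (\<Pi>\<^sub>M j\<in>{1..d}. borel)"

definition data_space :: "nat \<Rightarrow> nat \<Rightarrow> (nat \<Rightarrow> nat \<Rightarrow> real) measure" where
  "data_space n d = (\<Pi>\<^sub>M i\<in>{1..n}. vec_space d)"

definition mat_space :: "(nat \<times> nat) set \<Rightarrow> (nat \<times> nat \<Rightarrow> real) measure" where
  "mat_space B = (\<Pi>\<^sub>M b\<in>B. borel)"

abbreviation std_normal :: "real measure" where
  "std_normal \<equiv> density lborel (\<lambda>x. ennreal (std_normal_density x))"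

definition frob_norm :: "nat \<Rightarrow> (nat \<times> nat \<Rightarrow> real) \<Rightarrow> real" where
  "frob_norm d A = L2_set A (idx d)"


subsection \<open>Privacy\<close>

text \<open>The divergence is infinite unless \<open>P \<lless> Q\<close>; in that case, for probability measures, the
  integral is at least 1, so the real logarithm only meets positive arguments.\<close>

definition renyi_div :: "real \<Rightarrow> 'a measure \<Rightarrow> 'a measure \<Rightarrow> ereal" where
  "renyi_div s P Q =
     (let I = \<integral>\<^sup>+ x. ennreal (enn2real (RN_deriv Q P x) powr s) \<partial>Q
      in if absolutely_continuous Q P \<and> I < \<infinity> then ereal (ln (enn2real I) / (s - 1)) else \<infinity>)"

definition adjacent :: "nat \<Rightarrow> nat \<Rightarrow> (nat \<Rightarrow> nat \<Rightarrow> real) \<Rightarrow> (nat \<Rightarrow> nat \<Rightarrow> real) \<Rightarrow> bool" where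
  "adjacent n d S S' \<longleftrightarrow> S \<in> space (data_space n d) \<and> S' \<in> space (data_space n d) \<and>
     (\<exists>i\<in>{1..n}. \<forall>j\<in>{1..n} - {i}. S j = S' j)"

definition zCDP ::
  "nat \<Rightarrow> nat \<Rightarrow> real \<Rightarrow> ((nat \<Rightarrow> nat \<Rightarrow> real) \<Rightarrow> (nat \<times> nat \<Rightarrow> real) measure) \<Rightarrow> bool" where
  "zCDP n d \<rho> A \<longleftrightarrow>
     A \<in> data_space n d \<rightarrow>\<^sub>M prob_algebra (mat_space (idx d)) \<and>
     (\<forall>S S'. adjacent n d S S' \<longrightarrow>
        (\<forall>s>1. renyi_div s (A S) (A S') \<le> ereal (\<rho> * s)))"

text \<open>To be used with \<open>B\<close> finite and nonempty.\<close>

definition exp_mech :: "real \<Rightarrow> real \<Rightarrow> ('c \<Rightarrow> real) \<Rightarrow> 'c set \<Rightarrow> 'c pmf" where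
  "exp_mech \<epsilon> \<Delta> score B =
     embed_pmf (\<lambda>c. if c \<in> B
       then exp (\<epsilon> * score c / (2 * \<Delta>)) / (\<Sum>c'\<in>B. exp (\<epsilon> * score c' / (2 * \<Delta>))) else 0)"


subsection \<open>Model\<close>

definition psi2_norm :: "nat \<Rightarrow> (nat \<Rightarrow> real) measure \<Rightarrow> ennreal" where
  "psi2_norm d P =
     (SUP v\<in>{v. L2_set v {1..d} = 1}.
        INF t\<in>{t. t > 0 \<and> (\<integral>\<^sup>+ x. ennreal (exp ((\<Sum>j=1..d. x j * v j)\<^sup>2 / t\<^sup>2)) \<partial>P) \<le> 2}. ennreal t)"

definition mean_vec :: "(nat \<Rightarrow> real) measure \<Rightarrow> nat \<Rightarrow> real" where
  "mean_vec P i = (\<integral> x. x i \<partial>P)"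

definition cov_mat :: "(nat \<Rightarrow> real) measure \<Rightarrow> nat \<times> nat \<Rightarrow> real" where
  "cov_mat P = (\<lambda>(i, j). \<integral> x. (x i - mean_vec P i) * (x j - mean_vec P j) \<partial>P)"

definition class_G :: "nat \<Rightarrow> real \<Rightarrow> real \<Rightarrow> real \<Rightarrow> (nat \<times> nat \<Rightarrow> real) set" where
  "class_G d \<alpha> M0 M = {A.
     (\<forall>i\<in>{1..d}. \<forall>j\<in>{1..d}. A (i, j) = A (j, i)) \<and>
     (\<forall>x. 0 \<le> (\<Sum>i=1..d. \<Sum>j=1..d. x i * A (i, j) * x j) \<and>
          (\<Sum>i=1..d. \<Sum>j=1..d. x i * A (i, j) * x j) \<le> M0 * (\<Sum>i=1..d. (x i)\<^sup>2)) \<and>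
     (\<forall>k\<ge>1. \<forall>j\<in>{1..d}.
        (\<Sum>i | i \<in> {1..d} \<and> \<bar>int i - int j\<bar> > int k. \<bar>A (i, j)\<bar>) \<le> M * real k powr (- \<alpha>))}"

definition class_P :: "nat \<Rightarrow> real \<Rightarrow> real \<Rightarrow> real \<Rightarrow> real \<Rightarrow> (nat \<Rightarrow> real) measure set" where
  "class_P d \<alpha> K M0 M = {P.
     prob_space P \<and> sets P = sets (vec_space d) \<and>
     (\<forall>i\<in>{1..d}. mean_vec P i = 0) \<and>
     psi2_norm d P \<le> ennreal K \<and>
     cov_mat P \<in> class_G d \<alpha> M0 M}"

text \<open>Normalized squared Frobenius risk from \<open>n\<close> i.i.d. observations with distribution \<open>P\<close>; the
  inner integral is over the randomness of the algorithm.\<close>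

definition frob_risk :: "nat \<Rightarrow> nat \<Rightarrow>
    ((nat \<Rightarrow> nat \<Rightarrow> real) \<Rightarrow> (nat \<times> nat \<Rightarrow> real) measure) \<Rightarrow> (nat \<Rightarrow> real) measure \<Rightarrow> ennreal" where
  "frob_risk n d A P = ennreal (1 / real d) *
     (\<integral>\<^sup>+ X. (\<integral>\<^sup>+ S. ennreal ((frob_norm d (\<lambda>b. S b - cov_mat P b))\<^sup>2) \<partial>A X)
        \<partial>(\<Pi>\<^sub>M i\<in>{1..n}. P))"


subsection \<open>Clipping\<close>

text \<open>\<open>chi_vec R I x\<close> is the truncation of the subvector of \<open>x\<close> with index set \<open>I\<close>. In both
  definitions the value at zero is zero, since the coordinates vanish.\<close>

definition chi_vec :: "real \<Rightarrow> nat set \<Rightarrow> (nat \<Rightarrow> real) \<Rightarrow> nat \<Rightarrow> real" where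
  "chi_vec R I x = (\<lambda>j. x j * min 1 (R / L2_set x I))"

definition chi :: "real \<Rightarrow> real \<Rightarrow> real" where
  "chi R z = z * min 1 (R / \<bar>z\<bar>)"

text \<open>Clipping of the eigenvalues \<open>l p\<close> of a symmetric matrix \<open>A\<close> to \<open>[0, M0]\<close>; the columns of \<open>U\<close>
  form an orthonormal basis of eigenvectors. The result does not depend on the choice of \<open>U\<close>.\<close>

definition spectral_clip :: "nat \<Rightarrow> real \<Rightarrow> (nat \<times> nat \<Rightarrow> real) \<Rightarrow> nat \<times> nat \<Rightarrow> real" where
  "spectral_clip d M0 A = (THE B. B \<in> extensional (idx d) \<and>
     (\<exists>U l.
        (\<forall>p\<in>{1..d}. \<forall>q\<in>{1..d}. (\<Sum>i=1..d. U i p * U i q) = (if p = q then 1 else 0 :: real)) \<and>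
        (\<forall>(i, j)\<in>idx d. A (i, j) = (\<Sum>p=1..d. l p * U i p * U j p)) \<and>
        (\<forall>(i, j)\<in>idx d. B (i, j) = (\<Sum>p=1..d. max 0 (min M0 (l p)) * U i p * U j p))))"


subsection \<open>Block releases\<close>

text \<open>Laws of the released blocks, on the matrices indexed by \<open>I \<times> J\<close>. The Gaussian matrix in
  \<open>DPCovBlock\<close> is given by its upper triangular entries \<open>Z\<close>.\<close>

definition DPCovBlock :: "nat \<Rightarrow> nat \<Rightarrow> (nat \<Rightarrow> nat \<Rightarrow> real) \<Rightarrow> nat set \<Rightarrow> nat set \<Rightarrow>
    real \<Rightarrow> real \<Rightarrow> (nat \<times> nat \<Rightarrow> real) measure" where
  "DPCovBlock n d X I J \<rho>\<^sub>B R =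
     distr (\<Pi>\<^sub>M b\<in>{(i, j). 1 \<le> i \<and> i \<le> j \<and> j \<le> d}. std_normal) (mat_space (I \<times> J))
       (\<lambda>Z. \<lambda>(i, j)\<in>I \<times> J.
          (1 / real n) * (\<Sum>m=1..n. chi_vec R I (X m) i * chi_vec R J (X m) j)
          + sqrt (18 * R ^ 4 / (\<rho>\<^sub>B * (real n)\<^sup>2)) * Z (min i j, max i j))"

definition clipped_mean :: "nat \<Rightarrow> real \<Rightarrow> (nat \<Rightarrow> nat \<Rightarrow> real) \<Rightarrow> nat \<times> nat \<Rightarrow> real" where
  "clipped_mean n L X = (\<lambda>(i, j). (1 / real n) * (\<Sum>m=1..n. chi L (X m i * X m j)))"

text \<open>Law of the set selected by successive exponential mechanisms without replacement.\<close>

primrec peel_select :: "real \<Rightarrow> real \<Rightarrow> ('c \<Rightarrow> real) \<Rightarrow> 'c set \<Rightarrow> nat \<Rightarrow> 'c set pmf" where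
  "peel_select \<epsilon> \<Delta> score B 0 = return_pmf {}"
| "peel_select \<epsilon> \<Delta> score B (Suc m) =
     bind_pmf (peel_select \<epsilon> \<Delta> score B m)
       (\<lambda>S. map_pmf (\<lambda>c. insert c S) (exp_mech \<epsilon> \<Delta> score (B - S)))"

definition peel_rank :: "nat \<Rightarrow> nat \<Rightarrow> real \<Rightarrow> real \<Rightarrow> nat" where
  "peel_rank n k a \<rho>\<^sub>B =
     arg_min_on (\<lambda>r. a\<^sup>2 / real r + real r / real n + real k * (real r)\<^sup>2 / (\<rho>\<^sub>B * (real n)\<^sup>2)) {1..k}"

definition peel_release :: "nat \<Rightarrow> real \<Rightarrow> (nat \<Rightarrow> nat \<Rightarrow> real) \<Rightarrow> nat \<Rightarrow> nat set \<Rightarrow> nat set \<Rightarrow>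
    real \<Rightarrow> real \<Rightarrow> (nat \<times> nat \<Rightarrow> real) measure" where
  "peel_release n L X k I J a \<rho>\<^sub>B =
     (let r = peel_rank n k a \<rho>\<^sub>B; A = clipped_mean n L X;
          \<sigma> = sqrt (4 * L\<^sup>2 * real (k * r) / (\<rho>\<^sub>B * (real n)\<^sup>2))
      in measure_pmf (peel_select (sqrt (\<rho>\<^sub>B / real (k * r))) (2 * L / real n)
                        (\<lambda>b. \<bar>A b\<bar>) (I \<times> J) (k * r))
         \<bind> (\<lambda>S. distr (\<Pi>\<^sub>M b\<in>S. std_normal) (mat_space (I \<times> J))
                   (\<lambda>g. \<lambda>b\<in>I \<times> J. if b \<in> S then A b + \<sigma> * g b else 0)))"


subsection \<open>The center--outer dyadic peeling estimator\<close>

text \<open>In this section \<open>D\<close> is the padded dimension, the least \<open>2 ^ J * k0\<close> that is at least \<open>d\<close>.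
  A triple \<open>(k, l, r)\<close> stands for the block in block row \<open>l\<close> and block column \<open>l + r\<close> of the
  partition into blocks of side \<open>k\<close>.\<close>

definition pad_exp :: "nat \<Rightarrow> nat \<Rightarrow> nat" where
  "pad_exp d k0 = (LEAST J. d \<le> 2 ^ J * k0)"

definition pad_dim :: "nat \<Rightarrow> nat \<Rightarrow> nat" where
  "pad_dim d k0 = 2 ^ pad_exp d k0 * k0"

definition pad :: "nat \<Rightarrow> (nat \<Rightarrow> nat \<Rightarrow> real) \<Rightarrow> nat \<Rightarrow> nat \<Rightarrow> real" where
  "pad d X = (\<lambda>i j. if j \<in> {1..d} then X i j else 0)"

definition seg :: "nat \<Rightarrow> nat \<Rightarrow> nat set" where
  "seg k l = {1 + (l - 1) * k..l * k}"

definition block :: "nat \<times> nat \<times> nat \<Rightarrow> (nat \<times> nat) set" where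
  "block = (\<lambda>(k, l, r). seg k l \<times> seg k (l + r))"

definition center_blocks :: "nat \<Rightarrow> nat \<Rightarrow> (nat \<times> nat \<times> nat) set" where
  "center_blocks D k0 = {(k0, l, r) | l r. 1 \<le> l \<and> r \<in> {0, 1} \<and> l + r \<le> D div k0}"

definition outer_scales :: "nat \<Rightarrow> nat \<Rightarrow> nat set" where
  "outer_scales D k0 = {2 ^ j * k0 | j. 2 * (2 ^ j * k0) < D}"

definition outer_blocks :: "nat \<Rightarrow> nat \<Rightarrow> (nat \<times> nat \<times> nat) set" where
  "outer_blocks D k0 = (\<Union>k\<in>outer_scales D k0. \<Union>l\<in>{1..<D div (2 * k)}.
     {(k, 2 * l - 1, 2), (k, 2 * l - 1, 3), (k, 2 * l, 2)})"

text \<open>The constants \<open>C\<close>, \<open>C1\<close>, \<open>CG\<close> are those in the truncation level of the outer blocks, the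
  truncation radius of the center blocks and the peeling radius. The first case is a center block,
  the second an outer block. Since \<open>pad_exp d k0\<close> is the binary logarithm of \<open>D / k0\<close>, the natural
  number \<open>max 1 (pad_exp d k0 - 1)\<close> is the number of outer scales, or 1 if there are none.\<close>

definition block_release :: "real \<Rightarrow> real \<Rightarrow> real \<Rightarrow> real \<Rightarrow> real \<Rightarrow> nat \<Rightarrow> nat \<Rightarrow> real \<Rightarrow> nat \<Rightarrow>
    (nat \<Rightarrow> nat \<Rightarrow> real) \<Rightarrow> nat \<times> nat \<times> nat \<Rightarrow> (nat \<times> nat \<Rightarrow> real) measure" where
  "block_release \<alpha> K C C1 CG n d \<rho> k0 X = (\<lambda>(k, l, r).
     let D = pad_dim d k0; Y = pad d X in
     if r \<le> 1
     then DPCovBlock n D Y (seg k l) (seg k (l + r))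
            ((\<rho> / 4) / (2 * real (D div k0))) (K * sqrt (C1 * (real k0 + ln (real n))))
     else peel_release n (C * K\<^sup>2 * ln (real n)) Y k (seg k l) (seg k (l + r))
            (CG * real k powr (- \<alpha>))
            (\<rho> / (4 * real (max 1 (pad_exp d k0 - 1)) * real (D div (2 * k)))))"

text \<open>The released blocks are pairwise disjoint and lie on or above the diagonal blocks, so at most
  one summand contributes to each entry with \<open>i \<le> j\<close>.\<close>

definition assemble :: "(nat \<times> nat \<times> nat) set \<Rightarrow> (nat \<times> nat \<times> nat \<Rightarrow> nat \<times> nat \<Rightarrow> real) \<Rightarrow>
    nat \<times> nat \<Rightarrow> real" where
  "assemble T \<omega> = (\<lambda>(i, j). let b = (min i j, max i j) in
     \<Sum>t\<in>T. if b \<in> block t then \<omega> t b else 0)"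

text \<open>Given the data, the blocks are released independently: their joint law is a product.\<close>

definition peel_estimator :: "real \<Rightarrow> real \<Rightarrow> real \<Rightarrow> real \<Rightarrow> real \<Rightarrow> real \<Rightarrow> nat \<Rightarrow> nat \<Rightarrow> real \<Rightarrow> nat \<Rightarrow>
    (nat \<Rightarrow> nat \<Rightarrow> real) \<Rightarrow> (nat \<times> nat \<Rightarrow> real) measure" where
  "peel_estimator \<alpha> K M0 C C1 CG n d \<rho> k0 X =
     (let D = pad_dim d k0; T = center_blocks D k0 \<union> outer_blocks D k0
      in distr (\<Pi>\<^sub>M t\<in>T. block_release \<alpha> K C C1 CG n d \<rho> k0 X t) (mat_space (idx d))
           (\<lambda>\<omega>. restrict (spectral_clip D M0 (assemble T \<omega>)) (idx d)))"


subsection \<open>Center size and rate\<close>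

definition k0_target :: "real \<Rightarrow> nat \<Rightarrow> nat \<Rightarrow> real \<Rightarrow> real" where
  "k0_target \<alpha> n d \<rho> =
     min (real d / 2) (min (real n powr (1 / (2 * \<alpha> + 2)))
       ((real d / (\<rho> * (real n)\<^sup>2)) powr (- 1 / (2 * \<alpha> + 3))))"

definition rate :: "real \<Rightarrow> nat \<Rightarrow> nat \<Rightarrow> real \<Rightarrow> real" where
  "rate \<alpha> n d \<rho> =
     min (real n powr (- (2 * \<alpha> + 1) / (2 * \<alpha> + 2))) (real d / real n)
     + min ((real d / (\<rho> * (real n)\<^sup>2)) powr ((2 * \<alpha> + 1) / (2 * \<alpha> + 3)))
           ((real d) ^ 3 / (\<rho> * (real n)\<^sup>2))"

end

theory Submission
  imports Defs
begin

text \<open>Privacy. A Renyi bound of order \<open>s\<close> between \<open>P\<close> and \<open>Q\<close> is used in a dual form, \<open>renyi_le\<close>: for every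
bounded test function \<open>h \<ge> 0\<close>, the \<open>P\<close>-integral of \<open>h\<^sup>s\<^sup>-\<^sup>1\<close> is controlled by the \<open>L\<^sup>s(Q)\<close> norm of \<open>h\<close>.
Hoelder's inequality derives it from a bound on the \<open>s\<close>-th moment of the density, and the truncated
density is the test function that gives the moment back (\<open>renyi_div_le\<close>). In this form no density of a
composed mechanism is ever computed: postprocessing substitutes into \<open>h\<close>, adaptive composition is a
nested application (\<open>renyi_le_bind\<close>), and products add up. Only two divergences are calculated,
\<open>(a - b)\<^sup>2 / 2\<close> for a unit Gaussian shifted from \<open>b\<close> to \<open>a\<close>, and \<open>\<epsilon>\<^sup>2 / 2\<close> for an \<open>\<epsilon>\<close>-private selection. A
peeling release spends half of its budget on its selections and half on its noise; the center blocks
together spend at most \<open>\<rho> / 4\<close> and the outer scales at most \<open>3 \<rho> / 4\<close>. A private algorithm must be a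
Markov kernel, so the spectral clip has to be measurable. It is the Frobenius projection onto the convex
set of matrices between \<open>0\<close> and \<open>M0\<close> times the identity, hence Lipschitz. That the projection exists
rests on the spectral theorem, proved here for matrices indexed by \<open>{1..d}\<close> with \<open>d\<close> a variable.

Risk. The covariance matrix lies in the convex set, so projecting does not increase the distance to it,
and since the blocks tile the upper triangle, the squared error is at most twice the sum of the block
errors. A center block has a variance of order \<open>1 / n\<close> per entry, a squared truncation bias of the same
order because its radius exceeds the norm of the subvector except with probability \<open>O(1 / n)\<close>, and the noise.
An outer block at scale \<open>k\<close> has columns of absolute sum at most \<open>a\<close>, of order \<open>k\<close> to the power \<open>- \<alpha>\<close>. If
\<open>k * r\<close> entries are selected, one of them is at most \<open>a / r\<close>, so every entry left out is at most \<open>a / r\<close>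
up to sampling and selection errors, and the energy left out is of order
\<open>k * (1 / r - 1 / k) * a\<^sup>2\<close> (\<open>unselected_energy\<close>). The factor \<open>1 / r - 1 / k\<close> instead of \<open>1 / r\<close> is
essential: it vanishes if everything is selected, which is the right comparison in the regime where the
empirical covariance matrix needs no regularization.

Rates. The rank minimizes \<open>a\<^sup>2 / r\<close> plus sampling and privacy errors over \<open>r\<close>, and \<open>a\<^sup>2 / k\<close> can be
subtracted since it is the same for all \<open>r\<close>; so it may be compared with any \<open>s\<close> between \<open>1\<close> and \<open>k\<close>
(\<open>outer_risk_le\<close>). If the target size is \<open>d / 2\<close>, then \<open>s = k\<close> gives the rate of the unregularized
estimator. Otherwise \<open>s = k0\<close>: then \<open>a\<^sup>2 / k0\<close> is at most a multiple of \<open>k0\<close> to the power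
\<open>- (2 * \<alpha> + 1)\<close>, and the target size balances this against the larger of the sampling and privacy
errors (\<open>target_rate\<close>). The logarithms, from the truncation level, the uniform deviations, the
selections, the division of the budget and the number of scales, give a sixth power.\<close>

section \<open>Renyi divergence bounds in dual form\<close>

text \<open>The number \<open>t\<close> bounds the \<open>L\<^sup>s(Q)\<close> norm of \<open>h\<close>. Boundedness of \<open>h\<close> keeps all integrals finite, so that
the fibrewise norms of a test function on a product are again test functions.\<close>
definition renyi_le :: "real \<Rightarrow> real \<Rightarrow> 'a measure \<Rightarrow> 'a measure \<Rightarrow> bool" where
  "renyi_le s r P Q \<longleftrightarrow>
     (\<forall>h B t. h \<in> borel_measurable Q \<and> (\<forall>x\<in>space Q. 0 \<le> h x \<and> h x \<le> B) \<and> 0 \<le> t \<and>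
        (\<integral>\<^sup>+x. ennreal (h x powr s) \<partial>Q) \<le> ennreal (t powr s) \<longrightarrow>
        (\<integral>\<^sup>+x. ennreal (h x powr (s - 1)) \<partial>P) \<le> ennreal (exp ((s - 1) * r) * t powr (s - 1)))"

lemma renyi_leD:
  assumes "renyi_le s r P Q" "h \<in> borel_measurable Q"
    "\<And>x. x \<in> space Q \<Longrightarrow> 0 \<le> h x" "\<And>x. x \<in> space Q \<Longrightarrow> h x \<le> B" "0 \<le> t"
    "(\<integral>\<^sup>+x. ennreal (h x powr s) \<partial>Q) \<le> ennreal (t powr s)"
  shows "(\<integral>\<^sup>+x. ennreal (h x powr (s - 1)) \<partial>P) \<le> ennreal (exp ((s - 1) * r) * t powr (s - 1))"
  using assms unfolding renyi_le_def by blast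

text \<open>Young's inequality with the conjugate exponents \<open>s / (s - 1)\<close> and \<open>s\<close>.\<close>
lemma powr_young:
  fixes s u v :: real
  assumes "s > 1" "u \<ge> 0" "v \<ge> 0"
  shows "u powr (s - 1) * v \<le> (s - 1) / s * u powr s + v powr s / s"
proof -
  have "(u powr (s - 1)) * v \<le> (u powr (s - 1)) powr (s / (s - 1)) / (s / (s - 1)) + v powr s / s"
    by (rule Youngs_inequality) (use assms in \<open>auto simp: field_simps\<close>)
  thus ?thesis using assms by (simp add: powr_powr mult.commute)
qed

text \<open>Hoelder's inequality between \<open>f\<close> and \<open>h\<^sup>s\<^sup>-\<^sup>1\<close>, obtained by integrating Young's inequality for the two
functions divided by the bounds on their norms.\<close>
lemma renyi_le_density:
  fixes f :: "'a \<Rightarrow> real"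
  assumes s: "s > 1" and f[measurable]: "f \<in> borel_measurable Q" and f0: "\<And>x. x \<in> space Q \<Longrightarrow> 0 \<le> f x"
    and I: "(\<integral>\<^sup>+x. ennreal (f x powr s) \<partial>Q) \<le> ennreal (exp (s * (s - 1) * r))"
  shows "renyi_le s r (density Q (\<lambda>x. ennreal (f x))) Q"
  unfolding renyi_le_def
proof (intro allI impI, elim conjE)
  fix h :: "'a \<Rightarrow> real" and B t :: real
  assume h[measurable]: "h \<in> borel_measurable Q" and hB: "\<forall>x\<in>space Q. 0 \<le> h x \<and> h x \<le> B" and t: "0 \<le> t"
    and le: "(\<integral>\<^sup>+x. ennreal (h x powr s) \<partial>Q) \<le> ennreal (t powr s)"
  have eq: "(\<integral>\<^sup>+x. ennreal (h x powr (s - 1)) \<partial>density Q (\<lambda>x. ennreal (f x)))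
     = (\<integral>\<^sup>+x. ennreal (f x * h x powr (s - 1)) \<partial>Q)"
    by (subst nn_integral_density) (auto intro!: nn_integral_cong simp: ennreal_mult' f0)
  show "(\<integral>\<^sup>+x. ennreal (h x powr (s - 1)) \<partial>density Q (\<lambda>x. ennreal (f x)))
      \<le> ennreal (exp ((s - 1) * r) * t powr (s - 1))"
  proof (cases "t = 0")
    case True
    with le have "(\<integral>\<^sup>+x. ennreal (h x powr s) \<partial>Q) = 0" using s by simp
    hence "AE x in Q. ennreal (h x powr s) = 0"
      by (subst (asm) nn_integral_0_iff_AE) auto
    hence "AE x in Q. ennreal (f x * h x powr (s - 1)) = 0"
      by eventually_elim (auto simp: ennreal_eq_0_iff)
    hence "(\<integral>\<^sup>+x. ennreal (f x * h x powr (s - 1)) \<partial>Q) = 0"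
      by (subst nn_integral_0_iff_AE) auto
    thus ?thesis by (simp add: eq)
  next
    case False
    hence t: "t > 0" using t by simp
    \<comment> \<open>The normalization: \<open>F\<close> bounds the \<open>L\<^sup>s(Q)\<close> norm of \<open>f\<close>, as \<open>t\<close> does for \<open>h\<close>.\<close>
    define F where "F = exp ((s - 1) * r)"
    have F: "F > 0" by (simp add: F_def)
    have Fs: "F powr s = exp (s * (s - 1) * r)" by (simp add: F_def powr_def mult_ac)
    have pw: "f x * h x powr (s - 1) \<le> F * t powr (s - 1) * ((s - 1) / s * (h x powr s / t powr s) + f x powr s / F powr s / s)"
      if x: "x \<in> space Q" for x
    proof -
      have "(h x / t) powr (s - 1) * (f x / F) \<le> (s - 1) / s * (h x / t) powr s + (f x / F) powr s / s"
        using hB f0 x t F s by (intro powr_young) auto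
      hence "F * t powr (s - 1) * ((h x / t) powr (s - 1) * (f x / F)) \<le>
         F * t powr (s - 1) * ((s - 1) / s * (h x / t) powr s + (f x / F) powr s / s)"
        using F by (intro mult_left_mono) auto
      moreover have "F * t powr (s - 1) * ((h x / t) powr (s - 1) * (f x / F)) = f x * h x powr (s - 1)"
        using F t hB x by (simp add: powr_divide)
      ultimately show ?thesis using F t hB x f0 by (simp add: powr_divide) (simp add: ac_simps)
    qed
    have "(\<integral>\<^sup>+x. ennreal (f x * h x powr (s - 1)) \<partial>Q) \<le>
       (\<integral>\<^sup>+x. ennreal (F * t powr (s - 1) * ((s - 1) / s / t powr s)) * ennreal (h x powr s)
            + ennreal (F * t powr (s - 1) / F powr s / s) * ennreal (f x powr s) \<partial>Q)"
    proof (rule nn_integral_mono)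
      fix x assume x: "x \<in> space Q"
      define a where "a = F * t powr (s - 1) * ((s - 1) / s / t powr s)"
      define b where "b = F * t powr (s - 1) / F powr s / s"
      have ab: "a \<ge> 0" "b \<ge> 0" using s F t by (auto simp: a_def b_def)
      have "f x * h x powr (s - 1) \<le> a * h x powr s + b * f x powr s"
        using pw[OF x] by (simp add: a_def b_def algebra_simps)
      thus "ennreal (f x * h x powr (s - 1)) \<le> ennreal a * ennreal (h x powr s) + ennreal b * ennreal (f x powr s)"
        using ab by (simp add: ennreal_mult'[symmetric] ennreal_plus[symmetric] ennreal_leI del: ennreal_plus)
    qed
    also have "\<dots> = ennreal (F * t powr (s - 1) * ((s - 1) / s / t powr s)) * (\<integral>\<^sup>+x. ennreal (h x powr s) \<partial>Q)
            + ennreal (F * t powr (s - 1) / F powr s / s) * (\<integral>\<^sup>+x. ennreal (f x powr s) \<partial>Q)"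
      by (subst nn_integral_add) (auto simp: nn_integral_cmult)
    also have "\<dots> \<le> ennreal (F * t powr (s - 1) * ((s - 1) / s / t powr s)) * ennreal (t powr s)
            + ennreal (F * t powr (s - 1) / F powr s / s) * ennreal (F powr s)"
      using le I unfolding Fs by (intro add_mono mult_left_mono) auto
    also have "\<dots> = ennreal (F * t powr (s - 1) * ((s - 1) / s / t powr s) * t powr s + F * t powr (s - 1) / F powr s / s * F powr s)"
      using s F t by (simp add: ennreal_mult'[symmetric] ennreal_plus[symmetric] del: ennreal_plus)
    also have "F * t powr (s - 1) * ((s - 1) / s / t powr s) * t powr s + F * t powr (s - 1) / F powr s / s * F powr s
        = F * t powr (s - 1)"
      using s F t by (simp add: field_simps)
    finally show ?thesis by (simp add: eq F_def)
  qed
qed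

lemma renyi_le_refl:
  assumes "s > 1" "prob_space Q" shows "renyi_le s 0 Q Q"
proof -
  have "renyi_le s 0 (density Q (\<lambda>x. ennreal 1)) Q"
    by (rule renyi_le_density) (use assms in \<open>auto simp: prob_space.emeasure_space_1\<close>)
  thus ?thesis by (simp add: density_1)
qed

lemma renyi_le_mono:
  assumes "renyi_le s r P Q" "r \<le> r'" "s > 1"
  shows "renyi_le s r' P Q"
  unfolding renyi_le_def
proof (intro allI impI, elim conjE)
  fix h :: "_ \<Rightarrow> real" and B t :: real
  assume h: "h \<in> borel_measurable Q" "\<forall>x\<in>space Q. 0 \<le> h x \<and> h x \<le> B" "0 \<le> t"
    "(\<integral>\<^sup>+x. ennreal (h x powr s) \<partial>Q) \<le> ennreal (t powr s)"
  have "(\<integral>\<^sup>+x. ennreal (h x powr (s - 1)) \<partial>P) \<le> ennreal (exp ((s - 1) * r) * t powr (s - 1))"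
    by (rule renyi_leD[OF assms(1), of _ B]) (use h in auto)
  also have "\<dots> \<le> ennreal (exp ((s - 1) * r') * t powr (s - 1))"
    using assms by (intro ennreal_leI mult_right_mono) auto
  finally show "(\<integral>\<^sup>+x. ennreal (h x powr (s - 1)) \<partial>P) \<le> ennreal (exp ((s - 1) * r') * t powr (s - 1))" .
qed

lemma renyi_le_distr:
  assumes "renyi_le s r P Q" "f \<in> Q \<rightarrow>\<^sub>M N" "sets P = sets Q"
  shows "renyi_le s r (distr P N f) (distr Q N f)"
  unfolding renyi_le_def
proof (intro allI impI, elim conjE)
  fix h :: "_ \<Rightarrow> real" and B t :: real
  have fP: "f \<in> P \<rightarrow>\<^sub>M N" using assms(2,3) by (simp cong: measurable_cong_sets)
  assume h: "h \<in> borel_measurable (distr Q N f)" and hB: "\<forall>x\<in>space (distr Q N f). 0 \<le> h x \<and> h x \<le> B" and t: "0 \<le> t"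
    and le: "(\<integral>\<^sup>+x. ennreal (h x powr s) \<partial>distr Q N f) \<le> ennreal (t powr s)"
  from h have [measurable]: "h \<in> borel_measurable N" by simp
  have "(\<integral>\<^sup>+x. ennreal (h (f x) powr (s - 1)) \<partial>P) \<le> ennreal (exp ((s - 1) * r) * t powr (s - 1))"
    by (rule renyi_leD[OF assms(1), of _ B])
       (use hB t le assms(2) measurable_space[OF assms(2)] in \<open>auto simp: nn_integral_distr\<close>)
  thus "(\<integral>\<^sup>+x. ennreal (h x powr (s - 1)) \<partial>distr P N f) \<le> ennreal (exp ((s - 1) * r) * t powr (s - 1))"
    using fP by (simp add: nn_integral_distr)
qed

text \<open>Adaptive composition. For fixed \<open>x\<close> the bound on the second mechanism replaces \<open>h\<close> by its \<open>L\<^sup>s\<close> norm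
\<open>T x\<close> under \<open>\<kappa>' x\<close>, raised to \<open>s - 1\<close>, and \<open>T\<close> is a test function for the first mechanism with the same
norm as \<open>h\<close>. The set \<open>X\<close> collects the intermediate outputs that actually occur, which may be the
only ones for which the second mechanism is private.\<close>
lemma renyi_le_bind:
  assumes s: "s > 1" and PQ: "renyi_le s a P Q" "prob_space Q" "sets P = sets Q"
    and K: "\<kappa> \<in> Q \<rightarrow>\<^sub>M prob_algebra N" "\<kappa>' \<in> Q \<rightarrow>\<^sub>M prob_algebra N"
    and KK: "\<And>x. x \<in> space Q \<Longrightarrow> x \<in> X \<Longrightarrow> renyi_le s b (\<kappa> x) (\<kappa>' x)" and X: "AE x in P. x \<in> X"
  shows "renyi_le s (a + b) (P \<bind> \<kappa>) (Q \<bind> \<kappa>')"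
  unfolding renyi_le_def
proof (intro allI impI, elim conjE)
  fix h :: "_ \<Rightarrow> real" and B t :: real
  interpret Q: prob_space Q by fact
  note [measurable] = measurable_prob_algebraD[OF K(1)] measurable_prob_algebraD[OF K(2)]
  have KP: "\<kappa> \<in> P \<rightarrow>\<^sub>M subprob_algebra N"
    using measurable_prob_algebraD[OF K(1)] PQ(3) by (simp cong: measurable_cong_sets)
  have setsQ: "sets (Q \<bind> \<kappa>') = sets N"
    by (rule sets_bind) (use K(2) in \<open>auto dest: measurable_space simp: space_prob_algebra Q.not_empty\<close>)
  assume h: "h \<in> borel_measurable (Q \<bind> \<kappa>')" and hB: "\<forall>x\<in>space (Q \<bind> \<kappa>'). 0 \<le> h x \<and> h x \<le> B" and t: "0 \<le> t"
    and le: "(\<integral>\<^sup>+x. ennreal (h x powr s) \<partial>(Q \<bind> \<kappa>')) \<le> ennreal (t powr s)"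
  have h[measurable]: "h \<in> borel_measurable N" using h setsQ by (simp cong: measurable_cong_sets)
  have hB: "0 \<le> h x" "h x \<le> B" if "x \<in> space N" for x
    using hB sets_eq_imp_space_eq[OF setsQ] that by auto
  have pk: "prob_space (\<kappa>' x)" "sets (\<kappa>' x) = sets N" "sets (\<kappa> x) = sets N" if "x \<in> space Q" for x
    using measurable_space[OF K(2) that] measurable_space[OF K(1) that] by (auto simp: space_prob_algebra)
  define I where "I x = (\<integral>\<^sup>+y. ennreal (h y powr s) \<partial>\<kappa>' x)" for x
  have [measurable]: "I \<in> borel_measurable Q" unfolding I_def
    by (rule measurable_compose[OF _ nn_integral_measurable_subprob_algebra]) measurable
  have IB: "I x \<le> ennreal (max 0 B powr s)" if x: "x \<in> space Q" for x
  proof -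
    interpret k: prob_space "\<kappa>' x" using pk x by blast
    have "I x \<le> (\<integral>\<^sup>+y. ennreal (max 0 B powr s) \<partial>\<kappa>' x)" unfolding I_def
      using hB s sets_eq_imp_space_eq[OF pk(2)[OF x]]
      by (intro nn_integral_mono ennreal_leI powr_mono2) (auto simp: le_max_iff_disj)
    thus ?thesis by (simp add: k.emeasure_space_1)
  qed
  define T where "T x = enn2real (I x) powr (1/s)" for x
  have [measurable]: "T \<in> borel_measurable Q" unfolding T_def by measurable
  have Ts: "ennreal (T x powr s) = I x" if "x \<in> space Q" for x
    using IB[OF that] s le_less_trans[OF IB[OF that] ennreal_less_top]
    by (auto simp: T_def powr_powr ennreal_enn2real_if)
  have "(\<integral>\<^sup>+x. ennreal (T x powr s) \<partial>Q) = (\<integral>\<^sup>+x. I x \<partial>Q)"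
    by (intro nn_integral_cong) (simp add: Ts)
  also have "\<dots> = (\<integral>\<^sup>+x. ennreal (h x powr s) \<partial>(Q \<bind> \<kappa>'))"
    unfolding I_def by (subst nn_integral_bind[where B=N]) auto
  also note le
  finally have leT: "(\<integral>\<^sup>+x. ennreal (T x powr s) \<partial>Q) \<le> ennreal (t powr s)" .
  have "(\<integral>\<^sup>+x. ennreal (h x powr (s - 1)) \<partial>(P \<bind> \<kappa>)) = (\<integral>\<^sup>+x. (\<integral>\<^sup>+y. ennreal (h y powr (s - 1)) \<partial>\<kappa> x) \<partial>P)"
    using KP by (subst nn_integral_bind[where B=N]) auto
  also have "\<dots> \<le> (\<integral>\<^sup>+x. ennreal (exp ((s - 1) * b) * T x powr (s - 1)) \<partial>P)"
  proof (rule nn_integral_mono_AE)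
    show "AE x in P. (\<integral>\<^sup>+y. ennreal (h y powr (s - 1)) \<partial>\<kappa> x) \<le> ennreal (exp ((s - 1) * b) * T x powr (s - 1))"
      using X AE_space
    proof eventually_elim
      fix x assume xX: "x \<in> X" and "x \<in> space P"
    hence x: "x \<in> space Q" using sets_eq_imp_space_eq[OF PQ(3)] by simp
    show "(\<integral>\<^sup>+y. ennreal (h y powr (s - 1)) \<partial>\<kappa> x) \<le> ennreal (exp ((s - 1) * b) * T x powr (s - 1))"
    proof (rule renyi_leD[OF KK[OF x xX], of _ B])
      show "h \<in> borel_measurable (\<kappa>' x)" using h by (subst measurable_cong_sets[OF pk(2)[OF x] refl])
      show "(\<integral>\<^sup>+y. ennreal (h y powr s) \<partial>\<kappa>' x) \<le> ennreal (T x powr s)"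
        unfolding Ts[OF x] by (simp add: I_def)
      show "0 \<le> T x" by (simp add: T_def)
    qed (use hB sets_eq_imp_space_eq[OF pk(2)[OF x]] in simp_all)
    qed
  qed
  also have "\<dots> = ennreal (exp ((s - 1) * b)) * (\<integral>\<^sup>+x. ennreal (T x powr (s - 1)) \<partial>P)"
    using PQ(3) by (subst nn_integral_cmult[symmetric]) (auto simp: ennreal_mult' cong: measurable_cong_sets)
  also have "\<dots> \<le> ennreal (exp ((s - 1) * b)) * ennreal (exp ((s - 1) * a) * t powr (s - 1))"
  proof (intro mult_left_mono renyi_leD[OF PQ(1), of _ "(max 0 B powr s) powr (1/s)"])
    fix x assume x: "x \<in> space Q"
    have "enn2real (I x) \<le> max 0 B powr s"
      using enn2real_mono[OF IB[OF x] ennreal_less_top] by simp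
    thus "T x \<le> (max 0 B powr s) powr (1/s)" unfolding T_def using s by (intro powr_mono2) auto
  qed (use t leT in \<open>auto simp: T_def\<close>)
  also have "\<dots> = ennreal (exp ((s - 1) * (a + b)) * t powr (s - 1))"
    by (simp add: ennreal_mult'[symmetric] exp_add[symmetric] algebra_simps)
  finally show "(\<integral>\<^sup>+x. ennreal (h x powr (s - 1)) \<partial>(P \<bind> \<kappa>)) \<le> \<dots>" .
qed

text \<open>The converse of Hoelder's inequality. Indicators of null sets as test functions give absolute
continuity; the density cut off at \<open>N\<close> gives a bound on its own \<open>s\<close>-th moment that does not depend on
\<open>N\<close>, and monotone convergence removes the cutoff.\<close>
lemma renyi_div_le:
  assumes s: "s > 1" and le: "renyi_le s r P Q" and P: "prob_space P" and Q: "prob_space Q" and sets: "sets P = sets Q"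
  shows "renyi_div s P Q \<le> ereal (r * s)"
proof -
  interpret P: prob_space P by fact
  interpret Q: prob_space Q by fact
  have ac: "absolutely_continuous Q P"
    unfolding absolutely_continuous_def
  proof
    fix A assume A: "A \<in> null_sets Q"
    hence [measurable]: "A \<in> sets Q" by auto
    have "(\<integral>\<^sup>+x. ennreal (indicat_real A x powr (s - 1)) \<partial>P) \<le> ennreal (exp ((s - 1) * r) * 0 powr (s - 1))"
    proof (rule renyi_leD[OF le, of _ 1])
      have "(\<integral>\<^sup>+x. ennreal (indicat_real A x powr s) \<partial>Q) = (\<integral>\<^sup>+x. indicator A x \<partial>Q)"
        by (intro nn_integral_cong) (auto simp: indicator_def)
      thus "(\<integral>\<^sup>+x. ennreal (indicat_real A x powr s) \<partial>Q) \<le> ennreal (0 powr s)"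
        using A by (simp add: null_setsD1)
    qed (auto simp: indicator_def)
    moreover have "(\<integral>\<^sup>+x. ennreal (indicat_real A x powr (s - 1)) \<partial>P) = (\<integral>\<^sup>+x. indicator A x \<partial>P)"
      by (intro nn_integral_cong) (auto simp: indicator_def)
    ultimately show "A \<in> null_sets P" using sets by (auto simp: null_sets_def)
  qed
  define f where "f x = enn2real (RN_deriv Q P x)" for x
  have [measurable]: "f \<in> borel_measurable Q" unfolding f_def by measurable
  have f0: "f x \<ge> 0" for x by (simp add: f_def)
  have dens: "density Q (RN_deriv Q P) = P" by (rule Q.density_RN_deriv[OF ac sets])
  have trunc: "(\<integral>\<^sup>+x. ennreal (min (f x) (real N) powr s) \<partial>Q) \<le> ennreal (exp (s * (s - 1) * r))" for N :: nat
  proof -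
    define m where "m = (\<integral>\<^sup>+x. ennreal (min (f x) (real N) powr s) \<partial>Q)"
    have "m \<le> (\<integral>\<^sup>+x. ennreal (real N powr s) \<partial>Q)" unfolding m_def
      using s f0 by (intro nn_integral_mono ennreal_leI powr_mono2) auto
    hence mfin: "m < \<infinity>" by (simp add: Q.emeasure_space_1 order_le_less_trans)
    define t where "t = enn2real m powr (1/s)"
    have ts: "m = ennreal (t powr s)" using mfin s by (simp add: t_def powr_powr)
    have "m \<le> (\<integral>\<^sup>+x. RN_deriv Q P x * ennreal (min (f x) (real N) powr (s - 1)) \<partial>Q)"
      unfolding m_def
    proof (rule nn_integral_mono)
      fix x
      have "min (f x) (real N) powr s = min (f x) (real N) * min (f x) (real N) powr (s - 1)"
        using f0[of x] s by (cases "min (f x) (real N) = 0") (auto simp: powr_diff)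
      also have "\<dots> \<le> f x * min (f x) (real N) powr (s - 1)" by (intro mult_right_mono) auto
      finally have "ennreal (min (f x) (real N) powr s) \<le> ennreal (f x) * ennreal (min (f x) (real N) powr (s - 1))"
        by (simp add: ennreal_mult'[symmetric] f0 ennreal_leI)
      also have "ennreal (f x) \<le> RN_deriv Q P x" unfolding f_def by (simp add: ennreal_enn2real_if)
      finally show "ennreal (min (f x) (real N) powr s) \<le> RN_deriv Q P x * ennreal (min (f x) (real N) powr (s - 1))"
        by (simp add: mult_right_mono)
    qed
    also have "\<dots> = (\<integral>\<^sup>+x. ennreal (min (f x) (real N) powr (s - 1)) \<partial>density Q (RN_deriv Q P))"
      by (subst nn_integral_density) auto
    also have "\<dots> = (\<integral>\<^sup>+x. ennreal (min (f x) (real N) powr (s - 1)) \<partial>P)" by (simp add: dens)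
    also have "\<dots> \<le> ennreal (exp ((s - 1) * r) * t powr (s - 1))"
      by (rule renyi_leD[OF le, of _ "real N"]) (use f0 ts in \<open>auto simp: m_def t_def\<close>)
    \<comment> \<open>The moment \<open>t\<^sup>s\<close> of the truncated density is bounded in terms of its own power \<open>t\<^sup>s\<^sup>-\<^sup>1\<close>; dividing bounds \<open>t\<close>.\<close>
    finally have le: "t powr s \<le> exp ((s - 1) * r) * t powr (s - 1)"
      by (simp add: ts)
    have "t \<le> exp ((s - 1) * r)"
    proof (cases "t = 0")
      case False
      hence t: "t > 0" by (simp add: t_def)
      have "t * t powr (s - 1) \<le> exp ((s - 1) * r) * t powr (s - 1)"
        using le t by (simp add: powr_diff)
      thus ?thesis using t by simp
    qed simp
    hence "t powr s \<le> exp ((s - 1) * r) powr s" using s by (intro powr_mono2) (auto simp: t_def)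
    also have "\<dots> = exp (s * (s - 1) * r)" by (simp add: powr_def mult_ac)
    finally show ?thesis using ts unfolding m_def by (simp add: ennreal_leI)
  qed
  have "(\<integral>\<^sup>+x. ennreal (f x powr s) \<partial>Q) = (\<integral>\<^sup>+x. (SUP N::nat. ennreal (min (f x) (real N) powr s)) \<partial>Q)"
  proof (intro nn_integral_cong)
    fix x
    obtain N0 :: nat where "f x \<le> real N0" using real_arch_simple by blast
    show "ennreal (f x powr s) = (SUP N::nat. ennreal (min (f x) (real N) powr s))"
    proof (intro antisym SUP_least)
      show "ennreal (f x powr s) \<le> (SUP N::nat. ennreal (min (f x) (real N) powr s))"
        by (rule SUP_upper2[of N0]) (use \<open>f x \<le> real N0\<close> in \<open>auto simp: min_def\<close>)
      show "ennreal (min (f x) (real N) powr s) \<le> ennreal (f x powr s)" for N :: nat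
        using f0 s by (intro ennreal_leI powr_mono2) auto
    qed
  qed
  also have "\<dots> = (SUP N::nat. (\<integral>\<^sup>+x. ennreal (min (f x) (real N) powr s) \<partial>Q))"
    using f0 s by (intro nn_integral_monotone_convergence_SUP)
      (auto simp: incseq_def le_fun_def intro!: ennreal_leI powr_mono2)
  also have "\<dots> \<le> ennreal (exp (s * (s - 1) * r))" by (intro SUP_least trunc)
  finally have I: "(\<integral>\<^sup>+x. ennreal (f x powr s) \<partial>Q) \<le> ennreal (exp (s * (s - 1) * r))" .
  hence Ifin: "(\<integral>\<^sup>+x. ennreal (f x powr s) \<partial>Q) < \<infinity>" by (rule le_less_trans) simp
  have "enn2real (\<integral>\<^sup>+x. ennreal (f x powr s) \<partial>Q) \<le> exp (s * (s - 1) * r)"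
    using enn2real_mono[OF I ennreal_less_top] by simp
  \<comment> \<open>The logarithm is monotone only on positive arguments: the moment cannot vanish, as \<open>P\<close> has mass one.\<close>
  moreover have "enn2real (\<integral>\<^sup>+x. ennreal (f x powr s) \<partial>Q) > 0"
  proof -
    have "(\<integral>\<^sup>+x. ennreal (f x powr s) \<partial>Q) \<noteq> 0"
    proof
      assume "(\<integral>\<^sup>+x. ennreal (f x powr s) \<partial>Q) = 0"
      hence "AE x in Q. ennreal (f x powr s) = 0" by (subst (asm) nn_integral_0_iff_AE) auto
      moreover have "AE x in Q. RN_deriv Q P x \<noteq> \<infinity>"
        by (rule Q.RN_deriv_finite) (use ac sets P in \<open>auto intro: prob_space_imp_sigma_finite\<close>)
      ultimately have "AE x in Q. RN_deriv Q P x = 0"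
        by eventually_elim (auto simp: f_def ennreal_eq_0_iff enn2real_eq_0_iff)
      hence "emeasure (density Q (RN_deriv Q P)) (space Q) = 0"
        by (subst emeasure_density) (auto simp: nn_integral_0_iff_AE)
      thus False using P.emeasure_space_1 dens sets_eq_imp_space_eq[OF sets] by simp
    qed
    thus ?thesis using Ifin unfolding enn2real_positive_iff by (auto simp: zero_less_iff_neq_zero)
  qed
  ultimately have "ln (enn2real (\<integral>\<^sup>+x. ennreal (f x powr s) \<partial>Q)) \<le> ln (exp (s * (s - 1) * r))"
    by (intro ln_mono) auto
  hence "ln (enn2real (\<integral>\<^sup>+x. ennreal (f x powr s) \<partial>Q)) \<le> s * (s - 1) * r" by simp
  hence "ln (enn2real (\<integral>\<^sup>+x. ennreal (f x powr s) \<partial>Q)) / (s - 1) \<le> r * s"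
    using s by (simp add: field_simps)
  thus ?thesis using ac Ifin unfolding renyi_div_def f_def by (simp add: Let_def)
qed

section \<open>Products, Gaussian shifts and pure differential privacy\<close>

text \<open>The product measure is an adaptive composition whose second stage ignores the first.\<close>
lemma renyi_le_pair:
  assumes s: "s > 1" and "prob_space P" "prob_space Q" "prob_space P'" "prob_space Q'"
    "sets P = sets Q" "sets P' = sets Q'" "renyi_le s a P Q" "renyi_le s b P' Q'"
  shows "renyi_le s (a + b) (P \<Otimes>\<^sub>M P') (Q \<Otimes>\<^sub>M Q')"
proof -
  interpret PP: pair_prob_space P P' using assms(2,4) by (simp add: pair_prob_space_def pair_sigma_finite_def prob_space_imp_sigma_finite)
  interpret QQ: pair_prob_space Q Q' using assms(3,5) by (simp add: pair_prob_space_def pair_sigma_finite_def prob_space_imp_sigma_finite)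
  let ?N = "Q \<Otimes>\<^sub>M Q'"
  have N: "return (P \<Otimes>\<^sub>M P') = return ?N"
    by (rule ext, rule return_cong) (use assms in \<open>auto intro: sets_pair_measure_cong\<close>)
  note [measurable_cong] = assms(6,7)
  have kern: "(\<lambda>x. R \<bind> (\<lambda>y. return ?N (x, y))) \<in> Q \<rightarrow>\<^sub>M prob_algebra ?N"
    if "prob_space R" "sets R = sets Q'" for R
    by (rule measurable_bind_prob_space2[where N=Q'])
       (use that in \<open>auto simp: space_prob_algebra intro!: measurable_const\<close>)
  have inner: "renyi_le s (b + 0) (P' \<bind> (\<lambda>y. return ?N (x, y))) (Q' \<bind> (\<lambda>y. return ?N (x, y)))"
    if "x \<in> space Q" for x
    by (rule renyi_le_bind[where N="?N" and X=UNIV])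
       (use assms that in \<open>auto intro!: renyi_le_refl prob_space_return measurable_compose[OF _ measurable_return_prob_space] simp: space_pair_measure\<close>)
  have "renyi_le s (a + b) (P \<bind> (\<lambda>x. P' \<bind> (\<lambda>y. return ?N (x, y)))) (Q \<bind> (\<lambda>x. Q' \<bind> (\<lambda>y. return ?N (x, y))))"
    by (rule renyi_le_bind[where N="?N" and X=UNIV]) (use assms kern inner in simp_all)
  thus ?thesis
    unfolding PP.pair_measure_eq_bind[unfolded N, symmetric] QQ.pair_measure_eq_bind[symmetric] .
qed

lemma renyi_le_PiM:
  assumes s: "s > 1" and "finite I"
    and "\<And>i. i \<in> I \<Longrightarrow> prob_space (P i)" "\<And>i. i \<in> I \<Longrightarrow> prob_space (Q i)"
    and "\<And>i. i \<in> I \<Longrightarrow> sets (P i) = sets (Q i)" "\<And>i. i \<in> I \<Longrightarrow> renyi_le s (r i) (P i) (Q i)"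
  shows "renyi_le s (\<Sum>i\<in>I. r i) (PiM I P) (PiM I Q)"
  using assms(2-)
proof (induction I rule: finite_induct)
  case empty
  show ?case using renyi_le_refl[OF s prob_space_PiM[of "{}" Q]] by (simp add: PiM_empty)
next
  case (insert i I)
  have sets: "sets (PiM (insert i I) P) = sets (PiM (insert i I) Q)"
    by (intro sets_PiM_cong) (use insert in auto)
  have setsI: "sets (PiM I P) = sets (PiM I Q)"
    by (intro sets_PiM_cong) (use insert in auto)
  have "renyi_le s (r i + (\<Sum>i\<in>I. r i)) (P i \<Otimes>\<^sub>M PiM I P) (Q i \<Otimes>\<^sub>M PiM I Q)"
    by (rule renyi_le_pair[OF s]) (use insert setsI in \<open>auto intro!: prob_space_PiM\<close>)
  hence "renyi_le s (r i + (\<Sum>i\<in>I. r i)) (distr (P i \<Otimes>\<^sub>M PiM I P) (PiM (insert i I) Q) (\<lambda>(x, X). X(i := x)))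
      (distr (Q i \<Otimes>\<^sub>M PiM I Q) (PiM (insert i I) Q) (\<lambda>(x, X). X(i := x)))"
    by (rule renyi_le_distr) (use insert setsI in \<open>auto intro!: sets_pair_measure_cong\<close>)
  also have "distr (P i \<Otimes>\<^sub>M PiM I P) (PiM (insert i I) Q) (\<lambda>(x, X). X(i := x)) =
     distr (P i \<Otimes>\<^sub>M PiM I P) (PiM (insert i I) P) (\<lambda>(x, X). X(i := x))"
    by (rule distr_cong) (use sets in auto)
  also have "distr (P i \<Otimes>\<^sub>M PiM I P) (PiM (insert i I) P) (\<lambda>(x, X). X(i := x)) = PiM (insert i I) P"
    by (rule distr_pair_PiM_eq_PiM) (use insert in auto)
  also have "distr (Q i \<Otimes>\<^sub>M PiM I Q) (PiM (insert i I) Q) (\<lambda>(x, X). X(i := x)) = PiM (insert i I) Q"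
    by (rule distr_pair_PiM_eq_PiM) (use insert in auto)
  finally show ?case using insert by simp
qed

text \<open>Completing the square, the \<open>s\<close>-th power of the density ratio times the reference density is a constant
times the normal density centered at \<open>b + s * (a - b)\<close>.\<close>
lemma renyi_le_normal_shift:
  assumes s: "s > 1"
  shows "renyi_le s ((a - b)\<^sup>2 / 2) (density lborel (normal_density a 1)) (density lborel (normal_density b 1))"
proof -
  let ?Q = "density lborel (normal_density b 1)"
  define f where "f x = normal_density a 1 x / normal_density b 1 x" for x
  have nz: "normal_density m 1 x \<noteq> 0" "normal_density m 1 x > 0" for m x
    using normal_density_pos[of 1 m x] by auto
  have [measurable]: "f \<in> borel_measurable borel" unfolding f_def by measurable
  have fe: "f x = exp (((x - b)\<^sup>2 - (x - a)\<^sup>2) / 2)" for x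
    by (simp add: f_def normal_density_def exp_diff[symmetric] diff_divide_distrib)
  have "renyi_le s ((a - b)\<^sup>2 / 2) (density ?Q (\<lambda>x. ennreal (f x))) ?Q"
  proof (rule renyi_le_density[OF s])
    have "(\<integral>\<^sup>+x. ennreal (f x powr s) \<partial>?Q) = (\<integral>\<^sup>+x. ennreal (normal_density b 1 x * f x powr s) \<partial>lborel)"
      by (subst nn_integral_density) (auto simp: ennreal_mult')
    also have "\<dots> = (\<integral>\<^sup>+x. ennreal (exp (s * (s - 1) * ((a - b)\<^sup>2 / 2))) * ennreal (normal_density (b + s * (a - b)) 1 x) \<partial>lborel)"
    proof (intro nn_integral_cong)
      fix x :: real
      have "normal_density b 1 x * f x powr s = exp (s * (s - 1) * ((a - b)\<^sup>2 / 2)) * normal_density (b + s * (a - b)) 1 x"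
      proof -
        have "- (x - b)\<^sup>2 / 2 + s * (((x - b)\<^sup>2 - (x - a)\<^sup>2) / 2)
            = s * (s - 1) * ((a - b)\<^sup>2 / 2) + - (x - (b + s * (a - b)))\<^sup>2 / 2"
          by (simp add: power2_eq_square field_simps)
        hence "exp (- (x - b)\<^sup>2 / 2) * exp (s * (((x - b)\<^sup>2 - (x - a)\<^sup>2) / 2))
            = exp (s * (s - 1) * ((a - b)\<^sup>2 / 2)) * exp (- (x - (b + s * (a - b)))\<^sup>2 / 2)"
          by (simp only: exp_add[symmetric])
        thus ?thesis by (simp add: fe normal_density_def powr_def)
      qed
      thus "ennreal (normal_density b 1 x * f x powr s) = ennreal (exp (s * (s - 1) * ((a - b)\<^sup>2 / 2))) * ennreal (normal_density (b + s * (a - b)) 1 x)"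
        by (simp add: ennreal_mult'[symmetric])
    qed
    also have "\<dots> = ennreal (exp (s * (s - 1) * ((a - b)\<^sup>2 / 2))) * emeasure (density lborel (normal_density (b + s * (a - b)) 1)) UNIV"
      by (subst nn_integral_cmult) (auto simp: emeasure_density)
    also have "emeasure (density lborel (normal_density (b + s * (a - b)) 1)) UNIV = 1"
      using prob_space.emeasure_space_1[OF prob_space_normal_density[of 1 "b + s * (a - b)"]] by simp
    finally show "(\<integral>\<^sup>+x. ennreal (f x powr s) \<partial>?Q) \<le> ennreal (exp (s * (s - 1) * ((a - b)\<^sup>2 / 2)))" by simp
  qed (auto simp: fe)
  also have "density ?Q (\<lambda>x. ennreal (f x)) = density lborel (normal_density a 1)"
    by (subst density_density_eq) (use nz in \<open>auto simp: f_def ennreal_mult'[symmetric] intro!: density_cong\<close>)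
  finally show ?thesis .
qed

lemma distr_std_normal_shift:
  "distr std_normal borel (\<lambda>z. z + a) = density lborel (normal_density a 1)"
proof -
  interpret prob_space std_normal by (rule prob_space_normal_density) simp
  have "distributed std_normal lborel (\<lambda>x. x) (normal_density 0 1)"
    by (auto simp: distributed_def distr_id2)
  hence "distributed std_normal lborel (\<lambda>x. a + 1 * x) (normal_density (a + 1 * 0) (\<bar>1\<bar> * 1))"
    by (rule normal_density_affine) auto
  hence "distr std_normal lborel (\<lambda>x. a + x) = density lborel (normal_density a 1)"
    by (simp add: distributed_def)
  thus ?thesis by (simp add: add.commute cong: distr_cong)
qed

text \<open>The derivative has the sign of \<open>sinh z - z * cosh z\<close>, which vanishes at zero and has derivative
\<open>- z * sinh z\<close>.\<close>
lemma cosh_gauss_mono: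
  fixes x y :: real
  assumes "0 \<le> y" "y \<le> x"
  shows "cosh x * exp (- x\<^sup>2 / 2) \<le> cosh y * exp (- y\<^sup>2 / 2)"
proof (rule DERIV_nonpos_imp_nonincreasing[OF assms(2)])
  fix z :: real assume z: "y \<le> z" "z \<le> x"
  hence z0: "z \<ge> 0" using assms by simp
  have "((\<lambda>x. cosh x * exp (- x\<^sup>2 / 2)) has_real_derivative (sinh z - z * cosh z) * exp (- z\<^sup>2 / 2)) (at z)"
    by (auto intro!: derivative_eq_intros simp: algebra_simps power2_eq_square)
  moreover have "sinh z - z * cosh z \<le> sinh 0 - 0 * cosh (0::real)"
  proof (rule DERIV_nonpos_imp_nonincreasing[OF z0])
    fix w :: real assume w: "0 \<le> w" "w \<le> z"
    have "((\<lambda>z. sinh z - z * cosh z) has_real_derivative - w * sinh w) (at w)"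
      by (auto intro!: derivative_eq_intros simp: algebra_simps)
    moreover have "- w * sinh w \<le> 0" using w by simp
    ultimately show "\<exists>y. ((\<lambda>z. sinh z - z * cosh z) has_real_derivative y) (at w) \<and> y \<le> 0" by blast
  qed
  hence "(sinh z - z * cosh z) * exp (- z\<^sup>2 / 2) \<le> 0" by (intro mult_nonpos_nonneg) auto
  ultimately show "\<exists>l. ((\<lambda>x. cosh x * exp (- x\<^sup>2 / 2)) has_real_derivative l) (at z) \<and> l \<le> 0" by blast
qed

text \<open>The likelihood ratio lies between \<open>exp (- \<epsilon>)\<close> and \<open>exp \<epsilon>\<close> and has mean one. By convexity its \<open>s\<close>-th
moment is largest when it takes only the two extreme values, where it equals
\<open>cosh ((s - 1/2) * \<epsilon>) / cosh (\<epsilon> / 2)\<close>; \<open>cosh_gauss_mono\<close> compares this with the Gaussian exponent.\<close>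
lemma renyi_le_pure_dp:
  fixes p q :: "'a pmf"
  assumes s: "s > 1" and e: "\<epsilon> > 0"
    and pq: "\<And>x. pmf p x \<le> exp \<epsilon> * pmf q x" and qp: "\<And>x. pmf q x \<le> exp \<epsilon> * pmf p x"
  shows "renyi_le s (\<epsilon>\<^sup>2 / 2) (measure_pmf p) (measure_pmf q)"
proof -
  define f where "f x = pmf p x / pmf q x" for x
  have q0: "pmf p x = 0" if "pmf q x = 0" for x using pq[of x] pmf_nonneg[of p x] that by simp
  have dens: "density (measure_pmf q) (\<lambda>x. ennreal (f x)) = measure_pmf p"
  proof (rule measure_eqI)
    fix A
    have "emeasure (density (measure_pmf q) (\<lambda>x. ennreal (f x))) A = (\<integral>\<^sup>+x. ennreal (f x) * indicator A x \<partial>measure_pmf q)"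
      by (subst emeasure_density) auto
    also have "\<dots> = (\<integral>\<^sup>+x. ennreal (pmf q x) * (ennreal (f x) * indicator A x) \<partial>count_space UNIV)"
      by (rule nn_integral_measure_pmf)
    also have "\<dots> = (\<integral>\<^sup>+x. ennreal (pmf p x) * indicator A x \<partial>count_space UNIV)"
      using q0 by (intro nn_integral_cong) (auto simp: f_def ennreal_mult'[symmetric] indicator_def)
    also have "\<dots> = emeasure (measure_pmf p) A"
      by (subst nn_integral_measure_pmf[symmetric]) simp
    finally show "emeasure (density (measure_pmf q) (\<lambda>x. ennreal (f x))) A = emeasure (measure_pmf p) A" .
  qed simp
  have fb: "exp (- \<epsilon>) \<le> f x \<and> f x \<le> exp \<epsilon>" if "x \<in> set_pmf q" for x
    using pq[of x] qp[of x] pmf_positive[OF that] by (simp add: f_def field_simps exp_minus)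
  have D: "sinh \<epsilon> > 0" using e by simp
  \<comment> \<open>\<open>A * y + B\<close> is the chord of \<open>y powr s\<close> over the interval of possible likelihood ratios.\<close>
  define A where "A = (exp (s * \<epsilon>) - exp (- s * \<epsilon>)) / (2 * sinh \<epsilon>)"
  define B where "B = (exp \<epsilon> * exp (- s * \<epsilon>) - exp (- \<epsilon>) * exp (s * \<epsilon>)) / (2 * sinh \<epsilon>)"
  have chord: "f x powr s \<le> A * f x + B" if x: "x \<in> set_pmf q" for x
  proof -
    have fx: "f x > 0" using fb[OF x] by (meson exp_gt_zero less_le_trans)
    define t where "t = (f x - exp (- \<epsilon>)) / (2 * sinh \<epsilon>)"
    have s2: "2 * sinh \<epsilon> = exp \<epsilon> - exp (- \<epsilon>)" by (simp add: sinh_field_def)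
    have t: "0 \<le> t" "t \<le> 1" using fb[OF x] D by (simp_all add: t_def s2)
    have ft: "f x = (1 - t) * exp (- \<epsilon>) + t * exp \<epsilon>"
    proof -
      have "t * (exp \<epsilon> - exp (- \<epsilon>)) = f x - exp (- \<epsilon>)" using D unfolding t_def s2[symmetric] by simp
      thus ?thesis by (simp add: algebra_simps)
    qed
    have "convex_on {0<..} (\<lambda>y::real. y powr s)" using s by (intro convex_on_subset[OF powr_convex]) auto
    from convex_onD[OF this t, of "exp (- \<epsilon>)" "exp \<epsilon>"]
    have "f x powr s \<le> (1 - t) * exp (- \<epsilon>) powr s + t * exp \<epsilon> powr s" by (simp add: ft)
    also have "\<dots> = A * f x + B"
      using D unfolding A_def B_def t_def proof (simp add: powr_def field_simps)
      have e: "exp \<epsilon> = exp (- \<epsilon>) + 2 * sinh \<epsilon>" using s2 by simp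
      show "sinh \<epsilon> * (sinh \<epsilon> * (4 * exp (- (\<epsilon> * s)))) + sinh \<epsilon> * (2 * (exp (- \<epsilon>) * exp (- (\<epsilon> * s))))
         = exp \<epsilon> * (sinh \<epsilon> * (2 * exp (- (\<epsilon> * s))))"
        unfolding e by (simp add: algebra_simps)
    qed
    finally show ?thesis .
  qed
  have If: "(\<integral>\<^sup>+x. ennreal (f x) \<partial>measure_pmf q) = 1"
  proof -
    have "emeasure (density (measure_pmf q) (\<lambda>x. ennreal (f x))) UNIV = (\<integral>\<^sup>+x. ennreal (f x) \<partial>measure_pmf q)"
      by (subst emeasure_density) auto
    thus ?thesis unfolding dens by simp
  qed
  have I: "(\<integral>\<^sup>+x. ennreal (f x powr s) \<partial>measure_pmf q) \<le> ennreal (A + B)"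
  proof -
    \<comment> \<open>\<open>B\<close> may be negative, which nonnegative integrals cannot carry; it is moved to the other side.\<close>
    have AB: "0 \<le> A" using D e s by (auto simp: A_def intro!: divide_nonneg_pos)
    have "(\<integral>\<^sup>+x. ennreal (f x powr s) \<partial>measure_pmf q) + ennreal (- B)
        = (\<integral>\<^sup>+x. ennreal (f x powr s) + ennreal (- B) \<partial>measure_pmf q)"
      by (subst nn_integral_add) auto
    also have "\<dots> \<le> (\<integral>\<^sup>+x. ennreal A * ennreal (f x) + ennreal B \<partial>measure_pmf q)"
    proof (rule nn_integral_mono_AE, rule AE_pmfI)
      fix x assume x: "x \<in> set_pmf q"
      have "f x \<ge> 0" by (simp add: f_def)
      with chord[OF x] AB show "ennreal (f x powr s) + ennreal (- B) \<le> ennreal A * ennreal (f x) + ennreal B"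
        by (cases "B \<ge> 0") (auto simp: ennreal_mult'[symmetric] ennreal_plus[symmetric] ennreal_neg ennreal_leI simp del: ennreal_plus)
    qed
    also have "\<dots> = ennreal A + ennreal B"
      by (subst nn_integral_add) (auto simp: nn_integral_cmult If)
    finally have "(\<integral>\<^sup>+x. ennreal (f x powr s) \<partial>measure_pmf q) + ennreal (- B) \<le> ennreal A + ennreal B" .
    thus ?thesis
    proof (cases "B \<ge> 0")
      case False
      have "(\<integral>\<^sup>+x. ennreal (f x powr s) \<partial>measure_pmf q) + ennreal (- B) \<le> ennreal A"
        using \<open>_ \<le> ennreal A + ennreal B\<close> False by (simp add: ennreal_neg)
      moreover from this have "ennreal (- B) \<le> ennreal A"
        by (meson add_increasing order_refl order_trans zero_le)
      hence "- B \<le> A" using AB False by simp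
      hence "ennreal A = ennreal (A + B) + ennreal (- B)"
        using False by (simp add: ennreal_plus[symmetric] del: ennreal_plus)
      ultimately show ?thesis by (simp add: ennreal_add_left_cancel_le add.commute[of _ "ennreal (- B)"])
    qed (use AB in \<open>simp add: ennreal_neg\<close>)
  qed
  have "A + B = cosh ((s - 1/2) * \<epsilon>) / cosh (\<epsilon> / 2)"
  proof -
    define u v where "u = exp (s * \<epsilon>)" and "v = exp \<epsilon>"
    define w where "w = exp (\<epsilon> / 2)"
    have v: "v = w * w" by (simp add: v_def w_def exp_add[symmetric])
    have pos: "u > 0" "w > 1" using e by (auto simp: u_def w_def)
    have "A + B = ((u - 1 / u) + (v / u - u / v)) / (v - 1 / v)"
    proof -
      have e: "2 * sinh \<epsilon> = v - 1 / v" "exp (s * \<epsilon>) = u" "exp (- s * \<epsilon>) = 1 / u" "exp (- \<epsilon>) = 1 / v" "exp \<epsilon> = v"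
        by (simp_all add: sinh_field_def exp_minus u_def v_def inverse_eq_divide)
      show ?thesis unfolding A_def B_def add_divide_distrib[symmetric] e by simp
    qed
    moreover have "cosh ((s - 1/2) * \<epsilon>) = (u / w + w / u) / 2"
      by (simp add: cosh_field_def u_def w_def exp_diff[symmetric] algebra_simps)
    moreover have "cosh (\<epsilon> / 2) = (w + 1 / w) / 2"
      by (simp add: cosh_field_def w_def exp_minus field_simps)
    moreover have "((u - 1 / u) + (v / u - u / v)) / (v - 1 / v) = ((u / w + w / u) / 2) / ((w + 1 / w) / 2)"
    proof -
      have "w * w > 1 * 1" using pos by (intro mult_strict_mono) auto
      hence "w * w * (w * w) > 1 * 1" by (intro mult_strict_mono) auto
      hence nz: "v - 1 / v \<noteq> 0" "w + 1 / w \<noteq> 0" using pos by (auto simp: v field_simps add_eq_0_iff)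
      show ?thesis using nz pos unfolding v by (simp add: divide_simps) (simp add: algebra_simps)
    qed
    ultimately show ?thesis by (simp only:)
  qed
  also have "\<dots> \<le> exp (s * (s - 1) * (\<epsilon>\<^sup>2 / 2))"
  proof -
    have "cosh ((s - 1/2) * \<epsilon>) * exp (- ((s - 1/2) * \<epsilon>)\<^sup>2 / 2) \<le> cosh (\<epsilon>/2) * exp (- (\<epsilon>/2)\<^sup>2 / 2)"
      using s e by (intro cosh_gauss_mono) (auto simp: algebra_simps)
    hence "cosh ((s - 1/2) * \<epsilon>) * exp (- ((s - 1/2) * \<epsilon>)\<^sup>2 / 2) * exp (((s - 1/2) * \<epsilon>)\<^sup>2 / 2)
       \<le> cosh (\<epsilon>/2) * exp (- (\<epsilon>/2)\<^sup>2 / 2) * exp (((s - 1/2) * \<epsilon>)\<^sup>2 / 2)"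
      by (intro mult_right_mono) auto
    also have "cosh (\<epsilon>/2) * exp (- (\<epsilon>/2)\<^sup>2 / 2) * exp (((s - 1/2) * \<epsilon>)\<^sup>2 / 2) = cosh (\<epsilon>/2) * exp (s * (s - 1) * (\<epsilon>\<^sup>2 / 2))"
      unfolding mult.assoc exp_add[symmetric] by (simp add: power2_eq_square field_simps)
    also have "cosh ((s - 1/2) * \<epsilon>) * exp (- ((s - 1/2) * \<epsilon>)\<^sup>2 / 2) * exp (((s - 1/2) * \<epsilon>)\<^sup>2 / 2) = cosh ((s - 1/2) * \<epsilon>)"
      unfolding mult.assoc exp_add[symmetric] by simp
    finally show ?thesis by (simp add: field_simps cosh_real_pos)
  qed
  finally have "renyi_le s (\<epsilon>\<^sup>2 / 2) (density (measure_pmf q) (\<lambda>x. ennreal (f x))) (measure_pmf q)"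
    using I by (intro renyi_le_density[OF s]) (auto simp: f_def intro: order_trans ennreal_leI)
  thus ?thesis by (simp add: dens)
qed

section \<open>Privacy of the exponential mechanism and of peeling\<close>

lemma pmf_exp_mech:
  assumes "finite B" "B \<noteq> {}"
  shows "pmf (exp_mech \<epsilon> \<Delta> score B) c =
    (if c \<in> B then exp (\<epsilon> * score c / (2 * \<Delta>)) / (\<Sum>c'\<in>B. exp (\<epsilon> * score c' / (2 * \<Delta>))) else 0)"
  unfolding exp_mech_def
proof (rule pmf_embed_pmf)
  let ?w = "\<lambda>c. exp (\<epsilon> * score c / (2 * \<Delta>))"
  have pos: "(\<Sum>c'\<in>B. ?w c') > 0" using assms by (intro sum_pos) auto
  show "0 \<le> (if c \<in> B then ?w c / (\<Sum>c'\<in>B. ?w c') else 0)" for c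
    using pos by (simp add: less_imp_le)
  have "(\<integral>\<^sup>+c. ennreal (if c \<in> B then ?w c / (\<Sum>c'\<in>B. ?w c') else 0) \<partial>count_space UNIV)
     = (\<Sum>c\<in>B. ennreal (if c \<in> B then ?w c / (\<Sum>c'\<in>B. ?w c') else 0))"
    by (rule nn_integral_count_space') (use assms in auto)
  also have "\<dots> = (\<Sum>c\<in>B. ennreal (?w c / (\<Sum>c'\<in>B. ?w c')))" by (intro sum.cong) auto
  also have "\<dots> = ennreal (\<Sum>c\<in>B. ?w c / (\<Sum>c'\<in>B. ?w c'))"
    by (rule sum_ennreal) (use pos in \<open>simp add: less_imp_le\<close>)
  also have "(\<Sum>c\<in>B. ?w c / (\<Sum>c'\<in>B. ?w c')) = 1"
    using pos by (simp add: sum_divide_distrib[symmetric])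
  finally show "(\<integral>\<^sup>+c. ennreal (if c \<in> B then ?w c / (\<Sum>c'\<in>B. ?w c') else 0) \<partial>count_space UNIV) = 1" by simp
qed

lemma set_exp_mech:
  assumes "finite B" "B \<noteq> {}"
  shows "set_pmf (exp_mech \<epsilon> \<Delta> score B) = B"
proof -
  have "(\<Sum>c'\<in>B. exp (\<epsilon> * score c' / (2 * \<Delta>))) > 0" using assms by (intro sum_pos) auto
  thus ?thesis by (auto simp: set_pmf_eq pmf_exp_mech[OF assms])
qed

text \<open>Changing the score costs a factor \<open>exp (\<epsilon> / 2)\<close> in the weight of \<open>c\<close> and another one in the normalizing sum.\<close>
lemma exp_mech_dp:
  assumes B: "finite B" "B \<noteq> {}" and "\<epsilon> > 0" "\<Delta> > 0" and sens: "\<And>c. c \<in> B \<Longrightarrow> \<bar>sc c - sc' c\<bar> \<le> \<Delta>"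
  shows "pmf (exp_mech \<epsilon> \<Delta> sc B) c \<le> exp \<epsilon> * pmf (exp_mech \<epsilon> \<Delta> sc' B) c"
proof (cases "c \<in> B")
  case True
  have w: "exp (\<epsilon> * u / (2 * \<Delta>)) \<le> exp (\<epsilon> / 2) * exp (\<epsilon> * v / (2 * \<Delta>))" if "\<bar>u - v\<bar> \<le> \<Delta>" for u v
  proof -
    have "\<epsilon> * (u - v) \<le> \<epsilon> * \<Delta>" using that assms by (intro mult_left_mono) auto
    hence "\<epsilon> * u / (2 * \<Delta>) \<le> \<epsilon> / 2 + \<epsilon> * v / (2 * \<Delta>)"
      using assms by (simp add: field_simps)
    thus ?thesis by (simp add: exp_add[symmetric])
  qed
  let ?w = "\<lambda>sc c. exp (\<epsilon> * sc c / (2 * \<Delta>))"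
  have pos: "(\<Sum>c\<in>B. ?w sc c) > 0" "(\<Sum>c\<in>B. ?w sc' c) > 0" using B by (auto intro!: sum_pos)
  have "(\<Sum>c\<in>B. ?w sc' c) \<le> exp (\<epsilon> / 2) * (\<Sum>c\<in>B. ?w sc c)"
    unfolding sum_distrib_left using sens by (intro sum_mono w) (auto simp: abs_minus_commute)
  hence "?w sc c * (\<Sum>c\<in>B. ?w sc' c) \<le> (exp (\<epsilon> / 2) * ?w sc' c) * (exp (\<epsilon> / 2) * (\<Sum>c\<in>B. ?w sc c))"
    using w[OF sens[OF True]] pos by (intro mult_mono) auto
  also have "\<dots> = exp \<epsilon> * ?w sc' c * (\<Sum>c\<in>B. ?w sc c)"
    by (simp add: mult_ac) (simp add: mult.assoc[symmetric] exp_add[symmetric])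
  finally show ?thesis using True B pos by (simp add: pmf_exp_mech field_simps)
qed (use B in \<open>simp add: pmf_exp_mech\<close>)

lemma renyi_le_exp_mech:
  assumes "s > 1" "finite B" "\<epsilon> > 0" "\<Delta> > 0" "\<And>c. c \<in> B \<Longrightarrow> \<bar>sc c - sc' c\<bar> \<le> \<Delta>"
  shows "renyi_le s (\<epsilon>\<^sup>2 / 2) (measure_pmf (exp_mech \<epsilon> \<Delta> sc B)) (measure_pmf (exp_mech \<epsilon> \<Delta> sc' B))"
proof (cases "B = {}")
  case True
  \<comment> \<open>On the empty set both laws are the same unspecified value.\<close>
  hence "exp_mech \<epsilon> \<Delta> sc B = exp_mech \<epsilon> \<Delta> sc' B" by (simp add: exp_mech_def)
  thus ?thesis
    by (simp only:) (rule renyi_le_mono[OF renyi_le_refl], use assms in \<open>auto simp: prob_space_measure_pmf\<close>)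
next
  case False
  show ?thesis
    by (rule renyi_le_pure_dp) (use assms False in \<open>auto intro!: exp_mech_dp simp: abs_minus_commute\<close>)
qed

lemma set_peel_select:
  assumes "finite B" "m \<le> card B"
  shows "set_pmf (peel_select \<epsilon> \<Delta> sc B m) \<subseteq> {S. S \<subseteq> B \<and> card S = m}"
  using assms(2)
proof (induction m)
  case (Suc m)
  have "insert c S \<subseteq> B \<and> card (insert c S) = Suc m"
    if "S \<subseteq> B" "card S = m" "c \<in> set_pmf (exp_mech \<epsilon> \<Delta> sc (B - S))" for c S
  proof -
    have "S \<noteq> B" using that Suc.prems by auto
    hence "B - S \<noteq> {}" using that(1) by blast
    hence "c \<in> B - S" using that assms by (simp add: set_exp_mech)
    thus ?thesis using that assms finite_subset[of S B] by auto
  qed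
  moreover have "set_pmf (peel_select \<epsilon> \<Delta> sc B m) \<subseteq> {S. S \<subseteq> B \<and> card S = m}" using Suc by simp
  ultimately show ?case unfolding peel_select.simps set_bind_pmf set_map_pmf by blast
qed simp

lemma renyi_le_peel_select:
  assumes "s > 1" "finite B" "\<epsilon> > 0" "\<Delta> > 0" "\<And>c. c \<in> B \<Longrightarrow> \<bar>sc c - sc' c\<bar> \<le> \<Delta>"
  shows "renyi_le s (real m * (\<epsilon>\<^sup>2 / 2)) (measure_pmf (peel_select \<epsilon> \<Delta> sc B m)) (measure_pmf (peel_select \<epsilon> \<Delta> sc' B m))"
proof (induction m)
  case 0
  show ?case using renyi_le_refl[OF assms(1) prob_space_measure_pmf[of "return_pmf {}"]] by simp
next
  case (Suc m)
  have "renyi_le s (real m * (\<epsilon>\<^sup>2 / 2) + \<epsilon>\<^sup>2 / 2)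
     (measure_pmf (peel_select \<epsilon> \<Delta> sc B m) \<bind> (\<lambda>S. measure_pmf (map_pmf (\<lambda>c. insert c S) (exp_mech \<epsilon> \<Delta> sc (B - S)))))
     (measure_pmf (peel_select \<epsilon> \<Delta> sc' B m) \<bind> (\<lambda>S. measure_pmf (map_pmf (\<lambda>c. insert c S) (exp_mech \<epsilon> \<Delta> sc' (B - S)))))"
  proof (rule renyi_le_bind[where N="count_space UNIV" and X=UNIV])
    fix S :: "'a set"
    have "renyi_le s (\<epsilon>\<^sup>2 / 2) (measure_pmf (exp_mech \<epsilon> \<Delta> sc (B - S))) (measure_pmf (exp_mech \<epsilon> \<Delta> sc' (B - S)))"
      using assms by (intro renyi_le_exp_mech) auto
    thus "renyi_le s (\<epsilon>\<^sup>2 / 2) (measure_pmf (map_pmf (\<lambda>c. insert c S) (exp_mech \<epsilon> \<Delta> sc (B - S))))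
       (measure_pmf (map_pmf (\<lambda>c. insert c S) (exp_mech \<epsilon> \<Delta> sc' (B - S))))"
      unfolding map_pmf_rep_eq by (rule renyi_le_distr) auto
  qed (use Suc assms in \<open>auto simp: prob_space_measure_pmf space_prob_algebra\<close>)
  thus ?case by (simp add: measure_pmf_bind algebra_simps add_divide_distrib)
qed

section \<open>Privacy of Gaussian noise\<close>

lemma distr_PiM_componentwise:
  assumes I: "finite I" and M: "\<And>i. i \<in> I \<Longrightarrow> prob_space (M i)" and f: "\<And>i. i \<in> I \<Longrightarrow> f i \<in> M i \<rightarrow>\<^sub>M N i"
  shows "distr (PiM I M) (PiM I N) (\<lambda>x. \<lambda>i\<in>I. f i (x i)) = PiM I (\<lambda>i. distr (M i) (N i) (f i))"
proof -
  have pr: "prob_space (distr (M i) (N i) (f i))" if "i \<in> I" for i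
    using M[OF that] f[OF that] by (rule prob_space.prob_space_distr)
  define M' where "M' i = (if i \<in> I then M i else return (count_space UNIV) undefined)" for i
  define N' where "N' i = (if i \<in> I then distr (M i) (N i) (f i) else return (count_space UNIV) undefined)" for i
  interpret M': product_prob_space M'
    by (intro product_prob_spaceI) (auto simp: M'_def M prob_space_return)
  interpret N': product_prob_space N'
    by (intro product_prob_spaceI) (auto simp: N'_def pr prob_space_return)
  have eq: "PiM I M = PiM I M'" "PiM I (\<lambda>i. distr (M i) (N i) (f i)) = PiM I N'"
    by (intro PiM_cong; simp add: M'_def N'_def)+
  have fm[measurable]: "(\<lambda>x. \<lambda>i\<in>I. f i (x i)) \<in> PiM I M' \<rightarrow>\<^sub>M PiM I N"
    by (rule measurable_restrict) (use f in \<open>auto simp: M'_def intro!: measurable_compose[OF measurable_component_singleton]\<close>)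
  have setsN: "sets (PiM I N) = sets (PiM I N')"
    by (intro sets_PiM_cong) (auto simp: N'_def)
  show ?thesis unfolding eq
  proof (rule N'.PiM_eqI[OF I])
    show "sets (distr (PiM I M') (PiM I N) (\<lambda>x. \<lambda>i\<in>I. f i (x i))) = sets (PiM I N')" using setsN by simp
    fix A assume A: "\<And>i. i \<in> I \<Longrightarrow> A i \<in> sets (N' i)"
    hence A': "A i \<in> sets (N i)" if "i \<in> I" for i using that A[OF that] by (simp add: N'_def)
    have PA: "Pi\<^sub>E I A \<in> sets (PiM I N)" using A' I by (intro sets_PiM_I_finite) auto
    have "(\<lambda>x. \<lambda>i\<in>I. f i (x i)) -` Pi\<^sub>E I A \<inter> space (PiM I M') = Pi\<^sub>E I (\<lambda>i. f i -` A i \<inter> space (M' i))"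
      by (auto simp: space_PiM PiE_iff extensional_def)
    hence "emeasure (distr (PiM I M') (PiM I N) (\<lambda>x. \<lambda>i\<in>I. f i (x i))) (Pi\<^sub>E I A)
       = emeasure (PiM I M') (Pi\<^sub>E I (\<lambda>i. f i -` A i \<inter> space (M' i)))"
      using PA by (simp add: emeasure_distr)
    also have "\<dots> = (\<Prod>i\<in>I. emeasure (M' i) (f i -` A i \<inter> space (M' i)))"
      by (rule M'.emeasure_PiM[OF I]) (use A' f in \<open>auto simp: M'_def intro!: measurable_sets\<close>)
    also have "\<dots> = (\<Prod>i\<in>I. emeasure (N' i) (A i))"
      by (intro prod.cong) (use A' f in \<open>auto simp: M'_def N'_def emeasure_distr\<close>)
    finally show "emeasure (distr (PiM I M') (PiM I N) (\<lambda>x. \<lambda>i\<in>I. f i (x i))) (Pi\<^sub>E I A) = (\<Prod>i\<in>I. emeasure (N' i) (A i))" .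
  qed
qed

lemma PiM_std_normal_shift:
  assumes "finite I"
  shows "distr (PiM I (\<lambda>_. std_normal)) (PiM I (\<lambda>_. borel)) (\<lambda>z. \<lambda>i\<in>I. z i + a i)
     = PiM I (\<lambda>i. density lborel (normal_density (a i) 1))"
  by (subst distr_PiM_componentwise[where f="\<lambda>i x. x + a i", OF assms])
     (auto simp: prob_space_normal_density distr_std_normal_shift)

text \<open>Independent shifts of the coordinates cost half their squared Euclidean distance.\<close>
lemma renyi_le_std_normal_shift:
  assumes "s > 1" "finite I" "(\<Sum>i\<in>I. (a i - a' i)\<^sup>2) / 2 \<le> r"
  shows "renyi_le s r (distr (PiM I (\<lambda>_. std_normal)) (PiM I (\<lambda>_. borel)) (\<lambda>z. \<lambda>i\<in>I. z i + a i))
    (distr (PiM I (\<lambda>_. std_normal)) (PiM I (\<lambda>_. borel)) (\<lambda>z. \<lambda>i\<in>I. z i + a' i))"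
  unfolding PiM_std_normal_shift[OF assms(2)]
proof (rule renyi_le_mono[OF renyi_le_PiM[where r="\<lambda>i. (a i - a' i)\<^sup>2 / 2"]])
  show "(\<Sum>i\<in>I. (a i - a' i)\<^sup>2 / 2) \<le> r" using assms(3) by (simp add: sum_divide_distrib[symmetric])
qed (use assms in \<open>auto intro!: renyi_le_normal_shift prob_space_normal_density\<close>)

text \<open>A release that uses Gaussian noise is written as a function \<open>G\<close> of a shifted standard Gaussian vector
\<open>z + a\<close>. This covers releases that scale the noise and that read the same noise variable several times.\<close>
lemma renyi_le_gauss_post:
  assumes s: "s > 1" and I: "finite I" and r: "(\<Sum>i\<in>I. (a i - a' i)\<^sup>2) / 2 \<le> r"
    and G: "G \<in> PiM I (\<lambda>_. borel) \<rightarrow>\<^sub>M N"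
    and F: "\<And>z. F z = G (\<lambda>i\<in>I. z i + a i)" and F': "\<And>z. F' z = G (\<lambda>i\<in>I. z i + a' i)"
  shows "renyi_le s r (distr (PiM I (\<lambda>_. std_normal)) N F) (distr (PiM I (\<lambda>_. std_normal)) N F')"
proof -
  have m: "(\<lambda>z. \<lambda>i\<in>I. z i + b i) \<in> PiM I (\<lambda>_. std_normal) \<rightarrow>\<^sub>M PiM I (\<lambda>_. borel)" for b :: "_ \<Rightarrow> real"
    by (rule measurable_restrict) measurable
  have "renyi_le s r (distr (distr (PiM I (\<lambda>_. std_normal)) (PiM I (\<lambda>_. borel)) (\<lambda>z. \<lambda>i\<in>I. z i + a i)) N G)
     (distr (distr (PiM I (\<lambda>_. std_normal)) (PiM I (\<lambda>_. borel)) (\<lambda>z. \<lambda>i\<in>I. z i + a' i)) N G)"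
    by (rule renyi_le_distr[OF renyi_le_std_normal_shift[OF s I r]]) (use G in auto)
  thus ?thesis
    by (simp add: distr_distr[OF G m] comp_def F[symmetric] F'[symmetric])
qed

section \<open>Privacy of the block releases\<close>

lemma chi_bound: "L \<ge> 0 \<Longrightarrow> \<bar>chi L z\<bar> \<le> L"
  by (cases "z = 0") (auto simp: chi_def abs_mult min_def field_simps)

lemma L2_set_chi_vec:
  assumes "R \<ge> 0"
  shows "L2_set (chi_vec R I x) I \<le> R"
proof -
  have "L2_set (chi_vec R I x) I = L2_set x I * min 1 (R / L2_set x I)"
    unfolding chi_vec_def using assms by (intro L2_set_left_distrib[symmetric]) (auto simp: L2_set_nonneg)
  also have "\<dots> \<le> L2_set x I * (R / L2_set x I)"
    by (intro mult_left_mono) (auto simp: L2_set_nonneg)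
  also have "\<dots> \<le> R" using assms by simp
  finally show ?thesis .
qed

lemma sum_chi_vec_sq:
  assumes "R \<ge> 0"
  shows "(\<Sum>i\<in>I. (chi_vec R I x i)\<^sup>2) \<le> R\<^sup>2"
proof -
  have "(L2_set (chi_vec R I x) I)\<^sup>2 \<le> R\<^sup>2"
    using L2_set_chi_vec[OF assms] by (intro power_mono) (auto simp: L2_set_nonneg)
  thus ?thesis by (simp add: L2_set_def sum_nonneg)
qed

text \<open>The Frobenius distance of two rank-one matrices is at most the sum of their norms.\<close>
lemma sum_outer_diff_sq:
  fixes u v u' v' :: "nat \<Rightarrow> real"
  assumes "finite I" "finite J" "(\<Sum>i\<in>I. (u i)\<^sup>2) \<le> r" "(\<Sum>j\<in>J. (v j)\<^sup>2) \<le> r"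
    "(\<Sum>i\<in>I. (u' i)\<^sup>2) \<le> r" "(\<Sum>j\<in>J. (v' j)\<^sup>2) \<le> r"
  shows "(\<Sum>(i,j)\<in>I\<times>J. (u i * v j - u' i * v' j)\<^sup>2) \<le> 4 * r\<^sup>2"
proof -
  have pr: "(\<Sum>(i,j)\<in>I\<times>J. (p i)\<^sup>2 * (q j)\<^sup>2) \<le> r\<^sup>2"
    if "(\<Sum>i\<in>I. (p i)\<^sup>2) \<le> r" "(\<Sum>j\<in>J. (q j)\<^sup>2) \<le> r" for p q :: "nat \<Rightarrow> real"
  proof -
    have "(\<Sum>(i,j)\<in>I\<times>J. (p i)\<^sup>2 * (q j)\<^sup>2) = (\<Sum>i\<in>I. (p i)\<^sup>2) * (\<Sum>j\<in>J. (q j)\<^sup>2)"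
      by (simp only: sum_product sum.cartesian_product)
    also have "\<dots> \<le> r * r" using that by (intro mult_mono) (auto intro: sum_nonneg order_trans[OF sum_nonneg[of I "\<lambda>i. (p i)\<^sup>2"]])
    finally show ?thesis by (simp add: power2_eq_square)
  qed
  have "(\<Sum>(i,j)\<in>I\<times>J. (u i * v j - u' i * v' j)\<^sup>2)
     \<le> (\<Sum>(i,j)\<in>I\<times>J. 2 * ((u i)\<^sup>2 * (v j)\<^sup>2) + 2 * ((u' i)\<^sup>2 * (v' j)\<^sup>2))"
  proof (intro sum_mono, clarify)
    fix i j
    have "0 \<le> (u i * v j + u' i * v' j)\<^sup>2" by simp
    thus "(u i * v j - u' i * v' j)\<^sup>2 \<le> 2 * ((u i)\<^sup>2 * (v j)\<^sup>2) + 2 * ((u' i)\<^sup>2 * (v' j)\<^sup>2)"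
      by (simp add: power2_eq_square algebra_simps)
  qed
  also have "\<dots> = 2 * (\<Sum>(i,j)\<in>I\<times>J. (u i)\<^sup>2 * (v j)\<^sup>2) + 2 * (\<Sum>(i,j)\<in>I\<times>J. (u' i)\<^sup>2 * (v' j)\<^sup>2)"
    by (simp add: sum.distrib sum_distrib_left case_prod_unfold)
  also have "\<dots> \<le> 2 * r\<^sup>2 + 2 * r\<^sup>2" using assms by (intro add_mono mult_left_mono pr) auto
  finally show ?thesis by simp
qed

lemma mean_replace_one:
  fixes f :: "'b \<Rightarrow> real"
  assumes "i \<in> {1..n}" "\<And>j. j \<in> {1..n} - {i} \<Longrightarrow> X j = X' j"
  shows "(1 / real n) * (\<Sum>m=1..n. f (X m)) - (1 / real n) * (\<Sum>m=1..n. f (X' m)) = (f (X i) - f (X' i)) / real n"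
proof -
  have "(\<Sum>m=1..n. f (X m)) = f (X i) + (\<Sum>m\<in>{1..n} - {i}. f (X m))" for X :: "nat \<Rightarrow> 'b"
    using assms(1) by (intro sum.remove) auto
  moreover have "(\<Sum>m\<in>{1..n} - {i}. f (X m)) = (\<Sum>m\<in>{1..n} - {i}. f (X' m))"
    using assms(2) by (intro sum.cong) auto
  ultimately show ?thesis by (simp add: add_divide_distrib diff_divide_distrib)
qed

definition upper_triangle :: "nat \<Rightarrow> (nat \<times> nat) set" where
  "upper_triangle d = {(i, j). 1 \<le> i \<and> i \<le> j \<and> j \<le> d}"

lemma finite_upper_triangle: "finite (upper_triangle d)"
  by (rule finite_subset[of _ "{1..d} \<times> {1..d}"]) (auto simp: upper_triangle_def)

text \<open>A diagonal block reads the noise variable at \<open>(min i j, max i j)\<close> for both \<open>(i, j)\<close> and \<open>(j, i)\<close>, so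
the mechanism is expressed through the noise on the upper triangle, each variable once. Replacing an
observation moves the block by at most \<open>2 * R\<^sup>2 / n\<close> in Frobenius norm, which costs \<open>\<rho> / 9\<close> at
this noise level.\<close>
lemma renyi_le_DPCovBlock:
  assumes s: "s > 1" and I: "I \<subseteq> {1..d}" and J: "J \<subseteq> {1..d}"
    and IJ: "I = J \<or> (\<forall>i\<in>I. \<forall>j\<in>J. i < j)" and \<rho>: "\<rho> > 0" and R: "R > 0"
    and i0: "i0 \<in> {1..n}" "\<And>j. j \<in> {1..n} - {i0} \<Longrightarrow> X j = X' j"
  shows "renyi_le s \<rho> (DPCovBlock n d X I J \<rho> R) (DPCovBlock n d X' I J \<rho> R)"
proof -
  have n: "real n > 0" using i0 by auto
  have fin: "finite I" "finite J" using I J finite_subset by auto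
  define A where "A X = (\<lambda>(i, j). (1 / real n) * (\<Sum>m=1..n. chi_vec R I (X m) i * chi_vec R J (X m) j))" for X :: "nat \<Rightarrow> nat \<Rightarrow> real"
  define \<sigma> where "\<sigma> = sqrt (18 * R ^ 4 / (\<rho> * (real n)\<^sup>2))"
  have \<sigma>: "\<sigma> > 0" "\<sigma>\<^sup>2 = 18 * R ^ 4 / (\<rho> * (real n)\<^sup>2)" using \<rho> R n by (auto simp: \<sigma>_def)
  define a where "a X b = (if b \<in> I \<times> J then A X b / \<sigma> else 0)" for X b
  define G where "G = (\<lambda>w. \<lambda>(i, j)\<in>I \<times> J. \<sigma> * w (min i j, max i j))"
  have sym: "A X (min i j, max i j) = A X (i, j)" "(min i j, max i j) \<in> I \<times> J" "(min i j, max i j) \<in> upper_triangle d"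
    if "i \<in> I" "j \<in> J" for X i j
  proof -
    have mm: "(min i j, max i j) = (i, j) \<or> (I = J \<and> (min i j, max i j) = (j, i))"
    proof (cases "i \<le> j")
      case False
      hence "I = J" using IJ that by force
      thus ?thesis using False by (simp add: min_def max_def)
    qed (simp add: min_def max_def)
    have "A X (j, i) = A X (i, j)" if "I = J" using that by (simp add: A_def mult.commute)
    with mm show "A X (min i j, max i j) = A X (i, j)" by metis
    show "(min i j, max i j) \<in> I \<times> J" using mm that by auto
    have "i \<in> {1..d}" "j \<in> {1..d}" using that I J by auto
    thus "(min i j, max i j) \<in> upper_triangle d" by (auto simp: upper_triangle_def)
  qed
  have law: "DPCovBlock n d X I J \<rho> R = distr (PiM (upper_triangle d) (\<lambda>_. std_normal)) (mat_space (I \<times> J))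
     (\<lambda>Z. \<lambda>(i, j)\<in>I \<times> J. A X (i, j) + \<sigma> * Z (min i j, max i j))" for X
    unfolding DPCovBlock_def A_def \<sigma>_def upper_triangle_def by simp
  show ?thesis
    unfolding law
  proof (rule renyi_le_gauss_post[OF s finite_upper_triangle, where G=G and a="a X" and a'="a X'"])
    show "G \<in> PiM (upper_triangle d) (\<lambda>_. borel) \<rightarrow>\<^sub>M mat_space (I \<times> J)"
      unfolding G_def mat_space_def
      by (rule measurable_restrict) (use sym in \<open>auto intro!: borel_measurable_times measurable_component_singleton\<close>)
    have F: "(\<lambda>(i, j)\<in>I \<times> J. A X (i, j) + \<sigma> * Z (min i j, max i j)) = G (\<lambda>b\<in>upper_triangle d. Z b + a X b)" for X Z
      unfolding G_def using sym \<sigma> by (intro restrict_ext) (auto simp: a_def field_simps)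
    show "(\<lambda>(i, j)\<in>I \<times> J. A X (i, j) + \<sigma> * Z (min i j, max i j)) = G (\<lambda>b\<in>upper_triangle d. Z b + a X b)" for Z by (rule F)
    show "(\<lambda>(i, j)\<in>I \<times> J. A X' (i, j) + \<sigma> * Z (min i j, max i j)) = G (\<lambda>b\<in>upper_triangle d. Z b + a X' b)" for Z by (rule F)
    have dA: "A X (i, j) - A X' (i, j) = (chi_vec R I (X i0) i * chi_vec R J (X i0) j - chi_vec R I (X' i0) i * chi_vec R J (X' i0) j) / real n" for i j
      unfolding A_def using mean_replace_one[OF i0, where f="\<lambda>x. chi_vec R I x i * chi_vec R J x j"] by simp
    \<comment> \<open>Each noise variable is counted once on the left; on a diagonal block this is only part of the entries.\<close>
    have "(\<Sum>b\<in>upper_triangle d. (a X b - a X' b)\<^sup>2) \<le> (\<Sum>b\<in>I \<times> J. ((A X b - A X' b) / \<sigma>)\<^sup>2)"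
    proof -
      have "(\<Sum>b\<in>upper_triangle d. (a X b - a X' b)\<^sup>2) = (\<Sum>b\<in>upper_triangle d \<inter> (I \<times> J). (a X b - a X' b)\<^sup>2)"
        by (rule sum.mono_neutral_right) (auto simp: finite_upper_triangle a_def)
      also have "\<dots> = (\<Sum>b\<in>upper_triangle d \<inter> (I \<times> J). ((A X b - A X' b) / \<sigma>)\<^sup>2)"
        by (rule sum.cong) (auto simp: a_def diff_divide_distrib)
      also have "\<dots> \<le> (\<Sum>b\<in>I \<times> J. ((A X b - A X' b) / \<sigma>)\<^sup>2)"
        by (rule sum_mono2) (use fin in auto)
      finally show ?thesis .
    qed
    also have "\<dots> = (\<Sum>(i,j)\<in>I \<times> J. (chi_vec R I (X i0) i * chi_vec R J (X i0) j - chi_vec R I (X' i0) i * chi_vec R J (X' i0) j)\<^sup>2) / (real n)\<^sup>2 / \<sigma>\<^sup>2"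
      unfolding sum_divide_distrib by (intro sum.cong refl) (auto simp: dA power_divide)
    also have "\<dots> \<le> 4 * (R\<^sup>2)\<^sup>2 / (real n)\<^sup>2 / \<sigma>\<^sup>2"
      using R fin by (intro divide_right_mono sum_outer_diff_sq sum_chi_vec_sq) auto
    also have "\<dots> = 2 * \<rho> / 9" unfolding \<sigma>(2) using R \<rho> n by (simp add: field_simps power_mult[symmetric])
    finally show "(\<Sum>b\<in>upper_triangle d. (a X b - a X' b)\<^sup>2) / 2 \<le> \<rho>" using \<rho> by simp
  qed
qed

lemma clipped_mean_sens:
  assumes "L \<ge> 0" "i0 \<in> {1..n}" "\<And>j. j \<in> {1..n} - {i0} \<Longrightarrow> X j = X' j"
  shows "\<bar>clipped_mean n L X b - clipped_mean n L X' b\<bar> \<le> 2 * L / real n"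
proof -
  obtain i j where b: "b = (i, j)" by fastforce
  have "clipped_mean n L X b - clipped_mean n L X' b = (chi L (X i0 i * X i0 j) - chi L (X' i0 i * X' i0 j)) / real n"
    unfolding clipped_mean_def b using mean_replace_one[OF assms(2,3), where f="\<lambda>x. chi L (x i * x j)"] by simp
  moreover have "\<bar>chi L (X i0 i * X i0 j) - chi L (X' i0 i * X' i0 j)\<bar> \<le> 2 * L"
    using chi_bound[OF assms(1), of "X i0 i * X i0 j"] chi_bound[OF assms(1), of "X' i0 i * X' i0 j"] by linarith
  ultimately show ?thesis by (simp add: divide_right_mono)
qed

lemma peel_rank_in: "k \<ge> 1 \<Longrightarrow> peel_rank n k a \<rho> \<in> {1..k}"
  unfolding peel_rank_def by (rule arg_min_if_finite) auto

lemma peel_rank_le: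
  fixes a \<rho> :: real and n k :: nat
  assumes "r \<in> {1..k}"
  defines "f \<equiv> \<lambda>r. a\<^sup>2 / real r + real r / real n + real k * (real r)\<^sup>2 / (\<rho> * (real n)\<^sup>2)"
  shows "f (peel_rank n k a \<rho>) \<le> f r"
  unfolding peel_rank_def f_def[symmetric] using assms by (intro arg_min_least) auto

text \<open>The second stage of the peeling release, for a given set \<open>S\<close> of selected entries.\<close>
definition peel_noise :: "(nat \<times> nat \<Rightarrow> real) \<Rightarrow> real \<Rightarrow> (nat \<times> nat) set \<Rightarrow> (nat \<times> nat) set \<Rightarrow> (nat \<times> nat \<Rightarrow> real) measure" where
  "peel_noise A \<sigma> B S = distr (\<Pi>\<^sub>M b\<in>S. std_normal) (mat_space B) (\<lambda>g. \<lambda>b\<in>B. if b \<in> S then A b + \<sigma> * g b else 0)"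

lemma peel_noise_measurable:
  "(\<lambda>g. \<lambda>b\<in>B. if b \<in> S then A b + \<sigma> * g b else 0) \<in> (\<Pi>\<^sub>M b\<in>S. std_normal) \<rightarrow>\<^sub>M mat_space B"
  unfolding mat_space_def
proof (rule measurable_restrict)
  fix b show "(\<lambda>g. if b \<in> S then A b + \<sigma> * g b else 0) \<in> borel_measurable (\<Pi>\<^sub>M b\<in>S. std_normal)"
    by (cases "b \<in> S") (auto intro!: borel_measurable_add borel_measurable_times measurable_compose[OF measurable_component_singleton])
qed

lemma space_peel_noise: "peel_noise A \<sigma> B S \<in> space (prob_algebra (mat_space B))"
  unfolding peel_noise_def space_prob_algebra
  by (auto intro!: prob_space.prob_space_distr peel_noise_measurable prob_space_PiM prob_space_normal_density)

text \<open>The \<open>k * r\<close> selections cost \<open>\<rho> / 2\<close>. Given the selected set, whose size is \<open>k * r\<close> almost surely, the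
entries on it move by at most \<open>2 * L / n\<close> each, and the noise variance is such that this costs the
other \<open>\<rho> / 2\<close>.\<close>
lemma renyi_le_peel_release:
  assumes s: "s > 1" and I: "finite I" "card I = k" and J: "finite J" "card J = k"
    and k: "k \<ge> 1" and \<rho>: "\<rho> > 0" and L: "L > 0"
    and i0: "i0 \<in> {1..n}" "\<And>j. j \<in> {1..n} - {i0} \<Longrightarrow> X j = X' j"
  shows "renyi_le s \<rho> (peel_release n L X k I J a \<rho>) (peel_release n L X' k I J a \<rho>)"
proof -
  define r where "r = peel_rank n k a \<rho>"
  have r: "1 \<le> r" "r \<le> k" using peel_rank_in[OF k, of n a \<rho>] by (auto simp: r_def)
  have n: "real n > 0" using i0 by auto
  define \<sigma> where "\<sigma> = sqrt (4 * L\<^sup>2 * real (k * r) / (\<rho> * (real n)\<^sup>2))"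
  define e where "e = sqrt (\<rho> / real (k * r))"
  have kr: "real (k * r) > 0" using r k by simp
  have \<sigma>: "\<sigma> > 0" "\<sigma>\<^sup>2 = 4 * L\<^sup>2 * real (k * r) / (\<rho> * (real n)\<^sup>2)" using \<rho> L n kr by (auto simp: \<sigma>_def simp del: of_nat_mult)
  have e: "e > 0" "e\<^sup>2 = \<rho> / real (k * r)" using \<rho> kr by (auto simp: e_def simp del: of_nat_mult)
  define A where "A = clipped_mean n L X"
  define A' where "A' = clipped_mean n L X'"
  have dA: "\<bar>A b - A' b\<bar> \<le> 2 * L / real n" for b
    unfolding A_def A'_def using L by (intro clipped_mean_sens[OF _ i0]) auto
  have law: "peel_release n L X k I J a \<rho> =
     measure_pmf (peel_select e (2 * L / real n) (\<lambda>b. \<bar>clipped_mean n L X b\<bar>) (I \<times> J) (k * r)) \<bind> peel_noise (clipped_mean n L X) \<sigma> (I \<times> J)" for X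
    unfolding peel_release_def Let_def r_def e_def \<sigma>_def peel_noise_def by simp
  have "renyi_le s (real (k * r) * (e\<^sup>2 / 2) + \<rho> / 2) (peel_release n L X k I J a \<rho>) (peel_release n L X' k I J a \<rho>)"
    unfolding law A_def[symmetric] A'_def[symmetric]
  proof (rule renyi_le_bind[OF s, where N="mat_space (I \<times> J)" and X="{S. S \<subseteq> I \<times> J \<and> card S = k * r}"])
    show "renyi_le s (real (k * r) * (e\<^sup>2 / 2)) (measure_pmf (peel_select e (2 * L / real n) (\<lambda>b. \<bar>A b\<bar>) (I \<times> J) (k * r)))
      (measure_pmf (peel_select e (2 * L / real n) (\<lambda>b. \<bar>A' b\<bar>) (I \<times> J) (k * r)))"
      by (rule renyi_le_peel_select)
         (use s I J e L n dA in \<open>auto intro: order_trans[OF abs_triangle_ineq3]\<close>)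
    have "k * r \<le> card (I \<times> J)" using I J r by (simp add: card_cartesian_product)
    from set_peel_select[OF _ this] I J
    show "AE S in measure_pmf (peel_select e (2 * L / real n) (\<lambda>b. \<bar>A b\<bar>) (I \<times> J) (k * r)). S \<in> {S. S \<subseteq> I \<times> J \<and> card S = k * r}"
      by (intro AE_pmfI) blast
    fix S :: "(nat \<times> nat) set" assume S: "S \<in> {S. S \<subseteq> I \<times> J \<and> card S = k * r}"
    hence finS: "finite S" using I J by (auto intro: finite_subset)
    show "renyi_le s (\<rho> / 2) (peel_noise A \<sigma> (I \<times> J) S) (peel_noise A' \<sigma> (I \<times> J) S)"
      unfolding peel_noise_def
    proof (rule renyi_le_gauss_post[OF s finS, where a="\<lambda>b. A b / \<sigma>" and a'="\<lambda>b. A' b / \<sigma>"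
          and G="\<lambda>w. \<lambda>b\<in>I \<times> J. if b \<in> S then \<sigma> * w b else 0"])
      show "(\<lambda>w. \<lambda>b\<in>I \<times> J. if b \<in> S then \<sigma> * w b else 0) \<in> PiM S (\<lambda>_. borel) \<rightarrow>\<^sub>M mat_space (I \<times> J)"
        unfolding mat_space_def
      proof (rule measurable_restrict)
        fix b show "(\<lambda>w. if b \<in> S then \<sigma> * w b else 0) \<in> borel_measurable (PiM S (\<lambda>_. borel))"
          by (cases "b \<in> S") (auto intro!: borel_measurable_times measurable_component_singleton)
      qed
      have "(\<Sum>b\<in>S. (A b / \<sigma> - A' b / \<sigma>)\<^sup>2) \<le> (\<Sum>b\<in>S. (2 * L / real n)\<^sup>2 / \<sigma>\<^sup>2)"
      proof (rule sum_mono)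
        fix b
        have "(A b / \<sigma> - A' b / \<sigma>)\<^sup>2 = \<bar>A b - A' b\<bar>\<^sup>2 / \<sigma>\<^sup>2" by (simp add: diff_divide_distrib[symmetric] power_divide)
        also have "\<dots> \<le> (2 * L / real n)\<^sup>2 / \<sigma>\<^sup>2" by (intro divide_right_mono power_mono dA) auto
        finally show "(A b / \<sigma> - A' b / \<sigma>)\<^sup>2 \<le> (2 * L / real n)\<^sup>2 / \<sigma>\<^sup>2" .
      qed
      also have "\<dots> = real (k * r) * ((2 * L / real n)\<^sup>2 / \<sigma>\<^sup>2)" using S by simp
      also have "\<dots> = \<rho>" unfolding \<sigma>(2) using \<rho> L n kr by (simp add: power2_eq_square field_simps del: of_nat_mult)
      finally show "(\<Sum>b\<in>S. (A b / \<sigma> - A' b / \<sigma>)\<^sup>2) / 2 \<le> \<rho> / 2" by simp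
    qed (use \<sigma> in \<open>auto simp: fun_eq_iff field_simps\<close>)
  qed (use space_peel_noise in \<open>auto simp: prob_space_measure_pmf\<close>)
  moreover have "real (k * r) * (e\<^sup>2 / 2) + \<rho> / 2 = \<rho>"
    unfolding e(2) using kr by (simp del: of_nat_mult)
  ultimately show ?thesis by simp
qed

section \<open>The spectral theorem in an arbitrary dimension\<close>

definition orthonormal :: "nat \<Rightarrow> nat \<Rightarrow> (nat \<Rightarrow> nat \<Rightarrow> real) \<Rightarrow> bool" where
  "orthonormal d m U \<longleftrightarrow> (\<forall>p\<in>{1..m}. \<forall>q\<in>{1..m}. (\<Sum>i=1..d. U i p * U i q) = (if p = q then 1 else 0))"

text \<open>The rows of the projection onto the complement of an orthonormal family have squared norms that add up
to the dimension \<open>d - m\<close> of the complement. So there is a nonzero row if \<open>m < d\<close>, and all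
rows vanish if \<open>m = d\<close>.\<close>
lemma orthonormal_residual:
  assumes "orthonormal d m U"
  shows "(\<Sum>j=1..d. \<Sum>i=1..d. ((if i = j then 1 else 0) - (\<Sum>p=1..m. U j p * U i p))\<^sup>2) = real d - real m"
proof -
  have row: "(\<Sum>i=1..d. ((if i = j then 1 else 0) - (\<Sum>p=1..m. U j p * U i p))\<^sup>2) = 1 - (\<Sum>p=1..m. U j p * U j p)"
    if j: "j \<in> {1..d}" for j
  proof -
    define s where "s i = (\<Sum>p=1..m. U j p * U i p)" for i
    have "(\<Sum>i=1..d. (s i)\<^sup>2) = (\<Sum>i=1..d. \<Sum>p=1..m. \<Sum>q=1..m. (U j p * U i p) * (U j q * U i q))"
      by (simp add: s_def power2_eq_square sum_product)
    also have "\<dots> = (\<Sum>p=1..m. \<Sum>i=1..d. \<Sum>q=1..m. (U j p * U i p) * (U j q * U i q))"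
      by (rule sum.swap)
    also have "\<dots> = (\<Sum>p=1..m. \<Sum>q=1..m. \<Sum>i=1..d. (U j p * U i p) * (U j q * U i q))"
      by (intro sum.cong refl sum.swap)
    also have "\<dots> = (\<Sum>p=1..m. \<Sum>q=1..m. U j p * U j q * (\<Sum>i=1..d. U i p * U i q))"
      by (simp add: sum_distrib_left mult_ac)
    also have "\<dots> = (\<Sum>p=1..m. \<Sum>q=1..m. if q = p then U j p * U j p else 0)"
      using assms unfolding orthonormal_def by (intro sum.cong) auto
    also have "\<dots> = s j" by (simp add: s_def)
    finally have ss: "(\<Sum>i=1..d. (s i)\<^sup>2) = s j" .
    have "(\<Sum>i=1..d. ((if i = j then 1 else 0) - s i)\<^sup>2) = (\<Sum>i=1..d. (if i = j then 1 - 2 * s j else 0) + (s i)\<^sup>2)"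
      by (intro sum.cong refl) (auto simp: power2_eq_square algebra_simps)
    also have "\<dots> = 1 - s j" using j ss by (simp add: sum.distrib)
    finally show ?thesis by (simp add: s_def)
  qed
  have "(\<Sum>j=1..d. \<Sum>i=1..d. ((if i = j then 1 else 0) - (\<Sum>p=1..m. U j p * U i p))\<^sup>2) = (\<Sum>j=1..d. 1 - (\<Sum>p=1..m. U j p * U j p))"
    by (intro sum.cong refl row) auto
  also have "\<dots> = real d - (\<Sum>p=1..m. \<Sum>j=1..d. U j p * U j p)"
    by (simp add: sum_subtractf) (rule sum.swap)
  also have "(\<Sum>p=1..m. \<Sum>j=1..d. U j p * U j p) = (\<Sum>p=1..m. 1)"
    using assms unfolding orthonormal_def by (intro sum.cong) auto
  finally show ?thesis by simp
qed

lemma orthonormal_complete: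
  assumes "orthonormal d d U" "i \<in> {1..d}" "j \<in> {1..d}"
  shows "(\<Sum>p=1..d. U i p * U j p) = (if i = j then 1 else 0)"
proof -
  have "(\<Sum>j=1..d. \<Sum>i=1..d. ((if i = j then 1 else 0) - (\<Sum>p=1..d. U j p * U i p))\<^sup>2) = 0"
    using orthonormal_residual[OF assms(1)] by simp
  hence "\<forall>j\<in>{1..d}. (\<Sum>i=1..d. ((if i = j then 1 else 0) - (\<Sum>p=1..d. U j p * U i p))\<^sup>2) = 0"
    by (subst (asm) sum_nonneg_eq_0_iff) (auto intro!: sum_nonneg)
  hence "\<forall>j\<in>{1..d}. \<forall>i\<in>{1..d}. ((if i = j then 1 else 0) - (\<Sum>p=1..d. U j p * U i p))\<^sup>2 = 0"
    by (subst (asm) sum_nonneg_eq_0_iff) auto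
  with assms(2,3) have "((if i = j then 1 else 0) - (\<Sum>p=1..d. U j p * U i p))\<^sup>2 = 0" by blast
  thus ?thesis by (simp add: mult.commute split: if_splits)
qed

lemma orthogonal_unit_exists:
  assumes U: "orthonormal d m U" and "m < d"
  shows "\<exists>x. (\<forall>i. i \<notin> {1..d} \<longrightarrow> x i = 0) \<and> (\<Sum>i=1..d. (x i)\<^sup>2) = 1 \<and> (\<forall>p\<in>{1..m}. (\<Sum>i=1..d. x i * U i p) = 0)"
proof -
  define r where "r j i = (if i = j then 1 else 0) - (\<Sum>p=1..m. U j p * U i p)" for j i
  have "(\<Sum>j=1..d. \<Sum>i=1..d. (r j i)\<^sup>2) > 0"
    using orthonormal_residual[OF U] assms(2) by (simp add: r_def)
  then obtain j where j: "j \<in> {1..d}" and pos: "(\<Sum>i=1..d. (r j i)\<^sup>2) > 0"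
    using sum_nonpos[of "{1..d}" "\<lambda>j. \<Sum>i=1..d. (r j i)\<^sup>2"] by force
  define N where "N = sqrt (\<Sum>i=1..d. (r j i)\<^sup>2)"
  have N: "N > 0" "N\<^sup>2 = (\<Sum>i=1..d. (r j i)\<^sup>2)" using pos by (auto simp: N_def)
  have orth: "(\<Sum>i=1..d. r j i * U i p) = 0" if p: "p \<in> {1..m}" for p
  proof -
    have "(\<Sum>i=1..d. (\<Sum>q=1..m. U j q * U i q) * U i p) = (\<Sum>i=1..d. \<Sum>q=1..m. U j q * (U i q * U i p))"
      by (simp only: sum_distrib_right mult.assoc)
    also have "\<dots> = (\<Sum>q=1..m. \<Sum>i=1..d. U j q * (U i q * U i p))" by (rule sum.swap)
    also have "\<dots> = (\<Sum>q=1..m. U j q * (\<Sum>i=1..d. U i q * U i p))"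
      by (simp only: sum_distrib_left)
    also have "\<dots> = (\<Sum>q=1..m. if q = p then U j p else 0)"
      using U p unfolding orthonormal_def by (intro sum.cong) auto
    also have "\<dots> = U j p" using p by simp
    finally have *: "(\<Sum>i=1..d. (\<Sum>q=1..m. U j q * U i q) * U i p) = U j p" .
    have "(\<Sum>i=1..d. r j i * U i p) = (\<Sum>i=1..d. (if i = j then U j p else 0)) - (\<Sum>i=1..d. (\<Sum>q=1..m. U j q * U i q) * U i p)"
      unfolding sum_subtractf[symmetric] by (intro sum.cong refl) (auto simp: r_def algebra_simps)
    thus ?thesis using j unfolding * by simp
  qed
  show ?thesis
  proof (intro exI conjI ballI allI impI)
    let ?x = "\<lambda>i. if i \<in> {1..d} then r j i / N else 0"
    show "i \<notin> {1..d} \<Longrightarrow> ?x i = 0" for i by (rule if_not_P)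
    have "(\<Sum>i=1..d. (?x i)\<^sup>2) = (\<Sum>i=1..d. (r j i)\<^sup>2) / N\<^sup>2"
      unfolding sum_divide_distrib by (intro sum.cong) (auto simp: power_divide)
    also have "\<dots> = 1" unfolding N(2)[symmetric] using N(1) by simp
    finally show "(\<Sum>i=1..d. (?x i)\<^sup>2) = 1" .
    fix p assume p: "p \<in> {1..m}"
    have "(\<Sum>i=1..d. ?x i * U i p) = (\<Sum>i=1..d. r j i * U i p) / N"
      unfolding sum_divide_distrib by (intro sum.cong) auto
    thus "(\<Sum>i=1..d. ?x i * U i p) = 0" using orth[OF p] by simp
  qed
qed

definition quad_form :: "nat \<Rightarrow> (nat \<times> nat \<Rightarrow> real) \<Rightarrow> (nat \<Rightarrow> real) \<Rightarrow> real" where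
  "quad_form d A x = (\<Sum>i=1..d. \<Sum>j=1..d. x i * A (i, j) * x j)"

text \<open>Vectors are functions on all of \<open>nat\<close>. Freezing the coordinates outside \<open>{1..d}\<close> at zero makes the
sphere compact in the product topology, by Tychonoff's theorem.\<close>
lemma compact_constrained_sphere:
  fixes d m :: nat
  shows "compact {x. (\<forall>i. i \<notin> {1..d} \<longrightarrow> x i = 0) \<and> (\<Sum>i=1..d. (x i)\<^sup>2) = 1 \<and> (\<forall>p\<in>{1..m}. (\<Sum>i=1..d. x i * U i p) = (0::real))}"
  (is "compact ?K")
proof -
  let ?S = "\<lambda>i::nat. if i \<in> {1..d} then {-1..1} else {0::real}"
  have "compactin (product_topology (\<lambda>_::nat. euclidean) UNIV) (PiE UNIV ?S)"
    by (subst compactin_PiE) auto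
  hence box: "compact (PiE UNIV ?S)" by (simp add: euclidean_product_topology)
  have K: "?K = (\<Inter>i\<in>- {1..d}. {x. x i = 0}) \<inter> {x. (\<Sum>i=1..d. (x i)\<^sup>2) = 1} \<inter> (\<Inter>p\<in>{1..m}. {x. (\<Sum>i=1..d. x i * U i p) = 0})"
    by auto
  have cl: "closed ?K" unfolding K
    by (intro closed_Int closed_INT ballI closed_Collect_eq continuous_intros) auto
  have sub: "?K \<subseteq> PiE UNIV ?S"
  proof
    fix x assume x: "x \<in> ?K"
    have "x i \<in> ?S i" for i
    proof (cases "i \<in> {1..d}")
      case True
      have "(x i)\<^sup>2 \<le> (\<Sum>i=1..d. (x i)\<^sup>2)" using True by (intro member_le_sum) auto
      hence "(x i)\<^sup>2 \<le> 1" using x by simp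
      hence "\<bar>x i\<bar> \<le> 1" by (simp add: abs_square_le_1)
      thus ?thesis using True by auto
    qed (use x in simp)
    thus "x \<in> PiE UNIV ?S" by blast
  qed
  show ?thesis using compact_Int_closed[OF box cl] unfolding inf.absorb2[OF sub] .
qed

text \<open>A maximizer \<open>x\<close> of the quadratic form on the unit sphere of the orthogonal complement. The residual
\<open>w = A x - \<mu> x\<close> is orthogonal to \<open>x\<close> and, since the \<open>U p\<close> are eigenvectors, to all of them, so
\<open>x + t * w\<close> stays in the complement. Moving in this direction changes the form by
\<open>2 * t * norm w ^ 2\<close> to first order, so maximality forces \<open>w = 0\<close>.\<close>
lemma eigenvector_step:
  assumes sym: "\<And>i j. i \<in> {1..d} \<Longrightarrow> j \<in> {1..d} \<Longrightarrow> A (i, j) = A (j, i)"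
    and U: "orthonormal d m U" and m: "m < d"
    and eig: "\<And>p i. p \<in> {1..m} \<Longrightarrow> i \<in> {1..d} \<Longrightarrow> (\<Sum>j=1..d. A (i, j) * U j p) = l p * U i p"
  shows "\<exists>x \<mu>. (\<Sum>i=1..d. (x i)\<^sup>2) = 1 \<and> (\<forall>p\<in>{1..m}. (\<Sum>i=1..d. x i * U i p) = 0) \<and>
      (\<forall>i\<in>{1..d}. (\<Sum>j=1..d. A (i, j) * x j) = \<mu> * x i)"
proof -
  let ?K = "{x. (\<forall>i. i \<notin> {1..d} \<longrightarrow> x i = 0) \<and> (\<Sum>i=1..d. (x i)\<^sup>2) = 1 \<and> (\<forall>p\<in>{1..m}. (\<Sum>i=1..d. x i * U i p) = (0::real))}"
  have "continuous_on UNIV (quad_form d A)" unfolding quad_form_def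
    by (intro continuous_intros) auto
  hence "continuous_on ?K (quad_form d A)" by (rule continuous_on_subset) simp
  moreover have "?K \<noteq> {}" using orthogonal_unit_exists[OF U m] by blast
  ultimately have "\<exists>x\<in>?K. \<forall>y\<in>?K. quad_form d A y \<le> quad_form d A x"
    by (intro continuous_attains_sup compact_constrained_sphere)
  then obtain x where x: "x \<in> ?K" and max0: "\<forall>y\<in>?K. quad_form d A y \<le> quad_form d A x" by (rule bexE)
  have max: "quad_form d A y \<le> quad_form d A x" if "y \<in> ?K" for y using max0 that by (rule bspec)
  define \<mu> where "\<mu> = quad_form d A x"
  define Ax where "Ax i = (\<Sum>j=1..d. A (i, j) * x j)" for i
  define w where "w i = (if i \<in> {1..d} then Ax i - \<mu> * x i else 0)" for i
  have xx: "(\<Sum>i=1..d. x i * x i) = 1" using x by (simp add: power2_eq_square)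
  have xAx: "(\<Sum>i=1..d. x i * Ax i) = \<mu>" by (simp add: \<mu>_def quad_form_def Ax_def sum_distrib_left mult_ac)
  have wsum: "(\<Sum>i=1..d. f i * w i) = (\<Sum>i=1..d. f i * Ax i) - \<mu> * (\<Sum>i=1..d. f i * x i)" for f
    unfolding sum_distrib_left sum_subtractf[symmetric] by (intro sum.cong) (auto simp: w_def algebra_simps)
  have wx: "(\<Sum>i=1..d. x i * w i) = 0" using wsum[of x] xx xAx by simp
  have wU: "(\<Sum>i=1..d. w i * U i p) = 0" if p: "p \<in> {1..m}" for p
  proof -
    have "(\<Sum>i=1..d. U i p * Ax i) = (\<Sum>i=1..d. \<Sum>j=1..d. U i p * (A (i, j) * x j))"
      by (simp add: Ax_def sum_distrib_left)
    also have "\<dots> = (\<Sum>j=1..d. \<Sum>i=1..d. U i p * (A (i, j) * x j))" by (rule sum.swap)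
    also have "\<dots> = (\<Sum>j=1..d. x j * (\<Sum>i=1..d. A (j, i) * U i p))"
      unfolding sum_distrib_left using sym by (intro sum.cong) (auto simp: mult_ac)
    also have "\<dots> = (\<Sum>j=1..d. l p * (x j * U j p))"
      using eig[OF p] by (intro sum.cong) auto
    also have "\<dots> = 0" using x p by (simp add: sum_distrib_left[symmetric])
    finally have "(\<Sum>i=1..d. U i p * Ax i) = 0" .
    thus ?thesis using wsum[of "\<lambda>i. U i p"] x p by (simp add: mult.commute)
  qed
  define b where "b = (\<Sum>i=1..d. w i * w i)"
  have wAx: "(\<Sum>i=1..d. w i * Ax i) = b" using wsum[of w] wx by (simp add: b_def mult.commute)
  have ineq: "2 * t * b \<le> t\<^sup>2 * (\<mu> * b - quad_form d A w)" for t
  proof -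
    define N2 where "N2 = 1 + t\<^sup>2 * b"
    have b0: "b \<ge> 0" unfolding b_def by (intro sum_nonneg) auto
    have N2: "N2 > 0" unfolding N2_def using b0 by (simp add: add_pos_nonneg)
    define z where "z i = (x i + t * w i) / sqrt N2" for i
    have "(\<Sum>i=1..d. (z i)\<^sup>2) = (\<Sum>i=1..d. x i * x i + 2 * t * (x i * w i) + t\<^sup>2 * (w i * w i)) / N2"
      unfolding sum_divide_distrib using N2 by (intro sum.cong) (auto simp: z_def power_divide power2_eq_square algebra_simps)
    also have "(\<Sum>i=1..d. x i * x i + 2 * t * (x i * w i) + t\<^sup>2 * (w i * w i)) = N2"
      unfolding sum.distrib sum_distrib_left[symmetric] xx wx b_def[symmetric] by (simp add: N2_def)
    also have "N2 / N2 = 1" using N2 by simp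
    finally have zz: "(\<Sum>i=1..d. (z i)\<^sup>2) = 1" .
    have zU: "(\<Sum>i=1..d. z i * U i p) = 0" if p: "p \<in> {1..m}" for p
    proof -
      have "(\<Sum>i=1..d. z i * U i p) = ((\<Sum>i=1..d. x i * U i p) + t * (\<Sum>i=1..d. w i * U i p)) / sqrt N2"
        unfolding sum_distrib_left sum.distrib[symmetric] sum_divide_distrib by (intro sum.cong) (auto simp: z_def algebra_simps)
      thus ?thesis using wU[OF p] x p by simp
    qed
    have "z \<in> ?K" using zz zU x by (auto simp: z_def w_def)
    hence "quad_form d A z \<le> \<mu>" unfolding \<mu>_def by (rule max)
    also have "quad_form d A z = (\<mu> + 2 * t * b + t\<^sup>2 * quad_form d A w) / N2"
    proof -
      have "quad_form d A z = (\<Sum>i=1..d. \<Sum>j=1..d. (x i * A (i,j) * x j + t * (w i * A (i, j) * x j) + t * (x i * A (i, j) * w j) + t\<^sup>2 * (w i * A (i, j) * w j))) / N2"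
        unfolding quad_form_def sum_divide_distrib z_def using N2
        by (intro sum.cong refl) (simp add: field_simps power2_eq_square)
      also have "(\<Sum>i=1..d. \<Sum>j=1..d. (x i * A (i,j) * x j + t * (w i * A (i, j) * x j) + t * (x i * A (i, j) * w j) + t\<^sup>2 * (w i * A (i, j) * w j)))
         = quad_form d A x + t * (\<Sum>i=1..d. \<Sum>j=1..d. w i * A (i, j) * x j) + t * (\<Sum>i=1..d. \<Sum>j=1..d. x i * A (i, j) * w j) + t\<^sup>2 * quad_form d A w"
        by (simp add: quad_form_def sum.distrib sum_distrib_left[symmetric])
      also have "(\<Sum>i=1..d. \<Sum>j=1..d. w i * A (i, j) * x j) = b"
        unfolding wAx[symmetric] Ax_def by (simp add: sum_distrib_left mult_ac)
      also have "(\<Sum>i=1..d. \<Sum>j=1..d. x i * A (i, j) * w j) = (\<Sum>j=1..d. \<Sum>i=1..d. x i * A (i, j) * w j)" by (rule sum.swap)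
      also have "\<dots> = (\<Sum>j=1..d. \<Sum>i=1..d. w j * A (j, i) * x i)"
        using sym by (intro sum.cong refl) (auto simp: mult_ac)
      also have "\<dots> = b" unfolding wAx[symmetric] Ax_def by (simp add: sum_distrib_left mult_ac)
      finally show ?thesis by (simp add: \<mu>_def algebra_simps)
    qed
    finally show ?thesis using N2 by (simp add: field_simps N2_def)
  qed
  have "b \<le> 0"
  proof (rule ccontr)
    assume "\<not> b \<le> 0"
    hence b: "b > 0" by simp
    define c where "c = \<mu> * b - quad_form d A w"
    \<comment> \<open>Small enough for the linear term in \<open>t\<close> to exceed the quadratic one.\<close>
    define t where "t = b / (\<bar>c\<bar> + 1)"
    have t: "t > 0" using b by (auto simp: t_def intro!: divide_pos_pos)
    have "t * (2 * b) \<le> t * (t * c)" using ineq[of t] by (simp add: c_def power2_eq_square mult_ac)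
    hence "2 * b \<le> t * c" using t by simp
    also have "\<dots> \<le> t * (\<bar>c\<bar> + 1)" using t by (intro mult_left_mono) auto
    also have "\<dots> = b" by (simp add: t_def)
    finally show False using b by simp
  qed
  moreover have "b \<ge> 0" unfolding b_def by (intro sum_nonneg) auto
  ultimately have "b = 0" by simp
  hence "\<forall>i\<in>{1..d}. w i * w i = 0" unfolding b_def by (subst (asm) sum_nonneg_eq_0_iff) auto
  hence "\<forall>i\<in>{1..d}. Ax i = \<mu> * x i" by (auto simp: w_def)
  thus ?thesis using x unfolding Ax_def by blast
qed

theorem spectral_theorem:
  assumes sym: "\<And>i j. i \<in> {1..d} \<Longrightarrow> j \<in> {1..d} \<Longrightarrow> A (i, j) = A (j, i)"
  shows "\<exists>U l. orthonormal d d U \<and> (\<forall>(i, j)\<in>idx d. A (i, j) = (\<Sum>p=1..d. l p * U i p * U j p))"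
proof -
  have "m \<le> d \<Longrightarrow> \<exists>U l. orthonormal d m U \<and> (\<forall>p\<in>{1..m}. \<forall>i\<in>{1..d}. (\<Sum>j=1..d. A (i, j) * U j p) = l p * U i p)" for m
  proof (induction m)
    case 0
    show ?case by (simp add: orthonormal_def)
  next
    case (Suc m)
    from Suc.IH[OF Suc_leD[OF Suc.prems]] obtain U l where U: "orthonormal d m U" and
      eig0: "\<forall>p\<in>{1..m}. \<forall>i\<in>{1..d}. (\<Sum>j=1..d. A (i, j) * U j p) = l p * U i p" by blast
    have eig: "\<And>p i. p \<in> {1..m} \<Longrightarrow> i \<in> {1..d} \<Longrightarrow> (\<Sum>j=1..d. A (i, j) * U j p) = l p * U i p" using eig0 by blast
    have "m < d" using Suc.prems by simp
    from eigenvector_step[OF sym U this eig]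
    obtain x \<mu> where x1: "(\<Sum>i=1..d. (x i)\<^sup>2) = 1" "\<forall>p\<in>{1..m}. (\<Sum>i=1..d. x i * U i p) = 0"
      "\<forall>i\<in>{1..d}. (\<Sum>j=1..d. A (i, j) * x j) = \<mu> * x i" by blast
    have x: "(\<Sum>i=1..d. (x i)\<^sup>2) = 1" "\<And>p. p \<in> {1..m} \<Longrightarrow> (\<Sum>i=1..d. x i * U i p) = 0"
      "\<And>i. i \<in> {1..d} \<Longrightarrow> (\<Sum>j=1..d. A (i, j) * x j) = \<mu> * x i" using x1 by blast+
    define U' where "U' i p = (if p = Suc m then x i else U i p)" for i p
    have "orthonormal d (Suc m) U'"
      unfolding orthonormal_def
    proof (intro ballI)
      fix p q assume pq: "p \<in> {1..Suc m}" "q \<in> {1..Suc m}"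
      show "(\<Sum>i=1..d. U' i p * U' i q) = (if p = q then 1 else 0)"
      proof (cases "p = Suc m"; cases "q = Suc m")
        assume "p = Suc m" "q = Suc m" thus ?thesis using x(1) by (simp add: U'_def power2_eq_square)
      next
        assume "p = Suc m" "q \<noteq> Suc m" thus ?thesis using x(2)[of q] pq by (simp add: U'_def)
      next
        assume "p \<noteq> Suc m" "q = Suc m" thus ?thesis using x(2)[of p] pq by (simp add: U'_def mult.commute)
      next
        assume "p \<noteq> Suc m" "q \<noteq> Suc m" thus ?thesis using U pq by (auto simp: U'_def orthonormal_def)
      qed
    qed
    moreover have "\<forall>p\<in>{1..Suc m}. \<forall>i\<in>{1..d}. (\<Sum>j=1..d. A (i, j) * U' j p) = (l(Suc m := \<mu>)) p * U' i p"
      using x(3) eig by (auto simp: U'_def le_Suc_eq)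
    ultimately show ?case by blast
  qed
  from this[OF order_refl] obtain U l where U: "orthonormal d d U" and
      eig0: "\<forall>p\<in>{1..d}. \<forall>i\<in>{1..d}. (\<Sum>j=1..d. A (i, j) * U j p) = l p * U i p" by blast
  have eig: "\<And>p i. p \<in> {1..d} \<Longrightarrow> i \<in> {1..d} \<Longrightarrow> (\<Sum>j=1..d. A (i, j) * U j p) = l p * U i p" using eig0 by blast
  have "A (i, j) = (\<Sum>p=1..d. l p * U i p * U j p)" if ij: "i \<in> {1..d}" "j \<in> {1..d}" for i j
  proof -
    have "(\<Sum>p=1..d. l p * U i p * U j p) = (\<Sum>p=1..d. (\<Sum>k=1..d. A (i, k) * U k p) * U j p)"
      using eig ij by (intro sum.cong) auto
    also have "\<dots> = (\<Sum>p=1..d. \<Sum>k=1..d. A (i, k) * U k p * U j p)"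
      by (simp add: sum_distrib_right)
    also have "\<dots> = (\<Sum>k=1..d. \<Sum>p=1..d. A (i, k) * U k p * U j p)" by (rule sum.swap)
    also have "\<dots> = (\<Sum>k=1..d. A (i, k) * (\<Sum>p=1..d. U k p * U j p))"
      by (simp add: sum_distrib_left mult_ac)
    also have "\<dots> = (\<Sum>k=1..d. if k = j then A (i, j) else 0)"
      using orthonormal_complete[OF U] ij by (intro sum.cong) auto
    also have "\<dots> = A (i, j)" using ij by simp
    finally show ?thesis by simp
  qed
  thus ?thesis using U by blast
qed

section \<open>Spectral clipping as a projection\<close>

text \<open>The relation of which \<open>spectral_clip\<close> picks the unique extensional solution.\<close>
definition is_clip :: "nat \<Rightarrow> real \<Rightarrow> (nat \<times> nat \<Rightarrow> real) \<Rightarrow> (nat \<times> nat \<Rightarrow> real) \<Rightarrow> bool" where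
  "is_clip d M0 A B \<longleftrightarrow> (\<exists>U l. orthonormal d d U \<and>
        (\<forall>(i, j)\<in>idx d. A (i, j) = (\<Sum>p=1..d. l p * U i p * U j p)) \<and>
        (\<forall>(i, j)\<in>idx d. B (i, j) = (\<Sum>p=1..d. max 0 (min M0 (l p)) * U i p * U j p)))"

definition psd_le :: "nat \<Rightarrow> real \<Rightarrow> (nat \<times> nat \<Rightarrow> real) \<Rightarrow> bool" where
  "psd_le d M0 S \<longleftrightarrow> (\<forall>x. 0 \<le> quad_form d S x \<and> quad_form d S x \<le> M0 * (\<Sum>i=1..d. (x i)\<^sup>2))"

lemma quad_form_spectral:
  assumes "\<forall>(i, j)\<in>idx d. B (i, j) = (\<Sum>p=1..d. c p * U i p * U j p)"
  shows "quad_form d B x = (\<Sum>p=1..d. c p * (\<Sum>i=1..d. U i p * x i)\<^sup>2)"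
proof -
  have "quad_form d B x = (\<Sum>i=1..d. \<Sum>j=1..d. \<Sum>p=1..d. x i * (c p * U i p * U j p) * x j)"
    unfolding quad_form_def using assms by (intro sum.cong refl) (auto simp: sum_distrib_left sum_distrib_right)
  also have "\<dots> = (\<Sum>i=1..d. \<Sum>p=1..d. \<Sum>j=1..d. x i * (c p * U i p * U j p) * x j)"
    by (intro sum.cong refl sum.swap)
  also have "\<dots> = (\<Sum>p=1..d. \<Sum>i=1..d. \<Sum>j=1..d. x i * (c p * U i p * U j p) * x j)" by (rule sum.swap)
  also have "\<dots> = (\<Sum>p=1..d. c p * (\<Sum>i=1..d. U i p * x i)\<^sup>2)"
    by (simp add: power2_eq_square sum_product sum_distrib_left mult_ac)
  finally show ?thesis .
qed

lemma is_clip_psd: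
  assumes "is_clip d M0 A B" "M0 \<ge> 0"
  shows "psd_le d M0 B"
proof -
  obtain U l where U: "orthonormal d d U" and B: "\<forall>(i, j)\<in>idx d. B (i, j) = (\<Sum>p=1..d. max 0 (min M0 (l p)) * U i p * U j p)"
    using assms unfolding is_clip_def by blast
  show ?thesis unfolding psd_le_def
  proof (intro allI)
    fix x :: "nat \<Rightarrow> real"
    have q: "quad_form d B x = (\<Sum>p=1..d. max 0 (min M0 (l p)) * (\<Sum>i=1..d. U i p * x i)\<^sup>2)"
      by (rule quad_form_spectral[OF B])
    have "(\<Sum>p=1..d. (\<Sum>i=1..d. U i p * x i)\<^sup>2) = (\<Sum>p=1..d. \<Sum>i=1..d. \<Sum>j=1..d. (U i p * x i) * (U j p * x j))"
      by (simp add: power2_eq_square sum_product)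
    also have "\<dots> = (\<Sum>i=1..d. \<Sum>p=1..d. \<Sum>j=1..d. (U i p * x i) * (U j p * x j))" by (rule sum.swap)
    also have "\<dots> = (\<Sum>i=1..d. \<Sum>j=1..d. \<Sum>p=1..d. (U i p * x i) * (U j p * x j))" by (intro sum.cong refl sum.swap)
    also have "\<dots> = (\<Sum>i=1..d. \<Sum>j=1..d. x i * x j * (\<Sum>p=1..d. U i p * U j p))"
      by (simp add: sum_distrib_left mult_ac)
    also have "\<dots> = (\<Sum>i=1..d. \<Sum>j=1..d. if j = i then (x i)\<^sup>2 else 0)"
      using orthonormal_complete[OF U] by (intro sum.cong refl) (auto simp: power2_eq_square)
    also have "\<dots> = (\<Sum>i=1..d. (x i)\<^sup>2)" by simp
    finally have pars: "(\<Sum>p=1..d. (\<Sum>i=1..d. U i p * x i)\<^sup>2) = (\<Sum>i=1..d. (x i)\<^sup>2)" .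
    have "quad_form d B x \<le> (\<Sum>p=1..d. M0 * (\<Sum>i=1..d. U i p * x i)\<^sup>2)"
      unfolding q using assms(2) by (intro sum_mono mult_right_mono) auto
    also have "\<dots> = M0 * (\<Sum>i=1..d. (x i)\<^sup>2)" by (simp only: sum_distrib_left[symmetric] pars)
    finally show "0 \<le> quad_form d B x \<and> quad_form d B x \<le> M0 * (\<Sum>i=1..d. (x i)\<^sup>2)"
      unfolding q by (auto intro!: sum_nonneg)
  qed
qed

text \<open>The variational inequality of a projection onto a convex set. In the eigenbasis the inner product is a sum
of terms \<open>(l p - c p) * (u - c p)\<close>, where \<open>c p\<close> is the clipped eigenvalue and \<open>u\<close>, the value of the
quadratic form of \<open>S\<close> at the \<open>p\<close>-th eigenvector, lies in \<open>[0, M0]\<close>; this is the variational inequality for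
the projection onto an interval.\<close>
lemma is_clip_obtuse:
  assumes AB: "is_clip d M0 A B" and S: "psd_le d M0 S" and M0: "M0 \<ge> 0"
  shows "(\<Sum>b\<in>idx d. (A b - B b) * (S b - B b)) \<le> 0"
proof -
  obtain U l where U: "orthonormal d d U" and A: "\<forall>(i, j)\<in>idx d. A (i, j) = (\<Sum>p=1..d. l p * U i p * U j p)"
    and B: "\<forall>(i, j)\<in>idx d. B (i, j) = (\<Sum>p=1..d. max 0 (min M0 (l p)) * U i p * U j p)"
    using AB unfolding is_clip_def by blast
  define c where "c p = max 0 (min M0 (l p))" for p
  have "(\<Sum>b\<in>idx d. (A b - B b) * (S b - B b)) = (\<Sum>i=1..d. \<Sum>j=1..d. (A (i,j) - B (i,j)) * (S (i,j) - B (i,j)))"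
    by (simp add: sum.cartesian_product case_prod_unfold)
  also have "\<dots> = (\<Sum>i=1..d. \<Sum>j=1..d. \<Sum>p=1..d. (l p - c p) * (U i p * (S (i,j) - B (i,j)) * U j p))"
  proof (intro sum.cong refl)
    fix i j assume ij: "i \<in> {1..d}" "j \<in> {1..d}"
    have "A (i,j) - B (i,j) = (\<Sum>p=1..d. (l p - c p) * (U i p * U j p))"
      using A B ij by (simp add: c_def sum_subtractf[symmetric] algebra_simps)
    thus "(A (i,j) - B (i,j)) * (S (i,j) - B (i,j)) = (\<Sum>p=1..d. (l p - c p) * (U i p * (S (i,j) - B (i,j)) * U j p))"
      by (simp only: sum_distrib_right) (simp only: mult_ac)
  qed
  also have "\<dots> = (\<Sum>i=1..d. \<Sum>p=1..d. \<Sum>j=1..d. (l p - c p) * (U i p * (S (i,j) - B (i,j)) * U j p))"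
    by (intro sum.cong refl sum.swap)
  also have "\<dots> = (\<Sum>p=1..d. \<Sum>i=1..d. \<Sum>j=1..d. (l p - c p) * (U i p * (S (i,j) - B (i,j)) * U j p))" by (rule sum.swap)
  also have "\<dots> = (\<Sum>p=1..d. (l p - c p) * (quad_form d S (\<lambda>i. U i p) - quad_form d B (\<lambda>i. U i p)))"
    unfolding quad_form_def sum_subtractf[symmetric] sum_distrib_left by (intro sum.cong refl) (simp add: algebra_simps)
  also have "\<dots> \<le> 0"
  proof (intro sum_nonpos)
    fix p assume p: "p \<in> {1..d}"
    have "quad_form d B (\<lambda>i. U i p) = (\<Sum>q=1..d. c q * (\<Sum>i=1..d. U i q * U i p)\<^sup>2)"
      using quad_form_spectral[OF B] by (simp add: c_def)
    also have "\<dots> = (\<Sum>q=1..d. if q = p then c p else 0)"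
      using U p unfolding orthonormal_def by (intro sum.cong) auto
    also have "\<dots> = c p" using p by simp
    finally have qB: "quad_form d B (\<lambda>i. U i p) = c p" .
    have "(\<Sum>i=1..d. (U i p)\<^sup>2) = 1" using U p by (simp add: orthonormal_def power2_eq_square)
    hence qS: "0 \<le> quad_form d S (\<lambda>i. U i p)" "quad_form d S (\<lambda>i. U i p) \<le> M0"
      using S unfolding psd_le_def by (metis mult_1_right)+
    show "(l p - c p) * (quad_form d S (\<lambda>i. U i p) - quad_form d B (\<lambda>i. U i p)) \<le> 0"
      unfolding qB using qS M0
      by (cases "l p < 0"; cases "l p > M0") (auto simp: c_def mult_le_0_iff)
  qed
  finally show ?thesis .
qed

lemma obtuse_contract:
  fixes A B S :: "'a \<Rightarrow> real"
  assumes "(\<Sum>b\<in>I. (A b - B b) * (S b - B b)) \<le> 0"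
  shows "(\<Sum>b\<in>I. (B b - S b)\<^sup>2) \<le> (\<Sum>b\<in>I. (A b - S b)\<^sup>2)"
proof -
  have "(\<Sum>b\<in>I. (A b - S b)\<^sup>2) - (\<Sum>b\<in>I. (B b - S b)\<^sup>2) + 2 * (\<Sum>b\<in>I. (A b - B b) * (S b - B b)) = (\<Sum>b\<in>I. (A b - B b)\<^sup>2)"
    unfolding sum_distrib_left sum_subtractf[symmetric] sum.distrib[symmetric]
    by (intro sum.cong refl) (simp add: power2_eq_square algebra_simps)
  moreover have "(\<Sum>b\<in>I. (A b - B b)\<^sup>2) \<ge> 0" by (intro sum_nonneg) auto
  ultimately show ?thesis using assms by linarith
qed

lemma is_clip_nonexpansive:
  assumes "is_clip d M0 A B" "is_clip d M0 A' B'" "M0 \<ge> 0"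
  shows "(\<Sum>b\<in>idx d. (B b - B' b)\<^sup>2) \<le> (\<Sum>b\<in>idx d. (A b - A' b)\<^sup>2)"
proof -
  have 1: "(\<Sum>b\<in>idx d. (A b - B b) * (B' b - B b)) \<le> 0"
    using assms by (intro is_clip_obtuse is_clip_psd)
  have 2: "(\<Sum>b\<in>idx d. (A' b - B' b) * (B b - B' b)) \<le> 0"
    using assms by (intro is_clip_obtuse is_clip_psd)
  have "(\<Sum>b\<in>idx d. (A b - A' b)\<^sup>2) - (\<Sum>b\<in>idx d. (B b - B' b)\<^sup>2) + 2 * (\<Sum>b\<in>idx d. (A b - B b) * (B' b - B b)) + 2 * (\<Sum>b\<in>idx d. (A' b - B' b) * (B b - B' b))
     = (\<Sum>b\<in>idx d. ((A b - A' b) - (B b - B' b))\<^sup>2)"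
    unfolding sum_distrib_left sum_subtractf[symmetric] sum.distrib[symmetric]
    by (intro sum.cong refl) (simp add: power2_eq_square algebra_simps)
  moreover have "(\<Sum>b\<in>idx d. ((A b - A' b) - (B b - B' b))\<^sup>2) \<ge> 0" by (intro sum_nonneg) auto
  ultimately show ?thesis using 1 2 by linarith
qed

text \<open>Existence is the spectral theorem. Nonexpansiveness, applied to two clips of the same matrix, shows that
the result does not depend on the eigenbasis.\<close>
lemma is_clip_spectral_clip:
  assumes sym: "\<And>i j. i \<in> {1..d} \<Longrightarrow> j \<in> {1..d} \<Longrightarrow> A (i, j) = A (j, i)" and M0: "M0 \<ge> 0"
  shows "is_clip d M0 A (spectral_clip d M0 A)"
proof -
  let ?P = "\<lambda>B. B \<in> extensional (idx d) \<and> is_clip d M0 A B"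
  have eq: "spectral_clip d M0 A = (THE B. ?P B)"
    unfolding spectral_clip_def is_clip_def orthonormal_def by simp
  obtain U l where U: "orthonormal d d U" "\<forall>(i, j)\<in>idx d. A (i, j) = (\<Sum>p=1..d. l p * U i p * U j p)"
    using spectral_theorem[of d A] sym by blast
  have ex: "?P (\<lambda>(i, j)\<in>idx d. \<Sum>p=1..d. max 0 (min M0 (l p)) * U i p * U j p)"
    unfolding is_clip_def using U by (auto intro!: exI[of _ U] exI[of _ l])
  have uniq: "B = B'" if "?P B" "?P B'" for B B'
  proof -
    have "(\<Sum>b\<in>idx d. (B b - B' b)\<^sup>2) \<le> (\<Sum>b\<in>idx d. (A b - A b)\<^sup>2)"
      using that M0 by (intro is_clip_nonexpansive) auto
    hence "(\<Sum>b\<in>idx d. (B b - B' b)\<^sup>2) = 0" by (intro antisym sum_nonneg) auto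
    hence "\<forall>b\<in>idx d. B b = B' b" by (subst (asm) sum_nonneg_eq_0_iff) auto
    thus "B = B'" using that by (intro extensionalityI[of _ "idx d"]) auto
  qed
  have "?P (THE B. ?P B)" by (rule theI[of ?P, OF ex]) (rule uniq[OF _ ex])
  thus ?thesis unfolding eq by simp
qed

section \<open>Measurability of the spectral clip\<close>

text \<open>Precomposition with this map makes the clip a continuous function on the space of all matrices; on
asymmetric matrices it is undetermined.\<close>
definition symmetrize :: "(nat \<times> nat \<Rightarrow> real) \<Rightarrow> nat \<times> nat \<Rightarrow> real" where
  "symmetrize A = (\<lambda>(i, j). A (min i j, max i j))"

lemma continuous_spectral_clip:
  assumes M0: "M0 \<ge> 0" and b: "b \<in> idx d"
  shows "continuous_on UNIV (\<lambda>A. spectral_clip d M0 (symmetrize A) b)"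
  unfolding continuous_on_def
proof
  fix A :: "nat \<times> nat \<Rightarrow> real"
  have clip: "is_clip d M0 (symmetrize A) (spectral_clip d M0 (symmetrize A))" for A
    by (rule is_clip_spectral_clip[OF _ M0]) (simp add: symmetrize_def min.commute max.commute)
  let ?g = "\<lambda>A'. sqrt (\<Sum>c\<in>idx d. (symmetrize A' c - symmetrize A c)\<^sup>2)"
  have bd: "\<bar>spectral_clip d M0 (symmetrize A') b - spectral_clip d M0 (symmetrize A) b\<bar> \<le> ?g A'" for A'
  proof -
    have "(spectral_clip d M0 (symmetrize A') b - spectral_clip d M0 (symmetrize A) b)\<^sup>2
      \<le> (\<Sum>c\<in>idx d. (spectral_clip d M0 (symmetrize A') c - spectral_clip d M0 (symmetrize A) c)\<^sup>2)"
      using b by (intro member_le_sum) auto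
    also have "\<dots> \<le> (\<Sum>c\<in>idx d. (symmetrize A' c - symmetrize A c)\<^sup>2)"
      by (rule is_clip_nonexpansive[OF clip clip M0])
    finally show ?thesis by (simp add: real_le_rsqrt)
  qed
  have "isCont ?g A" unfolding symmetrize_def case_prod_unfold
    by (intro continuous_intros) (auto intro!: continuous_on_interior[of UNIV])
  hence "(?g \<longlongrightarrow> 0) (at A)" unfolding isCont_def by simp
  hence "((\<lambda>A'. spectral_clip d M0 (symmetrize A') b - spectral_clip d M0 (symmetrize A) b) \<longlongrightarrow> 0) (at A)"
    by (rule Lim_null_comparison[rotated]) (use bd in \<open>auto\<close>)
  thus "((\<lambda>A'. spectral_clip d M0 (symmetrize A') b) \<longlongrightarrow> spectral_clip d M0 (symmetrize A) b) (at A within UNIV)"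
    by (rule LIM_zero_cancel)
qed

text \<open>Matrices are functions on the countable index set \<open>nat \<times> nat\<close>, for which the product sigma algebra
is the Borel sigma algebra of the topology in which the clip is continuous.\<close>
lemma measurable_spectral_clip:
  assumes M0: "M0 \<ge> 0" and f: "\<And>c. c \<in> idx d \<Longrightarrow> (\<lambda>x. f x c) \<in> borel_measurable N"
    and sym: "\<And>x i j. f x (i, j) = f x (j, i)" and "d' \<le> d"
  shows "(\<lambda>x. restrict (spectral_clip d M0 (f x)) (idx d')) \<in> N \<rightarrow>\<^sub>M mat_space (idx d')"
  unfolding mat_space_def
proof (rule measurable_restrict)
  fix b assume "b \<in> idx d'"
  hence b: "b \<in> idx d" using \<open>d' \<le> d\<close> by auto
  \<comment> \<open>Entries outside the index set need not be measurable; the clip does not depend on them.\<close>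
  define g where "g x c = (if c \<in> idx d then f x c else 0)" for x c
  have "(\<lambda>x. g x c) \<in> borel_measurable N" for c
    unfolding g_def by (cases "c \<in> idx d") (use f in auto)
  hence "g \<in> N \<rightarrow>\<^sub>M Pi\<^sub>M UNIV (\<lambda>_. borel)"
    by (intro measurable_PiM_single') (auto simp: space_PiM)
  hence g: "g \<in> borel_measurable N"
    by (subst measurable_cong_sets[OF refl sets_PiM_equal_borel[symmetric]])
  have "(\<lambda>A. spectral_clip d M0 (symmetrize A) b) \<in> borel_measurable borel"
    by (intro borel_measurable_continuous_onI continuous_spectral_clip M0 b)
  from measurable_compose[OF g this]
  have "(\<lambda>x. spectral_clip d M0 (symmetrize (g x)) b) \<in> borel_measurable N" .
  moreover have "spectral_clip d M0 (symmetrize (g x)) = spectral_clip d M0 (f x)" for x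
  proof -
    have "symmetrize (g x) (i, j) = f x (i, j)" if "i \<in> {1..d}" "j \<in> {1..d}" for i j
      using that sym[of x i j] by (auto simp: symmetrize_def g_def min_def max_def)
    hence "\<forall>(i, j)\<in>idx d. symmetrize (g x) (i, j) = f x (i, j)" by auto
    thus ?thesis unfolding spectral_clip_def
      by (intro arg_cong[where f=The] ext arg_cong2[where f="(\<and>)"] refl arg_cong[where f=Ex]) auto
  qed
  ultimately show "(\<lambda>x. spectral_clip d M0 (f x) b) \<in> borel_measurable N" by simp
qed

section \<open>The block releases as Markov kernels\<close>

lemma measurable_PiM_kernel:
  assumes "finite I" "\<And>i. i \<in> I \<Longrightarrow> K i \<in> M \<rightarrow>\<^sub>M prob_algebra (N i)"
  shows "(\<lambda>x. PiM I (\<lambda>i. K i x)) \<in> M \<rightarrow>\<^sub>M prob_algebra (PiM I N)"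
  using assms
proof (induction I rule: finite_induct)
  case empty
  show ?case by (auto simp: PiM_empty space_prob_algebra intro!: measurable_const prob_spaceI)
next
  case (insert i I)
  have m: "(\<lambda>(y, X). X(i := y)) \<in> N i \<Otimes>\<^sub>M PiM I N \<rightarrow>\<^sub>M PiM (insert i I) N" by measurable
  have "(\<lambda>x. distr (K i x \<Otimes>\<^sub>M PiM I (\<lambda>i. K i x)) (PiM (insert i I) N) (\<lambda>(y, X). X(i := y))) \<in> M \<rightarrow>\<^sub>M prob_algebra (PiM (insert i I) N)"
    by (rule measurable_compose[OF measurable_pair_prob measurable_distr_prob_space[OF m]])
       (use insert in auto)
  also have "?this \<longleftrightarrow> ?case"
  proof (rule measurable_cong)
    fix x assume x: "x \<in> space M"
    have K: "prob_space (K j x)" "sets (K j x) = sets (N j)" if "j \<in> insert i I" for j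
      using measurable_space[OF insert.prems[OF that] x] by (auto simp: space_prob_algebra)
    have "distr (K i x \<Otimes>\<^sub>M PiM I (\<lambda>i. K i x)) (PiM (insert i I) N) (\<lambda>(y, X). X(i := y))
       = distr (K i x \<Otimes>\<^sub>M PiM I (\<lambda>i. K i x)) (PiM (insert i I) (\<lambda>i. K i x)) (\<lambda>(y, X). X(i := y))"
      by (rule distr_cong) (use K in \<open>auto intro!: sets_PiM_cong\<close>)
    also have "\<dots> = PiM (insert i I) (\<lambda>i. K i x)"
      by (rule distr_pair_PiM_eq_PiM) (use K in auto)
    finally show "distr (K i x \<Otimes>\<^sub>M PiM I (\<lambda>i. K i x)) (PiM (insert i I) N) (\<lambda>(y, X). X(i := y)) = PiM (insert i I) (\<lambda>i. K i x)" .
  qed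
  finally show ?case .
qed

lemma measurable_pad [measurable]:
  assumes "m \<in> {1..n}"
  shows "(\<lambda>X. pad d X m j) \<in> borel_measurable (data_space n d)"
proof (cases "j \<in> {1..d}")
  case True
  have "(\<lambda>X. X m) \<in> data_space n d \<rightarrow>\<^sub>M vec_space d"
    unfolding data_space_def using assms by (rule measurable_component_singleton)
  moreover have "(\<lambda>x. x j) \<in> vec_space d \<rightarrow>\<^sub>M borel"
    unfolding vec_space_def using True by (rule measurable_component_singleton)
  ultimately have "(\<lambda>X. X m j) \<in> borel_measurable (data_space n d)" by (rule measurable_compose)
  thus ?thesis unfolding pad_def using True by simp
qed (auto simp: pad_def)

lemma measurable_clipped_mean:
  "(\<lambda>X. clipped_mean n L (pad d X) b) \<in> borel_measurable (data_space n d)"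
proof -
  obtain i j where b: "b = (i, j)" by fastforce
  show ?thesis unfolding clipped_mean_def b chi_def by simp
qed

lemma measurable_center_entry:
  "(\<lambda>X. (1 / real n) * (\<Sum>m=1..n. chi_vec R I (pad d X m) i * chi_vec R J (pad d X m) j)) \<in> borel_measurable (data_space n d)"
  unfolding chi_vec_def L2_set_def by simp

lemma measurable_DPCovBlock:
  assumes I: "I \<subseteq> {1..D}" and J: "J \<subseteq> {1..D}"
  shows "(\<lambda>X. DPCovBlock n D (pad d X) I J \<rho> R) \<in> data_space n d \<rightarrow>\<^sub>M prob_algebra (mat_space (I \<times> J))"
  unfolding DPCovBlock_def upper_triangle_def[symmetric]
proof (rule measurable_distr_prob_space2[where M="\<Pi>\<^sub>M b\<in>upper_triangle D. std_normal"])
  show "(\<lambda>x. \<Pi>\<^sub>M b\<in>upper_triangle D. std_normal) \<in> data_space n d \<rightarrow>\<^sub>M prob_algebra (\<Pi>\<^sub>M b\<in>upper_triangle D. std_normal)"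
    by (intro measurable_const) (auto simp: space_prob_algebra intro!: prob_space_PiM prob_space_normal_density)
  let ?M = "data_space n d \<Otimes>\<^sub>M (\<Pi>\<^sub>M b\<in>upper_triangle D. std_normal)"
  show "(\<lambda>(X, Z). \<lambda>(i, j)\<in>I \<times> J. 1 / real n * (\<Sum>m = 1..n. chi_vec R I (pad d X m) i * chi_vec R J (pad d X m) j) +
              sqrt (18 * R ^ 4 / (\<rho> * (real n)\<^sup>2)) * Z (min i j, max i j))
    \<in> ?M \<rightarrow>\<^sub>M mat_space (I \<times> J)"
    unfolding mat_space_def case_prod_unfold
  proof (rule measurable_restrict, goal_cases)
    case (1 b)
    note b = this
    have [measurable]: "(\<lambda>x. snd x (min (fst b) (snd b), max (fst b) (snd b))) \<in> borel_measurable ?M"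
      by (rule measurable_compose[OF measurable_snd])
         (use b I J in \<open>auto intro!: measurable_compose[OF measurable_component_singleton] simp: min_def max_def subset_iff upper_triangle_def\<close>)
    have [measurable]: "(\<lambda>x. 1 / real n * (\<Sum>m = 1..n. chi_vec R I (pad d (fst x) m) (fst b) * chi_vec R J (pad d (fst x) m) (snd b))) \<in> borel_measurable ?M"
      by (rule measurable_compose[OF measurable_fst measurable_center_entry])
    show ?case
      by measurable
  qed
qed

lemma pmf_map_finite:
  assumes "finite B" "set_pmf p \<subseteq> B"
  shows "pmf (map_pmf f p) y = (\<Sum>c\<in>B. if f c = y then pmf p c else 0)"
proof -
  have "pmf (map_pmf f p) y = measure (measure_pmf p) (f -` {y})" by (rule pmf_map)
  also have "\<dots> = measure (measure_pmf p) {c\<in>B. f c = y}"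
    using assms(2) by (intro measure_pmf.finite_measure_eq_AE AE_pmfI) auto
  also have "\<dots> = (\<Sum>c\<in>{c\<in>B. f c = y}. pmf p c)"
    using assms by (intro measure_measure_pmf_finite) auto
  also have "\<dots> = (\<Sum>c\<in>B. if f c = y then pmf p c else 0)"
    using assms by (intro sum.mono_neutral_cong_left) auto
  finally show ?thesis .
qed

text \<open>The type of all sets of entries is uncountable, and only finitely many of them can be selected. So the
dependence of the selection on the data is expressed through the probability of each single outcome.\<close>
lemma measurable_pmf_peel_select:
  assumes B: "finite B" "m \<le> card B" and sc: "\<And>c. c \<in> B \<Longrightarrow> (\<lambda>x. sc x c) \<in> borel_measurable M"
  shows "(\<lambda>x. pmf (peel_select \<epsilon> \<Delta> (sc x) B m) S) \<in> borel_measurable M"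
  using B(2)
proof (induction m arbitrary: S)
  case (Suc m)
  let ?T = "{S. S \<subseteq> B \<and> card S = m}"
  have T: "finite ?T" using B by (auto intro: finite_subset[of _ "Pow B"])
  have eq: "pmf (peel_select \<epsilon> \<Delta> (sc x) B (Suc m)) S = (\<Sum>S'\<in>?T. pmf (peel_select \<epsilon> \<Delta> (sc x) B m) S' *
      (\<Sum>c\<in>B - S'. if insert c S' = S then exp (\<epsilon> * sc x c / (2 * \<Delta>)) / (\<Sum>c'\<in>B - S'. exp (\<epsilon> * sc x c' / (2 * \<Delta>))) else 0))" for x
  proof -
    have "pmf (peel_select \<epsilon> \<Delta> (sc x) B (Suc m)) S =
       (\<integral>S'. pmf (map_pmf (\<lambda>c. insert c S') (exp_mech \<epsilon> \<Delta> (sc x) (B - S'))) S \<partial>measure_pmf (peel_select \<epsilon> \<Delta> (sc x) B m))"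
      by (simp add: pmf_bind)
    also have "\<dots> = (\<Sum>S'\<in>?T. pmf (map_pmf (\<lambda>c. insert c S') (exp_mech \<epsilon> \<Delta> (sc x) (B - S'))) S * pmf (peel_select \<epsilon> \<Delta> (sc x) B m) S')"
      by (rule integral_measure_pmf_real[OF T]) (use set_peel_select[OF B(1) Suc_leD[OF Suc.prems], of \<epsilon> \<Delta> "sc x"] in blast)
    also have "\<dots> = (\<Sum>S'\<in>?T. pmf (peel_select \<epsilon> \<Delta> (sc x) B m) S' *
      (\<Sum>c\<in>B - S'. if insert c S' = S then exp (\<epsilon> * sc x c / (2 * \<Delta>)) / (\<Sum>c'\<in>B - S'. exp (\<epsilon> * sc x c' / (2 * \<Delta>))) else 0))"
    proof (intro sum.cong refl)
      fix S' assume S': "S' \<in> ?T"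
      hence "S' \<noteq> B" using Suc.prems by auto
      hence ne: "B - S' \<noteq> {}" "finite (B - S')" using S' B by auto
      have "pmf (map_pmf (\<lambda>c. insert c S') (exp_mech \<epsilon> \<Delta> (sc x) (B - S'))) S = 
        (\<Sum>c\<in>B - S'. if insert c S' = S then pmf (exp_mech \<epsilon> \<Delta> (sc x) (B - S')) c else 0)"
        by (rule pmf_map_finite) (use ne in \<open>auto simp: set_exp_mech\<close>)
      also have "\<dots> = (\<Sum>c\<in>B - S'. if insert c S' = S then exp (\<epsilon> * sc x c / (2 * \<Delta>)) / (\<Sum>c'\<in>B - S'. exp (\<epsilon> * sc x c' / (2 * \<Delta>))) else 0)"
        by (intro sum.cong refl) (use ne in \<open>auto simp: pmf_exp_mech\<close>)
      finally show "pmf (map_pmf (\<lambda>c. insert c S') (exp_mech \<epsilon> \<Delta> (sc x) (B - S'))) S * pmf (peel_select \<epsilon> \<Delta> (sc x) B m) S' =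
        pmf (peel_select \<epsilon> \<Delta> (sc x) B m) S' * (\<Sum>c\<in>B - S'. if insert c S' = S then exp (\<epsilon> * sc x c / (2 * \<Delta>)) / (\<Sum>c'\<in>B - S'. exp (\<epsilon> * sc x c' / (2 * \<Delta>))) else 0)"
        by (simp add: mult.commute)
    qed
    finally show ?thesis .
  qed
  have if_m: "(\<lambda>x. if P then f x else 0) \<in> borel_measurable M" if "f \<in> borel_measurable M" for P and f :: "_ \<Rightarrow> real"
    using that by (cases P) auto
  show ?case unfolding eq
    using Suc sc by (intro borel_measurable_sum borel_measurable_times if_m borel_measurable_divide
       borel_measurable_exp[THEN measurable_compose[rotated]] borel_measurable_const) (auto intro!: Suc.IH)
qed simp

lemma measurable_peel_noise:
  assumes "S \<subseteq> B" and A: "\<And>b. b \<in> B \<Longrightarrow> (\<lambda>x. A x b) \<in> borel_measurable M"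
  shows "(\<lambda>x. peel_noise (A x) \<sigma> B S) \<in> M \<rightarrow>\<^sub>M prob_algebra (mat_space B)"
  unfolding peel_noise_def
proof (rule measurable_distr_prob_space2[where M="\<Pi>\<^sub>M b\<in>S. std_normal"])
  show "(\<lambda>x. \<Pi>\<^sub>M b\<in>S. std_normal) \<in> M \<rightarrow>\<^sub>M prob_algebra (\<Pi>\<^sub>M b\<in>S. std_normal)"
    by (intro measurable_const) (auto simp: space_prob_algebra intro!: prob_space_PiM prob_space_normal_density)
  show "(\<lambda>(x, g). \<lambda>b\<in>B. if b \<in> S then A x b + \<sigma> * g b else 0) \<in> M \<Otimes>\<^sub>M (\<Pi>\<^sub>M b\<in>S. std_normal) \<rightarrow>\<^sub>M mat_space B"
    unfolding mat_space_def case_prod_unfold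
  proof (rule measurable_restrict)
    fix b assume b: "b \<in> B"
    show "(\<lambda>x. if b \<in> S then A (fst x) b + \<sigma> * snd x b else 0) \<in> borel_measurable (M \<Otimes>\<^sub>M (\<Pi>\<^sub>M b\<in>S. std_normal))"
    proof (cases "b \<in> S")
      case True
      have "(\<lambda>x. snd x b) \<in> borel_measurable (M \<Otimes>\<^sub>M (\<Pi>\<^sub>M b\<in>S. std_normal))"
        by (rule measurable_compose[OF measurable_snd]) (use True in \<open>auto intro!: measurable_compose[OF measurable_component_singleton]\<close>)
      moreover have "(\<lambda>x. A (fst x) b) \<in> borel_measurable (M \<Otimes>\<^sub>M (\<Pi>\<^sub>M b\<in>S. std_normal))"
        by (rule measurable_compose[OF measurable_fst A[OF b]])
      ultimately show ?thesis using True by simp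
    qed simp
  qed
qed

definition peel_sigma :: "nat \<Rightarrow> real \<Rightarrow> nat \<Rightarrow> nat \<Rightarrow> real \<Rightarrow> real" where
  "peel_sigma n L k r \<rho> = sqrt (4 * L\<^sup>2 * real (k * r) / (\<rho> * (real n)\<^sup>2))"

lemma peel_release_eq:
  "peel_release n L X k I J a \<rho> =
     measure_pmf (peel_select (sqrt (\<rho> / real (k * peel_rank n k a \<rho>))) (2 * L / real n)
       (\<lambda>b. \<bar>clipped_mean n L X b\<bar>) (I \<times> J) (k * peel_rank n k a \<rho>))
     \<bind> peel_noise (clipped_mean n L X) (peel_sigma n L k (peel_rank n k a \<rho>) \<rho>) (I \<times> J)"
  unfolding peel_release_def Let_def peel_noise_def peel_sigma_def by simp

lemma nn_integral_pmf_bind_kernel: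
  assumes T: "finite T" "set_pmf p \<subseteq> T" and K: "\<And>S. K S \<in> space (prob_algebra N)" and f: "f \<in> borel_measurable N"
  shows "(\<integral>\<^sup>+y. f y \<partial>(measure_pmf p \<bind> K)) = (\<Sum>S\<in>T. (\<integral>\<^sup>+y. f y \<partial>K S) * ennreal (pmf p S))"
proof -
  have "K \<in> measure_pmf p \<rightarrow>\<^sub>M subprob_algebra N"
    by (rule measurable_prob_algebraD) (use K in auto)
  hence "(\<integral>\<^sup>+y. f y \<partial>(measure_pmf p \<bind> K)) = (\<integral>\<^sup>+S. (\<integral>\<^sup>+y. f y \<partial>K S) \<partial>measure_pmf p)"
    by (rule nn_integral_bind[OF f])
  also have "\<dots> = (\<Sum>S\<in>T. (\<integral>\<^sup>+y. f y \<partial>K S) * ennreal (pmf p S))"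
    by (rule nn_integral_measure_pmf_support) (use T in \<open>auto simp: set_pmf_iff\<close>)
  finally show ?thesis .
qed

text \<open>The release is a finite mixture, over the sets that can be selected, of measurable kernels with measurable
weights.\<close>
lemma measurable_peel_release:
  assumes I: "finite I" "card I = k" and J: "finite J" "card J = k" and k: "k \<ge> 1"
  shows "(\<lambda>X. peel_release n L (pad d X) k I J a \<rho>) \<in> data_space n d \<rightarrow>\<^sub>M prob_algebra (mat_space (I \<times> J))"
proof -
  let ?B = "I \<times> J" and ?N = "mat_space (I \<times> J)"
  define r where "r = peel_rank n k a \<rho>"
  have r: "1 \<le> r" "r \<le> k" using peel_rank_in[OF k, of n a \<rho>] by (auto simp: r_def)
  have kr: "k * r \<le> card ?B" using I J r by (simp add: card_cartesian_product)
  let ?T = "{S. S \<subseteq> ?B \<and> card S = k * r}"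
  have T: "finite ?T" by (rule finite_subset[of _ "Pow ?B"]) (use I J in auto)
  define p where "p X = peel_select (sqrt (\<rho> / real (k * r))) (2 * L / real n) (\<lambda>b. \<bar>clipped_mean n L (pad d X) b\<bar>) ?B (k * r)" for X
  define K where "K X = peel_noise (clipped_mean n L (pad d X)) (peel_sigma n L k r \<rho>) ?B" for X
  have eq: "peel_release n L (pad d X) k I J a \<rho> = measure_pmf (p X) \<bind> K X" for X
    unfolding peel_release_eq p_def K_def r_def ..
  have Ksp: "K X S \<in> space (prob_algebra ?N)" for X S unfolding K_def by (rule space_peel_noise)
  have sp: "measure_pmf (p X) \<bind> K X \<in> space (prob_algebra ?N)" for X
  proof -
    have pm: "measure_pmf (p X) \<in> space (prob_algebra (count_space UNIV))" by (simp add: space_prob_algebra prob_space_measure_pmf)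
    have km: "K X \<in> count_space UNIV \<rightarrow>\<^sub>M prob_algebra ?N" using Ksp by auto
    show ?thesis using prob_space_bind'[OF pm km] sets_bind'[OF pm km] by (simp add: space_prob_algebra)
  qed
  have sub: "set_pmf (p X) \<subseteq> ?T" for X unfolding p_def by (rule set_peel_select) (use I J kr in auto)
  show ?thesis unfolding eq
  proof (rule measurable_prob_algebraI)
    show "prob_space (measure_pmf (p X) \<bind> K X)" for X using sp by (simp add: space_prob_algebra)
    show "(\<lambda>X. measure_pmf (p X) \<bind> K X) \<in> data_space n d \<rightarrow>\<^sub>M subprob_algebra ?N"
    proof (rule measurable_subprob_algebra)
      show "subprob_space (measure_pmf (p X) \<bind> K X)" for X
        using sp by (simp add: space_prob_algebra prob_space_imp_subprob_space)
      show "sets (measure_pmf (p X) \<bind> K X) = sets ?N" for X using sp by (simp add: space_prob_algebra)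
      fix E assume E: "E \<in> sets ?N"
      have "emeasure (measure_pmf (p X) \<bind> K X) E = (\<Sum>S\<in>?T. emeasure (K X S) E * ennreal (pmf (p X) S))" for X
      proof -
        have KE: "sets (K X S) = sets ?N" for S using Ksp by (simp add: space_prob_algebra)
        have "emeasure (measure_pmf (p X) \<bind> K X) E = (\<integral>\<^sup>+y. indicator E y \<partial>(measure_pmf (p X) \<bind> K X))"
          using E sp by (simp add: space_prob_algebra)
        also have "\<dots> = (\<Sum>S\<in>?T. (\<integral>\<^sup>+y. indicator E y \<partial>K X S) * ennreal (pmf (p X) S))"
          by (rule nn_integral_pmf_bind_kernel[OF T sub Ksp]) (use E in auto)
        finally show ?thesis using E KE by simp
      qed
      moreover have "(\<lambda>X. \<Sum>S\<in>?T. emeasure (K X S) E * ennreal (pmf (p X) S)) \<in> borel_measurable (data_space n d)"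
      proof (intro borel_measurable_sum borel_measurable_times_ennreal)
        fix S assume S: "S \<in> ?T"
        have "(\<lambda>X. K X S) \<in> data_space n d \<rightarrow>\<^sub>M prob_algebra ?N"
          unfolding K_def by (rule measurable_peel_noise) (use S measurable_clipped_mean in auto)
        thus "(\<lambda>X. emeasure (K X S) E) \<in> borel_measurable (data_space n d)"
          by (rule measurable_compose[OF measurable_prob_algebraD measurable_emeasure_subprob_algebra[OF E]])
        have "(\<lambda>X. pmf (p X) S) \<in> borel_measurable (data_space n d)"
          unfolding p_def by (rule measurable_pmf_peel_select) (use I J kr in \<open>auto intro!: borel_measurable_abs measurable_clipped_mean\<close>)
        thus "(\<lambda>X. ennreal (pmf (p X) S)) \<in> borel_measurable (data_space n d)" by simp
      qed
      ultimately show "(\<lambda>X. emeasure (measure_pmf (p X) \<bind> K X) E) \<in> borel_measurable (data_space n d)" by simp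
    qed
  qed
qed

section \<open>Block geometry\<close>

lemma card_seg: "l \<ge> 1 \<Longrightarrow> card (seg k l) = k"
  unfolding seg_def by (cases l) auto

lemma finite_seg: "finite (seg k l)" unfolding seg_def by simp

lemma seg_subset:
  assumes "1 \<le> l" "l * k \<le> D" shows "seg k l \<subseteq> {1..D}"
  using assms unfolding seg_def by auto

lemma seg_less:
  assumes "1 \<le> l" "l < l'" "i \<in> seg k l" "j \<in> seg k l'"
  shows "i < j"
proof -
  have "l * k \<le> (l' - 1) * k" using assms by (intro mult_right_mono) auto
  moreover have "i \<le> l * k" "(l' - 1) * k < j" using assms by (auto simp: seg_def)
  ultimately show ?thesis by linarith
qed

lemma pad_dim_ge:
  assumes "k0 \<ge> 1" shows "d \<le> pad_dim d k0"
proof -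
  have "d \<le> 2 ^ d * 1" by (simp add: less_imp_le[OF less_exp])
  also have "\<dots> \<le> 2 ^ d * k0" using assms by (intro mult_left_mono) auto
  finally have "d \<le> 2 ^ d * k0" .
  thus ?thesis unfolding pad_dim_def pad_exp_def by (rule LeastI)
qed

lemma outer_scales_eq:
  assumes "k0 \<ge> 1"
  shows "outer_scales (2 ^ J * k0) k0 = (\<lambda>j. 2 ^ j * k0) ` {..<J - 1}"
proof -
  have "2 * (2 ^ j * k0) < 2 ^ J * k0 \<longleftrightarrow> j < J - 1" for j
  proof -
    have "2 * (2 ^ j * k0) < 2 ^ J * k0 \<longleftrightarrow> 2 ^ Suc j * k0 < 2 ^ J * k0" by simp
    also have "\<dots> \<longleftrightarrow> 2 ^ Suc j < (2::nat) ^ J" using assms by (subst mult_less_cancel2) simp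
    also have "\<dots> \<longleftrightarrow> Suc j < J" by (rule power_strict_increasing_iff) simp
    finally show ?thesis by auto
  qed
  thus ?thesis unfolding outer_scales_def by auto
qed

lemma outer_scale_dvd:
  assumes "k0 \<ge> 1" "k \<in> outer_scales (2 ^ J * k0) k0"
  obtains q where "2 ^ J * k0 = 2 * k * q" "q \<ge> 2" "k \<ge> k0"
proof -
  obtain j where j: "k = 2 ^ j * k0" "j < J - 1" using assms by (auto simp: outer_scales_eq)
  hence "J = Suc j + (J - Suc j)" by simp
  hence "2 ^ J = (2::nat) ^ Suc j * 2 ^ (J - Suc j)" by (metis power_add)
  hence 1: "2 ^ J * k0 = 2 * k * 2 ^ (J - Suc j)" using j by simp
  have "(2::nat) ^ 1 \<le> 2 ^ (J - Suc j)" using j by (intro power_increasing) auto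
  hence 2: "(2::nat) \<le> 2 ^ (J - Suc j)" by simp
  have "1 * k0 \<le> k" unfolding j by (intro mult_right_mono) auto
  thus ?thesis using that[OF 1 2] by simp
qed

text \<open>The three outer blocks with \<open>q = 0, 1, 2\<close> that belong to the adjacent segments \<open>l\<close> and \<open>l + 1\<close> of twice
the side.\<close>
definition outer_block_at :: "nat \<Rightarrow> nat \<Rightarrow> nat \<Rightarrow> nat \<times> nat \<times> nat" where
  "outer_block_at k l q = (if q = 0 then (k, 2 * l - 1, 2) else if q = 1 then (k, 2 * l - 1, 3) else (k, 2 * l, 2))"

lemma outer_blocks_eq:
  "outer_blocks D k0 = (\<lambda>(k, l, q). outer_block_at k l q) ` (SIGMA k:outer_scales D k0. {1..<D div (2 * k)} \<times> {0, 1, 2})"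
proof -
  have "{(k, 2 * l - 1, 2), (k, 2 * l - 1, 3), (k, 2 * l, 2)} = outer_block_at k l ` {0, 1, 2}" for k l
    by (auto simp: outer_block_at_def)
  hence "outer_blocks D k0 = (\<Union>k\<in>outer_scales D k0. \<Union>l\<in>{1..<D div (2 * k)}. outer_block_at k l ` {0, 1, 2})"
    unfolding outer_blocks_def by simp
  also have "\<dots> = (\<lambda>(k, l, q). outer_block_at k l q) ` (SIGMA k:outer_scales D k0. {1..<D div (2 * k)} \<times> {0, 1, 2})"
    by (auto simp only: image_iff Sigma_def mem_Times_iff split: prod.splits) blast+
  finally show ?thesis .
qed

lemma finite_outer_scales: "k0 \<ge> 1 \<Longrightarrow> finite (outer_scales (2 ^ J * k0) k0)"
  by (simp add: outer_scales_eq)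

lemma finite_outer_blocks: "k0 \<ge> 1 \<Longrightarrow> finite (outer_blocks (2 ^ J * k0) k0)"
  unfolding outer_blocks_eq by (intro finite_imageI finite_SigmaI finite_outer_scales) auto

lemma center_blocks_eq:
  "center_blocks D k0 = (\<lambda>(l, r). (k0, l, r)) ` {(l, r). 1 \<le> l \<and> r \<in> {0, 1} \<and> l + r \<le> D div k0}"
  unfolding center_blocks_def by auto

lemma finite_center_blocks: "finite (center_blocks D k0)"
  unfolding center_blocks_eq
  by (rule finite_imageI, rule finite_subset[of _ "{1..D div k0} \<times> {0, 1}"]) auto

lemma card_center_blocks: "card (center_blocks D k0) \<le> 2 * (D div k0)"
proof -
  have "card (center_blocks D k0) \<le> card {(l, r). 1 \<le> l \<and> r \<in> {0, 1} \<and> l + r \<le> D div k0}"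
    unfolding center_blocks_eq by (rule card_image_le, rule finite_subset[of _ "{1..D div k0} \<times> {0, 1}"]) auto
  also have "\<dots> \<le> card ({1..D div k0} \<times> {0::nat, 1})" by (intro card_mono) auto
  finally show ?thesis by (simp add: card_cartesian_product)
qed

lemma sum_outer_blocks_le:
  fixes f :: "nat \<times> nat \<times> nat \<Rightarrow> real"
  assumes k0: "k0 \<ge> 1" and f: "\<And>k l r. f (k, l, r) \<le> g k" and f0: "\<And>t. 0 \<le> f t"
  shows "(\<Sum>t\<in>outer_blocks (2 ^ J * k0) k0. f t) \<le> (\<Sum>k\<in>outer_scales (2 ^ J * k0) k0. 3 * real ((2 ^ J * k0) div (2 * k)) * g k)"
proof -
  let ?D = "2 ^ J * k0"
  let ?S = "SIGMA k:outer_scales ?D k0. {1..<?D div (2 * k)} \<times> {0, 1, 2::nat}"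
  have finS: "finite ?S" by (intro finite_SigmaI finite_outer_scales k0) auto
  have "(\<Sum>t\<in>outer_blocks ?D k0. f t) \<le> (\<Sum>s\<in>?S. (f \<circ> (\<lambda>(k, l, q). outer_block_at k l q)) s)"
    unfolding outer_blocks_eq using finS f0 by (intro sum_image_le) auto
  also have "\<dots> \<le> (\<Sum>(k, l, q)\<in>?S. g k)"
    by (intro sum_mono) (auto simp: outer_block_at_def f)
  also have "\<dots> = (\<Sum>k\<in>outer_scales ?D k0. \<Sum>lq\<in>{1..<?D div (2 * k)} \<times> {0, 1, 2::nat}. g k)"
    using finite_outer_scales[OF k0, of J] by (subst sum.Sigma[symmetric]) (auto simp: case_prod_unfold)
  also have "\<dots> \<le> (\<Sum>k\<in>outer_scales ?D k0. 3 * real (?D div (2 * k)) * g k)"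
  proof (rule sum_mono)
    fix k
    have g0: "g k \<ge> 0" using f[of k 0 0] f0[of "(k, 0, 0)"] by linarith
    have "(\<Sum>lq\<in>{1..<?D div (2 * k)} \<times> {0, 1, 2::nat}. g k) = 3 * real (?D div (2 * k) - 1) * g k"
      by (simp add: card_cartesian_product)
    also have "\<dots> \<le> 3 * real (?D div (2 * k)) * g k" using g0 by (intro mult_right_mono) auto
    finally show "(\<Sum>lq\<in>{1..<?D div (2 * k)} \<times> {0, 1, 2::nat}. g k) \<le> 3 * real (?D div (2 * k)) * g k" .
  qed
  finally show ?thesis .
qed

lemma center_block_geom:
  assumes "(k, l, r) \<in> center_blocks D k0" "k0 \<ge> 1"
  shows "k = k0" "r \<le> 1" "l \<ge> 1" "seg k l \<subseteq> {1..D}" "seg k (l + r) \<subseteq> {1..D}"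
    "seg k l = seg k (l + r) \<or> (\<forall>i\<in>seg k l. \<forall>j\<in>seg k (l + r). i < j)"
proof -
  have a: "k = k0" "r \<in> {0, 1}" "l \<ge> 1" "l + r \<le> D div k0" using assms by (auto simp: center_blocks_def)
  thus "k = k0" "r \<le> 1" "l \<ge> 1" by auto
  have "(l + r) * k0 \<le> D div k0 * k0" using a by (intro mult_right_mono) auto
  also have "\<dots> \<le> D" by (rule div_times_less_eq_dividend)
  finally have b: "(l + r) * k0 \<le> D" .
  moreover have "l * k0 \<le> (l + r) * k0" by (intro mult_right_mono) auto
  ultimately have c: "l * k0 \<le> D" by linarith
  show "seg k l \<subseteq> {1..D}" using a c by (intro seg_subset) simp_all
  show "seg k (l + r) \<subseteq> {1..D}" using a b by (intro seg_subset) simp_all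
  show "seg k l = seg k (l + r) \<or> (\<forall>i\<in>seg k l. \<forall>j\<in>seg k (l + r). i < j)"
  proof (cases "r = 0")
    case False
    hence "l < l + r" by simp
    from seg_less[OF a(3) this] show ?thesis by blast
  qed simp
qed

text \<open>The last conclusion says that the entries of an outer block are more than \<open>k\<close> away from the diagonal: the
two segments are separated by at least one whole segment. This is where the decay of the covariances enters.\<close>
lemma outer_block_geom:
  assumes "(k, l, r) \<in> outer_blocks (2 ^ J * k0) k0" "k0 \<ge> 1"
  shows "k \<in> outer_scales (2 ^ J * k0) k0" "2 \<le> r" "l \<ge> 1" "k \<ge> 1" "seg k l \<subseteq> {1..2 ^ J * k0}" "seg k (l + r) \<subseteq> {1..2 ^ J * k0}"
    "\<forall>i\<in>seg k l. \<forall>j\<in>seg k (l + r). i + k < j"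
proof -
  let ?D = "2 ^ J * k0"
  obtain m where k: "k \<in> outer_scales ?D k0" and m: "m \<in> {1..<?D div (2 * k)}"
    and lr: "(l = 2 * m - 1 \<and> r = 2) \<or> (l = 2 * m - 1 \<and> r = 3) \<or> (l = 2 * m \<and> r = 2)"
    using assms(1) by (auto simp: outer_blocks_def)
  show "k \<in> outer_scales ?D k0" by fact
  obtain q where q: "?D = 2 * k * q" "q \<ge> 2" "k \<ge> k0" by (rule outer_scale_dvd[OF assms(2) k])
  show k1: "k \<ge> 1" using q assms by simp
  show l: "2 \<le> r" "l \<ge> 1" using lr m by auto
  have "?D div (2 * k) = q" using q k1 by simp
  hence "l + r \<le> 2 * q" using lr m by auto
  hence "(l + r) * k \<le> 2 * q * k" by (rule mult_right_mono) simp
  hence b: "(l + r) * k \<le> ?D" using q by (simp add: mult_ac)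
  moreover have "l * k \<le> (l + r) * k" by (intro mult_right_mono) auto
  ultimately have c: "l * k \<le> ?D" by linarith
  show "seg k l \<subseteq> {1..2 ^ J * k0}" using l c by (intro seg_subset) simp_all
  show "seg k (l + r) \<subseteq> {1..2 ^ J * k0}" using l b by (intro seg_subset) simp_all
  show "\<forall>i\<in>seg k l. \<forall>j\<in>seg k (l + r). i + k < j"
  proof (intro ballI)
    fix i j assume "i \<in> seg k l" "j \<in> seg k (l + r)"
    hence "i \<le> l * k" "(l + r - 1) * k < j" by (auto simp: seg_def)
    moreover have "(l + 1) * k \<le> (l + r - 1) * k" using l by (intro mult_right_mono) auto
    ultimately show "i + k < j" by (simp add: algebra_simps)
  qed
qed

section \<open>Privacy of the estimator\<close>

lemma measurable_block_release:
  assumes "t \<in> center_blocks (pad_dim d k0) k0 \<union> outer_blocks (pad_dim d k0) k0" "k0 \<ge> 1"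
  shows "(\<lambda>X. block_release \<alpha> K C C1 CG n d \<rho> k0 X t) \<in> data_space n d \<rightarrow>\<^sub>M prob_algebra (mat_space (block t))"
proof -
  obtain k l r where t: "t = (k, l, r)" by (cases t)
  show ?thesis
  proof (cases "r \<le> 1")
    case True
    hence "t \<in> center_blocks (pad_dim d k0) k0"
      using assms outer_block_geom(2)[of k l r "pad_exp d k0" k0] by (auto simp: t pad_dim_def)
    from center_block_geom[OF this[unfolded t] assms(2)] show ?thesis
      unfolding block_release_def t block_def Let_def using True by (auto intro!: measurable_DPCovBlock)
  next
    case False
    hence o: "t \<in> outer_blocks (pad_dim d k0) k0"
      using assms center_block_geom(2)[of k l r "pad_dim d k0" k0] by (auto simp: t)
    note g = outer_block_geom[OF o[unfolded t pad_dim_def] assms(2)]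
    show ?thesis
      unfolding block_release_def t block_def Let_def using False g
      by (auto intro!: measurable_peel_release simp: finite_seg card_seg)
  qed
qed

lemma assemble_sym: "assemble T \<omega> (i, j) = assemble T \<omega> (j, i)"
  by (simp add: assemble_def min.commute max.commute)

lemma measurable_assemble:
  assumes "finite T"
  shows "(\<lambda>\<omega>. assemble T \<omega> c) \<in> borel_measurable (PiM T (\<lambda>t. mat_space (block t)))"
proof -
  obtain i j where c: "c = (i, j)" by fastforce
  define b where "b = (min i j, max i j)"
  have "(\<lambda>\<omega>. if b \<in> block t then \<omega> t b else 0) \<in> borel_measurable (PiM T (\<lambda>t. mat_space (block t)))" if t: "t \<in> T" for t
  proof (cases "b \<in> block t")
    case True
    have "(\<lambda>\<omega>. \<omega> t) \<in> PiM T (\<lambda>t. mat_space (block t)) \<rightarrow>\<^sub>M mat_space (block t)"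
      using t by (rule measurable_component_singleton)
    moreover have "(\<lambda>x. x b) \<in> borel_measurable (mat_space (block t))"
      unfolding mat_space_def using True by (rule measurable_component_singleton)
    ultimately show ?thesis using True by (simp add: measurable_compose)
  qed simp
  thus ?thesis unfolding assemble_def c b_def Let_def by (auto intro!: borel_measurable_sum)
qed

lemma measurable_postprocess:
  assumes "M0 \<ge> 0" "k0 \<ge> 1" "finite T"
  shows "(\<lambda>\<omega>. restrict (spectral_clip (pad_dim d k0) M0 (assemble T \<omega>)) (idx d)) \<in> PiM T (\<lambda>t. mat_space (block t)) \<rightarrow>\<^sub>M mat_space (idx d)"
  using assms by (intro measurable_spectral_clip measurable_assemble assemble_sym pad_dim_ge)

text \<open>By postprocessing it suffices to add up the budgets of the blocks. There are at most
\<open>2 * (D div k0)\<close> center blocks, which share \<open>\<rho> / 4\<close>. At each outer scale there are fewer than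
\<open>3 * (D div (2 * k))\<close> blocks, so a scale spends at most \<open>3 / 4\<close> of \<open>\<rho>\<close> divided by the number of scales.\<close>
lemma peel_estimator_zCDP:
  assumes M0: "M0 \<ge> 0" and k0: "k0 \<ge> 1" and d: "d \<ge> 1" and n: "n \<ge> 2" and \<rho>: "\<rho> > 0" and K: "K > 0" and C: "C > 0" and C1: "C1 > 0"
  shows "zCDP n d \<rho> (peel_estimator \<alpha> K M0 C C1 CG n d \<rho> k0)"
proof -
  define D where "D = pad_dim d k0"
  define J where "J = pad_exp d k0"
  have DJ: "D = 2 ^ J * k0" by (simp add: D_def J_def pad_dim_def)
  define T where "T = center_blocks D k0 \<union> outer_blocks D k0"
  have T: "finite T" unfolding T_def DJ by (intro finite_UnI finite_center_blocks finite_outer_blocks k0)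
  let ?K = "\<lambda>t X. block_release \<alpha> K C C1 CG n d \<rho> k0 X t"
  let ?f = "\<lambda>\<omega>. restrict (spectral_clip D M0 (assemble T \<omega>)) (idx d)"
  have Km: "?K t \<in> data_space n d \<rightarrow>\<^sub>M prob_algebra (mat_space (block t))" if "t \<in> T" for t
    using that k0 unfolding T_def D_def by (intro measurable_block_release)
  have Kp: "prob_space (?K t X)" "sets (?K t X) = sets (mat_space (block t))" if "t \<in> T" "X \<in> space (data_space n d)" for t X
    using measurable_space[OF Km[OF that(1)] that(2)] by (auto simp: space_prob_algebra)
  have fm: "?f \<in> PiM T (\<lambda>t. mat_space (block t)) \<rightarrow>\<^sub>M mat_space (idx d)"
    unfolding D_def by (rule measurable_postprocess[OF M0 k0 T])
  have est: "peel_estimator \<alpha> K M0 C C1 CG n d \<rho> k0 X = distr (PiM T (\<lambda>t. ?K t X)) (mat_space (idx d)) ?f" for X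
    unfolding peel_estimator_def Let_def T_def D_def by simp
  have meas: "peel_estimator \<alpha> K M0 C C1 CG n d \<rho> k0 \<in> data_space n d \<rightarrow>\<^sub>M prob_algebra (mat_space (idx d))"
    unfolding est[abs_def]
    by (rule measurable_compose[OF measurable_PiM_kernel[OF T Km] measurable_distr_prob_space[OF fm]])
  have D1: "D \<ge> k0" using DJ k0 by simp
  have N: "D div k0 \<ge> 1" using D1 k0 by (simp add: div_greater_zero_iff Suc_leI)
  define \<rho>c where "\<rho>c = (\<rho> / 4) / (2 * real (D div k0))"
  define \<rho>o where "\<rho>o k = \<rho> / (4 * real (max 1 (J - 1)) * real (D div (2 * k)))" for k
  define rr where "rr = (\<lambda>(k, l::nat, r). if r \<le> (1::nat) then \<rho>c else \<rho>o k :: real)"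
  have \<rho>c: "\<rho>c > 0" unfolding \<rho>c_def using \<rho> N by (intro divide_pos_pos mult_pos_pos) auto
  have \<rho>o0: "\<rho>o k \<ge> 0" for k unfolding \<rho>o_def using \<rho> by auto
  have tot: "(\<Sum>t\<in>T. rr t) \<le> \<rho>"
  proof -
    have rr0: "rr t \<ge> 0" for t using \<rho>c \<rho>o0 by (cases t) (auto simp: rr_def)
    have "(\<Sum>t\<in>T. rr t) \<le> (\<Sum>t\<in>center_blocks D k0. rr t) + (\<Sum>t\<in>outer_blocks D k0. rr t)"
      unfolding T_def using rr0 finite_center_blocks finite_outer_blocks[OF k0] DJ by (subst sum.union_inter[symmetric]) (auto intro: sum_nonneg)
    also have "(\<Sum>t\<in>center_blocks D k0. rr t) = (\<Sum>t\<in>center_blocks D k0. \<rho>c)"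
      using center_block_geom(2)[OF _ k0] by (intro sum.cong refl) (auto simp: rr_def)
    also have "\<dots> = real (card (center_blocks D k0)) * \<rho>c" by simp
    also have "\<dots> \<le> real (2 * (D div k0)) * \<rho>c" using card_center_blocks[of D k0] \<rho>c by (intro mult_right_mono) linarith+
    also have "\<dots> = \<rho> / 4" using N by (simp add: \<rho>c_def)
    also have "(\<Sum>t\<in>outer_blocks D k0. rr t) = (\<Sum>t\<in>outer_blocks D k0. case t of (k, l, r) \<Rightarrow> \<rho>o k)"
      using outer_block_geom(2)[OF _ k0, of _ _ _ J] unfolding DJ by (intro sum.cong refl) (fastforce simp: rr_def)
    also have "\<dots> \<le> (\<Sum>k\<in>outer_scales D k0. 3 * real (D div (2 * k)) * \<rho>o k)"
      unfolding DJ by (rule sum_outer_blocks_le[OF k0]) (auto simp: \<rho>o0 split: prod.split)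
    also have "\<dots> = (\<Sum>k\<in>outer_scales D k0. 3 * \<rho> / (4 * real (max 1 (J - 1))))"
    proof (intro sum.cong refl)
      fix k assume "k \<in> outer_scales D k0"
      then obtain q where q: "D = 2 * k * q" "q \<ge> 2" "k \<ge> k0" unfolding DJ by (rule outer_scale_dvd[OF k0])
      hence "D div (2 * k) = q" using k0 by simp
      thus "3 * real (D div (2 * k)) * \<rho>o k = 3 * \<rho> / (4 * real (max 1 (J - 1)))" using q by (simp add: \<rho>o_def)
    qed
    also have "\<dots> = real (card (outer_scales D k0)) * (3 * \<rho> / (4 * real (max 1 (J - 1))))" by simp
    also have "\<dots> \<le> real (max 1 (J - 1)) * (3 * \<rho> / (4 * real (max 1 (J - 1))))"
    proof (intro mult_right_mono)
      have "card (outer_scales D k0) \<le> J - 1" unfolding DJ outer_scales_eq[OF k0] using card_image_le[of "{..<J - 1}"] by simp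
      thus "real (card (outer_scales D k0)) \<le> real (max 1 (J - 1))" by simp
    qed (use \<rho> in auto)
    also have "\<dots> = 3 * \<rho> / 4" by (simp add: field_simps)
    finally show ?thesis by simp
  qed
  have "renyi_div s (peel_estimator \<alpha> K M0 C C1 CG n d \<rho> k0 S) (peel_estimator \<alpha> K M0 C C1 CG n d \<rho> k0 S') \<le> ereal (\<rho> * s)"
    if adj: "adjacent n d S S'" and s: "s > 1" for S S' s
  proof (rule renyi_div_le[OF s])
    have sp: "S \<in> space (data_space n d)" "S' \<in> space (data_space n d)" using adj by (auto simp: adjacent_def)
    from adj obtain i0 where i0: "i0 \<in> {1..n}" "\<And>j. j \<in> {1..n} - {i0} \<Longrightarrow> S j = S' j"
      unfolding adjacent_def by blast
    have pd: "pad d S j = pad d S' j" if "j \<in> {1..n} - {i0}" for j unfolding pad_def i0(2)[OF that] ..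
    have each: "renyi_le s (rr t) (?K t S) (?K t S')" if t: "t \<in> T" for t
    proof -
      obtain k l r where tt: "t = (k, l, r)" by (cases t)
      have lnn: "ln (real n) > 0" using n by simp
      show ?thesis
      proof (cases "r \<le> 1")
        case True
        hence "(k, l, r) \<in> center_blocks D k0"
          using t outer_block_geom(2)[of k l r J k0] k0 by (auto simp: tt T_def DJ)
        note g = center_block_geom[OF this k0]
        have R: "K * sqrt (C1 * (real k0 + ln (real n))) > 0"
          using K C1 lnn k0 by (intro mult_pos_pos real_sqrt_gt_zero mult_pos_pos add_nonneg_pos) auto
        have "renyi_le s \<rho>c (DPCovBlock n D (pad d S) (seg k l) (seg k (l + r)) \<rho>c (K * sqrt (C1 * (real k0 + ln (real n)))))
          (DPCovBlock n D (pad d S') (seg k l) (seg k (l + r)) \<rho>c (K * sqrt (C1 * (real k0 + ln (real n)))))"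
          by (rule renyi_le_DPCovBlock[OF s g(4,5,6) \<rho>c R i0(1) pd])
        thus ?thesis using True
          by (simp only: tt block_release_def Let_def rr_def case_prod_conv if_True D_def[symmetric] \<rho>c_def[symmetric])
      next
        case False
        hence o: "(k, l, r) \<in> outer_blocks D k0"
          using t center_block_geom(2)[of k l r D k0] k0 by (auto simp: tt T_def)
        note g = outer_block_geom[OF o[unfolded DJ] k0]
        obtain q where q: "D = 2 * k * q" "q \<ge> 2" "k \<ge> k0"
          using g(1) unfolding DJ[symmetric] by (metis DJ outer_scale_dvd[OF k0])
        hence "\<rho>o k > 0" using \<rho> k0 by (auto simp: \<rho>o_def intro!: divide_pos_pos mult_pos_pos)
        moreover have "C * K\<^sup>2 * ln (real n) > 0" using C K lnn by simp
        ultimately have "renyi_le s (\<rho>o k) (peel_release n (C * K\<^sup>2 * ln (real n)) (pad d S) k (seg k l) (seg k (l + r)) (CG * real k powr - \<alpha>) (\<rho>o k))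
           (peel_release n (C * K\<^sup>2 * ln (real n)) (pad d S') k (seg k l) (seg k (l + r)) (CG * real k powr - \<alpha>) (\<rho>o k))"
          using g by (intro renyi_le_peel_release[OF s _ _ _ _ _ _ _ i0(1) pd]) (auto simp: finite_seg card_seg)
        thus ?thesis unfolding tt block_release_def Let_def rr_def using False
          by (simp add: D_def[symmetric] J_def[symmetric] \<rho>o_def)
      qed
    qed
    have "renyi_le s (\<Sum>t\<in>T. rr t) (PiM T (\<lambda>t. ?K t S)) (PiM T (\<lambda>t. ?K t S'))"
      by (rule renyi_le_PiM[OF s T]) (use each Kp sp in auto)
    hence "renyi_le s \<rho> (PiM T (\<lambda>t. ?K t S)) (PiM T (\<lambda>t. ?K t S'))"
      by (rule renyi_le_mono[OF _ tot s])
    moreover have "sets (PiM T (\<lambda>t. ?K t X)) = sets (PiM T (\<lambda>t. mat_space (block t)))" if "X \<in> space (data_space n d)" for X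
      using Kp that by (intro sets_PiM_cong) auto
    ultimately show "renyi_le s \<rho> (peel_estimator \<alpha> K M0 C C1 CG n d \<rho> k0 S) (peel_estimator \<alpha> K M0 C C1 CG n d \<rho> k0 S')"
      unfolding est using sp fm by (intro renyi_le_distr) (auto cong: measurable_cong_sets)
    show "prob_space (peel_estimator \<alpha> K M0 C C1 CG n d \<rho> k0 S)" "prob_space (peel_estimator \<alpha> K M0 C C1 CG n d \<rho> k0 S')"
      "sets (peel_estimator \<alpha> K M0 C C1 CG n d \<rho> k0 S) = sets (peel_estimator \<alpha> K M0 C C1 CG n d \<rho> k0 S')"
      using measurable_space[OF meas sp(1)] measurable_space[OF meas sp(2)] by (auto simp: space_prob_algebra)
  qed
  thus ?thesis unfolding zCDP_def using meas by blast
qed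

section \<open>Gaussian integrals\<close>

lemma nn_integral_std_normal_exp:
  "(\<integral>\<^sup>+z. ennreal (exp (u * z)) \<partial>std_normal) = ennreal (exp (u\<^sup>2 / 2))"
proof -
  have "(\<integral>\<^sup>+z. ennreal (exp (u * z)) \<partial>std_normal) = (\<integral>\<^sup>+z. ennreal (exp (u\<^sup>2 / 2)) * ennreal (normal_density u 1 z) \<partial>lborel)"
  proof (subst nn_integral_density)
    show "(\<integral>\<^sup>+x. ennreal (std_normal_density x) * ennreal (exp (u * x)) \<partial>lborel) = (\<integral>\<^sup>+z. ennreal (exp (u\<^sup>2 / 2)) * ennreal (normal_density u 1 z) \<partial>lborel)"
    proof (intro nn_integral_cong)
      fix x :: real
      have "- x\<^sup>2 / 2 + u * x = u\<^sup>2 / 2 + - (x - u)\<^sup>2 / 2" by (simp add: power2_eq_square field_simps)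
      hence "exp (- x\<^sup>2 / 2) * exp (u * x) = exp (u\<^sup>2 / 2) * exp (- (x - u)\<^sup>2 / 2)" by (simp only: exp_add[symmetric])
      hence "std_normal_density x * exp (u * x) = exp (u\<^sup>2 / 2) * normal_density u 1 x"
        by (simp add: normal_density_def)
      thus "ennreal (std_normal_density x) * ennreal (exp (u * x)) = ennreal (exp (u\<^sup>2 / 2)) * ennreal (normal_density u 1 x)"
        by (simp add: ennreal_mult'[symmetric])
    qed
  qed auto
  also have "\<dots> = ennreal (exp (u\<^sup>2 / 2)) * emeasure (density lborel (normal_density u 1)) UNIV"
    by (subst nn_integral_cmult) (auto simp: emeasure_density)
  also have "emeasure (density lborel (normal_density u 1)) UNIV = 1"
    using prob_space.emeasure_space_1[OF prob_space_normal_density[of 1 u]] by simp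
  finally show ?thesis by simp
qed

lemma nn_integral_std_normal_exp_sq:
  "(\<integral>\<^sup>+z. ennreal (exp (z\<^sup>2 / 4)) \<partial>std_normal) = ennreal (sqrt 2)"
proof -
  have "(\<integral>\<^sup>+z. ennreal (exp (z\<^sup>2 / 4)) \<partial>std_normal) = (\<integral>\<^sup>+z. ennreal (sqrt 2) * ennreal (normal_density 0 (sqrt 2) z) \<partial>lborel)"
  proof (subst nn_integral_density)
    show "(\<integral>\<^sup>+x. ennreal (std_normal_density x) * ennreal (exp (x\<^sup>2 / 4)) \<partial>lborel) = (\<integral>\<^sup>+z. ennreal (sqrt 2) * ennreal (normal_density 0 (sqrt 2) z) \<partial>lborel)"
    proof (intro nn_integral_cong)
      fix x :: real
      have "exp (- x\<^sup>2 / 2) * exp (x\<^sup>2 / 4) = exp (- x\<^sup>2 / 4)" by (simp add: exp_add[symmetric] field_simps)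
      hence "std_normal_density x * exp (x\<^sup>2 / 4) = sqrt 2 * normal_density 0 (sqrt 2) x"
        by (simp add: normal_density_def real_sqrt_mult field_simps)
      thus "ennreal (std_normal_density x) * ennreal (exp (x\<^sup>2 / 4)) = ennreal (sqrt 2) * ennreal (normal_density 0 (sqrt 2) x)"
        by (simp add: ennreal_mult'[symmetric])
    qed
  qed auto
  also have "\<dots> = ennreal (sqrt 2) * emeasure (density lborel (normal_density 0 (sqrt 2))) UNIV"
    by (subst nn_integral_cmult) (auto simp: emeasure_density)
  also have "emeasure (density lborel (normal_density 0 (sqrt 2))) UNIV = 1"
    using prob_space.emeasure_space_1[OF prob_space_normal_density[of "sqrt 2" 0]] by simp
  finally show ?thesis by simp
qed

lemma nn_integral_std_normal_affine_sq:
  "(\<integral>\<^sup>+z. ennreal ((a + \<sigma> * z)\<^sup>2) \<partial>std_normal) = ennreal (a\<^sup>2 + \<sigma>\<^sup>2)"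
proof -
  have m0: "has_bochner_integral std_normal (\<lambda>z. 1) (1::real)"
    using prob_space.prob_space[OF prob_space_normal_density[of 1 0]]
    by (auto simp: has_bochner_integral_iff prob_space.emeasure_space_1[OF prob_space_normal_density] finite_measure.integrable_const prob_space.finite_measure[OF prob_space_normal_density])
  have m1: "has_bochner_integral std_normal (\<lambda>z. z) (0::real)"
    using std_normal_moment_odd[of 0] by (simp add: has_bochner_integral_density)
  have m2: "has_bochner_integral std_normal (\<lambda>z. z\<^sup>2) (1::real)"
    using std_normal_moment_even[of 1] by (simp add: has_bochner_integral_density fact_numeral)
  have "has_bochner_integral std_normal (\<lambda>z. a\<^sup>2 * 1 + (2 * a * \<sigma>) * z + \<sigma>\<^sup>2 * z\<^sup>2) (a\<^sup>2 * 1 + (2 * a * \<sigma>) * 0 + \<sigma>\<^sup>2 * 1)"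
    by (intro has_bochner_integral_add has_bochner_integral_mult_right m0 m1 m2)
  hence "has_bochner_integral std_normal (\<lambda>z. (a + \<sigma> * z)\<^sup>2) (a\<^sup>2 + \<sigma>\<^sup>2)"
    by (simp add: power2_eq_square algebra_simps)
  thus ?thesis by (simp add: has_bochner_integral_iff nn_integral_eq_integral)
qed

section \<open>Sub-Gaussian vectors\<close>

locale subgauss = prob_space P for P :: "(nat \<Rightarrow> real) measure" +
  fixes d :: nat and K :: real
  assumes sets_P: "sets P = sets (vec_space d)" and K: "K > 0" and psi2: "psi2_norm d P \<le> ennreal K"
begin

lemma coord_measurable [measurable]: "j \<in> {1..d} \<Longrightarrow> (\<lambda>x. x j) \<in> borel_measurable P"
  unfolding measurable_cong_sets[OF sets_P refl] vec_space_def by (rule measurable_component_singleton)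

text \<open>The infimum in the definition of the norm may equal \<open>K\<close> without being attained there, so the exponential
moment is taken at \<open>2 * K\<close>.\<close>
lemma exp_unit:
  assumes v: "L2_set v {1..d} = 1"
  shows "(\<integral>\<^sup>+x. ennreal (exp ((\<Sum>j=1..d. x j * v j)\<^sup>2 / (4 * K\<^sup>2))) \<partial>P) \<le> 2"
proof -
  let ?T = "{t. t > 0 \<and> (\<integral>\<^sup>+ x. ennreal (exp ((\<Sum>j=1..d. x j * v j)\<^sup>2 / t\<^sup>2)) \<partial>P) \<le> 2}"
  have "(INF t\<in>?T. ennreal t) \<le> psi2_norm d P"
    unfolding psi2_norm_def by (rule SUP_upper) (use v in simp)
  also note psi2
  also have "ennreal K < ennreal (2 * K)" using K by (simp add: ennreal_lessI)
  finally obtain t where t: "t \<in> ?T" "ennreal t < ennreal (2 * K)" unfolding INF_less_iff by blast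
  hence tt: "t > 0" "t < 2 * K" using K by (auto simp: ennreal_less_iff)
  have "t\<^sup>2 \<le> (2 * K)\<^sup>2" using tt by (intro power_mono) auto
  hence "(\<integral>\<^sup>+x. ennreal (exp ((\<Sum>j=1..d. x j * v j)\<^sup>2 / (4 * K\<^sup>2))) \<partial>P) \<le> (\<integral>\<^sup>+ x. ennreal (exp ((\<Sum>j=1..d. x j * v j)\<^sup>2 / t\<^sup>2)) \<partial>P)"
    using tt K by (intro nn_integral_mono ennreal_leI) (auto intro!: divide_left_mono simp: power_mult_distrib)
  also have "\<dots> \<le> 2" using t by simp
  finally show ?thesis .
qed

text \<open>Linear exponential moments follow from the quadratic ones by
\<open>N * u / (2 * K) \<le> N\<^sup>2 / 4 + u\<^sup>2 / (4 * K\<^sup>2)\<close>, where \<open>N\<close> is the norm of \<open>g\<close>.\<close>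
lemma exp_linear:
  "(\<integral>\<^sup>+x. ennreal (exp ((\<Sum>j=1..d. x j * g j) / (2 * K))) \<partial>P) \<le> ennreal (2 * exp ((\<Sum>j=1..d. (g j)\<^sup>2) / 4))"
proof -
  define N where "N = L2_set g {1..d}"
  have N2: "N\<^sup>2 = (\<Sum>j=1..d. (g j)\<^sup>2)" by (simp add: N_def L2_set_def sum_nonneg)
  show ?thesis
  proof (cases "N = 0")
    case True
    hence "\<forall>j\<in>{1..d}. g j = 0" unfolding N_def by (subst (asm) L2_set_eq_0_iff) auto
    hence z: "(\<Sum>j=1..d. x j * g j) = 0" for x by (intro sum.neutral) auto
    have "(\<integral>\<^sup>+x. ennreal (exp ((\<Sum>j=1..d. x j * g j) / (2 * K))) \<partial>P) = 1"
      unfolding z by (simp add: emeasure_space_1)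
    also have "\<dots> \<le> ennreal (2 * exp ((\<Sum>j=1..d. (g j)\<^sup>2) / 4))"
      unfolding N2[symmetric] True by simp
    finally show ?thesis .
  next
    case False
    moreover have "N \<ge> 0" unfolding N_def by (rule L2_set_nonneg)
    ultimately have N: "N > 0" by simp
    define v where "v j = g j / N" for j
    have "L2_set v {1..d} = 1"
    proof -
      have "(\<Sum>j=1..d. (v j)\<^sup>2) = (\<Sum>j=1..d. (g j)\<^sup>2) / N\<^sup>2"
        unfolding v_def sum_divide_distrib by (simp add: power_divide)
      thus ?thesis unfolding L2_set_def N2[symmetric] using N by simp
    qed
    note ex = exp_unit[OF this]
    have gv: "(\<Sum>j=1..d. x j * g j) = N * (\<Sum>j=1..d. x j * v j)" for x
      unfolding sum_distrib_left v_def using N by (intro sum.cong) auto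
    have "(\<integral>\<^sup>+x. ennreal (exp ((\<Sum>j=1..d. x j * g j) / (2 * K))) \<partial>P) \<le>
        (\<integral>\<^sup>+x. ennreal (exp (N\<^sup>2 / 4)) * ennreal (exp ((\<Sum>j=1..d. x j * v j)\<^sup>2 / (4 * K\<^sup>2))) \<partial>P)"
    proof (intro nn_integral_mono)
      fix x
      define s where "s = (\<Sum>j=1..d. x j * v j)"
      have "0 \<le> (s / (2 * K) - N / 2)\<^sup>2" by simp
      hence "N * s / (2 * K) \<le> N\<^sup>2 / 4 + s\<^sup>2 / (4 * K\<^sup>2)" using K by (simp add: power2_eq_square field_simps)
      hence "exp (N * s / (2 * K)) \<le> exp (N\<^sup>2 / 4) * exp (s\<^sup>2 / (4 * K\<^sup>2))" by (simp add: exp_add[symmetric])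
      thus "ennreal (exp ((\<Sum>j=1..d. x j * g j) / (2 * K))) \<le> ennreal (exp (N\<^sup>2 / 4)) * ennreal (exp ((\<Sum>j=1..d. x j * v j)\<^sup>2 / (4 * K\<^sup>2)))"
        unfolding gv s_def[symmetric] by (simp add: ennreal_mult'[symmetric] ennreal_leI)
    qed
    also have "\<dots> = ennreal (exp (N\<^sup>2 / 4)) * (\<integral>\<^sup>+x. ennreal (exp ((\<Sum>j=1..d. x j * v j)\<^sup>2 / (4 * K\<^sup>2))) \<partial>P)"
      by (rule nn_integral_cmult) measurable
    also have "\<dots> \<le> ennreal (exp (N\<^sup>2 / 4)) * 2" by (intro mult_left_mono ex) auto
    also have "\<dots> = ennreal (2 * exp (N\<^sup>2 / 4))" by (simp add: ennreal_mult' mult.commute)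
    finally show ?thesis by (simp add: N2)
  qed
qed

text \<open>The exponential of the squared norm is a Gaussian average of exponentials of linear functionals. After
exchanging the integrals, \<open>exp_linear\<close> leaves a product of one-dimensional Gaussian integrals. The
constant \<open>8 * K\<^sup>2\<close> does not depend on the number of coordinates, which only enters through \<open>sqrt 2 ^ card I\<close>.\<close>
lemma exp_norm_sq:
  assumes I: "I \<subseteq> {1..d}"
  shows "(\<integral>\<^sup>+x. ennreal (exp ((\<Sum>i\<in>I. (x i)\<^sup>2) / (8 * K\<^sup>2))) \<partial>P) \<le> ennreal (2 * sqrt 2 ^ card I)"
proof -
  have fin: "finite I" using I finite_subset by auto
  let ?N = "PiM I (\<lambda>_. std_normal)"
  interpret N: product_prob_space "\<lambda>_::nat. std_normal"
    by (intro product_prob_spaceI prob_space_normal_density) auto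
  interpret PN: prob_space ?N by (intro prob_space_PiM prob_space_normal_density) auto
  interpret pair_sigma_finite P ?N by unfold_locales
  have gm: "(\<lambda>g. g j) \<in> borel_measurable ?N" if "j \<in> I" for j
    using measurable_component_singleton[OF that, of "\<lambda>_. std_normal"] by simp
  have pm: "(\<lambda>(x, g). ennreal (exp ((\<Sum>i\<in>I. x i * g i) / (2 * K)))) \<in> borel_measurable (P \<Otimes>\<^sub>M ?N)"
  proof -
    have "(\<lambda>z. fst z i) \<in> borel_measurable (P \<Otimes>\<^sub>M ?N)" if "i \<in> I" for i
      by (rule measurable_compose[OF measurable_fst coord_measurable]) (use I that in auto)
    moreover have "(\<lambda>z. snd z i) \<in> borel_measurable (P \<Otimes>\<^sub>M ?N)" if "i \<in> I" for i
      by (rule measurable_compose[OF measurable_snd gm[OF that]])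
    ultimately have "(\<lambda>z. \<Sum>i\<in>I. fst z i * snd z i) \<in> borel_measurable (P \<Otimes>\<^sub>M ?N)"
      by (intro borel_measurable_sum borel_measurable_times) auto
    thus ?thesis unfolding case_prod_unfold by measurable
  qed
  have "(\<integral>\<^sup>+x. ennreal (exp ((\<Sum>i\<in>I. (x i)\<^sup>2) / (8 * K\<^sup>2))) \<partial>P) = (\<integral>\<^sup>+x. (\<integral>\<^sup>+g. ennreal (exp ((\<Sum>i\<in>I. x i * g i) / (2 * K))) \<partial>?N) \<partial>P)"
  proof (intro nn_integral_cong)
    fix x
    have "(\<integral>\<^sup>+g. ennreal (exp ((\<Sum>i\<in>I. x i * g i) / (2 * K))) \<partial>?N) = (\<integral>\<^sup>+g. (\<Prod>i\<in>I. ennreal (exp (x i / (2 * K) * g i))) \<partial>?N)"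
      by (intro nn_integral_cong) (simp add: prod_ennreal exp_sum[OF fin, symmetric] sum_divide_distrib)
    also have "\<dots> = (\<Prod>i\<in>I. (\<integral>\<^sup>+z. ennreal (exp (x i / (2 * K) * z)) \<partial>std_normal))"
      by (rule N.product_nn_integral_prod[OF fin]) simp
    also have "\<dots> = (\<Prod>i\<in>I. ennreal (exp ((x i)\<^sup>2 / (8 * K\<^sup>2))))"
      unfolding nn_integral_std_normal_exp by (simp add: power_divide power_mult_distrib)
    also have "\<dots> = ennreal (exp ((\<Sum>i\<in>I. (x i)\<^sup>2) / (8 * K\<^sup>2)))"
      by (simp add: prod_ennreal exp_sum[OF fin, symmetric] sum_divide_distrib)
    finally show "ennreal (exp ((\<Sum>i\<in>I. (x i)\<^sup>2) / (8 * K\<^sup>2))) = (\<integral>\<^sup>+g. ennreal (exp ((\<Sum>i\<in>I. x i * g i) / (2 * K))) \<partial>?N)" ..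
  qed
  also have "\<dots> = (\<integral>\<^sup>+g. (\<integral>\<^sup>+x. ennreal (exp ((\<Sum>i\<in>I. x i * g i) / (2 * K))) \<partial>P) \<partial>?N)"
    using Fubini'[OF pm] by simp
  also have "\<dots> \<le> (\<integral>\<^sup>+g. 2 * (\<Prod>i\<in>I. ennreal (exp ((g i)\<^sup>2 / 4))) \<partial>?N)"
  proof (intro nn_integral_mono)
    fix g :: "nat \<Rightarrow> real"
    \<comment> \<open>\<open>exp_linear\<close> is stated for vectors on all coordinates.\<close>
    define g' where "g' j = (if j \<in> I then g j else 0)" for j
    have 1: "(\<Sum>i\<in>I. x i * g i) = (\<Sum>j=1..d. x j * g' j)" for x :: "nat \<Rightarrow> real"
      unfolding g'_def using I by (intro sum.mono_neutral_cong_left) auto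
    have 2: "(\<Sum>j=1..d. (g' j)\<^sup>2) = (\<Sum>i\<in>I. (g i)\<^sup>2)"
      unfolding g'_def using I by (intro sum.mono_neutral_cong_right) auto
    have "(\<integral>\<^sup>+x. ennreal (exp ((\<Sum>i\<in>I. x i * g i) / (2 * K))) \<partial>P) \<le> ennreal (2 * exp ((\<Sum>i\<in>I. (g i)\<^sup>2) / 4))"
      unfolding 1 2[symmetric] by (rule exp_linear)
    also have "\<dots> = 2 * (\<Prod>i\<in>I. ennreal (exp ((g i)\<^sup>2 / 4)))"
      by (simp add: prod_ennreal exp_sum[OF fin, symmetric] sum_divide_distrib ennreal_mult')
    finally show "(\<integral>\<^sup>+x. ennreal (exp ((\<Sum>i\<in>I. x i * g i) / (2 * K))) \<partial>P) \<le> 2 * (\<Prod>i\<in>I. ennreal (exp ((g i)\<^sup>2 / 4)))" .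
  qed
  also have "\<dots> = 2 * (\<integral>\<^sup>+g. (\<Prod>i\<in>I. ennreal (exp ((g i)\<^sup>2 / 4))) \<partial>?N)"
    by (rule nn_integral_cmult) (use gm in \<open>auto intro!: borel_measurable_prod_ennreal\<close>)
  also have "(\<integral>\<^sup>+g. (\<Prod>i\<in>I. ennreal (exp ((g i)\<^sup>2 / 4))) \<partial>?N) = (\<Prod>i\<in>I. (\<integral>\<^sup>+z. ennreal (exp (z\<^sup>2 / 4)) \<partial>std_normal))"
    by (rule N.product_nn_integral_prod[OF fin]) simp
  also have "2 * (\<Prod>i\<in>I. (\<integral>\<^sup>+z. ennreal (exp (z\<^sup>2 / 4)) \<partial>std_normal)) = ennreal (2 * sqrt 2 ^ card I)"
    unfolding nn_integral_std_normal_exp_sq by (simp add: ennreal_mult' ennreal_power)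
  finally show ?thesis .
qed

lemma exp_coord:
  assumes "j \<in> {1..d}"
  shows "(\<integral>\<^sup>+x. ennreal (exp ((x j)\<^sup>2 / (4 * K\<^sup>2))) \<partial>P) \<le> 2"
proof -
  define v where "v i = (if i = j then 1 else 0 :: real)" for i
  have "(\<Sum>i=1..d. (v i)\<^sup>2) = (\<Sum>i=1..d. if i = j then 1 else 0)" by (intro sum.cong) (auto simp: v_def)
  hence "L2_set v {1..d} = 1" unfolding L2_set_def using assms by simp
  moreover have "(\<Sum>i=1..d. x i * v i) = x j" for x unfolding v_def using assms by (simp add: if_distrib cong: if_cong)
  ultimately show ?thesis using exp_unit[of v] by simp
qed

lemma fourth_moment:
  assumes "j \<in> {1..d}"
  shows "(\<integral>\<^sup>+x. ennreal ((x j) ^ 4) \<partial>P) \<le> ennreal (64 * K ^ 4)"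
proof -
  have "(\<integral>\<^sup>+x. ennreal ((x j) ^ 4) \<partial>P) \<le> (\<integral>\<^sup>+x. ennreal (32 * K ^ 4) * ennreal (exp ((x j)\<^sup>2 / (4 * K\<^sup>2))) \<partial>P)"
  proof (intro nn_integral_mono)
    fix x :: "nat \<Rightarrow> real"
    define u where "u = (x j)\<^sup>2 / (4 * K\<^sup>2)"
    have u: "u \<ge> 0" by (simp add: u_def)
    have "u\<^sup>2 \<le> 2 * exp u"
    proof -
      have "0 \<le> exp u - 1 - u - u\<^sup>2 / 2" using exp_lower_Taylor_quadratic[OF u] by simp
      thus ?thesis using u by simp
    qed
    hence "16 * K ^ 4 * u\<^sup>2 \<le> 16 * K ^ 4 * (2 * exp u)" by (intro mult_left_mono) auto
    moreover have "16 * K ^ 4 * u\<^sup>2 = (x j) ^ 4" using K by (simp add: u_def power2_eq_square power4_eq_xxxx field_simps)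
    ultimately have "(x j) ^ 4 \<le> 32 * K ^ 4 * exp u" by simp
    thus "ennreal ((x j) ^ 4) \<le> ennreal (32 * K ^ 4) * ennreal (exp ((x j)\<^sup>2 / (4 * K\<^sup>2)))"
      by (simp add: ennreal_mult'[symmetric] u_def ennreal_leI)
  qed
  also have "\<dots> = ennreal (32 * K ^ 4) * (\<integral>\<^sup>+x. ennreal (exp ((x j)\<^sup>2 / (4 * K\<^sup>2))) \<partial>P)"
    by (rule nn_integral_cmult) (use assms in measurable)
  also have "\<dots> \<le> ennreal (32 * K ^ 4) * 2" by (intro mult_left_mono exp_coord assms) auto
  also have "\<dots> = ennreal (64 * K ^ 4)"
    using ennreal_mult'[of "32 * K ^ 4" 2] by simp
  finally show ?thesis .
qed

text \<open>An observation with its zero coordinates outside \<open>{1..d}\<close>, as the estimator sees it.\<close>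
definition padded :: "(nat \<Rightarrow> real) \<Rightarrow> nat \<Rightarrow> real" where
  "padded x = (\<lambda>j. if j \<in> {1..d} then x j else 0)"

lemma padded_measurable [measurable]: "(\<lambda>x. padded x j) \<in> borel_measurable P"
  unfolding padded_def by (cases "j \<in> {1..d}") auto

lemma padded_product_moment: "(\<integral>\<^sup>+x. ennreal ((padded x i * padded x j)\<^sup>2) \<partial>P) \<le> ennreal (64 * K ^ 4)"
proof (cases "i \<in> {1..d} \<and> j \<in> {1..d}")
  case True
  define h where "h = (1/2::real)"
  have h: "h \<ge> 0" "h + h = 1" by (auto simp: h_def)
  have "(\<integral>\<^sup>+x. ennreal ((padded x i * padded x j)\<^sup>2) \<partial>P) \<le> (\<integral>\<^sup>+x. ennreal h * ennreal ((x i) ^ 4) + ennreal h * ennreal ((x j) ^ 4) \<partial>P)"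
  proof (intro nn_integral_mono)
    fix x :: "nat \<Rightarrow> real"
    have "0 \<le> ((x i)\<^sup>2 - (x j)\<^sup>2)\<^sup>2" by simp
    hence "(padded x i * padded x j)\<^sup>2 \<le> h * (x i) ^ 4 + h * (x j) ^ 4"
      using True by (simp add: padded_def h_def power2_eq_square power4_eq_xxxx algebra_simps)
    thus "ennreal ((padded x i * padded x j)\<^sup>2) \<le> ennreal h * ennreal ((x i) ^ 4) + ennreal h * ennreal ((x j) ^ 4)"
      using h by (simp add: ennreal_mult'[symmetric] ennreal_plus[symmetric] ennreal_leI del: ennreal_plus)
  qed
  also have "\<dots> = ennreal h * (\<integral>\<^sup>+x. ennreal ((x i) ^ 4) \<partial>P) + ennreal h * (\<integral>\<^sup>+x. ennreal ((x j) ^ 4) \<partial>P)"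
    using True by (subst nn_integral_add) (auto simp: nn_integral_cmult)
  also have "\<dots> \<le> ennreal h * ennreal (64 * K ^ 4) + ennreal h * ennreal (64 * K ^ 4)"
    using True by (intro add_mono mult_left_mono fourth_moment) auto
  also have "\<dots> = ennreal (64 * K ^ 4)"
    using h by (simp add: ennreal_mult'[symmetric] ennreal_plus[symmetric] distrib_right[symmetric] del: ennreal_plus)
  finally show ?thesis .
qed (auto simp: padded_def)

lemma markov_exp:
  assumes f[measurable]: "f \<in> borel_measurable P" and I: "(\<integral>\<^sup>+x. ennreal (exp (f x)) \<partial>P) \<le> ennreal c" and c: "c \<ge> 0"
  shows "prob {x\<in>space P. f x \<ge> s} \<le> c * exp (- s)"
proof -
  have "emeasure P {x\<in>space P. f x \<ge> s} = (\<integral>\<^sup>+x. indicator {x\<in>space P. f x \<ge> s} x \<partial>P)"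
    by simp
  also have "\<dots> \<le> (\<integral>\<^sup>+x. ennreal (exp (- s)) * ennreal (exp (f x)) \<partial>P)"
    by (intro nn_integral_mono) (auto simp: indicator_def ennreal_mult'[symmetric] exp_add[symmetric])
  also have "\<dots> = ennreal (exp (- s)) * (\<integral>\<^sup>+x. ennreal (exp (f x)) \<partial>P)" by (rule nn_integral_cmult) measurable
  also have "\<dots> \<le> ennreal (exp (- s)) * ennreal c" by (intro mult_left_mono I) auto
  also have "\<dots> = ennreal (c * exp (- s))" using c by (simp add: ennreal_mult'[symmetric] mult.commute)
  finally show ?thesis using c by (simp add: emeasure_eq_measure)
qed

lemma norm_tail:
  assumes s: "s \<ge> 0" and that: "finite I"
  shows "prob {x\<in>space P. (\<Sum>i\<in>I. (padded x i)\<^sup>2) \<ge> s} \<le> 2 * sqrt 2 ^ card I * exp (- s / (8 * K\<^sup>2))"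
proof -
  let ?I = "I \<inter> {1..d}"
  have "(\<Sum>i\<in>I. (padded x i)\<^sup>2) = (\<Sum>i\<in>?I. (x i)\<^sup>2)" for x
    unfolding padded_def using that by (intro sum.mono_neutral_cong_right) auto
  moreover have "(\<Sum>i\<in>?I. (x i)\<^sup>2) \<ge> s \<longleftrightarrow> (\<Sum>i\<in>?I. (x i)\<^sup>2) / (8 * K\<^sup>2) \<ge> s / (8 * K\<^sup>2)" for x
    using K by (simp add: divide_le_cancel)
  ultimately have "prob {x\<in>space P. (\<Sum>i\<in>I. (padded x i)\<^sup>2) \<ge> s} = prob {x\<in>space P. (\<Sum>i\<in>?I. (x i)\<^sup>2) / (8 * K\<^sup>2) \<ge> s / (8 * K\<^sup>2)}" by simp
  also have "\<dots> \<le> 2 * sqrt 2 ^ card ?I * exp (- (s / (8 * K\<^sup>2)))"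
    by (rule markov_exp) (auto intro!: exp_norm_sq)
  also have "\<dots> \<le> 2 * sqrt 2 ^ card I * exp (- (s / (8 * K\<^sup>2)))"
    using that by (intro mult_right_mono mult_left_mono power_increasing card_mono) auto
  finally show ?thesis by simp
qed

lemma coord_tail:
  assumes s: "s \<ge> 0"
  shows "prob {x\<in>space P. (padded x j)\<^sup>2 \<ge> s} \<le> 2 * exp (- s / (4 * K\<^sup>2))"
proof (cases "j \<in> {1..d}")
  case True
  have "(padded x j)\<^sup>2 \<ge> s \<longleftrightarrow> (x j)\<^sup>2 / (4 * K\<^sup>2) \<ge> s / (4 * K\<^sup>2)" for x
    using K True by (simp add: divide_le_cancel padded_def)
  hence "prob {x\<in>space P. (padded x j)\<^sup>2 \<ge> s} = prob {x\<in>space P. (x j)\<^sup>2 / (4 * K\<^sup>2) \<ge> s / (4 * K\<^sup>2)}" by simp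
  also have "\<dots> \<le> 2 * exp (- (s / (4 * K\<^sup>2)))"
    by (rule markov_exp) (use True exp_coord in \<open>auto\<close>)
  finally show ?thesis by simp
next
  case False
  show ?thesis
  proof (cases "s = 0")
    case True
    have "prob {x\<in>space P. (padded x j)\<^sup>2 \<ge> s} \<le> 1" by simp
    thus ?thesis using True by (simp add: prob_space)
  qed (use False s in \<open>auto simp: padded_def\<close>)
qed

text \<open>The truncated variable differs from \<open>z\<close> only on \<open>E\<close>. There \<open>\<bar>z\<bar> \<le> z\<^sup>2 / w + w / 4\<close>, and \<open>w = sqrt n\<close> balances
the second moment against the probability of \<open>E\<close>.\<close>
lemma truncation_bias:
  assumes [measurable]: "z \<in> borel_measurable P" "z' \<in> borel_measurable P" "E \<in> events"
    and m: "(\<integral>\<^sup>+x. ennreal ((z x)\<^sup>2) \<partial>P) \<le> ennreal m" and m0: "m \<ge> 0" and E: "prob E \<le> 4 / real n" and n: "n > 0"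
    and z': "\<And>x. x \<in> space P \<Longrightarrow> \<bar>z x - z' x\<bar> \<le> \<bar>z x\<bar>" and off: "\<And>x. x \<in> space P \<Longrightarrow> x \<notin> E \<Longrightarrow> z' x = z x"
    and z'b: "\<And>x. x \<in> space P \<Longrightarrow> \<bar>z' x\<bar> \<le> B"
  shows "((\<integral>x. z' x \<partial>P) - (\<integral>x. z x \<partial>P))\<^sup>2 \<le> (m + 4)\<^sup>2 / real n"
proof -
  have sq: "integrable P (\<lambda>x. (z x)\<^sup>2)"
    by (rule integrableI_bounded) (use m in \<open>auto simp: order_le_less_trans[OF m ennreal_less_top]\<close>)
  have iz: "integrable P z" by (rule square_integrable_imp_integrable[OF _ sq]) measurable
  have iz': "integrable P z'" by (rule integrable_const_bound[of _ B]) (use z'b in auto)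
  have I2: "(\<integral>x. (z x)\<^sup>2 \<partial>P) \<le> m"
    using m m0 nn_integral_eq_integral[OF sq] by simp
  define w where "w = sqrt (real n)"
  have w: "w > 0" "w * w = real n" using n by (auto simp: w_def)
  have iE: "integrable P (\<lambda>x. indicator E x :: real)" by (simp add: integrable_indicator_iff emeasure_eq_measure)
  have "\<bar>(\<integral>x. z' x \<partial>P) - (\<integral>x. z x \<partial>P)\<bar> = \<bar>\<integral>x. z' x - z x \<partial>P\<bar>" using iz iz' by simp
  also have "\<dots> \<le> (\<integral>x. \<bar>z' x - z x\<bar> \<partial>P)" by (rule integral_abs_bound)
  also have "\<dots> \<le> (\<integral>x. (z x)\<^sup>2 / w + w / 4 * indicator E x \<partial>P)"
  proof (rule integral_mono)
    fix x assume x: "x \<in> space P"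
    show "\<bar>z' x - z x\<bar> \<le> (z x)\<^sup>2 / w + w / 4 * indicator E x"
    proof (cases "x \<in> E")
      case True
      have "0 \<le> (\<bar>z x\<bar> - w / 2)\<^sup>2" by simp
      hence "w * \<bar>z x\<bar> \<le> (z x)\<^sup>2 + w * w / 4" by (simp add: power2_eq_square algebra_simps)
      hence "\<bar>z x\<bar> \<le> (z x)\<^sup>2 / w + w / 4" using w(1) by (simp add: field_simps)
      thus ?thesis using z'[OF x] True by (simp add: abs_minus_commute)
    qed (use off[OF x] w in auto)
  qed (use iz iz' sq iE in auto)
  also have "\<dots> = (\<integral>x. (z x)\<^sup>2 \<partial>P) / w + w / 4 * prob E" using sq iE by simp
  also have "\<dots> \<le> m / w + w / 4 * (4 / real n)"
    using I2 E w by (intro add_mono divide_right_mono mult_left_mono) auto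
  also have "\<dots> \<le> (m + 4) / w" using w by (simp add: w(2)[symmetric] field_simps)
  finally have "\<bar>(\<integral>x. z' x \<partial>P) - (\<integral>x. z x \<partial>P)\<bar>\<^sup>2 \<le> ((m + 4) / w)\<^sup>2" by (intro power_mono) auto
  thus "((\<integral>x. z' x \<partial>P) - (\<integral>x. z x \<partial>P))\<^sup>2 \<le> (m + 4)\<^sup>2 / real n"
    using w by (simp add: power_divide power2_eq_square)
qed

text \<open>By \<open>norm_tail\<close> a subvector exceeds the radius with probability at most \<open>2 / n\<close>: for \<open>C1 \<ge> 8\<close> the exponent
is at least \<open>k + ln n\<close>, and \<open>exp k\<close> dominates the factor \<open>sqrt 2 ^ k\<close>.\<close>
lemma center_truncation:
  fixes i j :: nat
  assumes C1: "C1 \<ge> 8" and n: "n \<ge> 1" and I: "finite I" "card I = k" "i \<in> I" and J: "finite J" "card J = k" "j \<in> J"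
  defines "R \<equiv> K * sqrt (C1 * (real k + ln (real n)))"
  defines "z' \<equiv> \<lambda>x. chi_vec R I (padded x) i * chi_vec R J (padded x) j"
  shows "((\<integral>x. z' x \<partial>P) - (\<integral>x. padded x i * padded x j \<partial>P))\<^sup>2 \<le> (64 * K ^ 4 + 4)\<^sup>2 / real n"
    "(\<integral>\<^sup>+x. ennreal ((z' x)\<^sup>2) \<partial>P) \<le> ennreal (64 * K ^ 4)" "z' \<in> borel_measurable P"
proof -
  have k: "k \<ge> 1" using I by (metis One_nat_def Suc_leI card_gt_0_iff empty_iff)
  have ln0: "ln (real n) \<ge> 0" using n by simp
  have R: "R > 0" unfolding R_def using K C1 k ln0 by (intro mult_pos_pos real_sqrt_gt_zero add_pos_nonneg) auto
  have R2: "R\<^sup>2 = K\<^sup>2 * (C1 * (real k + ln (real n)))" unfolding R_def using C1 k ln0 by (simp add: power_mult_distrib)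
  define E where "E S = {x\<in>space P. (\<Sum>i\<in>S. (padded x i)\<^sup>2) \<ge> R\<^sup>2}" for S
  have Em: "E S \<in> events" for S unfolding E_def by measurable
  have Ep: "prob (E S) \<le> 2 / real n" if "finite S" "card S = k" for S
  proof -
    have "prob (E S) \<le> 2 * sqrt 2 ^ card S * exp (- R\<^sup>2 / (8 * K\<^sup>2))" unfolding E_def using that by (intro norm_tail) auto
    also have "- R\<^sup>2 / (8 * K\<^sup>2) = - (C1 / 8 * (real k + ln (real n)))" unfolding R2 using K by (simp add: field_simps)
    also have "2 * sqrt 2 ^ card S * exp (- (C1 / 8 * (real k + ln (real n)))) \<le> 2 * exp (real k) * exp (- (1 * (real k + ln (real n))))"
    proof (rule mult_mono)
      have "sqrt 2 \<le> exp (1::real)" using exp_ge_add_one_self[of 1] sqrt2_less_2 by linarith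
      hence "sqrt 2 ^ k \<le> exp 1 ^ k" by (intro power_mono) auto
      thus "2 * sqrt 2 ^ card S \<le> 2 * exp (real k)" using that by (simp add: exp_of_nat_mult[symmetric])
      have "1 * (real k + ln (real n)) \<le> C1 / 8 * (real k + ln (real n))" using C1 ln0 by (intro mult_right_mono) auto
      thus "exp (- (C1 / 8 * (real k + ln (real n)))) \<le> exp (- (1 * (real k + ln (real n))))" by simp
    qed auto
    also have "\<dots> = 2 * exp (- ln (real n))" by (simp add: mult.assoc exp_add[symmetric])
    also have "\<dots> = 2 / real n" using n by (simp add: exp_minus field_simps)
    finally show ?thesis .
  qed
  have fac: "0 \<le> min 1 (R / L2_set y S) \<and> min 1 (R / L2_set y S) \<le> 1" for y S
    using R by (auto simp: L2_set_nonneg)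
  define c where "c x = min 1 (R / L2_set (padded x) I) * min 1 (R / L2_set (padded x) J)" for x
  have c: "0 \<le> c x" "c x \<le> 1" for x
  proof -
    note f = fac[of "padded x" I] fac[of "padded x" J]
    show "0 \<le> c x" unfolding c_def using f by (intro mult_nonneg_nonneg) blast+
    show "c x \<le> 1" unfolding c_def using f by (intro mult_le_one) blast+
  qed
  have z'c: "z' x = c x * (padded x i * padded x j)" for x by (simp add: z'_def c_def chi_vec_def mult_ac)
  \<comment> \<open>If the norm is zero the quotient is \<open>R / 0 = 0\<close>, but then the coordinate vanishes.\<close>
  have one: "min 1 (R / L2_set (padded x) S) = 1 \<or> padded x s = 0"
    if "x \<in> space P" "x \<notin> E S" "finite S" "s \<in> S" for x S s
  proof (cases "L2_set (padded x) S = 0")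
    case True thus ?thesis using that by (simp add: L2_set_eq_0_iff)
  next
    case False
    hence "L2_set (padded x) S > 0" using L2_set_nonneg[of "padded x" S] by linarith
    moreover have "L2_set (padded x) S \<le> R" unfolding L2_set_def using that R by (auto simp: E_def intro!: real_le_lsqrt)
    ultimately show ?thesis by (simp add: min_def field_simps)
  qed
  have m: "z' \<in> borel_measurable P" unfolding z'_def chi_vec_def L2_set_def by measurable
  show "z' \<in> borel_measurable P" by (rule m)
  show "((\<integral>x. z' x \<partial>P) - (\<integral>x. padded x i * padded x j \<partial>P))\<^sup>2 \<le> (64 * K ^ 4 + 4)\<^sup>2 / real n"
  proof (rule truncation_bias[where E="E I \<union> E J" and B="R * R"])
    have "prob (E I \<union> E J) \<le> prob (E I) + prob (E J)" by (intro measure_Un_le Em)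
    also have "\<dots> \<le> 2 / real n + 2 / real n" by (intro add_mono Ep I J)
    finally show "prob (E I \<union> E J) \<le> 4 / real n" by simp
    fix x assume x: "x \<in> space P"
    show "\<bar>padded x i * padded x j - z' x\<bar> \<le> \<bar>padded x i * padded x j\<bar>"
    proof -
      have "\<bar>padded x i * padded x j - z' x\<bar> = \<bar>(1 - c x) * (padded x i * padded x j)\<bar>" by (simp add: z'c algebra_simps)
      also have "\<dots> = (1 - c x) * \<bar>padded x i * padded x j\<bar>" using c[of x] by (simp add: abs_mult)
      also have "\<dots> \<le> 1 * \<bar>padded x i * padded x j\<bar>" using c[of x] by (intro mult_right_mono) auto
      finally show ?thesis by simp
    qed
    show "z' x = padded x i * padded x j" if "x \<notin> E I \<union> E J"
      using one[OF x _ I(1) I(3)] one[OF x _ J(1) J(3)] that unfolding z'c c_def by auto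
    have cb: "\<bar>chi_vec R S (padded x) s\<bar> \<le> R" if "finite S" "s \<in> S" for S s
    proof -
      have "\<bar>chi_vec R S (padded x) s\<bar> = \<bar>padded x s\<bar> * min 1 (R / L2_set (padded x) S)"
        unfolding chi_vec_def abs_mult abs_of_nonneg[OF conjunct1[OF fac]] ..
      also have "\<dots> \<le> L2_set (padded x) S * min 1 (R / L2_set (padded x) S)"
        using fac member_le_L2_set[OF that, of "\<lambda>s. \<bar>padded x s\<bar>"] by (intro mult_right_mono) (auto simp: L2_set_def)
      also have "\<dots> \<le> L2_set (padded x) S * (R / L2_set (padded x) S)" by (intro mult_left_mono) (auto simp: L2_set_nonneg)
      also have "\<dots> \<le> R" using R by simp
      finally show ?thesis .
    qed
    show "\<bar>z' x\<bar> \<le> R * R" unfolding z'_def abs_mult using cb I J R by (intro mult_mono) auto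
  qed (use m Em padded_product_moment n K in auto)
  have "(\<integral>\<^sup>+x. ennreal ((z' x)\<^sup>2) \<partial>P) \<le> (\<integral>\<^sup>+x. ennreal ((padded x i * padded x j)\<^sup>2) \<partial>P)"
  proof (intro nn_integral_mono ennreal_leI)
    fix x
    have "(c x)\<^sup>2 \<le> 1" using c[of x] by (simp add: power_le_one)
    hence "(c x)\<^sup>2 * (padded x i * padded x j)\<^sup>2 \<le> 1 * (padded x i * padded x j)\<^sup>2" by (intro mult_right_mono) auto
    thus "(z' x)\<^sup>2 \<le> (padded x i * padded x j)\<^sup>2" unfolding z'c by (simp add: power_mult_distrib)
  qed
  also note padded_product_moment
  finally show "(\<integral>\<^sup>+x. ennreal ((z' x)\<^sup>2) \<partial>P) \<le> ennreal (64 * K ^ 4)" .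
qed

text \<open>A product exceeds \<open>L\<close> only if one of its factors exceeds \<open>sqrt L\<close>, which for \<open>C \<ge> 4\<close> has probability at most
\<open>2 / n\<close> for each of them.\<close>
lemma outer_truncation:
  fixes i j :: nat
  assumes C: "C \<ge> 4" and n: "n \<ge> 2"
  defines "L \<equiv> C * K\<^sup>2 * ln (real n)"
  defines "z' \<equiv> \<lambda>x. chi L (padded x i * padded x j)"
  shows "((\<integral>x. z' x \<partial>P) - (\<integral>x. padded x i * padded x j \<partial>P))\<^sup>2 \<le> (64 * K ^ 4 + 4)\<^sup>2 / real n" "z' \<in> borel_measurable P"
proof -
  have ln0: "ln (real n) > 0" using n by simp
  have L: "L > 0" unfolding L_def using C K ln0 by simp
  define E where "E s = {x\<in>space P. (padded x s)\<^sup>2 \<ge> L}" for s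
  have Em: "E s \<in> events" for s unfolding E_def by measurable
  have Ep: "prob (E s) \<le> 2 / real n" for s
  proof -
    have "prob (E s) \<le> 2 * exp (- L / (4 * K\<^sup>2))" unfolding E_def using L by (intro coord_tail) auto
    also have "- L / (4 * K\<^sup>2) = - (C / 4 * ln (real n))" unfolding L_def using K by (simp add: field_simps)
    also have "\<dots> \<le> - (1 * ln (real n))" using C ln0 by (intro le_imp_neg_le mult_right_mono) auto
    finally show ?thesis using n by (simp add: exp_minus field_simps)
  qed
  show m: "z' \<in> borel_measurable P" unfolding z'_def chi_def by measurable
  define c where "c y = min 1 (L / \<bar>y\<bar>)" for y
  have c: "0 \<le> c y" "c y \<le> 1" for y unfolding c_def using L by auto
  have z'c: "z' x = c (padded x i * padded x j) * (padded x i * padded x j)" for x by (simp add: z'_def c_def chi_def mult_ac)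
  show "((\<integral>x. z' x \<partial>P) - (\<integral>x. padded x i * padded x j \<partial>P))\<^sup>2 \<le> (64 * K ^ 4 + 4)\<^sup>2 / real n"
  proof (rule truncation_bias[where E="E i \<union> E j" and B="L"])
    have "prob (E i \<union> E j) \<le> prob (E i) + prob (E j)" by (intro measure_Un_le Em)
    also have "\<dots> \<le> 2 / real n + 2 / real n" by (intro add_mono Ep)
    finally show "prob (E i \<union> E j) \<le> 4 / real n" by simp
    fix x assume x: "x \<in> space P"
    define y where "y = padded x i * padded x j"
    show "\<bar>padded x i * padded x j - z' x\<bar> \<le> \<bar>padded x i * padded x j\<bar>"
    proof -
      have "\<bar>y - c y * y\<bar> = \<bar>(1 - c y) * y\<bar>" by (simp add: algebra_simps)
      also have "\<dots> = (1 - c y) * \<bar>y\<bar>" using c[of y] by (simp add: abs_mult)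
      also have "\<dots> \<le> 1 * \<bar>y\<bar>" using c[of y] by (intro mult_right_mono) auto
      finally show ?thesis by (simp add: z'c y_def)
    qed
    show "z' x = padded x i * padded x j" if "x \<notin> E i \<union> E j"
    proof -
      have "(padded x i)\<^sup>2 \<le> L" "(padded x j)\<^sup>2 \<le> L" using that x by (auto simp: E_def)
      moreover have "0 \<le> (\<bar>padded x i\<bar> - \<bar>padded x j\<bar>)\<^sup>2" by simp
      hence "2 * \<bar>y\<bar> \<le> (padded x i)\<^sup>2 + (padded x j)\<^sup>2" by (simp add: y_def abs_mult power2_eq_square algebra_simps)
      ultimately have "\<bar>y\<bar> \<le> L" by linarith
      hence "c y = 1 \<or> y = 0" unfolding c_def by (auto simp: min_def field_simps)
      thus ?thesis unfolding z'c y_def[symmetric] by auto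
    qed
    show "\<bar>z' x\<bar> \<le> L"
    proof -
      have "\<bar>c y * y\<bar> = c y * \<bar>y\<bar>" using c[of y] by (simp add: abs_mult)
      also have "\<dots> \<le> L / \<bar>y\<bar> * \<bar>y\<bar>" unfolding c_def by (intro mult_right_mono) auto
      also have "\<dots> \<le> L" using L by simp
      finally show ?thesis by (simp add: z'c y_def)
    qed
  qed (use m Em padded_product_moment n K in auto)
qed

end

section \<open>Means of i.i.d. observations\<close>

locale iid = prob_space P for P :: "'b measure" +
  fixes n :: nat
  assumes n: "n \<ge> 1"
begin

abbreviation "PP \<equiv> (\<Pi>\<^sub>M i\<in>{1..n}. P)"

lemma prob_PP: "prob_space PP" by (intro prob_space_PiM prob_space_axioms)

lemma comp_measurable: "m \<in> {1..n} \<Longrightarrow> f \<in> borel_measurable P \<Longrightarrow> (\<lambda>X. f (X m)) \<in> borel_measurable PP"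
  by (rule measurable_compose[OF measurable_component_singleton])

lemma distr_comp: "m \<in> {1..n} \<Longrightarrow> distr PP P (\<lambda>X. X m) = P"
  by (rule distr_PiM_component) (auto intro: prob_space_axioms)

lemma indep_coords:
  assumes f: "f \<in> borel_measurable P"
  shows "prob_space.indep_vars PP (\<lambda>_. borel) (\<lambda>m X. f (X m)) {1..n}"
proof -
  interpret Q: prob_space PP by (rule prob_PP)
  have "Q.indep_vars (\<lambda>_. P) (\<lambda>m X. X m) {1..n}"
  proof (subst Q.indep_vars_iff_distr_eq_PiM')
    have "distr PP PP (\<lambda>x. \<lambda>i\<in>{1..n}. x i) = distr PP PP (\<lambda>x. x)"
      by (rule distr_cong) (auto simp: space_PiM PiE_iff extensional_restrict)
    also have "\<dots> = PP" by (rule distr_id2) simp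
    also have "\<dots> = (\<Pi>\<^sub>M i\<in>{1..n}. distr PP P (\<lambda>X. X i))"
      by (rule PiM_cong[OF refl]) (rule distr_comp[symmetric])
    finally show "distr PP PP (\<lambda>x. \<lambda>i\<in>{1..n}. x i) = (\<Pi>\<^sub>M i\<in>{1..n}. distr PP P (\<lambda>X. X i))" .
  qed (use n in auto)
  from Q.indep_vars_compose[OF this, of "\<lambda>_. f" "\<lambda>_. borel"] f show ?thesis by (simp add: comp_def)
qed

lemma integral_comp:
  fixes f :: "'b \<Rightarrow> real"
  assumes "m \<in> {1..n}" "f \<in> borel_measurable P"
  shows "(\<integral>X. f (X m) \<partial>PP) = (\<integral>x. f x \<partial>P)" "integrable P f \<Longrightarrow> integrable PP (\<lambda>X. f (X m))"
proof -
  have m: "(\<lambda>X. X m) \<in> PP \<rightarrow>\<^sub>M P" using assms(1) by (rule measurable_component_singleton)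
  show "(\<integral>X. f (X m) \<partial>PP) = (\<integral>x. f x \<partial>P)"
    using integral_distr[OF m assms(2)] distr_comp[OF assms(1)] by simp
  show "integrable P f \<Longrightarrow> integrable PP (\<lambda>X. f (X m))"
    using integrable_distr_eq[OF m assms(2)] distr_comp[OF assms(1)] by simp
qed

text \<open>Bias and variance of the empirical mean as an estimator of \<open>c\<close>; the covariances of distinct observations vanish.\<close>
lemma mean_sq_dev:
  fixes f :: "'b \<Rightarrow> real"
  assumes f[measurable]: "f \<in> borel_measurable P" and v: "(\<integral>\<^sup>+x. ennreal ((f x)\<^sup>2) \<partial>P) \<le> ennreal v" and v0: "v \<ge> 0"
  shows "(\<integral>\<^sup>+X. ennreal (((1 / real n) * (\<Sum>m=1..n. f (X m)) - c)\<^sup>2) \<partial>PP) \<le> ennreal (v / real n + ((\<integral>x. f x \<partial>P) - c)\<^sup>2)"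
proof -
  interpret Q: prob_space PP by (rule prob_PP)
  have isq: "integrable P (\<lambda>x. (f x)\<^sup>2)"
    by (rule integrableI_bounded) (use v in \<open>auto simp: order_le_less_trans[OF v ennreal_less_top]\<close>)
  have i1: "integrable P f" by (rule square_integrable_imp_integrable[OF _ isq]) measurable
  define \<mu> where "\<mu> = (\<integral>x. f x \<partial>P)"
  define g where "g x = f x - \<mu>" for x
  have gm[measurable]: "g \<in> borel_measurable P" unfolding g_def by measurable
  have ig: "integrable P g" unfolding g_def using i1 by simp
  have ig0: "(\<integral>x. g x \<partial>P) = 0" unfolding g_def using i1 by (simp add: \<mu>_def prob_space)
  have gsq: "(g x)\<^sup>2 = (f x)\<^sup>2 - 2 * \<mu> * f x + \<mu>\<^sup>2" for x by (simp add: g_def power2_eq_square algebra_simps)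
  have igs: "integrable P (\<lambda>x. (g x)\<^sup>2)" unfolding gsq using isq i1 by simp
  have "(\<integral>x. (g x)\<^sup>2 \<partial>P) = (\<integral>x. (f x)\<^sup>2 \<partial>P) - \<mu>\<^sup>2"
    unfolding gsq using isq i1 by (simp add: prob_space \<mu>_def[symmetric] power2_eq_square)
  also have "\<dots> \<le> v" using v v0 nn_integral_eq_integral[OF isq] by (simp add: add_increasing2 add.commute)
      (smt (verit) ennreal_le_iff zero_le_power2)
  finally have gv: "(\<integral>x. (g x)\<^sup>2 \<partial>P) \<le> v" .
  have cross: "has_bochner_integral PP (\<lambda>X. g (X m) * g (X m')) (if m = m' then (\<integral>x. (g x)\<^sup>2 \<partial>P) else 0)"
    if mm: "m \<in> {1..n}" "m' \<in> {1..n}" for m m'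
  proof (cases "m = m'")
    case True
    thus ?thesis using integral_comp[OF mm(1), of "\<lambda>x. (g x)\<^sup>2"] igs
      by (simp add: has_bochner_integral_iff power2_eq_square)
  next
    case False
    have iv: "Q.indep_vars (\<lambda>_. borel) (\<lambda>m X. g (X m)) {1..n}" by (rule indep_coords[OF gm])
    have iv2: "Q.indep_vars (\<lambda>_. borel) (\<lambda>m X. g (X m)) {m, m'}"
      by (rule Q.indep_vars_subset[OF iv]) (use mm in auto)
    have ii: "integrable PP (\<lambda>X. g (X i))" if "i \<in> {m, m'}" for i
      using integral_comp(2)[OF _ gm ig, of i] mm that by auto
    from Q.indep_vars_lebesgue_integral[OF _ iv2 ii] Q.indep_vars_integrable[OF _ iv2 ii]
      integral_comp(1)[OF mm(1) gm] integral_comp(1)[OF mm(2) gm] ig0 False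
    show ?thesis by (simp add: has_bochner_integral_iff)
  qed
  have lin: "has_bochner_integral PP (\<lambda>X. g (X m)) 0" if "m \<in> {1..n}" for m
    using integral_comp[OF that gm] ig ig0 by (simp add: has_bochner_integral_iff)
  define b where "b = \<mu> - c"
  have nn: "real n > 0" using n by simp
  have hb: "has_bochner_integral PP (\<lambda>X. (1 / (real n)\<^sup>2) * (\<Sum>m=1..n. \<Sum>m'=1..n. g (X m) * g (X m')) + (2 * b / real n) * (\<Sum>m=1..n. g (X m)) + b\<^sup>2)
     ((1 / (real n)\<^sup>2) * (\<Sum>m=1..n. \<Sum>m'=1..n. if m = m' then (\<integral>x. (g x)\<^sup>2 \<partial>P) else 0) + (2 * b / real n) * (\<Sum>m=1..n. 0) + b\<^sup>2)"
  proof (intro has_bochner_integral_add has_bochner_integral_mult_right has_bochner_integral_sum cross lin)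
    show "has_bochner_integral PP (\<lambda>x. b\<^sup>2) (b\<^sup>2)" using Q.prob_space Q.integrable_const[of "b\<^sup>2"] by (simp add: has_bochner_integral_iff)
  qed auto
  have eq: "(1 / (real n)\<^sup>2) * (\<Sum>m=1..n. \<Sum>m'=1..n. g (X m) * g (X m')) + (2 * b / real n) * (\<Sum>m=1..n. g (X m)) + b\<^sup>2
      = ((1 / real n) * (\<Sum>m=1..n. f (X m)) - c)\<^sup>2" for X
  proof -
    have "(\<Sum>m=1..n. f (X m)) = (\<Sum>m=1..n. g (X m)) + real n * \<mu>" by (simp add: g_def sum_subtractf)
    hence "(1 / real n) * (\<Sum>m=1..n. f (X m)) - c = (\<Sum>m=1..n. g (X m)) / real n + b" using nn by (simp add: b_def field_simps)
    moreover have "(\<Sum>m=1..n. \<Sum>m'=1..n. g (X m) * g (X m')) = (\<Sum>m=1..n. g (X m))\<^sup>2" by (simp add: power2_eq_square sum_product)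
    ultimately show ?thesis by (simp only: power2_sum power_divide) (simp add: algebra_simps)
  qed
  have val: "(1 / (real n)\<^sup>2) * (\<Sum>m=1..n. \<Sum>m'=1..n. if m = m' then (\<integral>x. (g x)\<^sup>2 \<partial>P) else 0) + (2 * b / real n) * (\<Sum>m=1..n. 0) + b\<^sup>2 = (\<integral>x. (g x)\<^sup>2 \<partial>P) / real n + b\<^sup>2"
    using nn by (simp add: power2_eq_square)
  have "(\<integral>\<^sup>+X. ennreal (((1 / real n) * (\<Sum>m=1..n. f (X m)) - c)\<^sup>2) \<partial>PP) = ennreal ((\<integral>x. (g x)\<^sup>2 \<partial>P) / real n + b\<^sup>2)"
    using hb unfolding eq val by (simp add: has_bochner_integral_iff nn_integral_eq_integral)
  also have "\<dots> \<le> ennreal (v / real n + b\<^sup>2)" using gv nn by (intro ennreal_leI add_mono divide_right_mono) auto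
  finally show ?thesis by (simp add: b_def \<mu>_def)
qed

lemma hoeffding_mean:
  fixes f :: "'b \<Rightarrow> real"
  assumes f[measurable]: "f \<in> borel_measurable P" and L: "L > 0" "\<And>x. x \<in> space P \<Longrightarrow> \<bar>f x\<bar> \<le> L" and t: "t \<ge> 0"
  shows "measure PP {X\<in>space PP. \<bar>(1 / real n) * (\<Sum>m=1..n. f (X m)) - (\<integral>x. f x \<partial>P)\<bar> \<ge> t} \<le> 2 * exp (- real n * t\<^sup>2 / (2 * L\<^sup>2))"
proof -
  interpret Q: prob_space PP by (rule prob_PP)
  have nn: "real n > 0" using n by simp
  interpret H: Hoeffding_ineq PP "{1..n}" "\<lambda>m X. f (X m)" "\<lambda>_. - L" "\<lambda>_. L" "real n * (\<integral>x. f x \<partial>P)"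
  proof unfold_locales
    show "Q.indep_vars (\<lambda>_. borel) (\<lambda>m X. f (X m)) {1..n}" by (rule indep_coords[OF f])
    show "AE x in PP. f (x i) \<in> {- L..L}" if "i \<in> {1..n}" for i
      using L(2) that by (intro AE_I2) (fastforce simp: space_PiM PiE_iff abs_le_iff)
    show "real n * (\<integral>x. f x \<partial>P) \<equiv> (\<Sum>i=1..n. Q.expectation (\<lambda>X. f (X i)))"
      
    proof (rule eq_reflection)
      have "(\<Sum>i=1..n. Q.expectation (\<lambda>X. f (X i))) = (\<Sum>i=1..n. (\<integral>x. f x \<partial>P))"
        by (intro sum.cong refl integral_comp(1) f)
      thus "real n * (\<integral>x. f x \<partial>P) = (\<Sum>i=1..n. Q.expectation (\<lambda>X. f (X i)))" by simp
    qed
  qed auto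
  have "measure PP {X\<in>space PP. \<bar>(\<Sum>m=1..n. f (X m)) - real n * (\<integral>x. f x \<partial>P)\<bar> \<ge> real n * t}
     \<le> 2 * exp (- 2 * (real n * t)\<^sup>2 / (\<Sum>i=1..n. (L - - L)\<^sup>2))"
    by (rule H.Hoeffding_ineq_abs_ge) (use nn L t in auto)
  also have "- 2 * (real n * t)\<^sup>2 / (\<Sum>i=1..n. (L - - L)\<^sup>2) = - real n * t\<^sup>2 / (2 * L\<^sup>2)"
    using nn L by (simp add: power2_eq_square field_simps)
  also have "{X\<in>space PP. \<bar>(\<Sum>m=1..n. f (X m)) - real n * (\<integral>x. f x \<partial>P)\<bar> \<ge> real n * t}
      = {X\<in>space PP. \<bar>(1 / real n) * (\<Sum>m=1..n. f (X m)) - (\<integral>x. f x \<partial>P)\<bar> \<ge> t}"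
  proof (intro Collect_cong conj_cong refl)
    fix X
    have "(1 / real n) * (\<Sum>m=1..n. f (X m)) - (\<integral>x. f x \<partial>P) = ((\<Sum>m=1..n. f (X m)) - real n * (\<integral>x. f x \<partial>P)) / real n"
      using nn by (simp add: field_simps)
    thus "(real n * t \<le> \<bar>(\<Sum>m=1..n. f (X m)) - real n * (\<integral>x. f x \<partial>P)\<bar>) = (t \<le> \<bar>(1 / real n) * (\<Sum>m=1..n. f (X m)) - (\<integral>x. f x \<partial>P)\<bar>)"
      using nn by (simp add: pos_le_divide_eq mult.commute)
  qed
  finally show ?thesis by simp
qed

text \<open>Outside the Hoeffding failure events all squared deviations are at most \<open>t\<^sup>2\<close>, and on them at most \<open>4 * L\<^sup>2\<close>,
as the variables are bounded by \<open>L\<close>. The level \<open>t\<close> makes each failure have probability at most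
\<open>1 / (card B * n)\<close>. The single function \<open>Q\<close> bounds all deviations, so that the analysis of a release for
fixed data can be integrated over the data.\<close>
lemma uniform_deviation:
  fixes f :: "'c \<Rightarrow> 'b \<Rightarrow> real"
  assumes B: "finite B" "card B \<ge> 1" and f[measurable]: "\<And>b. b \<in> B \<Longrightarrow> f b \<in> borel_measurable P" and L: "L > 0" "\<And>b x. b \<in> B \<Longrightarrow> x \<in> space P \<Longrightarrow> \<bar>f b x\<bar> \<le> L"
  shows "\<exists>Q. Q \<in> borel_measurable PP \<and> (\<forall>X. Q X \<ge> 0) \<and>
     (\<forall>X\<in>space PP. \<forall>b\<in>B. ((1 / real n) * (\<Sum>m=1..n. f b (X m)) - (\<integral>x. f b x \<partial>P))\<^sup>2 \<le> Q X) \<and>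
     (\<integral>\<^sup>+X. ennreal (Q X) \<partial>PP) \<le> ennreal (2 * L\<^sup>2 * (ln (2 * real (card B) * real n) + 2) / real n)"
proof -
  interpret Q: prob_space PP by (rule prob_PP)
  have nn: "real n \<ge> 1" using n by simp
  \<comment> \<open>The Hoeffding bound \<open>2 * exp (- n * t\<^sup>2 / (2 * L\<^sup>2))\<close> equals \<open>1 / (card B * n)\<close> at this \<open>t\<close>.\<close>
  define t where "t = sqrt (2 * L\<^sup>2 * ln (2 * real (card B) * real n) / real n)"
  have arg: "2 * real (card B) * real n \<ge> 1"
  proof -
    have "1 * 1 \<le> (2 * real (card B)) * real n" using B nn by (intro mult_mono) auto
    thus ?thesis by simp
  qed
  have t2: "t\<^sup>2 = 2 * L\<^sup>2 * ln (2 * real (card B) * real n) / real n" "t \<ge> 0"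
    using arg nn L by (auto simp: t_def)
  define dev where "dev b X = (1 / real n) * (\<Sum>m=1..n. f b (X m)) - (\<integral>x. f b x \<partial>P)" for b X
  define E where "E b = {X\<in>space PP. \<bar>dev b X\<bar> \<ge> t}" for b
  have dm: "dev b \<in> borel_measurable PP" if "b \<in> B" for b unfolding dev_def
    by (intro borel_measurable_diff borel_measurable_times borel_measurable_sum comp_measurable f that) (use n in auto)
  have Em: "E b \<in> sets PP" if "b \<in> B" for b using dm[OF that] unfolding E_def by measurable
  have Ep: "measure PP (E b) \<le> 1 / (real (card B) * real n)" if b: "b \<in> B" for b
  proof -
    have "measure PP (E b) \<le> 2 * exp (- real n * t\<^sup>2 / (2 * L\<^sup>2))"
      unfolding E_def dev_def by (rule hoeffding_mean[OF f[OF b] L(1) L(2)[OF b] t2(2)])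
    also have "- real n * t\<^sup>2 / (2 * L\<^sup>2) = - ln (2 * real (card B) * real n)"
      unfolding t2 using L nn by (simp add: field_simps)
    also have "2 * exp (- ln (2 * real (card B) * real n)) = 1 / (real (card B) * real n)"
      using arg by (simp add: exp_minus exp_ln field_simps)
    finally show ?thesis .
  qed
  define Q where "Q X = t\<^sup>2 + (\<Sum>b\<in>B. 4 * L\<^sup>2 * indicator (E b) X)" for X
  have Qm: "Q \<in> borel_measurable PP" unfolding Q_def
    by (intro borel_measurable_add borel_measurable_sum borel_measurable_times borel_measurable_const borel_measurable_indicator Em)
  have Q0: "Q X \<ge> 0" for X unfolding Q_def by (intro add_nonneg_nonneg sum_nonneg) auto
  have Qb: "(dev b X)\<^sup>2 \<le> Q X" if X: "X \<in> space PP" and b: "b \<in> B" for X b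
  proof (cases "X \<in> E b")
    case True
    have Xm: "X m \<in> space P" if "m \<in> {1..n}" for m using X that by (auto simp: space_PiM PiE_iff)
    have "\<bar>(1 / real n) * (\<Sum>m=1..n. f b (X m))\<bar> \<le> (1 / real n) * (\<Sum>m=1..n. L)"
      unfolding abs_mult using L(2)[OF b Xm] nn by (intro mult_mono order_trans[OF sum_abs] sum_mono) auto
    hence 1: "\<bar>(1 / real n) * (\<Sum>m=1..n. f b (X m))\<bar> \<le> L" using nn by simp
    have "integrable P (f b)" by (rule integrable_const_bound[of _ L]) (use L(2)[OF b] f[OF b] in auto)
    hence "\<bar>\<integral>x. f b x \<partial>P\<bar> \<le> (\<integral>x. L \<partial>P)"
      by (intro order_trans[OF integral_abs_bound] integral_mono) (use L(2)[OF b] in auto)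
    hence 2: "\<bar>\<integral>x. f b x \<partial>P\<bar> \<le> L" by (simp add: prob_space)
    have "\<bar>dev b X\<bar> \<le> 2 * L" unfolding dev_def using 1 2 by linarith
    hence "(dev b X)\<^sup>2 \<le> (2 * L)\<^sup>2" by (metis abs_ge_zero power2_abs power_mono)
    also have "\<dots> = 4 * L\<^sup>2 * indicator (E b) X" using True by (simp add: power_mult_distrib)
    also have "\<dots> \<le> (\<Sum>b\<in>B. 4 * L\<^sup>2 * indicator (E b) X)"
      using b B by (intro member_le_sum) auto
    also have "\<dots> \<le> Q X" unfolding Q_def by simp
    finally show ?thesis .
  next
    case False
    hence "\<bar>dev b X\<bar> \<le> t" using X by (simp add: E_def)
    hence "(dev b X)\<^sup>2 \<le> t\<^sup>2" by (metis abs_ge_zero power2_abs power_mono)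
    also have "\<dots> \<le> Q X" unfolding Q_def by (simp add: sum_nonneg)
    finally show ?thesis .
  qed
  have "has_bochner_integral PP Q (t\<^sup>2 + (\<Sum>b\<in>B. 4 * L\<^sup>2 * measure PP (E b)))"
    unfolding Q_def
  proof (intro has_bochner_integral_add has_bochner_integral_sum has_bochner_integral_mult_right)
    show "has_bochner_integral PP (\<lambda>X. t\<^sup>2) (t\<^sup>2)" using Q.prob_space Q.integrable_const[of "t\<^sup>2"] by (simp add: has_bochner_integral_iff)
    show "has_bochner_integral PP (indicator (E b)) (measure PP (E b))" if "b \<in> B" for b
      using Em[OF that] Q.emeasure_finite[of "E b"] by (intro has_bochner_integral_real_indicator) (simp_all add: less_top)
  qed
  hence "(\<integral>\<^sup>+X. ennreal (Q X) \<partial>PP) = ennreal (t\<^sup>2 + (\<Sum>b\<in>B. 4 * L\<^sup>2 * measure PP (E b)))"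
    using Q0 by (simp add: has_bochner_integral_iff nn_integral_eq_integral)
  also have "\<dots> \<le> ennreal (2 * L\<^sup>2 * (ln (2 * real (card B) * real n) + 2) / real n)"
  proof (intro ennreal_leI)
    have "(\<Sum>b\<in>B. 4 * L\<^sup>2 * measure PP (E b)) \<le> (\<Sum>b\<in>B. 4 * L\<^sup>2 * (1 / (real (card B) * real n)))"
      by (intro sum_mono mult_left_mono Ep) auto
    also have "\<dots> = 4 * L\<^sup>2 / real n" using B by (cases "B = {}") simp_all
    finally show "t\<^sup>2 + (\<Sum>b\<in>B. 4 * L\<^sup>2 * measure PP (E b)) \<le> 2 * L\<^sup>2 * (ln (2 * real (card B) * real n) + 2) / real n"
      unfolding t2 using nn by (simp add: field_simps)
  qed
  finally show ?thesis using Qm Q0 Qb unfolding dev_def by blast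
qed

end

section \<open>The entries that a good selection leaves out\<close>

lemma sum_abs_block:
  fixes \<Sigma> :: "nat \<times> nat \<Rightarrow> real"
  assumes "finite J" "card J = k" and col: "\<And>j. j \<in> J \<Longrightarrow> (\<Sum>i\<in>I. \<bar>\<Sigma> (i, j)\<bar>) \<le> a"
  shows "(\<Sum>b\<in>I \<times> J. \<bar>\<Sigma> b\<bar>) \<le> real k * a"
proof -
  have "(\<Sum>b\<in>I \<times> J. \<bar>\<Sigma> b\<bar>) = (\<Sum>i\<in>I. \<Sum>j\<in>J. \<bar>\<Sigma> (i, j)\<bar>)" by (simp add: sum.cartesian_product case_prod_unfold)
  also have "\<dots> = (\<Sum>j\<in>J. \<Sum>i\<in>I. \<bar>\<Sigma> (i, j)\<bar>)" by (rule sum.swap)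
  also have "\<dots> \<le> (\<Sum>j\<in>J. a)" by (intro sum_mono col)
  finally show ?thesis using assms by simp
qed

lemma sum_sq_block:
  fixes \<Sigma> :: "nat \<times> nat \<Rightarrow> real"
  assumes "finite I" "finite J" "card J = k" and col: "\<And>j. j \<in> J \<Longrightarrow> (\<Sum>i\<in>I. \<bar>\<Sigma> (i, j)\<bar>) \<le> a"
  shows "(\<Sum>b\<in>I \<times> J. (\<Sigma> b)\<^sup>2) \<le> real k * a\<^sup>2"
proof -
  have "(\<Sum>b\<in>I \<times> J. (\<Sigma> b)\<^sup>2) = (\<Sum>i\<in>I. \<Sum>j\<in>J. (\<Sigma> (i, j))\<^sup>2)" by (simp add: sum.cartesian_product case_prod_unfold)
  also have "\<dots> = (\<Sum>j\<in>J. \<Sum>i\<in>I. (\<Sigma> (i, j))\<^sup>2)" by (rule sum.swap)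
  also have "\<dots> \<le> (\<Sum>j\<in>J. a\<^sup>2)"
  proof (rule sum_mono)
    fix j assume j: "j \<in> J"
    have "(\<Sum>i\<in>I. (\<Sigma> (i, j))\<^sup>2) = (\<Sum>i\<in>I. \<bar>\<Sigma> (i, j)\<bar> * \<bar>\<Sigma> (i, j)\<bar>)" by (simp add: power2_eq_square)
    also have "\<dots> \<le> (\<Sum>i\<in>I. \<bar>\<Sigma> (i, j)\<bar> * (\<Sum>i\<in>I. \<bar>\<Sigma> (i, j)\<bar>))"
      using assms(1) by (intro sum_mono mult_left_mono member_le_sum) auto
    also have "\<dots> = (\<Sum>i\<in>I. \<bar>\<Sigma> (i, j)\<bar>)\<^sup>2" by (simp add: sum_distrib_right power2_eq_square)
    also have "\<dots> \<le> a\<^sup>2" using col[OF j] by (intro power_mono sum_nonneg) auto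
    finally show "(\<Sum>i\<in>I. (\<Sigma> (i, j))\<^sup>2) \<le> a\<^sup>2" .
  qed
  finally show ?thesis using assms by simp
qed

text \<open>The \<open>k * r\<close> selected entries have absolute sum at most \<open>k * a\<close>, so one of them is at most \<open>a / r\<close>. As the
selected entries nearly dominate the others, every entry left out is at most \<open>a / r + e\<close>
with \<open>e = 2 * \<eta> + \<tau>\<close>. If at most half of the block is selected, the sum of squares is bounded by the
maximum times the sum, and \<open>1 / r\<close> is at most \<open>2 * (1 / r - 1 / k)\<close>. Otherwise only
\<open>k * (k - r)\<close> entries remain, and each square is bounded by the maximum; this count produces
the factor \<open>1 / r - 1 / k\<close>.\<close>
lemma unselected_energy:
  fixes \<Sigma> A :: "nat \<times> nat \<Rightarrow> real" and k r :: nat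
  assumes I: "finite I" "card I = k" and J: "finite J" "card J = k" and r: "1 \<le> r" "r \<le> k"
    and S: "S \<subseteq> I \<times> J" "card S = k * r" and a: "a \<ge> 0"
    and col: "\<And>j. j \<in> J \<Longrightarrow> (\<Sum>i\<in>I. \<bar>\<Sigma> (i, j)\<bar>) \<le> a"
    and dev: "\<And>b. b \<in> I \<times> J \<Longrightarrow> \<bar>A b - \<Sigma> b\<bar> \<le> \<eta>" and \<tau>: "\<tau> \<ge> 0"
    and good: "\<And>c b. c \<in> S \<Longrightarrow> b \<in> I \<times> J - S \<Longrightarrow> \<bar>A b\<bar> \<le> \<bar>A c\<bar> + \<tau>"
  shows "(\<Sum>b\<in>I \<times> J - S. (\<Sigma> b)\<^sup>2) \<le> 4 * real k * (1 / real r - 1 / real k) * a\<^sup>2 + 2 * real k * real r * (2 * \<eta> + \<tau>)\<^sup>2"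
proof -
  define e where "e = 2 * \<eta> + \<tau>"
  have rr: "real r > 0" "real k > 0" "real r \<le> real k" using r by auto
  have finB: "finite (I \<times> J)" using I J by simp
  have finS: "finite S" using S finB finite_subset by blast
  have tot: "(\<Sum>b\<in>I \<times> J. \<bar>\<Sigma> b\<bar>) \<le> real k * a" by (rule sum_abs_block[OF J col])
  have pt: "\<bar>\<Sigma> b\<bar> \<le> a / real r + e" if b: "b \<in> I \<times> J - S" for b
  proof -
    have "\<exists>c\<in>S. \<bar>\<Sigma> c\<bar> \<le> a / real r"
    proof (rule ccontr)
      assume "\<not> ?thesis"
      hence lt: "\<And>c. c \<in> S \<Longrightarrow> a / real r < \<bar>\<Sigma> c\<bar>" by force
      have "S \<noteq> {}" using S r by auto
      hence "(\<Sum>c\<in>S. a / real r) < (\<Sum>c\<in>S. \<bar>\<Sigma> c\<bar>)" using finS lt by (intro sum_strict_mono) auto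
      also have "\<dots> \<le> (\<Sum>b\<in>I \<times> J. \<bar>\<Sigma> b\<bar>)" using S finB by (intro sum_mono2) auto
      also note tot
      finally show False using S rr by simp
    qed
    then obtain c where c: "c \<in> S" "\<bar>\<Sigma> c\<bar> \<le> a / real r" by blast
    have "\<bar>A b - \<Sigma> b\<bar> \<le> \<eta>" "\<bar>A c - \<Sigma> c\<bar> \<le> \<eta>" using dev b c S by auto
    thus ?thesis using good[OF c(1) b] c(2) unfolding e_def by linarith
  qed
  have e0: "e \<ge> 0"
  proof -
    obtain b where "b \<in> I \<times> J" using I J r by (metis card.empty card_cartesian_product equals0I mult_is_0 not_one_le_zero order_trans)
    from dev[OF this] \<tau> show ?thesis unfolding e_def by linarith
  qed
  show ?thesis unfolding e_def[symmetric]
  proof (cases "2 * real r \<le> real k")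
    case True
    have "(\<Sum>b\<in>I \<times> J - S. (\<Sigma> b)\<^sup>2) = (\<Sum>b\<in>I \<times> J - S. \<bar>\<Sigma> b\<bar> * \<bar>\<Sigma> b\<bar>)" by (simp add: power2_eq_square)
    also have "\<dots> \<le> (\<Sum>b\<in>I \<times> J - S. (a / real r + e) * \<bar>\<Sigma> b\<bar>)"
      by (intro sum_mono mult_right_mono pt) auto
    also have "\<dots> = (a / real r + e) * (\<Sum>b\<in>I \<times> J - S. \<bar>\<Sigma> b\<bar>)" by (simp add: sum_distrib_left)
    also have "\<dots> \<le> (a / real r + e) * (\<Sum>b\<in>I \<times> J. \<bar>\<Sigma> b\<bar>)"
      using finB a rr e0 by (intro mult_left_mono sum_mono2) auto
    also have "\<dots> \<le> (a / real r + e) * (real k * a)" using tot a rr e0 by (intro mult_left_mono) auto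
    also have "\<dots> \<le> real k * (3 / 2 * a\<^sup>2 / real r + real r * e\<^sup>2 / 2)"
    proof -
      have "0 \<le> (a - real r * e)\<^sup>2" by simp
      hence "2 * real r * (a * e) \<le> a\<^sup>2 + (real r)\<^sup>2 * e\<^sup>2" by (simp add: power2_eq_square algebra_simps)
      hence "a * e \<le> a\<^sup>2 / (2 * real r) + real r * e\<^sup>2 / 2" using rr by (simp add: field_simps power2_eq_square)
      hence "a\<^sup>2 / real r + a * e \<le> 3 / 2 * a\<^sup>2 / real r + real r * e\<^sup>2 / 2" by (simp add: field_simps)
      hence "real k * (a\<^sup>2 / real r + a * e) \<le> real k * (3 / 2 * a\<^sup>2 / real r + real r * e\<^sup>2 / 2)" by (rule mult_left_mono) simp
      thus ?thesis by (simp add: power2_eq_square algebra_simps)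
    qed
    also have "\<dots> \<le> real k * (4 * (1 / real r - 1 / real k) * a\<^sup>2 + 2 * real r * e\<^sup>2)"
    proof (intro mult_left_mono add_mono)
      have "1 / real k \<le> 1 / (2 * real r)" using True rr by (intro divide_left_mono) auto
      hence "2 / real r \<le> 4 * (1 / real r - 1 / real k)" by (simp add: field_simps)
      hence "2 / real r * a\<^sup>2 \<le> 4 * (1 / real r - 1 / real k) * a\<^sup>2" by (rule mult_right_mono) simp
      moreover have "3 / 2 * a\<^sup>2 / real r \<le> 2 / real r * a\<^sup>2" using rr by (simp add: field_simps)
      ultimately show "3 / 2 * a\<^sup>2 / real r \<le> 4 * (1 / real r - 1 / real k) * a\<^sup>2" by linarith
      have "0 \<le> real r * e\<^sup>2" using rr by simp
      thus "real r * e\<^sup>2 / 2 \<le> 2 * real r * e\<^sup>2" by simp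
    qed simp
    finally show "(\<Sum>b\<in>I \<times> J - S. (\<Sigma> b)\<^sup>2) \<le> 4 * real k * (1 / real r - 1 / real k) * a\<^sup>2 + 2 * real k * real r * e\<^sup>2"
      by (simp add: distrib_left mult_ac)
  next
    case False
    have "card (I \<times> J - S) = k * k - k * r" using I J S finS by (simp add: card_Diff_subset card_cartesian_product)
    hence card: "real (card (I \<times> J - S)) = real k * (real k - real r)" using r by (simp add: of_nat_diff right_diff_distrib)
    have "(\<Sum>b\<in>I \<times> J - S. (\<Sigma> b)\<^sup>2) \<le> (\<Sum>b\<in>I \<times> J - S. 2 * a\<^sup>2 / (real r)\<^sup>2 + 2 * e\<^sup>2)"
    proof (rule sum_mono)
      fix b assume b: "b \<in> I \<times> J - S"
      have "(\<Sigma> b)\<^sup>2 = \<bar>\<Sigma> b\<bar>\<^sup>2" by simp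
      also have "\<dots> \<le> (a / real r + e)\<^sup>2" by (intro power_mono pt b) auto
      also have "\<dots> \<le> 2 * (a / real r)\<^sup>2 + 2 * e\<^sup>2"
        using sum_squares_bound[of "a / real r" e] by (simp add: power2_sum)
      finally show "(\<Sigma> b)\<^sup>2 \<le> 2 * a\<^sup>2 / (real r)\<^sup>2 + 2 * e\<^sup>2" by (simp add: power_divide)
    qed
    also have "\<dots> = real k * (real k - real r) * (2 * a\<^sup>2 / (real r)\<^sup>2) + real k * ((real k - real r) * (2 * e\<^sup>2))"
      by (simp add: card algebra_simps)
    also have "\<dots> \<le> 4 * real k * (1 / real r - 1 / real k) * a\<^sup>2 + real k * (real r * (2 * e\<^sup>2))"
    proof (intro add_mono mult_left_mono mult_right_mono)
      have "real k * (real k - real r) \<le> (2 * real r) * (real k - real r)" using False rr by (intro mult_right_mono) auto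
      hence "real k * (real k - real r) * (2 * a\<^sup>2 / (real r)\<^sup>2) \<le> (2 * real r) * (real k - real r) * (2 * a\<^sup>2 / (real r)\<^sup>2)"
        by (rule mult_right_mono) simp
      also have "\<dots> = 4 * real k * (1 / real r - 1 / real k) * a\<^sup>2" using rr by (simp add: power2_eq_square field_simps)
      finally show "real k * (real k - real r) * (2 * a\<^sup>2 / (real r)\<^sup>2) \<le> 4 * real k * (1 / real r - 1 / real k) * a\<^sup>2" .
    qed (use False in auto)
    finally show "(\<Sum>b\<in>I \<times> J - S. (\<Sigma> b)\<^sup>2) \<le> 4 * real k * (1 / real r - 1 / real k) * a\<^sup>2 + 2 * real k * real r * e\<^sup>2"
      by (simp add: distrib_left mult_ac)
  qed
qed

section \<open>Utility of the exponential mechanism\<close>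

text \<open>A candidate whose score is beaten by more than \<open>\<tau>\<close> has at most the fraction \<open>exp (- \<epsilon> * \<tau> / (2 * \<Delta>))\<close> of
the total weight.\<close>
lemma exp_mech_utility:
  assumes B: "finite B" "B \<noteq> {}" and \<epsilon>: "\<epsilon> > 0" "\<Delta> > 0"
  shows "measure (measure_pmf (exp_mech \<epsilon> \<Delta> sc B)) {c. \<exists>b\<in>B. sc b > sc c + \<tau>} \<le> real (card B) * exp (- \<epsilon> * \<tau> / (2 * \<Delta>))"
proof -
  let ?w = "\<lambda>c. exp (\<epsilon> * sc c / (2 * \<Delta>))"
  let ?W = "\<Sum>c\<in>B. ?w c"
  let ?E = "{c\<in>B. \<exists>b\<in>B. sc b > sc c + \<tau>}"
  have W: "?W > 0" using B by (intro sum_pos) auto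
  have "measure (measure_pmf (exp_mech \<epsilon> \<Delta> sc B)) {c. \<exists>b\<in>B. sc b > sc c + \<tau>} = measure (measure_pmf (exp_mech \<epsilon> \<Delta> sc B)) ?E"
    by (intro measure_pmf.finite_measure_eq_AE AE_pmfI) (auto simp: set_exp_mech[OF B])
  also have "\<dots> = (\<Sum>c\<in>?E. pmf (exp_mech \<epsilon> \<Delta> sc B) c)" by (rule measure_measure_pmf_finite) (use B in auto)
  also have "\<dots> \<le> (\<Sum>c\<in>?E. exp (- \<epsilon> * \<tau> / (2 * \<Delta>)))"
  proof (rule sum_mono)
    fix c assume c: "c \<in> ?E"
    then obtain b where b: "b \<in> B" "sc b > sc c + \<tau>" by blast
    have "?w b \<le> ?W" using b B by (intro member_le_sum) auto
    have "\<epsilon> * sc c + \<epsilon> * \<tau> \<le> \<epsilon> * sc b" using b(2) \<epsilon> by (simp add: distrib_left[symmetric])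
    hence "\<epsilon> * sc c / (2 * \<Delta>) \<le> - \<epsilon> * \<tau> / (2 * \<Delta>) + \<epsilon> * sc b / (2 * \<Delta>)"
      using \<epsilon> unfolding add_divide_distrib[symmetric] by (intro divide_right_mono) auto
    hence "?w c \<le> exp (- \<epsilon> * \<tau> / (2 * \<Delta>)) * ?w b" by (simp add: exp_add[symmetric])
    also have "\<dots> \<le> exp (- \<epsilon> * \<tau> / (2 * \<Delta>)) * ?W" using \<open>?w b \<le> ?W\<close> by (intro mult_left_mono) auto
    finally show "pmf (exp_mech \<epsilon> \<Delta> sc B) c \<le> exp (- \<epsilon> * \<tau> / (2 * \<Delta>))"
      using c W by (simp add: pmf_exp_mech[OF B] pos_divide_le_eq)
  qed
  also have "\<dots> = real (card ?E) * exp (- \<epsilon> * \<tau> / (2 * \<Delta>))" by simp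
  also have "\<dots> \<le> real (card B) * exp (- \<epsilon> * \<tau> / (2 * \<Delta>))"
    using B by (intro mult_right_mono) (auto intro!: card_mono)
  finally show ?thesis .
qed

definition near_top :: "('c \<Rightarrow> real) \<Rightarrow> 'c set \<Rightarrow> real \<Rightarrow> 'c set \<Rightarrow> bool" where
  "near_top sc B \<tau> S \<longleftrightarrow> (\<forall>c\<in>S. \<forall>b\<in>B - S. sc b \<le> sc c + \<tau>)"

text \<open>If \<open>S\<close> is nearly dominant, then adding an element that is nearly maximal among those left keeps it so: the
earlier elements are compared with fewer competitors. So the failure probabilities of the single selections
add up.\<close>
lemma peel_select_utility:
  assumes B: "finite B" and m: "m \<le> card B" and \<epsilon>: "\<epsilon> > 0" "\<Delta> > 0"
  shows "emeasure (measure_pmf (peel_select \<epsilon> \<Delta> sc B m)) {S. \<not> near_top sc B \<tau> S} \<le> ennreal (real m * (real (card B) * exp (- \<epsilon> * \<tau> / (2 * \<Delta>))))"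
  using m
proof (induction m)
  case 0
  show ?case by (simp add: near_top_def)
next
  case (Suc m)
  let ?q = "real (card B) * exp (- \<epsilon> * \<tau> / (2 * \<Delta>))"
  let ?bad = "{S. \<not> near_top sc B \<tau> S}"
  have "emeasure (measure_pmf (peel_select \<epsilon> \<Delta> sc B (Suc m))) ?bad
     = (\<integral>\<^sup>+S. emeasure (measure_pmf (map_pmf (\<lambda>c. insert c S) (exp_mech \<epsilon> \<Delta> sc (B - S)))) ?bad \<partial>measure_pmf (peel_select \<epsilon> \<Delta> sc B m))"
    by simp
  also have "\<dots> \<le> (\<integral>\<^sup>+S. indicator ?bad S + ennreal ?q \<partial>measure_pmf (peel_select \<epsilon> \<Delta> sc B m))"
  proof (rule nn_integral_mono_AE, rule AE_pmfI)
    fix S assume "S \<in> set_pmf (peel_select \<epsilon> \<Delta> sc B m)"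
    hence S: "S \<subseteq> B" "card S = m" using set_peel_select[OF B Suc_leD[OF Suc.prems]] by blast+
    show "emeasure (measure_pmf (map_pmf (\<lambda>c. insert c S) (exp_mech \<epsilon> \<Delta> sc (B - S)))) ?bad \<le> indicator ?bad S + ennreal ?q"
    proof (cases "near_top sc B \<tau> S")
      case False
      have "emeasure (measure_pmf (map_pmf (\<lambda>c. insert c S) (exp_mech \<epsilon> \<Delta> sc (B - S)))) ?bad \<le> 1" by (rule measure_pmf.emeasure_le_1)
      also have "\<dots> \<le> indicator ?bad S + ennreal ?q" using False by simp
      finally show ?thesis .
    next
      case True
      have "S \<noteq> B" using S Suc.prems by auto
      hence ne: "finite (B - S)" "B - S \<noteq> {}" using S B by auto
      have "emeasure (measure_pmf (map_pmf (\<lambda>c. insert c S) (exp_mech \<epsilon> \<Delta> sc (B - S)))) ?bad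
         = emeasure (measure_pmf (exp_mech \<epsilon> \<Delta> sc (B - S))) ((\<lambda>c. insert c S) -` ?bad)" by (simp add: map_pmf_rep_eq emeasure_distr)
      also have "\<dots> \<le> emeasure (measure_pmf (exp_mech \<epsilon> \<Delta> sc (B - S))) {c. \<exists>b\<in>B - S. sc b > sc c + \<tau>}"
      proof (rule emeasure_mono)
        show "(\<lambda>c. insert c S) -` ?bad \<subseteq> {c. \<exists>b\<in>B - S. sc b > sc c + \<tau>}"
        proof
          fix c assume "c \<in> (\<lambda>c. insert c S) -` ?bad"
          then obtain c' b where cb: "c' \<in> insert c S" "b \<in> B - insert c S" "sc b > sc c' + \<tau>" by (auto simp: near_top_def not_le)
          have "\<not> sc b \<le> sc c' + \<tau>" using cb(3) by simp
          hence "c' \<notin> S" using True cb(2) unfolding near_top_def by blast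
          thus "c \<in> {c. \<exists>b\<in>B - S. sc b > sc c + \<tau>}" using cb by auto
        qed
      qed simp
      also have "\<dots> \<le> ennreal (real (card (B - S)) * exp (- \<epsilon> * \<tau> / (2 * \<Delta>)))"
        unfolding measure_pmf.emeasure_eq_measure by (intro ennreal_leI exp_mech_utility ne \<epsilon>)
      also have "\<dots> \<le> ennreal ?q" using B by (intro ennreal_leI mult_right_mono) (auto intro!: card_mono)
      finally show ?thesis by (simp add: add_increasing)
    qed
  qed
  also have "\<dots> = emeasure (measure_pmf (peel_select \<epsilon> \<Delta> sc B m)) ?bad + ennreal ?q"
    by (subst nn_integral_add) auto
  also have "\<dots> \<le> ennreal (real m * ?q) + ennreal ?q" using Suc by (intro add_mono) auto
  also have "\<dots> = ennreal (real (Suc m) * ?q)" by (subst ennreal_plus[symmetric]) (auto simp: algebra_simps)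
  finally show ?case .
qed

section \<open>Error of the added noise\<close>

lemma nn_integral_PiM_std_normal_comp:
  assumes "b \<in> S" and f: "f \<in> borel_measurable borel"
  shows "(\<integral>\<^sup>+g. f (g b) \<partial>(\<Pi>\<^sub>M b\<in>S. std_normal)) = (\<integral>\<^sup>+z. f z \<partial>std_normal)"
proof -
  have "distr (\<Pi>\<^sub>M b\<in>S. std_normal) std_normal (\<lambda>g. g b) = std_normal"
    by (rule distr_PiM_component) (use assms in \<open>auto intro: prob_space_normal_density\<close>)
  hence "(\<integral>\<^sup>+z. f z \<partial>std_normal) = (\<integral>\<^sup>+z. f z \<partial>distr (\<Pi>\<^sub>M b\<in>S. std_normal) std_normal (\<lambda>g. g b))" by simp
  also have "\<dots> = (\<integral>\<^sup>+g. f (g b) \<partial>(\<Pi>\<^sub>M b\<in>S. std_normal))"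
    by (rule nn_integral_distr) (use assms in \<open>auto intro: measurable_component_singleton\<close>)
  finally show ?thesis ..
qed

lemma measurable_block_sq:
  "finite B \<Longrightarrow> (\<lambda>Y. ennreal (\<Sum>b\<in>B. (Y b - \<Sigma> b)\<^sup>2)) \<in> borel_measurable (mat_space B)"
  unfolding mat_space_def
  by (intro measurable_compose[OF _ measurable_ennreal] borel_measurable_sum borel_measurable_power borel_measurable_diff) auto

lemma peel_noise_risk:
  assumes B: "finite B" "S \<subseteq> B"
  shows "(\<integral>\<^sup>+Y. ennreal (\<Sum>b\<in>B. (Y b - \<Sigma> b)\<^sup>2) \<partial>peel_noise A \<sigma> B S) = ennreal ((\<Sum>b\<in>S. (A b - \<Sigma> b)\<^sup>2 + \<sigma>\<^sup>2) + (\<Sum>b\<in>B - S. (\<Sigma> b)\<^sup>2))"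
proof -
  let ?N = "\<Pi>\<^sub>M b\<in>S. std_normal"
  interpret N: prob_space ?N by (intro prob_space_PiM prob_space_normal_density) auto
  have gm: "(\<lambda>g. g b) \<in> borel_measurable ?N" if "b \<in> S" for b
    using measurable_component_singleton[OF that, of "\<lambda>_. std_normal"] by simp
  have "(\<integral>\<^sup>+Y. ennreal (\<Sum>b\<in>B. (Y b - \<Sigma> b)\<^sup>2) \<partial>peel_noise A \<sigma> B S)
     = (\<integral>\<^sup>+g. ennreal (\<Sum>b\<in>B. ((if b \<in> S then A b + \<sigma> * g b else 0) - \<Sigma> b)\<^sup>2) \<partial>?N)"
    unfolding peel_noise_def by (subst nn_integral_distr[OF peel_noise_measurable]) (auto simp: measurable_block_sq[OF B(1)] cong: sum.cong)
  also have "\<dots> = (\<integral>\<^sup>+g. (\<Sum>b\<in>S. ennreal ((A b - \<Sigma> b + \<sigma> * g b)\<^sup>2)) + ennreal (\<Sum>b\<in>B - S. (\<Sigma> b)\<^sup>2) \<partial>?N)"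
  proof (intro nn_integral_cong)
    fix g :: "nat \<times> nat \<Rightarrow> real"
    have "(\<Sum>b\<in>B. ((if b \<in> S then A b + \<sigma> * g b else 0) - \<Sigma> b)\<^sup>2)
       = (\<Sum>b\<in>S. ((if b \<in> S then A b + \<sigma> * g b else 0) - \<Sigma> b)\<^sup>2) + (\<Sum>b\<in>B - S. ((if b \<in> S then A b + \<sigma> * g b else 0) - \<Sigma> b)\<^sup>2)"
      by (subst sum.subset_diff[OF B(2,1)]) (rule add.commute)
    also have "\<dots> = (\<Sum>b\<in>S. (A b - \<Sigma> b + \<sigma> * g b)\<^sup>2) + (\<Sum>b\<in>B - S. (\<Sigma> b)\<^sup>2)"
      by (intro arg_cong2[where f="(+)"] sum.cong) (auto simp: algebra_simps)
    finally show "ennreal (\<Sum>b\<in>B. ((if b \<in> S then A b + \<sigma> * g b else 0) - \<Sigma> b)\<^sup>2) = (\<Sum>b\<in>S. ennreal ((A b - \<Sigma> b + \<sigma> * g b)\<^sup>2)) + ennreal (\<Sum>b\<in>B - S. (\<Sigma> b)\<^sup>2)"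
      by (simp add: sum_ennreal sum_nonneg)
  qed
  also have "\<dots> = (\<integral>\<^sup>+g. (\<Sum>b\<in>S. ennreal ((A b - \<Sigma> b + \<sigma> * g b)\<^sup>2)) \<partial>?N) + ennreal (\<Sum>b\<in>B - S. (\<Sigma> b)\<^sup>2)"
    using gm by (subst nn_integral_add) (auto simp: N.emeasure_space_1 intro!: borel_measurable_sum)
  also have "(\<integral>\<^sup>+g. (\<Sum>b\<in>S. ennreal ((A b - \<Sigma> b + \<sigma> * g b)\<^sup>2)) \<partial>?N) = (\<Sum>b\<in>S. (\<integral>\<^sup>+g. ennreal ((A b - \<Sigma> b + \<sigma> * g b)\<^sup>2) \<partial>?N))"
    using gm by (intro nn_integral_sum) auto
  also have "\<dots> = (\<Sum>b\<in>S. ennreal ((A b - \<Sigma> b)\<^sup>2 + \<sigma>\<^sup>2))"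
  proof (intro sum.cong refl)
    fix b assume "b \<in> S"
    thus "(\<integral>\<^sup>+g. ennreal ((A b - \<Sigma> b + \<sigma> * g b)\<^sup>2) \<partial>?N) = ennreal ((A b - \<Sigma> b)\<^sup>2 + \<sigma>\<^sup>2)"
      using nn_integral_PiM_std_normal_comp[of b S "\<lambda>z. ennreal ((A b - \<Sigma> b + \<sigma> * z)\<^sup>2)"] by (simp add: nn_integral_std_normal_affine_sq)
  qed
  also have "(\<Sum>b\<in>S. ennreal ((A b - \<Sigma> b)\<^sup>2 + \<sigma>\<^sup>2)) = ennreal (\<Sum>b\<in>S. (A b - \<Sigma> b)\<^sup>2 + \<sigma>\<^sup>2)" by (rule sum_ennreal) simp
  also have "\<dots> + ennreal (\<Sum>b\<in>B - S. (\<Sigma> b)\<^sup>2) = ennreal ((\<Sum>b\<in>S. (A b - \<Sigma> b)\<^sup>2 + \<sigma>\<^sup>2) + (\<Sum>b\<in>B - S. (\<Sigma> b)\<^sup>2))"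
    by (rule ennreal_plus[symmetric]) (auto intro!: sum_nonneg)
  finally show ?thesis .
qed

section \<open>Risk of the block releases\<close>

text \<open>The slack \<open>\<tau>\<close> is chosen such that a selection that is not nearly dominant has probability at most
\<open>1 / n\<close>. In that case the energy left out is at most the energy \<open>k * a\<^sup>2\<close> of the whole block, which gives
the last term.\<close>
lemma peel_release_risk:
  fixes \<Sigma> :: "nat \<times> nat \<Rightarrow> real" and k n :: nat
  assumes I: "finite I" "card I = k" and J: "finite J" "card J = k" and k: "k \<ge> 1" and n: "n \<ge> 1" and \<rho>: "\<rho> > 0" and L: "L > 0"
    and a: "a \<ge> 0" and col: "\<And>j. j \<in> J \<Longrightarrow> (\<Sum>i\<in>I. \<bar>\<Sigma> (i, j)\<bar>) \<le> a"
    and dev: "\<And>b. b \<in> I \<times> J \<Longrightarrow> \<bar>clipped_mean n L X b - \<Sigma> b\<bar> \<le> \<eta>"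
  defines "r \<equiv> peel_rank n k a \<rho>"
  defines "\<tau> \<equiv> 4 * L / real n * sqrt (real (k * r) / \<rho>) * ln (real k ^ 4 * real n)"
  shows "(\<integral>\<^sup>+Y. ennreal (\<Sum>b\<in>I \<times> J. (Y b - \<Sigma> b)\<^sup>2) \<partial>peel_release n L X k I J a \<rho>)
    \<le> ennreal (real (k * r) * (\<eta>\<^sup>2 + (peel_sigma n L k r \<rho>)\<^sup>2) + (4 * real k * (1 / real r - 1 / real k) * a\<^sup>2 + 2 * real k * real r * (2 * \<eta> + \<tau>)\<^sup>2) + real k * a\<^sup>2 / real n)"
proof -
  let ?B = "I \<times> J"
  let ?A = "clipped_mean n L X"
  have r: "1 \<le> r" "r \<le> k" using peel_rank_in[OF k, of n a \<rho>] by (auto simp: r_def)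
  have finB: "finite ?B" and cardB: "card ?B = k * k" using I J by (auto simp: card_cartesian_product)
  have kr: "k * r \<le> card ?B" using r by (simp add: cardB)
  have krp: "real (k * r) > 0" using r k by simp
  have nn: "real n \<ge> 1" using n by simp
  define e where "e = sqrt (\<rho> / real (k * r))"
  have e: "e > 0" using \<rho> krp by (simp add: e_def)
  define \<sigma> where "\<sigma> = peel_sigma n L k r \<rho>"
  define p where "p = peel_select e (2 * L / real n) (\<lambda>b. \<bar>?A b\<bar>) ?B (k * r)"
  define bad where "bad = {S. \<not> near_top (\<lambda>b. \<bar>?A b\<bar>) ?B \<tau> S}"
  have arg: "real k ^ 4 * real n \<ge> 1"
  proof -
    have "1 * 1 \<le> real k ^ 4 * real n" using k nn by (intro mult_mono) auto
    thus ?thesis by simp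
  qed
  have \<tau>0: "\<tau> \<ge> 0" unfolding \<tau>_def using L nn \<rho> arg by (intro mult_nonneg_nonneg) auto
  \<comment> \<open>The failure probability of one selection is \<open>k\<^sup>2\<close> times the exponential of this number;
    there are at most \<open>k\<^sup>2\<close> selections.\<close>
  have ex: "- e * \<tau> / (2 * (2 * L / real n)) = - ln (real k ^ 4 * real n)"
  proof -
    have "e * sqrt (real (k * r) / \<rho>) = 1" unfolding e_def real_sqrt_mult[symmetric] using \<rho> krp by (simp del: of_nat_mult)
    hence "e * \<tau> = 4 * L / real n * ln (real k ^ 4 * real n)" by (simp add: \<tau>_def mult_ac)
    hence "e * \<tau> / (4 * L / real n) = ln (real k ^ 4 * real n)" using L nn by simp
    thus ?thesis by (simp add: mult.commute)
  qed
  have pbad: "emeasure (measure_pmf p) bad \<le> ennreal (1 / real n)"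
  proof -
    have "emeasure (measure_pmf p) bad \<le> ennreal (real (k * r) * (real (card ?B) * exp (- e * \<tau> / (2 * (2 * L / real n)))))"
      unfolding p_def bad_def using L nn by (intro peel_select_utility finB kr e) auto
    also have "\<dots> \<le> ennreal (1 / real n)"
    proof (rule ennreal_leI)
      have "real (k * r) * (real (card ?B) * exp (- e * \<tau> / (2 * (2 * L / real n)))) = real (k * r) * real (k * k) * (1 / (real k ^ 4 * real n))"
        unfolding ex cardB using arg by (simp add: exp_minus exp_ln inverse_eq_divide)
      also have "\<dots> \<le> real (k * k) * real (k * k) * (1 / (real k ^ 4 * real n))"
        using r by (intro mult_right_mono) (auto intro!: mult_left_mono)
      also have "\<dots> = 1 / real n" using k by (simp add: power4_eq_xxxx)
      finally show "real (k * r) * (real (card ?B) * exp (- e * \<tau> / (2 * (2 * L / real n)))) \<le> 1 / real n" .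
    qed
    finally show ?thesis .
  qed
  define G where "G = real (k * r) * (\<eta>\<^sup>2 + \<sigma>\<^sup>2) + (4 * real k * (1 / real r - 1 / real k) * a\<^sup>2 + 2 * real k * real r * (2 * \<eta> + \<tau>)\<^sup>2)"
  have inv: "1 / real k \<le> 1 / real r" using r by (intro divide_left_mono) auto
  have Q0: "4 * real k * (1 / real r - 1 / real k) * a\<^sup>2 + 2 * real k * real r * (2 * \<eta> + \<tau>)\<^sup>2 \<ge> 0"
    using inv by (intro add_nonneg_nonneg mult_nonneg_nonneg) auto
  have G0: "G \<ge> 0" unfolding G_def using Q0 by simp
  have inner: "(\<integral>\<^sup>+Y. ennreal (\<Sum>b\<in>?B. (Y b - \<Sigma> b)\<^sup>2) \<partial>peel_noise ?A \<sigma> ?B S) \<le> ennreal G + ennreal (real k * a\<^sup>2) * indicator bad S"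
    if S: "S \<in> set_pmf p" for S
  proof -
    have SB: "S \<subseteq> ?B" "card S = k * r" using S set_peel_select[OF finB kr] unfolding p_def by blast+
    have s1: "(\<Sum>b\<in>S. (?A b - \<Sigma> b)\<^sup>2 + \<sigma>\<^sup>2) \<le> real (k * r) * (\<eta>\<^sup>2 + \<sigma>\<^sup>2)"
    proof -
      have "(\<Sum>b\<in>S. (?A b - \<Sigma> b)\<^sup>2 + \<sigma>\<^sup>2) \<le> (\<Sum>b\<in>S. \<eta>\<^sup>2 + \<sigma>\<^sup>2)"
      proof (intro sum_mono add_right_mono)
        fix b assume "b \<in> S"
        hence "\<bar>?A b - \<Sigma> b\<bar>\<^sup>2 \<le> \<eta>\<^sup>2" using dev SB by (intro power_mono) auto
        thus "(?A b - \<Sigma> b)\<^sup>2 \<le> \<eta>\<^sup>2" by simp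
      qed
      thus ?thesis using SB by simp
    qed
    have "(\<Sum>b\<in>S. (?A b - \<Sigma> b)\<^sup>2 + \<sigma>\<^sup>2) + (\<Sum>b\<in>?B - S. (\<Sigma> b)\<^sup>2) \<le> G + real k * a\<^sup>2 * indicator bad S"
    proof (cases "S \<in> bad")
      case True
      have "(\<Sum>b\<in>?B - S. (\<Sigma> b)\<^sup>2) \<le> (\<Sum>b\<in>?B. (\<Sigma> b)\<^sup>2)" using finB by (intro sum_mono2) auto
      also have "\<dots> \<le> real k * a\<^sup>2" by (rule sum_sq_block[OF I(1) J col])
      finally show ?thesis using s1 Q0 True unfolding G_def by simp
    next
      case False
      hence good: "\<bar>?A b\<bar> \<le> \<bar>?A c\<bar> + \<tau>" if "c \<in> S" "b \<in> ?B - S" for c b using that unfolding bad_def near_top_def by blast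
      have "(\<Sum>b\<in>?B - S. (\<Sigma> b)\<^sup>2) \<le> 4 * real k * (1 / real r - 1 / real k) * a\<^sup>2 + 2 * real k * real r * (2 * \<eta> + \<tau>)\<^sup>2"
        by (rule unselected_energy[OF I J r SB a col dev \<tau>0 good])
      thus ?thesis using s1 False unfolding G_def by simp
    qed
    hence "ennreal ((\<Sum>b\<in>S. (?A b - \<Sigma> b)\<^sup>2 + \<sigma>\<^sup>2) + (\<Sum>b\<in>?B - S. (\<Sigma> b)\<^sup>2)) \<le> ennreal (G + real k * a\<^sup>2 * indicator bad S)" by (rule ennreal_leI)
    also have "\<dots> = ennreal G + ennreal (real k * a\<^sup>2) * indicator bad S"
      using G0 by (auto simp: indicator_def)
    finally show ?thesis unfolding peel_noise_risk[OF finB SB(1)] .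
  qed
  have km: "peel_noise ?A \<sigma> ?B \<in> measure_pmf p \<rightarrow>\<^sub>M subprob_algebra (mat_space ?B)"
    by (rule measurable_prob_algebraD) (use space_peel_noise in auto)
  have "(\<integral>\<^sup>+Y. ennreal (\<Sum>b\<in>?B. (Y b - \<Sigma> b)\<^sup>2) \<partial>peel_release n L X k I J a \<rho>)
     = (\<integral>\<^sup>+S. (\<integral>\<^sup>+Y. ennreal (\<Sum>b\<in>?B. (Y b - \<Sigma> b)\<^sup>2) \<partial>peel_noise ?A \<sigma> ?B S) \<partial>measure_pmf p)"
    unfolding peel_release_eq r_def[symmetric] e_def[symmetric] \<sigma>_def[symmetric] p_def[symmetric]
    by (rule nn_integral_bind[OF measurable_block_sq[OF finB] km])
  also have "\<dots> \<le> (\<integral>\<^sup>+S. ennreal G + ennreal (real k * a\<^sup>2) * indicator bad S \<partial>measure_pmf p)"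
    by (intro nn_integral_mono_AE AE_pmfI inner)
  also have "\<dots> = ennreal G + ennreal (real k * a\<^sup>2) * emeasure (measure_pmf p) bad"
    by (subst nn_integral_add) (auto simp: nn_integral_cmult_indicator measure_pmf.emeasure_space_1)
  also have "\<dots> \<le> ennreal G + ennreal (real k * a\<^sup>2) * ennreal (1 / real n)"
    by (intro add_left_mono mult_left_mono pbad) auto
  also have "\<dots> = ennreal (G + real k * a\<^sup>2 / real n)"
    using G0 nn by (simp add: ennreal_mult'[symmetric] ennreal_plus[symmetric] del: ennreal_plus)
  finally show ?thesis unfolding G_def \<sigma>_def .
qed

lemma DPCovBlock_risk:
  assumes I: "finite I" "I \<subseteq> {1..d}" and J: "finite J" "J \<subseteq> {1..d}" and \<rho>: "\<rho> > 0" and n: "n \<ge> 1"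
  shows "(\<integral>\<^sup>+Y. ennreal (\<Sum>b\<in>I \<times> J. (Y b - \<Sigma> b)\<^sup>2) \<partial>DPCovBlock n d X I J \<rho> R)
    = ennreal (\<Sum>(i, j)\<in>I \<times> J. ((1 / real n) * (\<Sum>m=1..n. chi_vec R I (X m) i * chi_vec R J (X m) j) - \<Sigma> (i, j))\<^sup>2 + 18 * R ^ 4 / (\<rho> * (real n)\<^sup>2))"
proof -
  let ?U = "upper_triangle d"
  let ?N = "\<Pi>\<^sub>M b\<in>?U. std_normal"
  define A where "A = (\<lambda>(i, j). (1 / real n) * (\<Sum>m=1..n. chi_vec R I (X m) i * chi_vec R J (X m) j))"
  define \<sigma> where "\<sigma> = sqrt (18 * R ^ 4 / (\<rho> * (real n)\<^sup>2))"
  define mm where "mm = (\<lambda>(i, j). (min i j, max i j :: nat))"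
  have \<sigma>2: "\<sigma>\<^sup>2 = 18 * R ^ 4 / (\<rho> * (real n)\<^sup>2)" unfolding \<sigma>_def using \<rho> by simp
  have law: "DPCovBlock n d X I J \<rho> R = distr ?N (mat_space (I \<times> J)) (\<lambda>Z. \<lambda>b\<in>I \<times> J. A b + \<sigma> * Z (mm b))"
    unfolding DPCovBlock_def A_def \<sigma>_def upper_triangle_def mm_def by (rule distr_cong) (auto simp: fun_eq_iff)
  have mU: "mm b \<in> ?U" if "b \<in> I \<times> J" for b using that I J by (force simp: mm_def upper_triangle_def min_def max_def)
  have gm: "(\<lambda>Z. Z (mm b)) \<in> borel_measurable ?N" if "b \<in> I \<times> J" for b
    using measurable_component_singleton[OF mU[OF that], of "\<lambda>_. std_normal"] by simp
  have m: "(\<lambda>Z. \<lambda>b\<in>I \<times> J. A b + \<sigma> * Z (mm b)) \<in> ?N \<rightarrow>\<^sub>M mat_space (I \<times> J)"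
    unfolding mat_space_def by (rule measurable_restrict) (use gm in auto)
  have fin: "finite (I \<times> J)" using I J by simp
  have "(\<integral>\<^sup>+Y. ennreal (\<Sum>b\<in>I \<times> J. (Y b - \<Sigma> b)\<^sup>2) \<partial>DPCovBlock n d X I J \<rho> R)
     = (\<integral>\<^sup>+Z. ennreal (\<Sum>b\<in>I \<times> J. (A b + \<sigma> * Z (mm b) - \<Sigma> b)\<^sup>2) \<partial>?N)"
    unfolding law by (subst nn_integral_distr[OF m]) (auto simp: measurable_block_sq[OF fin] cong: sum.cong)
  also have "\<dots> = (\<integral>\<^sup>+Z. (\<Sum>b\<in>I \<times> J. ennreal ((A b - \<Sigma> b + \<sigma> * Z (mm b))\<^sup>2)) \<partial>?N)"
    by (simp add: algebra_simps)
  also have "\<dots> = (\<Sum>b\<in>I \<times> J. (\<integral>\<^sup>+Z. ennreal ((A b - \<Sigma> b + \<sigma> * Z (mm b))\<^sup>2) \<partial>?N))"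
    using gm by (intro nn_integral_sum) auto
  also have "\<dots> = (\<Sum>b\<in>I \<times> J. ennreal ((A b - \<Sigma> b)\<^sup>2 + \<sigma>\<^sup>2))"
  proof (intro sum.cong refl)
    fix b assume "b \<in> I \<times> J"
    thus "(\<integral>\<^sup>+Z. ennreal ((A b - \<Sigma> b + \<sigma> * Z (mm b))\<^sup>2) \<partial>?N) = ennreal ((A b - \<Sigma> b)\<^sup>2 + \<sigma>\<^sup>2)"
      using nn_integral_PiM_std_normal_comp[OF mU[of b], of "\<lambda>z. ennreal ((A b - \<Sigma> b + \<sigma> * z)\<^sup>2)"] by (simp add: nn_integral_std_normal_affine_sq)
  qed
  also have "\<dots> = ennreal (\<Sum>b\<in>I \<times> J. (A b - \<Sigma> b)\<^sup>2 + \<sigma>\<^sup>2)" by (rule sum_ennreal) auto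
  finally show ?thesis by (simp add: A_def \<sigma>2 case_prod_unfold)
qed

section \<open>The blocks tile the upper triangle\<close>

text \<open>The position of the block of side \<open>k\<close> that contains \<open>i\<close>, counted from zero so that doubling the side halves it.\<close>
definition block_pos :: "nat \<Rightarrow> nat \<Rightarrow> nat" where "block_pos k i = (i - 1) div k"

lemma in_seg_iff:
  assumes "k \<ge> 1" "i \<ge> 1" "l \<ge> 1"
  shows "i \<in> seg k l \<longleftrightarrow> l = block_pos k i + 1"
proof -
  obtain q where q: "l = Suc q" using assms by (cases l) auto
  have "i \<in> seg k l \<longleftrightarrow> q * k \<le> i - 1 \<and> i - 1 < Suc q * k" using assms unfolding seg_def q by auto
  also have "\<dots> \<longleftrightarrow> (i - 1) div k = q"
    using assms by (metis One_nat_def Suc_le_lessD div_nat_eqI dividend_less_times_div div_times_less_eq_dividend mult.commute mult_Suc)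
  finally show ?thesis unfolding block_pos_def q by auto
qed

text \<open>To be used with \<open>i \<le> j\<close>: the blocks of \<open>i\<close> and \<open>j\<close> are equal or adjacent.\<close>
definition near_blocks :: "nat \<Rightarrow> nat \<Rightarrow> nat \<Rightarrow> bool" where "near_blocks k i j \<longleftrightarrow> block_pos k j \<le> block_pos k i + 1"

lemma block_pos_double: "block_pos (2 * k) i = block_pos k i div 2"
  unfolding block_pos_def by (simp add: div_mult2_eq mult.commute[of 2])

lemma block_pos_mono: "i \<le> j \<Longrightarrow> block_pos k i \<le> block_pos k j"
  unfolding block_pos_def by (intro div_le_mono) simp

lemma near_blocks_double: "near_blocks k i j \<Longrightarrow> near_blocks (2 * k) i j"
  unfolding near_blocks_def block_pos_double by linarith

lemma center_block_iff:
  assumes k0: "k0 \<ge> 1" and ij: "1 \<le> i" "i \<le> j" "j \<le> 2 ^ J * k0"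
  shows "t \<in> center_blocks (2 ^ J * k0) k0 \<and> (i, j) \<in> block t \<longleftrightarrow> t = (k0, block_pos k0 i + 1, block_pos k0 j - block_pos k0 i) \<and> near_blocks k0 i j"
proof
  assume a: "t \<in> center_blocks (2 ^ J * k0) k0 \<and> (i, j) \<in> block t"
  then obtain l r where t: "t = (k0, l, r)" "1 \<le> l" "r \<in> {0, 1}" by (auto simp: center_blocks_def)
  from a have "i \<in> seg k0 l" "j \<in> seg k0 (l + r)" by (auto simp: t block_def)
  hence "l = block_pos k0 i + 1" "l + r = block_pos k0 j + 1" using in_seg_iff[OF k0] ij t by auto
  thus "t = (k0, block_pos k0 i + 1, block_pos k0 j - block_pos k0 i) \<and> near_blocks k0 i j" using t by (auto simp: near_blocks_def)
next
  assume a: "t = (k0, block_pos k0 i + 1, block_pos k0 j - block_pos k0 i) \<and> near_blocks k0 i j"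
  have m: "block_pos k0 i \<le> block_pos k0 j" by (rule block_pos_mono[OF ij(2)])
  have "j - 1 < 2 ^ J * k0" using ij by simp
  hence "block_pos k0 j < 2 ^ J" unfolding block_pos_def using k0 by (simp add: div_less_iff_less_mult)
  hence "t \<in> center_blocks (2 ^ J * k0) k0" using a m k0 by (auto simp: center_blocks_def near_blocks_def)
  moreover have "(i, j) \<in> block t" using a m in_seg_iff[OF k0] ij by (auto simp: block_def)
  ultimately show "t \<in> center_blocks (2 ^ J * k0) k0 \<and> (i, j) \<in> block t" ..
qed

text \<open>Two adjacent segments of side \<open>2 * k\<close> have two children each. Of the four pairs of children only the one
across the common boundary is adjacent; the other three are the outer blocks of that pair. So \<open>(i, j)\<close>
lies in an outer block at scale \<open>k\<close> if and only if its blocks are apart at scale \<open>k\<close> and near at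
scale \<open>2 * k\<close>.\<close>
lemma outer_block_iff:
  assumes k0: "k0 \<ge> 1" and ij: "1 \<le> i" "i \<le> j" "j \<le> 2 ^ J * k0"
  shows "t \<in> outer_blocks (2 ^ J * k0) k0 \<and> (i, j) \<in> block t \<longleftrightarrow>
    (\<exists>s<J - 1. t = (2 ^ s * k0, block_pos (2 ^ s * k0) i + 1, block_pos (2 ^ s * k0) j - block_pos (2 ^ s * k0) i) \<and> \<not> near_blocks (2 ^ s * k0) i j \<and> near_blocks (2 ^ Suc s * k0) i j)"
proof -
  have dd: "2 ^ J * k0 div (2 * (2 ^ s * k0)) = 2 ^ (J - Suc s)" if "s < J - 1" for s
  proof -
    have "J = Suc s + (J - Suc s)" using that by simp
    hence "2 ^ J = (2::nat) ^ Suc s * 2 ^ (J - Suc s)" by (metis power_add)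
    hence "2 ^ J * k0 = 2 ^ (J - Suc s) * (2 * (2 ^ s * k0))" by simp
    thus ?thesis using k0 by simp
  qed
  show ?thesis
  proof
    assume a: "t \<in> outer_blocks (2 ^ J * k0) k0 \<and> (i, j) \<in> block t"
    then obtain k m where k: "k \<in> outer_scales (2 ^ J * k0) k0" and m: "m \<in> {1..<2 ^ J * k0 div (2 * k)}"
      and t: "t \<in> {(k, 2 * m - 1, 2), (k, 2 * m - 1, 3), (k, 2 * m, 2)}" unfolding outer_blocks_def by blast
    obtain l r where t2: "t = (k, l, r)" using t by auto
    have lr: "(l = 2 * m - 1 \<and> (r = 2 \<or> r = 3)) \<or> (l = 2 * m \<and> r = 2)" using t unfolding t2 by auto
    have l1: "l \<ge> 1" using lr m by auto
    from k obtain s where s: "s < J - 1" "k = 2 ^ s * k0" by (auto simp: outer_scales_eq[OF k0])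
    have k1: "k \<ge> 1" using s k0 by simp
    from a have "i \<in> seg k l" "j \<in> seg k (l + r)" by (auto simp: t2 block_def)
    hence p: "l = block_pos k i + 1" "l + r = block_pos k j + 1" using in_seg_iff[OF k1] ij l1 by auto
    have "\<not> near_blocks k i j" using p lr by (auto simp: near_blocks_def)
    moreover have "near_blocks (2 * k) i j"
    proof -
      obtain h where h: "m = Suc h" using m by (cases m) auto
      have "(block_pos k i = 2 * h \<and> (block_pos k j = 2 * h + 2 \<or> block_pos k j = 2 * h + 3)) \<or> (block_pos k i = 2 * h + 1 \<and> block_pos k j = 2 * h + 3)"
        using p lr unfolding h by auto
      thus ?thesis unfolding near_blocks_def block_pos_double by auto
    qed
    moreover have "t = (k, block_pos k i + 1, block_pos k j - block_pos k i)" using p t2 by auto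
    ultimately show "\<exists>s<J - 1. t = (2 ^ s * k0, block_pos (2 ^ s * k0) i + 1, block_pos (2 ^ s * k0) j - block_pos (2 ^ s * k0) i) \<and> \<not> near_blocks (2 ^ s * k0) i j \<and> near_blocks (2 ^ Suc s * k0) i j"
      using s by (auto simp: mult.assoc)
  next
    assume "\<exists>s<J - 1. t = (2 ^ s * k0, block_pos (2 ^ s * k0) i + 1, block_pos (2 ^ s * k0) j - block_pos (2 ^ s * k0) i) \<and> \<not> near_blocks (2 ^ s * k0) i j \<and> near_blocks (2 ^ Suc s * k0) i j"
    then obtain s where s: "s < J - 1" and t: "t = (2 ^ s * k0, block_pos (2 ^ s * k0) i + 1, block_pos (2 ^ s * k0) j - block_pos (2 ^ s * k0) i)"
      and n: "\<not> near_blocks (2 ^ s * k0) i j" "near_blocks (2 * (2 ^ s * k0)) i j" by (auto simp: mult.assoc)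
    define k where "k = 2 ^ s * k0"
    have k1: "k \<ge> 1" using k0 by (simp add: k_def)
    define p q where "p = block_pos k i" and "q = block_pos k j"
    have pq: "q \<ge> p + 2" "q div 2 \<le> p div 2 + 1" using n unfolding near_blocks_def block_pos_double k_def[symmetric] p_def q_def by auto
    have "j - 1 < 2 ^ J * k0" using ij by simp
    also have "2 ^ J * k0 = 2 ^ (J - Suc s) * (2 * k)"
    proof -
      have "J = Suc s + (J - Suc s)" using s by simp
      hence "2 ^ J = (2::nat) ^ Suc s * 2 ^ (J - Suc s)" by (metis power_add)
      thus ?thesis by (simp add: k_def)
    qed
    finally have "q div 2 < 2 ^ (J - Suc s)" unfolding q_def block_pos_double[symmetric] block_pos_def using k1 by (simp add: div_less_iff_less_mult)
    define m where "m = p div 2 + 1"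
    have mm: "m \<in> {1..<2 ^ J * k0 div (2 * k)}" unfolding k_def dd[OF s] m_def using \<open>q div 2 < _\<close> pq by auto
    have "(k, p + 1, q - p) \<in> {(k, 2 * m - 1, 2), (k, 2 * m - 1, 3), (k, 2 * m, 2)}"
    proof (cases "even p")
      case True
      then obtain h where h: "p = 2 * h" by blast
      hence "q = p + 2 \<or> q = p + 3" using pq by auto
      thus ?thesis using h by (auto simp: m_def)
    next
      case False
      then obtain h where h: "p = 2 * h + 1" using oddE by blast
      hence "q = p + 2" using pq by auto
      thus ?thesis using h by (auto simp: m_def)
    qed
    hence tm: "t \<in> {(k, 2 * m - 1, 2), (k, 2 * m - 1, 3), (k, 2 * m, 2)}"
      unfolding t k_def[symmetric] p_def[symmetric] q_def[symmetric] .
    have ks: "k \<in> outer_scales (2 ^ J * k0) k0" unfolding outer_scales_eq[OF k0] k_def using s by (intro imageI) simp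
    have "t \<in> outer_blocks (2 ^ J * k0) k0"
      unfolding outer_blocks_def by (rule UN_I[OF ks], rule UN_I[OF mm], rule tm)
    moreover have "(i, j) \<in> block t" unfolding t block_def k_def[symmetric] p_def[symmetric] q_def[symmetric]
      using in_seg_iff[OF k1] ij pq by (auto simp: p_def q_def)
    ultimately show "t \<in> outer_blocks (2 ^ J * k0) k0 \<and> (i, j) \<in> block t" ..
  qed
qed

text \<open>Nearness is preserved when the side doubles, and every pair is near at the last scale. So there is a unique
first scale at which a pair is near: if it is \<open>k0\<close>, the pair lies in a center block, and otherwise in
an outer block of the preceding scale.\<close>
lemma blocks_tile:
  assumes k0: "k0 \<ge> 1" and ij: "1 \<le> i" "i \<le> j" "j \<le> 2 ^ J * k0"
  shows "\<exists>!t. t \<in> center_blocks (2 ^ J * k0) k0 \<union> outer_blocks (2 ^ J * k0) k0 \<and> (i, j) \<in> block t"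
proof -
  define N where "N s = near_blocks (2 ^ s * k0) i j" for s
  have step: "N s \<Longrightarrow> N (Suc s)" for s unfolding N_def using near_blocks_double[of "2 ^ s * k0" i j] by (simp add: mult.assoc)
  have mono: "N s'" if "N s" "s \<le> s'" for s s'
    using that(2,1) by (induction s' rule: dec_induct) (auto intro: step)
  have top: "N (J - 1)"
  proof -
    have "block_pos (2 ^ (J - 1) * k0) j \<le> 1"
    proof -
      have "2 ^ J * k0 \<le> 2 * (2 ^ (J - 1) * k0)" by (cases J) auto
      hence "j - 1 < 2 * (2 ^ (J - 1) * k0)" using ij by linarith
      hence "block_pos (2 ^ (J - 1) * k0) j < 2" unfolding block_pos_def using k0 by (simp add: div_less_iff_less_mult)
      thus ?thesis by simp
    qed
    thus ?thesis unfolding N_def near_blocks_def by simp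
  qed
  define s0 where "s0 = (LEAST s. N s)"
  have s0: "N s0" "s0 \<le> J - 1" "\<And>s. s < s0 \<Longrightarrow> \<not> N s"
    unfolding s0_def using top by (auto intro: LeastI Least_le dest: not_less_Least)
  define c where "c s = (2 ^ s * k0, block_pos (2 ^ s * k0) i + 1, block_pos (2 ^ s * k0) j - block_pos (2 ^ s * k0) i)" for s
  have iff: "t \<in> center_blocks (2 ^ J * k0) k0 \<union> outer_blocks (2 ^ J * k0) k0 \<and> (i, j) \<in> block t
     \<longleftrightarrow> (t = c 0 \<and> N 0) \<or> (\<exists>s<J - 1. t = c s \<and> \<not> N s \<and> N (Suc s))" for t
    using center_block_iff[OF k0 ij, of t] outer_block_iff[OF k0 ij, of t] unfolding N_def c_def by auto
  show ?thesis unfolding iff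
  proof (cases "s0 = 0")
    case True
    hence "N s" for s using mono[OF s0(1), of s] by simp
    thus "\<exists>!t. (t = c 0 \<and> N 0) \<or> (\<exists>s<J - 1. t = c s \<and> \<not> N s \<and> N (Suc s))" by auto
  next
    case False
    then obtain u where u: "s0 = Suc u" by (cases s0) auto
    have n0: "\<not> N 0" using s0(3)[of 0] False by simp
    have uu: "u < J - 1" "\<not> N u" "N (Suc u)" using s0 u by auto
    have uniq: "s = u" if "\<not> N s" "N (Suc s)" for s
    proof (rule antisym)
      show "s \<le> u" using mono[OF uu(3), of s] that by (meson not_less_eq_eq)
      show "u \<le> s" using mono[OF that(2), of u] uu by (meson not_less_eq_eq)
    qed
    show "\<exists>!t. (t = c 0 \<and> N 0) \<or> (\<exists>s<J - 1. t = c s \<and> \<not> N s \<and> N (Suc s))"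
      using n0 uu uniq by blast
  qed
qed

text \<open>The blocks on the diagonal reach below it, so their sum is only an upper bound for the sum over the upper
triangle; the factor 2 accounts for the reflected entries.\<close>
lemma assemble_error:
  fixes \<Sigma> :: "nat \<times> nat \<Rightarrow> real" and J k0 :: nat
  assumes k0: "k0 \<ge> 1" and sym: "\<And>i j. \<Sigma> (i, j) = \<Sigma> (j, i)"
  defines "D \<equiv> 2 ^ J * k0" and "T \<equiv> center_blocks (2 ^ J * k0) k0 \<union> outer_blocks (2 ^ J * k0) k0"
  shows "(\<Sum>b\<in>idx D. (assemble T \<omega> b - \<Sigma> b)\<^sup>2) \<le> 2 * (\<Sum>t\<in>T. \<Sum>b\<in>block t. (\<omega> t b - \<Sigma> b)\<^sup>2)"
proof -
  have finT: "finite T" unfolding T_def by (intro finite_UnI finite_center_blocks finite_outer_blocks k0)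
  have finb: "finite (block t)" for t by (cases t) (simp add: block_def finite_seg)
  define U where "U = {(i, j). 1 \<le> i \<and> i \<le> j \<and> j \<le> D}"
  have finU: "finite U" by (rule finite_subset[of _ "idx D"]) (auto simp: U_def)
  define E where "E b = (assemble T \<omega> b - \<Sigma> b)\<^sup>2" for b
  have E_sym: "E (i, j) = E (j, i)" for i j unfolding E_def using sym[of i j] assemble_sym[of T \<omega> i j] by simp
  have pt: "E b = (\<Sum>t\<in>T. if b \<in> block t then (\<omega> t b - \<Sigma> b)\<^sup>2 else 0)" if b: "b \<in> U" for b
  proof -
    obtain i j where ij: "b = (i, j)" "1 \<le> i" "i \<le> j" "j \<le> D" using b by (auto simp: U_def)
    obtain t0 where t0: "t0 \<in> T" "b \<in> block t0" and un: "\<And>t. t \<in> T \<Longrightarrow> b \<in> block t \<Longrightarrow> t = t0"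
      using blocks_tile[OF k0 ij(2,3), of J] ij unfolding D_def T_def by blast
    have one: "(\<Sum>t\<in>T. if b \<in> block t then f t else 0) = f t0" for f :: "nat \<times> nat \<times> nat \<Rightarrow> real"
    proof -
      have "(\<Sum>t\<in>T. if b \<in> block t then f t else 0) = (\<Sum>t\<in>T. if t = t0 then f t0 else 0)"
      proof (intro sum.cong refl)
        fix t assume "t \<in> T"
        thus "(if b \<in> block t then f t else 0) = (if t = t0 then f t0 else 0)"
          using un[of t] t0(2) by (cases "b \<in> block t") auto
      qed
      thus ?thesis using finT t0(1) by simp
    qed
    have "assemble T \<omega> b = (\<Sum>t\<in>T. if b \<in> block t then \<omega> t b else 0)"
      unfolding ij(1) using ij(2-) by (simp add: assemble_def Let_def min_def max_def)
    thus ?thesis unfolding E_def one by simp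
  qed
  have cov: "idx D \<subseteq> U \<union> prod.swap ` U"
  proof
    fix b assume "b \<in> idx D"
    then obtain i j where ij: "b = (i, j)" "1 \<le> i" "i \<le> D" "1 \<le> j" "j \<le> D" by auto
    show "b \<in> U \<union> prod.swap ` U"
    proof (cases "i \<le> j")
      case True thus ?thesis using ij by (simp add: U_def)
    next
      case False
      hence "(j, i) \<in> U" using ij by (simp add: U_def)
      hence "prod.swap (j, i) \<in> prod.swap ` U" by (rule imageI)
      thus ?thesis using ij by simp
    qed
  qed
  have "(\<Sum>b\<in>idx D. E b) \<le> (\<Sum>b\<in>U \<union> prod.swap ` U. E b)"
    by (rule sum_mono2[OF _ cov]) (use finU in \<open>simp_all add: E_def\<close>)
  also have "\<dots> \<le> (\<Sum>b\<in>U. E b) + (\<Sum>b\<in>prod.swap ` U. E b)"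
  proof -
    have "(\<Sum>b\<in>U \<union> prod.swap ` U. E b) + (\<Sum>b\<in>U \<inter> prod.swap ` U. E b) = (\<Sum>b\<in>U. E b) + (\<Sum>b\<in>prod.swap ` U. E b)"
      by (rule sum.union_inter) (use finU in auto)
    moreover have "(\<Sum>b\<in>U \<inter> prod.swap ` U. E b) \<ge> 0" by (intro sum_nonneg) (auto simp: E_def)
    ultimately show ?thesis by linarith
  qed
  also have "(\<Sum>b\<in>prod.swap ` U. E b) = (\<Sum>b\<in>U. E b)"
    by (subst sum.reindex) (auto simp: E_sym prod.swap_def case_prod_unfold)
  finally have "(\<Sum>b\<in>idx D. E b) \<le> 2 * (\<Sum>b\<in>U. E b)" by simp
  also have "(\<Sum>b\<in>U. E b) = (\<Sum>b\<in>U. \<Sum>t\<in>T. if b \<in> block t then (\<omega> t b - \<Sigma> b)\<^sup>2 else 0)"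
    by (intro sum.cong pt) auto
  also have "\<dots> = (\<Sum>t\<in>T. \<Sum>b\<in>U. if b \<in> block t then (\<omega> t b - \<Sigma> b)\<^sup>2 else 0)" by (rule sum.swap)
  also have "\<dots> \<le> (\<Sum>t\<in>T. \<Sum>b\<in>block t. (\<omega> t b - \<Sigma> b)\<^sup>2)"
  proof (rule sum_mono)
    fix t
    have "(\<Sum>b\<in>U. if b \<in> block t then (\<omega> t b - \<Sigma> b)\<^sup>2 else 0) = (\<Sum>b\<in>U \<inter> block t. (\<omega> t b - \<Sigma> b)\<^sup>2)"
      using finU by (simp add: sum.inter_restrict)
    also have "\<dots> \<le> (\<Sum>b\<in>block t. (\<omega> t b - \<Sigma> b)\<^sup>2)" using finb by (intro sum_mono2) auto
    finally show "(\<Sum>b\<in>U. if b \<in> block t then (\<omega> t b - \<Sigma> b)\<^sup>2 else 0) \<le> (\<Sum>b\<in>block t. (\<omega> t b - \<Sigma> b)\<^sup>2)" .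
  qed
  finally show ?thesis unfolding E_def by simp
qed

section \<open>Risk of the estimator\<close>

text \<open>For one block of side \<open>k0\<close>: in each entry the variance, the squared truncation bias and the noise variance.\<close>
definition center_risk :: "real \<Rightarrow> real \<Rightarrow> nat \<Rightarrow> real \<Rightarrow> nat \<Rightarrow> nat \<Rightarrow> real" where
  "center_risk K C1 n \<rho> k0 D =
     (real k0)\<^sup>2 * (64 * K ^ 4 / real n + (64 * K ^ 4 + 4)\<^sup>2 / real n
        + 18 * (K * sqrt (C1 * (real k0 + ln (real n)))) ^ 4 / ((\<rho> / 4) / (2 * real (D div k0)) * (real n)\<^sup>2))"

text \<open>For one block of side \<open>k\<close> with peeling radius \<open>a\<close> and budget \<open>\<rho>\<close>: \<open>q\<close> bounds the mean of the largest squared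
sampling deviation, \<open>(64 * K ^ 4 + 4)\<^sup>2 / n\<close> is the squared truncation bias, and \<open>\<tau>\<close> is the slack of
the selection.\<close>
definition outer_risk :: "real \<Rightarrow> real \<Rightarrow> nat \<Rightarrow> real \<Rightarrow> real \<Rightarrow> nat \<Rightarrow> real" where
  "outer_risk K L n a \<rho> k =
     (let r = peel_rank n k a \<rho>;
          \<tau> = 4 * L / real n * sqrt (real (k * r) / \<rho>) * ln (real k ^ 4 * real n);
          q = 2 * L\<^sup>2 * (ln (2 * (real k)\<^sup>2 * real n) + 2) / real n
      in 34 * real (k * r) * (q + (64 * K ^ 4 + 4)\<^sup>2 / real n) + real (k * r) * (peel_sigma n L k r \<rho>)\<^sup>2
         + 4 * real (k * r) * \<tau>\<^sup>2 + 4 * real k * (1 / real r - 1 / real k) * a\<^sup>2 + real k * a\<^sup>2 / real n)"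

definition scale_risk :: "real \<Rightarrow> real \<Rightarrow> real \<Rightarrow> real \<Rightarrow> nat \<Rightarrow> nat \<Rightarrow> real \<Rightarrow> nat \<Rightarrow> nat \<Rightarrow> real" where
  "scale_risk \<alpha> K C CG n d \<rho> k0 k =
     outer_risk K (C * K\<^sup>2 * ln (real n)) n (CG * real k powr - \<alpha>)
       (\<rho> / (4 * real (max 1 (pad_exp d k0 - 1)) * real (pad_dim d k0 div (2 * k)))) k"

definition total_risk :: "real \<Rightarrow> real \<Rightarrow> real \<Rightarrow> real \<Rightarrow> real \<Rightarrow> nat \<Rightarrow> nat \<Rightarrow> real \<Rightarrow> nat \<Rightarrow> real" where
  "total_risk \<alpha> K C C1 CG n d \<rho> k0 =
     (let D = pad_dim d k0 in
      2 / real d * (2 * real (D div k0) * center_risk K C1 n \<rho> k0 D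
        + (\<Sum>k\<in>outer_scales D k0. 3 * real (D div (2 * k)) * scale_risk \<alpha> K C CG n d \<rho> k0 k)))"

locale peel_model = subgauss P d K for P d K +
  fixes \<alpha> M0 M :: real and n :: nat
  assumes inP: "P \<in> class_P d \<alpha> K M0 M" and n: "n \<ge> 2" and M0: "M0 > 0" and M: "M > 0" and d: "d \<ge> 1"

sublocale peel_model \<subseteq> iid P n
  by unfold_locales (use n in auto)

context peel_model
begin

text \<open>The covariance matrix, extended by zero to the padded coordinates.\<close>
definition \<Sigma> :: "nat \<times> nat \<Rightarrow> real" where "\<Sigma> = (\<lambda>(i, j). \<integral>x. padded x i * padded x j \<partial>P)"

lemma \<Sigma>_sym: "\<Sigma> (i, j) = \<Sigma> (j, i)" by (simp add: \<Sigma>_def mult.commute)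

lemma \<Sigma>_cov: "i \<in> {1..d} \<Longrightarrow> j \<in> {1..d} \<Longrightarrow> \<Sigma> (i, j) = cov_mat P (i, j)"
  using inP unfolding class_P_def \<Sigma>_def cov_mat_def padded_def by simp

lemma \<Sigma>_zero: "i \<notin> {1..d} \<or> j \<notin> {1..d} \<Longrightarrow> \<Sigma> (i, j) = 0"
  unfolding \<Sigma>_def padded_def by auto

lemma class_G: "cov_mat P \<in> class_G d \<alpha> M0 M" using inP by (simp add: class_P_def)

lemma \<Sigma>_psd: assumes "d \<le> D" shows "psd_le D M0 \<Sigma>"
  unfolding psd_le_def
proof (intro allI)
  fix x :: "nat \<Rightarrow> real"
  have "quad_form D \<Sigma> x = (\<Sum>i=1..d. \<Sum>j=1..d. x i * cov_mat P (i, j) * x j)"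
    unfolding quad_form_def
  proof (rule sum.mono_neutral_cong_right)
    fix i assume "i \<in> {1..d}"
    thus "(\<Sum>j=1..D. x i * \<Sigma> (i, j) * x j) = (\<Sum>j=1..d. x i * cov_mat P (i, j) * x j)"
      using assms by (intro sum.mono_neutral_cong_right) (auto simp: \<Sigma>_zero \<Sigma>_cov)
  next
    show "\<forall>i\<in>{1..D} - {1..d}. (\<Sum>j=1..D. x i * \<Sigma> (i, j) * x j) = 0"
      by (intro ballI sum.neutral) (auto simp: \<Sigma>_zero)
  qed (use assms in auto)
  moreover have "0 \<le> (\<Sum>i=1..d. \<Sum>j=1..d. x i * cov_mat P (i, j) * x j)"
    "(\<Sum>i=1..d. \<Sum>j=1..d. x i * cov_mat P (i, j) * x j) \<le> M0 * (\<Sum>i=1..d. (x i)\<^sup>2)"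
    using class_G unfolding class_G_def by blast+
  moreover have "M0 * (\<Sum>i=1..d. (x i)\<^sup>2) \<le> M0 * (\<Sum>i=1..D. (x i)\<^sup>2)"
    using M0 assms by (intro mult_left_mono sum_mono2) auto
  ultimately show "0 \<le> quad_form D \<Sigma> x \<and> quad_form D \<Sigma> x \<le> M0 * (\<Sum>i=1..D. (x i)\<^sup>2)" by linarith
qed

lemma \<Sigma>_column:
  assumes "k \<ge> 1" "finite I" "\<And>i. i \<in> I \<Longrightarrow> i + k < j"
  shows "(\<Sum>i\<in>I. \<bar>\<Sigma> (i, j)\<bar>) \<le> M * real k powr - \<alpha>"
proof (cases "j \<in> {1..d}")
  case True
  have "(\<Sum>i\<in>I. \<bar>\<Sigma> (i, j)\<bar>) = (\<Sum>i\<in>I \<inter> {1..d}. \<bar>cov_mat P (i, j)\<bar>)"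
    using assms(2) True by (intro sum.mono_neutral_cong_right) (auto simp: \<Sigma>_zero \<Sigma>_cov)
  also have "\<dots> \<le> (\<Sum>i | i \<in> {1..d} \<and> \<bar>int i - int j\<bar> > int k. \<bar>cov_mat P (i, j)\<bar>)"
    using assms(3) by (intro sum_mono2) force+
  also have "\<dots> \<le> M * real k powr - \<alpha>" using class_G assms(1) True unfolding class_G_def by blast
  finally show ?thesis .
next
  case False
  hence "(\<Sum>i\<in>I. \<bar>\<Sigma> (i, j)\<bar>) = 0" by (intro sum.neutral) (auto simp: \<Sigma>_zero)
  thus ?thesis using M by simp
qed

lemma sets_PP: "sets PP = sets (data_space n d)"
  unfolding data_space_def by (intro sets_PiM_cong refl sets_P)

lemma pad_eq_padded: "pad d X m = padded (X m)" unfolding pad_def padded_def ..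

lemma center_block_mean_risk:
  assumes I: "finite I" "card I = k0" "I \<subseteq> {1..D}" and J: "finite J" "card J = k0" "J \<subseteq> {1..D}" and C1: "C1 \<ge> 8" and \<rho>: "\<rho>' > 0"
  defines "R \<equiv> K * sqrt (C1 * (real k0 + ln (real n)))"
  shows "(\<integral>\<^sup>+X. (\<integral>\<^sup>+Y. ennreal (\<Sum>b\<in>I \<times> J. (Y b - \<Sigma> b)\<^sup>2) \<partial>DPCovBlock n D (pad d X) I J \<rho>' R) \<partial>PP)
    \<le> ennreal ((real k0)\<^sup>2 * (64 * K ^ 4 / real n + (64 * K ^ 4 + 4)\<^sup>2 / real n + 18 * R ^ 4 / (\<rho>' * (real n)\<^sup>2)))"
proof -
  interpret Q: prob_space PP by (rule prob_PP)
  define v where "v = 18 * R ^ 4 / (\<rho>' * (real n)\<^sup>2)"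
  have v0: "v \<ge> 0" unfolding v_def using \<rho> by simp
  define f where "f b x = chi_vec R I (padded x) (fst b) * chi_vec R J (padded x) (snd b)" for b x
  have n1: "1 \<le> n" using n by simp
  have tr: "((\<integral>x. f b x \<partial>P) - \<Sigma> b)\<^sup>2 \<le> (64 * K ^ 4 + 4)\<^sup>2 / real n" "(\<integral>\<^sup>+x. ennreal ((f b x)\<^sup>2) \<partial>P) \<le> ennreal (64 * K ^ 4)"
    "f b \<in> borel_measurable P" if b: "b \<in> I \<times> J" for b
    using center_truncation[OF C1 n1 I(1,2) _ J(1,2), of "fst b" "snd b"] b
    unfolding f_def R_def \<Sigma>_def case_prod_unfold by auto
  have "(\<integral>\<^sup>+X. (\<integral>\<^sup>+Y. ennreal (\<Sum>b\<in>I \<times> J. (Y b - \<Sigma> b)\<^sup>2) \<partial>DPCovBlock n D (pad d X) I J \<rho>' R) \<partial>PP)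
     = (\<integral>\<^sup>+X. (\<Sum>b\<in>I \<times> J. ennreal (((1 / real n) * (\<Sum>m=1..n. f b (X m)) - \<Sigma> b)\<^sup>2) + ennreal v) \<partial>PP)"
  proof (intro nn_integral_cong)
    fix X
    have "(\<integral>\<^sup>+Y. ennreal (\<Sum>b\<in>I \<times> J. (Y b - \<Sigma> b)\<^sup>2) \<partial>DPCovBlock n D (pad d X) I J \<rho>' R)
       = ennreal (\<Sum>b\<in>I \<times> J. ((1 / real n) * (\<Sum>m=1..n. f b (X m)) - \<Sigma> b)\<^sup>2 + v)"
      unfolding DPCovBlock_risk[OF I(1,3) J(1,3) \<rho> n1] by (simp add: case_prod_unfold f_def pad_eq_padded v_def)
    also have "\<dots> = (\<Sum>b\<in>I \<times> J. ennreal (((1 / real n) * (\<Sum>m=1..n. f b (X m)) - \<Sigma> b)\<^sup>2 + v))"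
      by (rule sum_ennreal[symmetric]) (simp add: v0)
    also have "\<dots> = (\<Sum>b\<in>I \<times> J. ennreal (((1 / real n) * (\<Sum>m=1..n. f b (X m)) - \<Sigma> b)\<^sup>2) + ennreal v)"
      by (intro sum.cong refl ennreal_plus v0) simp
    finally show "(\<integral>\<^sup>+Y. ennreal (\<Sum>b\<in>I \<times> J. (Y b - \<Sigma> b)\<^sup>2) \<partial>DPCovBlock n D (pad d X) I J \<rho>' R)
       = (\<Sum>b\<in>I \<times> J. ennreal (((1 / real n) * (\<Sum>m=1..n. f b (X m)) - \<Sigma> b)\<^sup>2) + ennreal v)" .
  qed
  also have "\<dots> = (\<Sum>b\<in>I \<times> J. (\<integral>\<^sup>+X. ennreal (((1 / real n) * (\<Sum>m=1..n. f b (X m)) - \<Sigma> b)\<^sup>2) \<partial>PP) + ennreal v)"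
  proof -
    have m: "(\<lambda>X. ennreal (((1 / real n) * (\<Sum>m=1..n. f b (X m)) - \<Sigma> b)\<^sup>2)) \<in> borel_measurable PP" if "b \<in> I \<times> J" for b
      by (intro measurable_compose[OF _ measurable_ennreal] borel_measurable_power borel_measurable_diff borel_measurable_times borel_measurable_sum borel_measurable_const comp_measurable tr(3) that)
    show ?thesis
      by (subst nn_integral_sum) (use m in \<open>auto simp: nn_integral_add Q.emeasure_space_1[simplified]\<close>)
  qed
  also have "\<dots> \<le> (\<Sum>b\<in>I \<times> J. ennreal (64 * K ^ 4 / real n + (64 * K ^ 4 + 4)\<^sup>2 / real n) + ennreal v)"
  proof (intro sum_mono add_right_mono)
    fix b assume b: "b \<in> I \<times> J"
    have "(\<integral>\<^sup>+X. ennreal (((1 / real n) * (\<Sum>m=1..n. f b (X m)) - \<Sigma> b)\<^sup>2) \<partial>PP) \<le> ennreal (64 * K ^ 4 / real n + ((\<integral>x. f b x \<partial>P) - \<Sigma> b)\<^sup>2)"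
      by (rule mean_sq_dev[OF tr(3,2)[OF b]]) simp
    also have "\<dots> \<le> ennreal (64 * K ^ 4 / real n + (64 * K ^ 4 + 4)\<^sup>2 / real n)"
      by (intro ennreal_leI add_left_mono tr(1) b)
    finally show "(\<integral>\<^sup>+X. ennreal (((1 / real n) * (\<Sum>m=1..n. f b (X m)) - \<Sigma> b)\<^sup>2) \<partial>PP) \<le> ennreal (64 * K ^ 4 / real n + (64 * K ^ 4 + 4)\<^sup>2 / real n)" .
  qed
  also have "\<dots> = (\<Sum>b\<in>I \<times> J. ennreal (64 * K ^ 4 / real n + (64 * K ^ 4 + 4)\<^sup>2 / real n + v))"
    by (intro sum.cong refl ennreal_plus[symmetric] v0) simp
  also have "\<dots> = ennreal (\<Sum>b\<in>I \<times> J. 64 * K ^ 4 / real n + (64 * K ^ 4 + 4)\<^sup>2 / real n + v)"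
    by (rule sum_ennreal) (simp add: v0)
  also have "\<dots> = ennreal ((real k0)\<^sup>2 * (64 * K ^ 4 / real n + (64 * K ^ 4 + 4)\<^sup>2 / real n + v))"
    using I J by (simp add: card_cartesian_product power2_eq_square)
  finally show ?thesis unfolding v_def .
qed

text \<open>The bound for fixed data is affine in \<open>\<eta>\<^sup>2\<close>, where \<open>\<eta>\<close> bounds the errors of the clipped means over the block;
\<open>\<eta>\<^sup>2\<close> is at most twice the largest squared sampling deviation plus twice the squared truncation bias.\<close>
lemma outer_block_mean_risk:
  assumes I: "finite I" "card I = k" and J: "finite J" "card J = k" and k: "k \<ge> 1"
    and far: "\<forall>i\<in>I. \<forall>j\<in>J. i + k < j" and C: "C \<ge> 4" and \<rho>: "\<rho>' > 0" and CG: "CG \<ge> M"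
  defines "L \<equiv> C * K\<^sup>2 * ln (real n)" and "a \<equiv> CG * real k powr - \<alpha>"
  shows "(\<integral>\<^sup>+X. (\<integral>\<^sup>+Y. ennreal (\<Sum>b\<in>I \<times> J. (Y b - \<Sigma> b)\<^sup>2) \<partial>peel_release n L (pad d X) k I J a \<rho>') \<partial>PP)
    \<le> ennreal (outer_risk K L n a \<rho>' k)"
proof -
  interpret Q: prob_space PP by (rule prob_PP)
  have n1: "1 \<le> n" using n by simp
  have nn: "real n > 0" using n by simp
  have L: "L > 0" unfolding L_def using C K n by simp
  have a: "a \<ge> 0" unfolding a_def using CG M by simp
  have col: "(\<Sum>i\<in>I. \<bar>\<Sigma> (i, j)\<bar>) \<le> a" if "j \<in> J" for j
  proof -
    have "(\<Sum>i\<in>I. \<bar>\<Sigma> (i, j)\<bar>) \<le> M * real k powr - \<alpha>" using far that by (intro \<Sigma>_column k I) auto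
    also have "\<dots> \<le> a" unfolding a_def using CG by (intro mult_right_mono) auto
    finally show ?thesis .
  qed
  define r where "r = peel_rank n k a \<rho>'"
  define \<tau> where "\<tau> = 4 * L / real n * sqrt (real (k * r) / \<rho>') * ln (real k ^ 4 * real n)"
  define q where "q = 2 * L\<^sup>2 * (ln (2 * (real k)\<^sup>2 * real n) + 2) / real n"
  define \<beta> where "\<beta> = (64 * K ^ 4 + 4)\<^sup>2 / real n"
  define s2 where "s2 = (peel_sigma n L k r \<rho>')\<^sup>2"
  have r: "1 \<le> r" "r \<le> k" using peel_rank_in[OF k, of n a \<rho>'] by (auto simp: r_def)
  have inv: "1 / real k \<le> 1 / real r" using r by (intro divide_left_mono) auto
  have \<beta>0: "\<beta> \<ge> 0" by (simp add: \<beta>_def)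
  define f where "f b x = chi L (padded x (fst b) * padded x (snd b))" for b x
  have fm: "f b \<in> borel_measurable P" for b
    using outer_truncation(2)[OF C n, of "fst b" "snd b"] unfolding f_def L_def .
  have bias: "((\<integral>x. f b x \<partial>P) - \<Sigma> b)\<^sup>2 \<le> \<beta>" for b
    using outer_truncation(1)[OF C n, of "fst b" "snd b"] unfolding f_def L_def \<Sigma>_def \<beta>_def case_prod_unfold .
  have cB: "finite (I \<times> J)" "card (I \<times> J) = k * k" using I J by (auto simp: card_cartesian_product)
  have cB1: "card (I \<times> J) \<ge> 1" using k by (simp add: cB)
  obtain Qf where Qm: "Qf \<in> borel_measurable PP" and Q0: "\<And>X. Qf X \<ge> 0"
    and Qb: "\<And>X b. X \<in> space PP \<Longrightarrow> b \<in> I \<times> J \<Longrightarrow> ((1 / real n) * (\<Sum>m=1..n. f b (X m)) - (\<integral>x. f b x \<partial>P))\<^sup>2 \<le> Qf X"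
    and QI: "(\<integral>\<^sup>+X. ennreal (Qf X) \<partial>PP) \<le> ennreal (2 * L\<^sup>2 * (ln (2 * real (card (I \<times> J)) * real n) + 2) / real n)"
  proof -
    have fb: "\<bar>f b x\<bar> \<le> L" for b x unfolding f_def using L by (intro chi_bound) simp
    show ?thesis using uniform_deviation[where f=f, OF cB(1) cB1 fm L fb] that by blast
  qed
  have QI: "(\<integral>\<^sup>+X. ennreal (Qf X) \<partial>PP) \<le> ennreal q"
    using QI unfolding q_def cB by (simp add: power2_eq_square)
  define c0 where "c0 = 34 * real (k * r) * \<beta> + real (k * r) * s2 + 4 * real (k * r) * \<tau>\<^sup>2 + 4 * real k * (1 / real r - 1 / real k) * a\<^sup>2 + real k * a\<^sup>2 / real n"
  have c00: "c0 \<ge> 0" unfolding c0_def s2_def using inv \<beta>0 by (intro add_nonneg_nonneg mult_nonneg_nonneg divide_nonneg_nonneg) auto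
  define c1 where "c1 = 34 * real (k * r)"
  have c10: "c1 \<ge> 0" by (simp add: c1_def)
  have q0: "q \<ge> 0"
  proof -
    have "(real k)\<^sup>2 \<ge> 1" using k by (simp add: one_le_power)
    hence "1 * 1 \<le> 2 * (real k)\<^sup>2 * real n" using n1 by (intro mult_mono) auto
    hence "ln (2 * (real k)\<^sup>2 * real n) \<ge> 0" by simp
    thus ?thesis unfolding q_def by simp
  qed
  have pt: "(\<integral>\<^sup>+Y. ennreal (\<Sum>b\<in>I \<times> J. (Y b - \<Sigma> b)\<^sup>2) \<partial>peel_release n L (pad d X) k I J a \<rho>') \<le> ennreal c1 * ennreal (Qf X) + ennreal c0"
    if X: "X \<in> space PP" for X
  proof -
    define \<eta> where "\<eta> = sqrt (2 * Qf X + 2 * \<beta>)"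
    have \<eta>2: "\<eta>\<^sup>2 = 2 * Qf X + 2 * \<beta>" unfolding \<eta>_def using Q0[of X] \<beta>0 by simp
    have \<eta>0: "\<eta> \<ge> 0" unfolding \<eta>_def using Q0[of X] \<beta>0 by simp
    have dev: "\<bar>clipped_mean n L (pad d X) b - \<Sigma> b\<bar> \<le> \<eta>" if b: "b \<in> I \<times> J" for b
    proof -
      define u where "u = (1 / real n) * (\<Sum>m=1..n. f b (X m))"
      have cm: "clipped_mean n L (pad d X) b = u" unfolding clipped_mean_def u_def f_def case_prod_unfold pad_eq_padded ..
      have "(u - \<Sigma> b)\<^sup>2 = ((u - (\<integral>x. f b x \<partial>P)) + ((\<integral>x. f b x \<partial>P) - \<Sigma> b))\<^sup>2" by simp
      also have "\<dots> \<le> 2 * (u - (\<integral>x. f b x \<partial>P))\<^sup>2 + 2 * ((\<integral>x. f b x \<partial>P) - \<Sigma> b)\<^sup>2"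
        using sum_squares_bound[of "u - (\<integral>x. f b x \<partial>P)" "(\<integral>x. f b x \<partial>P) - \<Sigma> b"] unfolding power2_sum by linarith
      also have "\<dots> \<le> 2 * Qf X + 2 * \<beta>" using Qb[OF X b] bias[of b] unfolding u_def by linarith
      finally show ?thesis unfolding cm \<eta>_def by (intro real_le_rsqrt) simp
    qed
    have "(2 * \<eta> + \<tau>)\<^sup>2 \<le> 8 * \<eta>\<^sup>2 + 2 * \<tau>\<^sup>2"
      using sum_squares_bound[of "2 * \<eta>" \<tau>] by (simp add: power2_sum power_mult_distrib)
    hence "2 * real k * real r * (2 * \<eta> + \<tau>)\<^sup>2 \<le> 2 * real k * real r * (8 * \<eta>\<^sup>2 + 2 * \<tau>\<^sup>2)" by (intro mult_left_mono) auto
    hence le: "real (k * r) * (\<eta>\<^sup>2 + s2) + (4 * real k * (1 / real r - 1 / real k) * a\<^sup>2 + 2 * real k * real r * (2 * \<eta> + \<tau>)\<^sup>2) + real k * a\<^sup>2 / real n \<le> c1 * Qf X + c0"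
      unfolding c1_def c0_def \<eta>2 by (simp add: algebra_simps)
    have "(\<integral>\<^sup>+Y. ennreal (\<Sum>b\<in>I \<times> J. (Y b - \<Sigma> b)\<^sup>2) \<partial>peel_release n L (pad d X) k I J a \<rho>') \<le>
       ennreal (real (k * r) * (\<eta>\<^sup>2 + s2) + (4 * real k * (1 / real r - 1 / real k) * a\<^sup>2 + 2 * real k * real r * (2 * \<eta> + \<tau>)\<^sup>2) + real k * a\<^sup>2 / real n)"
      unfolding r_def s2_def \<tau>_def by (rule peel_release_risk[OF I J k n1 \<rho> L a col dev])
    also have "\<dots> \<le> ennreal (c1 * Qf X + c0)" by (rule ennreal_leI[OF le])
    also have "\<dots> = ennreal c1 * ennreal (Qf X) + ennreal c0"
      using c10 c00 Q0[of X] by (simp add: ennreal_mult'[symmetric])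
    finally show ?thesis .
  qed
  have "(\<integral>\<^sup>+X. (\<integral>\<^sup>+Y. ennreal (\<Sum>b\<in>I \<times> J. (Y b - \<Sigma> b)\<^sup>2) \<partial>peel_release n L (pad d X) k I J a \<rho>') \<partial>PP)
     \<le> (\<integral>\<^sup>+X. ennreal c1 * ennreal (Qf X) + ennreal c0 \<partial>PP)"
    by (intro nn_integral_mono pt)
  also have "\<dots> = ennreal c1 * (\<integral>\<^sup>+X. ennreal (Qf X) \<partial>PP) + ennreal c0"
    using Qm Q.emeasure_space_1 by (subst nn_integral_add) (auto simp: nn_integral_cmult)
  also have "\<dots> \<le> ennreal c1 * ennreal q + ennreal c0" by (intro add_right_mono mult_left_mono QI) auto
  also have "\<dots> = ennreal (c1 * q + c0)" using c10 c00 q0 by (simp add: ennreal_mult'[symmetric])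
  also have "c1 * q + c0 = outer_risk K L n a \<rho>' k"
    unfolding outer_risk_def Let_def c1_def c0_def r_def[symmetric] \<tau>_def[symmetric] q_def[symmetric] \<beta>_def[symmetric] s2_def[symmetric]
    by (simp add: algebra_simps)
  finally show ?thesis .
qed

text \<open>The clip does not increase the distance to the covariance matrix, which is a fixed point of it; \<open>assemble_error\<close>
reduces the remaining error to the blocks, and the error of each block depends on its own release only.\<close>
theorem risk_bound:
  assumes k0: "k0 \<ge> 1" and \<rho>: "\<rho> > 0" and CG: "CG \<ge> M" and C: "C \<ge> 4" and C1: "C1 \<ge> 8"
  shows "frob_risk n d (peel_estimator \<alpha> K M0 C C1 CG n d \<rho> k0) P \<le> ennreal (total_risk \<alpha> K C C1 CG n d \<rho> k0)"
proof -
  define D where "D = pad_dim d k0"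
  define J where "J = pad_exp d k0"
  have DJ: "D = 2 ^ J * k0" by (simp add: D_def J_def pad_dim_def)
  have dD: "d \<le> D" unfolding D_def by (rule pad_dim_ge[OF k0])
  define T where "T = center_blocks D k0 \<union> outer_blocks D k0"
  have finC: "finite (center_blocks D k0)" by (rule finite_center_blocks)
  have finO: "finite (outer_blocks D k0)" unfolding DJ by (rule finite_outer_blocks[OF k0])
  have finT: "finite T" unfolding T_def using finC finO by simp
  let ?K = "\<lambda>t X. block_release \<alpha> K C C1 CG n d \<rho> k0 X t"
  let ?f = "\<lambda>\<omega>. restrict (spectral_clip D M0 (assemble T \<omega>)) (idx d)"
  have Km: "?K t \<in> data_space n d \<rightarrow>\<^sub>M prob_algebra (mat_space (block t))" if "t \<in> T" for t
    using that k0 unfolding T_def D_def by (intro measurable_block_release)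
  have Kp: "prob_space (?K t X)" "sets (?K t X) = sets (mat_space (block t))" if "t \<in> T" "X \<in> space (data_space n d)" for t X
    using measurable_space[OF Km[OF that(1)] that(2)] by (auto simp: space_prob_algebra)
  have fm: "?f \<in> PiM T (\<lambda>t. mat_space (block t)) \<rightarrow>\<^sub>M mat_space (idx d)"
    unfolding D_def using M0 by (intro measurable_postprocess k0 finT) simp
  have est: "peel_estimator \<alpha> K M0 C C1 CG n d \<rho> k0 X = distr (PiM T (\<lambda>t. ?K t X)) (mat_space (idx d)) ?f" for X
    unfolding peel_estimator_def Let_def T_def D_def by simp
  have spPP: "space PP = space (data_space n d)" by (rule sets_eq_imp_space_eq[OF sets_PP])
  have finb: "finite (block t)" for t by (cases t) (simp add: block_def finite_seg)
  define err where "err t Y = ennreal (\<Sum>b\<in>block t. (Y b - \<Sigma> b)\<^sup>2)" for t and Y :: "nat \<times> nat \<Rightarrow> real"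
  have errm: "err t \<in> borel_measurable (mat_space (block t))" for t unfolding err_def by (rule measurable_block_sq[OF finb])
  define Rt where "Rt t X = (\<integral>\<^sup>+Y. err t Y \<partial>?K t X)" for t X
  have Rm: "Rt t \<in> borel_measurable PP" if "t \<in> T" for t
    unfolding Rt_def measurable_cong_sets[OF sets_PP refl]
    by (rule measurable_compose[OF measurable_prob_algebraD[OF Km[OF that]] nn_integral_measurable_subprob_algebra[OF errm]])
  have inner: "(\<integral>\<^sup>+S. ennreal ((frob_norm d (\<lambda>b. S b - cov_mat P b))\<^sup>2) \<partial>peel_estimator \<alpha> K M0 C C1 CG n d \<rho> k0 X) \<le> 2 * (\<Sum>t\<in>T. Rt t X)"
    if X: "X \<in> space PP" for X
  proof -
    have Xd: "X \<in> space (data_space n d)" using X spPP by simp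
    have setsK: "sets (PiM T (\<lambda>t. ?K t X)) = sets (PiM T (\<lambda>t. mat_space (block t)))"
      using Kp(2)[OF _ Xd] by (intro sets_PiM_cong) auto
    have fm': "?f \<in> PiM T (\<lambda>t. ?K t X) \<rightarrow>\<^sub>M mat_space (idx d)" using fm unfolding measurable_cong_sets[OF setsK refl] .
    have frob: "(frob_norm d A)\<^sup>2 = (\<Sum>b\<in>idx d. (A b)\<^sup>2)" for A unfolding frob_norm_def L2_set_def by (simp add: sum_nonneg)
    have mm: "(\<lambda>S. ennreal ((frob_norm d (\<lambda>b. S b - cov_mat P b))\<^sup>2)) \<in> borel_measurable (mat_space (idx d))"
      unfolding frob by (rule measurable_block_sq) simp
    have "(\<integral>\<^sup>+S. ennreal ((frob_norm d (\<lambda>b. S b - cov_mat P b))\<^sup>2) \<partial>peel_estimator \<alpha> K M0 C C1 CG n d \<rho> k0 X)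
       = (\<integral>\<^sup>+\<omega>. ennreal ((frob_norm d (\<lambda>b. ?f \<omega> b - cov_mat P b))\<^sup>2) \<partial>PiM T (\<lambda>t. ?K t X))"
      unfolding est by (subst nn_integral_distr[OF fm']) (use mm in auto)
    also have "\<dots> \<le> (\<integral>\<^sup>+\<omega>. 2 * (\<Sum>t\<in>T. err t (\<omega> t)) \<partial>PiM T (\<lambda>t. ?K t X))"
    proof (intro nn_integral_mono)
      fix \<omega>
      have clip: "is_clip D M0 (assemble T \<omega>) (spectral_clip D M0 (assemble T \<omega>))"
        using M0 by (intro is_clip_spectral_clip assemble_sym) simp
      have "(frob_norm d (\<lambda>b. ?f \<omega> b - cov_mat P b))\<^sup>2 = (\<Sum>b\<in>idx d. (spectral_clip D M0 (assemble T \<omega>) b - \<Sigma> b)\<^sup>2)"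
        unfolding frob by (intro sum.cong refl) (auto simp: \<Sigma>_cov)
      also have "\<dots> \<le> (\<Sum>b\<in>idx D. (spectral_clip D M0 (assemble T \<omega>) b - \<Sigma> b)\<^sup>2)"
        using dD by (intro sum_mono2) auto
      also have "\<dots> \<le> (\<Sum>b\<in>idx D. (assemble T \<omega> b - \<Sigma> b)\<^sup>2)"
        using M0 by (intro obtuse_contract is_clip_obtuse[OF clip \<Sigma>_psd[OF dD]]) simp
      also have "\<dots> \<le> 2 * (\<Sum>t\<in>T. \<Sum>b\<in>block t. (\<omega> t b - \<Sigma> b)\<^sup>2)"
        unfolding T_def DJ by (rule assemble_error[where \<Sigma>=\<Sigma>, OF k0 \<Sigma>_sym])
      finally have "ennreal ((frob_norm d (\<lambda>b. ?f \<omega> b - cov_mat P b))\<^sup>2) \<le> ennreal (2 * (\<Sum>t\<in>T. \<Sum>b\<in>block t. (\<omega> t b - \<Sigma> b)\<^sup>2))" by (rule ennreal_leI)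
      also have "\<dots> = 2 * (\<Sum>t\<in>T. err t (\<omega> t))" unfolding err_def by (simp add: ennreal_mult' sum_ennreal sum_nonneg)
      finally show "ennreal ((frob_norm d (\<lambda>b. ?f \<omega> b - cov_mat P b))\<^sup>2) \<le> 2 * (\<Sum>t\<in>T. err t (\<omega> t))" .
    qed
    also have "\<dots> = 2 * (\<Sum>t\<in>T. (\<integral>\<^sup>+\<omega>. err t (\<omega> t) \<partial>PiM T (\<lambda>t. ?K t X)))"
    proof -
      have cm: "(\<lambda>\<omega>. err t (\<omega> t)) \<in> borel_measurable (PiM T (\<lambda>t. ?K t X))" if "t \<in> T" for t
        by (rule measurable_compose[OF measurable_component_singleton[OF that]])
           (use errm in \<open>simp add: measurable_cong_sets[OF Kp(2)[OF that Xd] refl]\<close>)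
      show ?thesis by (subst nn_integral_cmult) (use cm in \<open>auto simp: nn_integral_sum\<close>)
    qed
    also have "\<dots> = 2 * (\<Sum>t\<in>T. Rt t X)"
    proof (intro arg_cong[where f="(*) 2"] sum.cong refl)
      fix t assume t: "t \<in> T"
      have "distr (PiM T (\<lambda>t. ?K t X)) (?K t X) (\<lambda>\<omega>. \<omega> t) = ?K t X"
        by (rule distr_PiM_component) (use Kp(1)[OF _ Xd] t in auto)
      hence "Rt t X = (\<integral>\<^sup>+Y. err t Y \<partial>distr (PiM T (\<lambda>t. ?K t X)) (?K t X) (\<lambda>\<omega>. \<omega> t))" unfolding Rt_def by simp
      also have "\<dots> = (\<integral>\<^sup>+\<omega>. err t (\<omega> t) \<partial>PiM T (\<lambda>t. ?K t X))"
        by (subst nn_integral_distr[OF measurable_component_singleton[OF t]])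
           (use errm in \<open>auto simp: measurable_cong_sets[OF Kp(2)[OF t Xd] refl]\<close>)
      finally show "(\<integral>\<^sup>+\<omega>. err t (\<omega> t) \<partial>PiM T (\<lambda>t. ?K t X)) = Rt t X" ..
    qed
    finally show ?thesis .
  qed
  define cr where "cr = center_risk K C1 n \<rho> k0 D"
  define orr where "orr k = scale_risk \<alpha> K C CG n d \<rho> k0 k" for k
  have orr: "orr k = outer_risk K (C * K\<^sup>2 * ln (real n)) n (CG * real k powr - \<alpha>) (\<rho> / (4 * real (max 1 (J - 1)) * real (D div (2 * k)))) k" for k
    unfolding orr_def scale_risk_def J_def D_def ..
  \<comment> \<open>The maximum with zero makes the bound nonnegative also for scales that do not occur.\<close>
  define g where "g = (\<lambda>(k, l::nat, r). if r \<le> (1::nat) then max 0 cr else max 0 (orr k) :: real)"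
  have g0: "g t \<ge> 0" for t by (cases t) (auto simp: g_def)
  have DK: "D div k0 \<ge> 1" using DJ k0 by simp
  have RtI: "(\<integral>\<^sup>+X. Rt t X \<partial>PP) \<le> ennreal (g t)" if t: "t \<in> T" for t
  proof -
    obtain k l r where tt: "t = (k, l, r)" by (cases t)
    show ?thesis
    proof (cases "r \<le> 1")
      case True
      hence "(k, l, r) \<in> center_blocks D k0"
        using t outer_block_geom(2)[of k l r J k0] k0 by (auto simp: tt T_def DJ)
      note ge = center_block_geom[OF this k0]
      have "\<rho> / 4 / (2 * real (D div k0)) > 0" using \<rho> DK by (intro divide_pos_pos mult_pos_pos) auto
      from center_block_mean_risk[OF finite_seg _ ge(4) finite_seg _ ge(5) C1 this] ge(1,3)
      have "(\<integral>\<^sup>+X. Rt t X \<partial>PP) \<le> ennreal cr"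
        unfolding Rt_def err_def tt block_release_def Let_def case_prod_conv block_def cr_def center_risk_def D_def[symmetric] using True
        by (simp add: card_seg)
      also have "\<dots> \<le> ennreal (g t)" unfolding g_def tt using True by (auto intro: ennreal_leI)
      finally show ?thesis .
    next
      case False
      hence o: "(k, l, r) \<in> outer_blocks D k0"
        using t center_block_geom(2)[of k l r D k0] k0 by (auto simp: tt T_def)
      note ge = outer_block_geom[OF o[unfolded DJ] k0]
      obtain q where q: "D = 2 * k * q" "q \<ge> 2" "k \<ge> k0"
        using ge(1) unfolding DJ[symmetric] by (metis DJ outer_scale_dvd[OF k0])
      hence "D div (2 * k) = q" using k0 by simp
      hence "\<rho> / (4 * real (max 1 (J - 1)) * real (D div (2 * k))) > 0" using \<rho> q by (intro divide_pos_pos mult_pos_pos) auto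
      from outer_block_mean_risk[OF finite_seg _ finite_seg _ ge(4) ge(7) C this CG] ge(3)
      have "(\<integral>\<^sup>+X. Rt t X \<partial>PP) \<le> ennreal (orr k)"
        unfolding Rt_def err_def tt block_release_def Let_def case_prod_conv block_def orr D_def[symmetric] J_def[symmetric] using False
        by (simp add: card_seg)
      also have "\<dots> \<le> ennreal (g t)" unfolding g_def tt using False by (auto intro: ennreal_leI)
      finally show ?thesis .
    qed
  qed
  have cr0: "cr \<ge> 0" unfolding cr_def center_risk_def using \<rho> by (intro mult_nonneg_nonneg add_nonneg_nonneg divide_nonneg_nonneg) auto
  have or0: "orr k \<ge> 0" if kk: "k \<in> outer_scales D k0" for k
  proof -
    obtain q where q: "D = 2 * k * q" "q \<ge> 2" "k \<ge> k0" using kk unfolding DJ by (rule outer_scale_dvd[OF k0])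
    have k1: "k \<ge> 1" using q k0 by simp
    have "(real k)\<^sup>2 \<ge> 1" using k1 by (simp add: one_le_power)
    hence arg: "1 * 1 \<le> 2 * (real k)\<^sup>2 * real n" using n by (intro mult_mono) auto
    hence l0: "ln (2 * (real k)\<^sup>2 * real n) \<ge> 0" by simp
    have inv: "1 / real k \<le> 1 / real (peel_rank n k a \<rho>'')" for a \<rho>''
      using peel_rank_in[OF k1, of n a \<rho>''] by (intro divide_left_mono) auto
    show ?thesis unfolding orr outer_risk_def Let_def using l0 inv
      by (intro add_nonneg_nonneg mult_nonneg_nonneg divide_nonneg_nonneg) auto
  qed
  have sumg: "(\<Sum>t\<in>T. g t) \<le> 2 * real (D div k0) * cr + (\<Sum>k\<in>outer_scales D k0. 3 * real (D div (2 * k)) * orr k)"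
  proof -
    have "(\<Sum>t\<in>T. g t) \<le> (\<Sum>t\<in>center_blocks D k0. g t) + (\<Sum>t\<in>outer_blocks D k0. g t)"
      unfolding T_def using g0 finC finO by (subst sum.union_inter[symmetric]) (auto intro: sum_nonneg)
    also have "(\<Sum>t\<in>center_blocks D k0. g t) = (\<Sum>t\<in>center_blocks D k0. cr)"
      using center_block_geom(2)[OF _ k0] cr0 by (intro sum.cong refl) (auto simp: g_def)
    also have "\<dots> = real (card (center_blocks D k0)) * cr" by simp
    also have "\<dots> \<le> 2 * real (D div k0) * cr" using card_center_blocks[of D k0] cr0 by (intro mult_right_mono) linarith+
    also have "(\<Sum>t\<in>outer_blocks D k0. g t) = (\<Sum>t\<in>outer_blocks D k0. case t of (k, l, r) \<Rightarrow> max 0 (orr k))"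
      using outer_block_geom(2)[OF _ k0, of _ _ _ J] unfolding DJ by (intro sum.cong refl) (fastforce simp: g_def)
    also have "\<dots> \<le> (\<Sum>k\<in>outer_scales D k0. 3 * real (D div (2 * k)) * max 0 (orr k))"
      unfolding DJ by (rule sum_outer_blocks_le[OF k0]) (auto split: prod.split)
    also have "\<dots> = (\<Sum>k\<in>outer_scales D k0. 3 * real (D div (2 * k)) * orr k)"
      using or0 by (intro sum.cong refl) (simp add: max_def)
    finally show ?thesis by simp
  qed
  have "(\<integral>\<^sup>+X. (\<integral>\<^sup>+S. ennreal ((frob_norm d (\<lambda>b. S b - cov_mat P b))\<^sup>2) \<partial>peel_estimator \<alpha> K M0 C C1 CG n d \<rho> k0 X) \<partial>PP)
     \<le> (\<integral>\<^sup>+X. 2 * (\<Sum>t\<in>T. Rt t X) \<partial>PP)" by (intro nn_integral_mono inner)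
  also have "\<dots> = 2 * (\<Sum>t\<in>T. (\<integral>\<^sup>+X. Rt t X \<partial>PP))"
    by (subst nn_integral_cmult) (use Rm in \<open>auto simp: nn_integral_sum\<close>)
  also have "\<dots> \<le> 2 * (\<Sum>t\<in>T. ennreal (g t))" by (intro mult_left_mono sum_mono RtI) auto
  also have "\<dots> = ennreal (2 * (\<Sum>t\<in>T. g t))" by (simp add: ennreal_mult' sum_ennreal g0)
  also have "\<dots> \<le> ennreal (2 * (2 * real (D div k0) * cr + (\<Sum>k\<in>outer_scales D k0. 3 * real (D div (2 * k)) * orr k)))"
    by (intro ennreal_leI mult_left_mono sumg) simp
  finally have "frob_risk n d (peel_estimator \<alpha> K M0 C C1 CG n d \<rho> k0) P \<le>
     ennreal (1 / real d) * ennreal (2 * (2 * real (D div k0) * cr + (\<Sum>k\<in>outer_scales D k0. 3 * real (D div (2 * k)) * orr k)))"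
    unfolding frob_risk_def by (intro mult_left_mono) auto
  also have "\<dots> = ennreal (2 / real d * (2 * real (D div k0) * cr + (\<Sum>k\<in>outer_scales D k0. 3 * real (D div (2 * k)) * orr k)))"
    by (simp add: ennreal_mult'[symmetric])
  finally show ?thesis unfolding total_risk_def Let_def cr_def orr_def D_def .
qed

end

section \<open>Rates\<close>

text \<open>If the target size is \<open>d / 2\<close>, both minima in the rate are of the order of their second arguments. Otherwise
one of the two other terms attains the minimum that defines the target; call it \<open>u\<close> (sampling) or
\<open>w\<close> (privacy). Its power with exponent \<open>- (2 * \<alpha> + 1)\<close> is exactly the first argument of the
corresponding minimum, and this argument is the smaller one, since \<open>u\<close> or \<open>w\<close> is at most \<open>d / 2\<close>.\<close>
lemma target_rate:
  fixes \<alpha> \<rho> :: real and n d :: nat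
  assumes \<alpha>: "\<alpha> > 0" and \<rho>: "\<rho> > 0" and n: "n \<ge> 1" and d: "d \<ge> 1"
  defines "x \<equiv> real d / (\<rho> * (real n)\<^sup>2)" and "t \<equiv> k0_target \<alpha> n d \<rho>"
  shows "t > 0" "t / real n + x * t\<^sup>2 \<le> rate \<alpha> n d \<rho>"
    "real d / real n + x * (real d)\<^sup>2 \<le> 4 * rate \<alpha> n d \<rho> \<or> t powr (- (2 * \<alpha> + 1)) \<le> rate \<alpha> n d \<rho>"
proof -
  have nn: "real n > 0" and dd: "real d > 0" using n d by auto
  have x: "x > 0" unfolding x_def using \<rho> nn dd by simp
  define a b where "a = 1 / (2 * \<alpha> + 2)" and "b = 1 / (2 * \<alpha> + 3)"
  define u where "u = real n powr a"
  define w where "w = x powr (- b)"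
  have t: "t = min (real d / 2) (min u w)" unfolding t_def k0_target_def u_def w_def x_def a_def b_def by simp
  have uw: "u > 0" "w > 0" unfolding u_def w_def using nn x by auto
  show t0: "t > 0" unfolding t using dd uw by simp
  define e1 where "e1 = real n powr (- (2 * \<alpha> + 1) / (2 * \<alpha> + 2))"
  define e2 where "e2 = x powr ((2 * \<alpha> + 1) / (2 * \<alpha> + 3))"
  have e1: "u / real n = e1"
  proof -
    have "a - 1 = - (2 * \<alpha> + 1) / (2 * \<alpha> + 2)" unfolding a_def using \<alpha> by (simp add: field_simps)
    moreover have "u / real n = real n powr (a - 1)" unfolding u_def using nn by (simp add: powr_diff)
    ultimately show ?thesis unfolding e1_def by simp
  qed
  have e2: "x * w\<^sup>2 = e2"
  proof -
    have "1 + (- b) * 2 = (2 * \<alpha> + 1) / (2 * \<alpha> + 3)" unfolding b_def using \<alpha> by (simp add: field_simps)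
    moreover have "x * w\<^sup>2 = x powr 1 * x powr (- b * 2)" unfolding w_def using x by (simp add: power2_eq_square powr_add[symmetric] mult.commute)
    ultimately show ?thesis unfolding e2_def powr_add[symmetric] by simp
  qed
  have u1: "u powr (- (2 * \<alpha> + 1)) = e1"
  proof -
    have "a * (- (2 * \<alpha> + 1)) = - (2 * \<alpha> + 1) / (2 * \<alpha> + 2)" unfolding a_def by simp
    thus ?thesis unfolding u_def e1_def powr_powr by simp
  qed
  have w1: "w powr (- (2 * \<alpha> + 1)) = e2"
  proof -
    have "- b * (- (2 * \<alpha> + 1)) = b * (2 * \<alpha> + 1)" by (rule minus_mult_minus)
    hence "- b * (- (2 * \<alpha> + 1)) = (2 * \<alpha> + 1) / (2 * \<alpha> + 3)" unfolding b_def by simp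
    thus ?thesis unfolding w_def e2_def powr_powr by simp
  qed
  have d3: "(real d) ^ 3 / (\<rho> * (real n)\<^sup>2) = x * (real d)\<^sup>2" by (simp add: x_def power2_eq_square power3_eq_cube)
  have rate: "rate \<alpha> n d \<rho> = min e1 (real d / real n) + min e2 (x * (real d)\<^sup>2)"
    unfolding rate_def e1_def e2_def d3 x_def[symmetric] ..
  have tn: "t / real n \<le> e1" "t / real n \<le> real d / real n"
    unfolding e1[symmetric] using nn dd by (auto intro!: divide_right_mono simp: t)
  have "t\<^sup>2 \<le> w\<^sup>2" "t\<^sup>2 \<le> (real d)\<^sup>2" using t0 dd by (auto intro!: power_mono simp: t)
  hence tx: "x * t\<^sup>2 \<le> e2" "x * t\<^sup>2 \<le> x * (real d)\<^sup>2"
    unfolding e2[symmetric] using x by (auto intro!: mult_left_mono)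
  show "t / real n + x * t\<^sup>2 \<le> rate \<alpha> n d \<rho>" unfolding rate using tn tx by (intro add_mono) auto
  have e0: "e1 > 0" "e2 > 0" unfolding e1_def e2_def using nn x by auto
  consider "t = real d / 2" "real d / 2 \<le> u" "real d / 2 \<le> w" | "t = u" "u \<le> real d / 2" | "t = w" "w \<le> real d / 2"
    unfolding t by linarith
  thus "real d / real n + x * (real d)\<^sup>2 \<le> 4 * rate \<alpha> n d \<rho> \<or> t powr (- (2 * \<alpha> + 1)) \<le> rate \<alpha> n d \<rho>"
  proof cases
    case 1
    have "real d / 2 / real n \<le> u / real n" using 1 nn by (intro divide_right_mono) auto
    hence 2: "real d / real n \<le> 2 * e1" unfolding e1 by simp
    have "(real d / 2)\<^sup>2 \<le> w\<^sup>2" using 1 by (intro power_mono) auto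
    hence "x * (real d / 2)\<^sup>2 \<le> x * w\<^sup>2" using x by (intro mult_left_mono) auto
    hence 3: "x * (real d)\<^sup>2 \<le> 4 * e2" unfolding e2 by (simp add: power_divide)
    have below_min: "v \<le> 4 * min e v" if "0 \<le> v" "v \<le> 4 * e" for v e :: real using that by (simp add: min_def)
    have "real d / real n \<ge> 0" "x * (real d)\<^sup>2 \<ge> 0" using x by auto
    hence "real d / real n \<le> 4 * min e1 (real d / real n)" "x * (real d)\<^sup>2 \<le> 4 * min e2 (x * (real d)\<^sup>2)"
      using 2 3 e0 by (intro below_min; linarith)+
    thus ?thesis unfolding rate distrib_left by (intro disjI1 add_mono)
  next
    case 2
    have "e1 \<le> real d / real n" unfolding e1[symmetric] using 2 nn dd by (intro divide_right_mono) auto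
    hence "e1 \<le> rate \<alpha> n d \<rho>" unfolding rate using e0 x by (simp add: min_def)
    thus ?thesis using 2 u1 by simp
  next
    case 3
    have "w\<^sup>2 \<le> (real d)\<^sup>2" using 3 uw by (intro power_mono) auto
    hence "e2 \<le> x * (real d)\<^sup>2" unfolding e2[symmetric] using x by (intro mult_left_mono) auto
    hence "e2 \<le> rate \<alpha> n d \<rho>" unfolding rate using e0 dd nn by (simp add: min_def)
    thus ?thesis using 3 w1 by simp
  qed
qed

text \<open>The budget may be as large as \<open>\<rho>max\<close>, which could make the quotient small; for \<open>n \<ge> \<rho>max\<^sup>2\<close> one still has
\<open>\<rho> \<le> sqrt n\<close>.\<close>
lemma log_factor:
  fixes \<rho> \<rho>max :: real and n d :: nat
  assumes n: "n \<ge> 3" "real n \<ge> \<rho>max\<^sup>2" and \<rho>: "0 < \<rho>" "\<rho> \<le> \<rho>max" and d: "d \<ge> 1"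
  defines "\<Lambda> \<equiv> ln (exp 1 * real d * real n / \<rho>)"
  shows "\<Lambda> \<ge> 1" "ln (real n) \<le> 2 * \<Lambda>" "ln (real d) \<le> \<Lambda>"
proof -
  have nn: "real n > 0" "real d \<ge> 1" using n d by auto
  have "\<rho>\<^sup>2 \<le> \<rho>max\<^sup>2" using \<rho> by (intro power_mono) auto
  hence "\<rho>\<^sup>2 \<le> real n" using n by linarith
  hence "ln (\<rho>\<^sup>2) \<le> ln (real n)" using \<rho> by (intro ln_mono) auto
  hence lr: "2 * ln \<rho> \<le> ln (real n)" using \<rho> by (simp add: ln_realpow)
  have "\<Lambda> = 1 + ln (real d) + ln (real n) - ln \<rho>" unfolding \<Lambda>_def using nn \<rho> by (simp add: ln_div ln_mult)
  hence L: "\<Lambda> \<ge> 1 + ln (real d) + ln (real n) / 2" using lr by linarith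
  have "ln (real d) \<ge> 0" "ln (real n) \<ge> 0" using nn n by auto
  thus "\<Lambda> \<ge> 1" "ln (real n) \<le> 2 * \<Lambda>" "ln (real d) \<le> \<Lambda>" using L by linarith+
qed

lemma pad_facts:
  assumes k0: "k0 \<ge> 1" and d: "d \<ge> 1"
  shows "pad_exp d k0 \<noteq> 0 \<Longrightarrow> 2 ^ (pad_exp d k0 - 1) * k0 < d"
    "real (pad_dim d k0) \<le> 2 * real d + real k0"
proof -
  show 1: "2 ^ (pad_exp d k0 - 1) * k0 < d" if "pad_exp d k0 \<noteq> 0"
  proof (rule ccontr)
    assume "\<not> 2 ^ (pad_exp d k0 - 1) * k0 < d"
    hence "d \<le> 2 ^ (pad_exp d k0 - 1) * k0" by simp
    hence "pad_exp d k0 \<le> pad_exp d k0 - 1" unfolding pad_exp_def by (rule Least_le)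
    thus False using that by simp
  qed
  have "pad_dim d k0 \<le> 2 * d + k0"
  proof (cases "pad_exp d k0 = 0")
    case False
    then obtain j where j: "pad_exp d k0 = Suc j" by (cases "pad_exp d k0") auto
    thus ?thesis using 1[OF False] unfolding pad_dim_def by simp
  qed (simp add: pad_dim_def)
  thus "real (pad_dim d k0) \<le> 2 * real d + real k0" by linarith
qed

text \<open>The rank \<open>r\<close> minimizes \<open>a\<^sup>2 / r + r / n + y * r\<^sup>2\<close>. Subtracting \<open>a\<^sup>2 / k\<close> from both sides of the comparison
with another \<open>s\<close> gives the energy factor \<open>1 / r - 1 / k\<close> that appears in \<open>unselected_energy\<close>. The
factor \<open>L\<^sup>2\<close> and the squared logarithm in \<open>\<tau>\<^sup>2\<close> are each of order \<open>\<Lambda>\<^sup>2\<close>.\<close>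
lemma outer_risk_le:
  fixes K C CG a \<rho>k \<Lambda> y :: real and n k :: nat
  assumes k: "k \<ge> 1" and n: "n \<ge> 2" and K: "K > 0" and C: "C > 0" and \<rho>k: "\<rho>k > 0"
    and \<Lambda>: "\<Lambda> \<ge> 1" "ln (real n) \<le> 2 * \<Lambda>" "ln (real k) \<le> \<Lambda>" and a: "a\<^sup>2 \<le> CG\<^sup>2"
    and y: "real k / (\<rho>k * (real n)\<^sup>2) = y"
    and s: "s \<in> {1..k}"
  defines "L \<equiv> C * K\<^sup>2 * ln (real n)"
  defines "W \<equiv> 34 * (56 * C\<^sup>2 * K ^ 4 + (64 * K ^ 4 + 4)\<^sup>2) + CG\<^sup>2 + 9232 * C\<^sup>2 * K ^ 4 + 4"
  shows "outer_risk K L n a \<rho>k k \<le> real k * (W * \<Lambda> ^ 4 * (a\<^sup>2 * (1 / real s - 1 / real k) + real s / real n + y * (real s)\<^sup>2))"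
proof -
  define r where "r = peel_rank n k a \<rho>k"
  have r: "1 \<le> r" "r \<le> k" using peel_rank_in[OF k, of n a \<rho>k] by (auto simp: r_def)
  have nn: "real n > 0" and rr: "real r \<ge> 1" "real r > 0" and kk: "real k \<ge> 1" "real k > 0" using n r k by auto
  have y0: "y \<ge> 0" unfolding y[symmetric] using \<rho>k by simp
  have ln0: "ln (real n) \<ge> 0" "ln (real k) \<ge> 0" using n k by auto
  have inv: "1 / real k \<le> 1 / real r" using r by (intro divide_left_mono) auto
  have L0: "L \<ge> 0" unfolding L_def using C ln0 by simp
  have "L \<le> C * K\<^sup>2 * (2 * \<Lambda>)" unfolding L_def using C \<Lambda> by (intro mult_left_mono) auto
  hence "L\<^sup>2 \<le> (C * K\<^sup>2 * (2 * \<Lambda>))\<^sup>2" using L0 by (intro power_mono) auto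
  also have "\<dots> = 4 * C\<^sup>2 * K ^ 4 * \<Lambda>\<^sup>2" by (simp add: power_mult_distrib power_mult[symmetric])
  finally have L2: "L\<^sup>2 \<le> 4 * C\<^sup>2 * K ^ 4 * \<Lambda>\<^sup>2" .
  define CK where "CK = C\<^sup>2 * K ^ 4"
  have CK: "CK \<ge> 0" by (simp add: CK_def)
  have L2: "L\<^sup>2 \<le> 4 * CK * \<Lambda>\<^sup>2" using L2 by (simp add: CK_def mult_ac)
  have P34: "\<Lambda> ^ 3 \<le> \<Lambda> ^ 4" "\<Lambda>\<^sup>2 \<le> \<Lambda> ^ 4" "1 \<le> \<Lambda> ^ 4" using \<Lambda> by (auto intro!: power_increasing one_le_power)
  define q where "q = 2 * L\<^sup>2 * (ln (2 * (real k)\<^sup>2 * real n) + 2) / real n"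
  have lq: "ln (2 * (real k)\<^sup>2 * real n) + 2 \<le> 7 * \<Lambda>"
  proof -
    have "ln (2 * (real k)\<^sup>2 * real n) = ln 2 + 2 * ln (real k) + ln (real n)"
      using kk nn by (simp add: ln_mult ln_realpow)
    moreover have "ln (2::real) \<le> 1" using ln_2_less_1 by simp
    ultimately show ?thesis using \<Lambda> by linarith
  qed
  have lq0: "ln (2 * (real k)\<^sup>2 * real n) + 2 \<ge> 0"
  proof -
    have "ln (2 * (real k)\<^sup>2 * real n) = ln 2 + 2 * ln (real k) + ln (real n)"
      using kk nn by (simp add: ln_mult ln_realpow)
    thus ?thesis using ln0 by simp
  qed
  have qn: "q \<le> 56 * CK * \<Lambda> ^ 4 / real n"
  proof -
    have "2 * L\<^sup>2 * (ln (2 * (real k)\<^sup>2 * real n) + 2) \<le> 2 * (4 * CK * \<Lambda>\<^sup>2) * (7 * \<Lambda>)"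
      using L2 lq lq0 CK by (intro mult_mono mult_left_mono) auto
    also have "\<dots> = 56 * CK * \<Lambda> ^ 3" by (simp add: power2_eq_square power3_eq_cube)
    also have "\<dots> \<le> 56 * CK * \<Lambda> ^ 4" using P34 CK by (intro mult_left_mono) auto
    finally show ?thesis unfolding q_def using nn by (intro divide_right_mono) auto
  qed
  define B where "B = (64 * K ^ 4 + 4)\<^sup>2"
  have B0: "B \<ge> 0" by (simp add: B_def)
  have krn: "real (k * r) / (\<rho>k * (real n)\<^sup>2) = y * real r" unfolding y[symmetric] by simp
  have sig: "(peel_sigma n L k r \<rho>k)\<^sup>2 = 4 * L\<^sup>2 * (y * real r)"
    unfolding peel_sigma_def krn[symmetric] using \<rho>k by simp
  define \<tau> where "\<tau> = 4 * L / real n * sqrt (real (k * r) / \<rho>k) * ln (real k ^ 4 * real n)"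
  define l4 where "l4 = ln (real k ^ 4 * real n)"
  have l4: "0 \<le> l4" "l4 \<le> 6 * \<Lambda>"
  proof -
    have "l4 = 4 * ln (real k) + ln (real n)" unfolding l4_def using kk nn by (simp add: ln_mult ln_realpow)
    thus "0 \<le> l4" "l4 \<le> 6 * \<Lambda>" using ln0 \<Lambda> by auto
  qed
  have tau: "\<tau>\<^sup>2 = 16 * L\<^sup>2 * (y * real r) * l4\<^sup>2"
  proof -
    have "\<tau>\<^sup>2 = 16 * L\<^sup>2 / (real n)\<^sup>2 * (real (k * r) / \<rho>k) * l4\<^sup>2"
      unfolding \<tau>_def l4_def[symmetric] using \<rho>k by (simp add: power_mult_distrib power_divide del: of_nat_mult)
    also have "\<dots> = 16 * L\<^sup>2 * (real (k * r) / (\<rho>k * (real n)\<^sup>2)) * l4\<^sup>2" by (simp add: field_simps)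
    finally show ?thesis unfolding krn .
  qed
  define Y where "Y = y * (real r)\<^sup>2"
  have Y0: "Y \<ge> 0" unfolding Y_def using y0 by simp
  define V where "V = a\<^sup>2 * (1 / real r - 1 / real k)"
  have V0: "V \<ge> 0" unfolding V_def using inv by simp
  have T1: "34 * real r * (q + B / real n) \<le> 34 * (56 * CK + B) * \<Lambda> ^ 4 * (real r / real n)"
  proof -
    have "B / real n \<le> B * \<Lambda> ^ 4 / real n" using B0 P34 nn by (intro divide_right_mono) (auto simp: mult_le_cancel_left1)
    hence "q + B / real n \<le> (56 * CK + B) * \<Lambda> ^ 4 / real n" using qn by (simp add: distrib_right add_divide_distrib)
    hence "34 * real r * (q + B / real n) \<le> 34 * real r * ((56 * CK + B) * \<Lambda> ^ 4 / real n)" by (intro mult_left_mono) auto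
    thus ?thesis by (simp add: mult_ac)
  qed
  have T2: "real r * (4 * L\<^sup>2 * (y * real r)) \<le> 16 * CK * \<Lambda> ^ 4 * Y"
  proof -
    have "4 * L\<^sup>2 \<le> 16 * CK * \<Lambda> ^ 4"
    proof -
      have "4 * L\<^sup>2 \<le> 16 * CK * \<Lambda>\<^sup>2" using L2 by simp
      also have "\<dots> \<le> 16 * CK * \<Lambda> ^ 4" using P34 CK by (intro mult_left_mono) auto
      finally show ?thesis .
    qed
    hence "4 * L\<^sup>2 * Y \<le> 16 * CK * \<Lambda> ^ 4 * Y" using Y0 by (rule mult_right_mono)
    thus ?thesis by (simp add: Y_def power2_eq_square mult_ac)
  qed
  have T3: "4 * real r * (16 * L\<^sup>2 * (y * real r) * l4\<^sup>2) \<le> 9216 * CK * \<Lambda> ^ 4 * Y"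
  proof -
    have "l4\<^sup>2 \<le> (6 * \<Lambda>)\<^sup>2" using l4 by (intro power_mono) auto
    hence "64 * L\<^sup>2 * l4\<^sup>2 \<le> 64 * (4 * CK * \<Lambda>\<^sup>2) * (6 * \<Lambda>)\<^sup>2" using L2 CK by (intro mult_mono mult_left_mono) auto
    also have "\<dots> = 9216 * CK * \<Lambda> ^ 4" by (simp add: power2_eq_square power4_eq_xxxx)
    finally have "64 * L\<^sup>2 * l4\<^sup>2 * Y \<le> 9216 * CK * \<Lambda> ^ 4 * Y" using Y0 by (rule mult_right_mono)
    thus ?thesis by (simp add: Y_def power2_eq_square mult_ac)
  qed
  have T4: "a\<^sup>2 / real n \<le> CG\<^sup>2 * \<Lambda> ^ 4 * (real r / real n)"
  proof -
    have "a\<^sup>2 \<le> CG\<^sup>2 * 1 * 1" using a by simp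
    also have "\<dots> \<le> CG\<^sup>2 * \<Lambda> ^ 4 * real r" using P34 rr by (intro mult_mono mult_left_mono) auto
    finally have "a\<^sup>2 / real n \<le> CG\<^sup>2 * \<Lambda> ^ 4 * real r / real n" using nn by (intro divide_right_mono) auto
    thus ?thesis by simp
  qed
  have T5: "4 * V \<le> 4 * \<Lambda> ^ 4 * V"
  proof -
    have "4 * 1 * V \<le> 4 * \<Lambda> ^ 4 * V" using P34 V0 by (intro mult_right_mono mult_left_mono) auto
    thus ?thesis by simp
  qed
  have W: "W = 34 * (56 * CK + B) + CG\<^sup>2 + 9232 * CK + 4" unfolding W_def CK_def B_def by (simp add: mult_ac)
  have rn0: "real r / real n \<ge> 0" by simp
  define E where "E = \<Lambda> ^ 4"
  have E0: "E \<ge> 0" unfolding E_def using P34 by linarith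
  have "outer_risk K L n a \<rho>k k = real k * (34 * real r * (q + B / real n) + real r * (4 * L\<^sup>2 * (y * real r)) + 4 * real r * (16 * L\<^sup>2 * (y * real r) * l4\<^sup>2) + 4 * V + a\<^sup>2 / real n)"
    unfolding outer_risk_def Let_def r_def[symmetric] \<tau>_def[symmetric] q_def[symmetric] B_def[symmetric] sig tau V_def
    using kk rr nn by (simp add: field_simps)
  also have "\<dots> \<le> real k * (34 * (56 * CK + B) * E * (real r / real n) + 16 * CK * E * Y + 9216 * CK * E * Y + 4 * E * V + CG\<^sup>2 * E * (real r / real n))"
    unfolding E_def using T1 T2 T3 T4 T5 by (intro mult_left_mono add_mono) auto
  also have "\<dots> \<le> real k * (W * E * (V + real r / real n + Y))"
  proof (intro mult_left_mono)
    have "0 \<le> (CG\<^sup>2 + 9232 * CK + 34 * (56 * CK + B)) * (E * V)" using CK B0 E0 V0 by (intro mult_nonneg_nonneg add_nonneg_nonneg) auto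
    moreover have "0 \<le> (9232 * CK + 4) * (E * (real r / real n))" using CK E0 rn0 by (intro mult_nonneg_nonneg add_nonneg_nonneg) auto
    moreover have "0 \<le> (34 * (56 * CK + B) + CG\<^sup>2 + 4) * (E * Y)" using CK B0 E0 Y0 by (intro mult_nonneg_nonneg add_nonneg_nonneg) auto
    moreover have "W * E * (V + real r / real n + Y) = 
      (34 * (56 * CK + B) * E * (real r / real n) + 16 * CK * E * Y + 9216 * CK * E * Y + 4 * E * V + CG\<^sup>2 * E * (real r / real n))
      + (CG\<^sup>2 + 9232 * CK + 34 * (56 * CK + B)) * (E * V) + (9232 * CK + 4) * (E * (real r / real n)) + (34 * (56 * CK + B) + CG\<^sup>2 + 4) * (E * Y)"
      unfolding W by (simp add: algebra_simps)
    ultimately show "34 * (56 * CK + B) * E * (real r / real n) + 16 * CK * E * Y + 9216 * CK * E * Y + 4 * E * V + CG\<^sup>2 * E * (real r / real n) \<le> W * E * (V + real r / real n + Y)"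
      by linarith
  qed simp
  also have "\<dots> \<le> real k * (W * E * (a\<^sup>2 * (1 / real s - 1 / real k) + real s / real n + y * (real s)\<^sup>2))"
  proof (intro mult_left_mono)
    have ky: "real k * u / (\<rho>k * (real n)\<^sup>2) = y * u" for u unfolding y[symmetric] by simp
    have "a\<^sup>2 / real r + real r / real n + y * (real r)\<^sup>2 \<le> a\<^sup>2 / real s + real s / real n + y * (real s)\<^sup>2"
      using peel_rank_le[OF s, where a=a and \<rho>=\<rho>k and n=n] unfolding r_def[symmetric] ky .
    thus "V + real r / real n + Y \<le> a\<^sup>2 * (1 / real s - 1 / real k) + real s / real n + y * (real s)\<^sup>2"
      unfolding V_def Y_def by (simp add: right_diff_distrib)
    show "0 \<le> W * E" unfolding W using CK B0 E0 by (intro mult_nonneg_nonneg add_nonneg_nonneg) auto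
  qed simp
  finally show ?thesis unfolding E_def .
qed

lemma center_risk_le:
  fixes K C1 \<rho> \<Lambda> :: real and n k0 N :: nat
  assumes k0: "k0 \<ge> 1" and n: "n \<ge> 2" and K: "K > 0" and C1: "C1 > 0" and \<rho>: "\<rho> > 0" and N: "N \<ge> 1"
    and \<Lambda>: "\<Lambda> \<ge> 1" "ln (real n) \<le> 2 * \<Lambda>"
  defines "D \<equiv> N * k0"
  shows "real N * center_risk K C1 n \<rho> k0 D \<le> real D * ((64 * K ^ 4 + (64 * K ^ 4 + 4)\<^sup>2) * (real k0 / real n) + 1296 * K ^ 4 * C1\<^sup>2 * \<Lambda>\<^sup>2 * (real D / (\<rho> * (real n)\<^sup>2) * (real k0)\<^sup>2))"
proof -
  have kk: "real k0 \<ge> 1" and nn: "real n > 0" and NN: "real N > 0" using k0 n N by auto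
  have ln0: "ln (real n) \<ge> 0" using n by simp
  have DN: "D div k0 = N" unfolding D_def using k0 by simp
  have Dr: "real D = real N * real k0" unfolding D_def by simp
  define R where "R = K * sqrt (C1 * (real k0 + ln (real n)))"
  have "R ^ 4 = (R\<^sup>2)\<^sup>2" by (simp add: power_mult[symmetric])
  also have "R\<^sup>2 = K\<^sup>2 * (C1 * (real k0 + ln (real n)))" unfolding R_def using C1 ln0 by (simp add: power_mult_distrib)
  also have "(K\<^sup>2 * (C1 * (real k0 + ln (real n))))\<^sup>2 = K ^ 4 * C1\<^sup>2 * (real k0 + ln (real n))\<^sup>2"
    by (simp add: power_mult_distrib power_mult[symmetric])
  finally have R4: "R ^ 4 = K ^ 4 * C1\<^sup>2 * (real k0 + ln (real n))\<^sup>2" .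
  have "real k0 + ln (real n) \<le> real k0 * (3 * \<Lambda>)"
  proof -
    have "real k0 * 1 + 1 * ln (real n) \<le> real k0 * \<Lambda> + real k0 * (2 * \<Lambda>)" using kk \<Lambda> ln0 by (intro add_mono mult_mono) auto
    thus ?thesis by (simp add: algebra_simps)
  qed
  hence "(real k0 + ln (real n))\<^sup>2 \<le> (real k0 * (3 * \<Lambda>))\<^sup>2" using ln0 by (intro power_mono) auto
  hence R4le: "R ^ 4 \<le> K ^ 4 * C1\<^sup>2 * (9 * \<Lambda>\<^sup>2 * (real k0)\<^sup>2)" unfolding R4 by (intro mult_left_mono) (auto simp: power_mult_distrib mult_ac)
  have "real N * center_risk K C1 n \<rho> k0 D = real D * ((64 * K ^ 4 + (64 * K ^ 4 + 4)\<^sup>2) * (real k0 / real n) + 144 * R ^ 4 * (real D / (\<rho> * (real n)\<^sup>2)))"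
    unfolding center_risk_def DN R_def[symmetric] Dr using kk nn NN \<rho> by (simp add: field_simps power2_eq_square)
  also have "\<dots> \<le> real D * ((64 * K ^ 4 + (64 * K ^ 4 + 4)\<^sup>2) * (real k0 / real n) + 144 * (K ^ 4 * C1\<^sup>2 * (9 * \<Lambda>\<^sup>2 * (real k0)\<^sup>2)) * (real D / (\<rho> * (real n)\<^sup>2)))"
    using R4le \<rho> by (intro mult_left_mono add_left_mono mult_right_mono) auto
  finally show ?thesis by (simp add: mult_ac)
qed

text \<open>The two summands come from the center and from the outer blocks; \<open>2 + c_up\<close> bounds the ratio of the padded
dimension to \<open>d\<close>.\<close>
definition rate_const :: "real \<Rightarrow> real \<Rightarrow> real \<Rightarrow> real \<Rightarrow> real \<Rightarrow> real \<Rightarrow> real \<Rightarrow> real" where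
  "rate_const \<alpha> K C C1 CG c_lo c_up =
     4 * (2 + c_up) * ((64 * K ^ 4 + (64 * K ^ 4 + 4)\<^sup>2) * c_up + 1296 * K ^ 4 * C1\<^sup>2 * ((2 + c_up) * c_up\<^sup>2))
     + 6 * (2 + c_up) * (34 * (56 * C\<^sup>2 * K ^ 4 + (64 * K ^ 4 + 4)\<^sup>2) + CG\<^sup>2 + 9232 * C\<^sup>2 * K ^ 4 + 4)
         * (16 * (2 + c_up) + CG\<^sup>2 * c_lo powr (- (2 * \<alpha> + 1)) + c_up + 4 * (2 + c_up) * c_up\<^sup>2)"

text \<open>At each scale the outer blocks have total side of order \<open>d\<close>, and \<open>y\<close>, the ratio of \<open>k\<close> to the budget
of a block times \<open>n\<^sup>2\<close>, is the same for all scales. In the first case of \<open>target_rate\<close> the rank is compared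
with \<open>k\<close>, so that the term with \<open>a\<^sup>2\<close> vanishes; in the second case with \<open>k0\<close>. The number of scales and
the division of the budget by it contribute one factor \<open>\<Lambda>\<close> each.\<close>
lemma risk_rate:
  fixes \<alpha> K C C1 CG c_lo c_up M \<rho> \<rho>max :: real and n d k0 :: nat
  assumes \<alpha>: "\<alpha> > 0" and K: "K > 0" and CG: "CG > 0" and C: "C > 0" and C1: "C1 > 0" and c_lo: "c_lo > 0" and c_up: "c_up > 0"
    and n: "n \<ge> 3" "real n \<ge> \<rho>max\<^sup>2" and \<rho>: "0 < \<rho>" "\<rho> \<le> \<rho>max" and d: "d \<ge> 1"
    and k0: "k0 \<ge> 1" "c_lo * k0_target \<alpha> n d \<rho> \<le> real k0" "real k0 \<le> c_up * k0_target \<alpha> n d \<rho>"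
  defines "\<Lambda> \<equiv> ln (exp 1 * real d * real n / \<rho>)"
  shows "total_risk \<alpha> K C C1 CG n d \<rho> k0 \<le> rate_const \<alpha> K C C1 CG c_lo c_up * \<Lambda> ^ 6 * rate \<alpha> n d \<rho>"
proof -
  define D where "D = pad_dim d k0"
  define t where "t = k0_target \<alpha> n d \<rho>"
  define x where "x = real d / (\<rho> * (real n)\<^sup>2)"
  define Rt where "Rt = rate \<alpha> n d \<rho>"
  define cD where "cD = 2 + c_up"
  define J where "J = pad_exp d k0"
  have DJ: "D = 2 ^ J * k0" by (simp add: D_def J_def pad_dim_def)
  have nn: "real n > 0" and dd: "real d > 0" using n d by auto
  have n1: "n \<ge> 1" "n \<ge> 2" using n by auto
  have x: "x > 0" unfolding x_def using \<rho> nn dd by simp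
  note tr = target_rate[OF \<alpha> \<rho>(1) n1(1) d, folded t_def x_def Rt_def]
  have t0: "t > 0" by (rule tr(1))
  have tn0: "t / real n \<ge> 0" "x * t\<^sup>2 \<ge> 0" using t0 x nn by auto
  have tn: "t / real n \<le> Rt" "x * t\<^sup>2 \<le> Rt" using tr(2) tn0 by linarith+
  have Rt0: "Rt \<ge> 0" using tn tn0 by linarith
  have kk: "real k0 \<ge> 1" using k0 by simp
  have ku: "real k0 \<le> c_up * t" "c_lo * t \<le> real k0" using k0 by (auto simp: t_def)
  note lf = log_factor[OF n \<rho> d, folded \<Lambda>_def]
  have \<Lambda>: "\<Lambda> \<ge> 1" by (rule lf(1))
  have td: "t \<le> real d / 2" unfolding t_def k0_target_def by simp
  have cD: "cD \<ge> 2" using c_up by (simp add: cD_def)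
  have Dd: "real D \<le> cD * real d"
  proof -
    have "c_up * t \<le> c_up * (real d / 2)" using td c_up by (intro mult_left_mono) auto
    also have "\<dots> \<le> c_up * real d" using dd c_up by simp
    finally have "real k0 \<le> c_up * real d" using ku by linarith
    thus ?thesis using pad_facts(2)[OF k0(1) d] unfolding D_def cD_def by (simp add: algebra_simps)
  qed
  have Dx: "real D / (\<rho> * (real n)\<^sup>2) \<le> cD * x"
  proof -
    have "real D / (\<rho> * (real n)\<^sup>2) \<le> cD * real d / (\<rho> * (real n)\<^sup>2)" using Dd \<rho> by (intro divide_right_mono) auto
    thus ?thesis by (simp add: x_def)
  qed
  have kn: "real k0 / real n \<le> c_up * Rt"
  proof -
    have "real k0 / real n \<le> c_up * t / real n" using ku nn by (intro divide_right_mono) auto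
    also have "\<dots> = c_up * (t / real n)" by simp
    also have "\<dots> \<le> c_up * Rt" using tn c_up by (intro mult_left_mono) auto
    finally show ?thesis .
  qed
  have kx: "x * (real k0)\<^sup>2 \<le> c_up\<^sup>2 * Rt"
  proof -
    have "(real k0)\<^sup>2 \<le> (c_up * t)\<^sup>2" using ku by (intro power_mono) auto
    hence "x * (real k0)\<^sup>2 \<le> x * (c_up * t)\<^sup>2" using x by (intro mult_left_mono) auto
    also have "\<dots> = c_up\<^sup>2 * (x * t\<^sup>2)" by (simp add: power_mult_distrib)
    also have "\<dots> \<le> c_up\<^sup>2 * Rt" using tn by (intro mult_left_mono) auto
    finally show ?thesis .
  qed
  have \<Lambda>26: "\<Lambda>\<^sup>2 \<le> \<Lambda> ^ 6" "1 \<le> \<Lambda> ^ 6" using \<Lambda> by (auto intro!: power_increasing one_le_power)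
  define \<kappa> where "\<kappa> = 64 * K ^ 4 + (64 * K ^ 4 + 4)\<^sup>2"
  have \<kappa>0: "\<kappa> \<ge> 0" by (simp add: \<kappa>_def)
  have center: "2 / real d * (2 * real (D div k0) * center_risk K C1 n \<rho> k0 D)
     \<le> 4 * cD * (\<kappa> * c_up + 1296 * K ^ 4 * C1\<^sup>2 * (cD * c_up\<^sup>2)) * \<Lambda> ^ 6 * Rt"
  proof -
    have N: "D div k0 = 2 ^ J" "(1::nat) \<le> 2 ^ J" unfolding DJ using k0 by auto
    have "real (D div k0) * center_risk K C1 n \<rho> k0 D \<le> real D * (\<kappa> * (real k0 / real n) + 1296 * K ^ 4 * C1\<^sup>2 * \<Lambda>\<^sup>2 * (real D / (\<rho> * (real n)\<^sup>2) * (real k0)\<^sup>2))"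
      using center_risk_le[OF k0(1) n1(2) K C1 \<rho>(1) N(2) \<Lambda> lf(2)] unfolding N(1) DJ[symmetric] \<kappa>_def .
    also have "\<dots> \<le> real D * (\<kappa> * (c_up * Rt) * \<Lambda> ^ 6 + 1296 * K ^ 4 * C1\<^sup>2 * \<Lambda> ^ 6 * (cD * (c_up\<^sup>2 * Rt)))"
    proof (intro mult_left_mono add_mono)
      have "\<kappa> * (real k0 / real n) \<le> \<kappa> * (c_up * Rt)" by (rule mult_left_mono[OF kn \<kappa>0])
      also have "\<dots> = \<kappa> * (c_up * Rt) * 1" by simp
      also have "\<dots> \<le> \<kappa> * (c_up * Rt) * \<Lambda> ^ 6" using \<Lambda>26 \<kappa>0 c_up Rt0 by (intro mult_left_mono) auto
      finally show "\<kappa> * (real k0 / real n) \<le> \<kappa> * (c_up * Rt) * \<Lambda> ^ 6" .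
      have "real D / (\<rho> * (real n)\<^sup>2) * (real k0)\<^sup>2 \<le> cD * x * (real k0)\<^sup>2" using Dx by (intro mult_right_mono) auto
      also have "\<dots> \<le> cD * (c_up\<^sup>2 * Rt)" using kx cD by (simp add: mult.assoc mult_left_mono)
      finally have hx: "real D / (\<rho> * (real n)\<^sup>2) * (real k0)\<^sup>2 \<le> cD * (c_up\<^sup>2 * Rt)" .
      show "1296 * K ^ 4 * C1\<^sup>2 * \<Lambda>\<^sup>2 * (real D / (\<rho> * (real n)\<^sup>2) * (real k0)\<^sup>2) \<le> 1296 * K ^ 4 * C1\<^sup>2 * \<Lambda> ^ 6 * (cD * (c_up\<^sup>2 * Rt))"
        by (rule mult_mono[OF mult_left_mono[OF \<Lambda>26(1)] hx]) (use \<Lambda> \<rho> in auto)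
    qed simp
    also have "\<dots> = real D * ((\<kappa> * c_up + 1296 * K ^ 4 * C1\<^sup>2 * (cD * c_up\<^sup>2)) * \<Lambda> ^ 6 * Rt)" by (simp add: algebra_simps)
    also have "\<dots> \<le> cD * real d * ((\<kappa> * c_up + 1296 * K ^ 4 * C1\<^sup>2 * (cD * c_up\<^sup>2)) * \<Lambda> ^ 6 * Rt)"
      using Dd \<kappa>0 c_up cD Rt0 \<Lambda>26 by (intro mult_right_mono mult_nonneg_nonneg add_nonneg_nonneg) auto
    finally have "4 / real d * (real (D div k0) * center_risk K C1 n \<rho> k0 D) \<le> 4 / real d * (cD * real d * ((\<kappa> * c_up + 1296 * K ^ 4 * C1\<^sup>2 * (cD * c_up\<^sup>2)) * \<Lambda> ^ 6 * Rt))"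
      by (rule mult_left_mono) simp
    thus ?thesis using dd by (simp add: mult_ac)
  qed
  define Jm where "Jm = real (max 1 (J - 1))"
  have Jm1: "Jm \<ge> 1" by (simp add: Jm_def)
  have Jm: "Jm \<le> 2 * \<Lambda>"
  proof (cases "J - 1 \<le> 1")
    case True thus ?thesis using \<Lambda> by (simp add: Jm_def max_def)
  next
    case False
    hence "J \<noteq> 0" by auto
    from pad_facts(1)[OF k0(1) d] this have "2 ^ (J - 1) * k0 < d" by (simp add: J_def)
    moreover have "2 ^ (J - 1) * 1 \<le> 2 ^ (J - 1) * k0" using k0 by (intro mult_left_mono) auto
    ultimately have "2 ^ (J - 1) \<le> d" by linarith
    hence "(2::real) ^ (J - 1) \<le> real d" by (metis of_nat_le_iff of_nat_numeral of_nat_power)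
    hence "ln ((2::real) ^ (J - 1)) \<le> ln (real d)" using dd by (intro ln_mono) auto
    hence "real (J - 1) * ln 2 \<le> \<Lambda>" using lf(3) by (simp add: ln_realpow)
    moreover have "real (J - 1) * (1/2) \<le> real (J - 1) * ln 2" using ln2_ge_two_thirds by (intro mult_left_mono) auto
    ultimately show ?thesis using False by (simp add: Jm_def max_def)
  qed
  define W where "W = 34 * (56 * C\<^sup>2 * K ^ 4 + (64 * K ^ 4 + 4)\<^sup>2) + CG\<^sup>2 + 9232 * C\<^sup>2 * K ^ 4 + 4"
  have W0: "W \<ge> 0" unfolding W_def by (intro add_nonneg_nonneg mult_nonneg_nonneg) auto
  define cl where "cl = c_lo powr (- (2 * \<alpha> + 1))"
  define G0 where "G0 = 16 * cD + CG\<^sup>2 * cl + c_up + 4 * cD * c_up\<^sup>2"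
  have cl0: "cl \<ge> 0" by (simp add: cl_def)
  have G00: "G0 \<ge> 0" unfolding G0_def using cD c_up cl0 by (intro add_nonneg_nonneg mult_nonneg_nonneg) auto
  define sr where "sr = scale_risk \<alpha> K C CG n d \<rho> k0"
  have sr: "sr k = outer_risk K (C * K\<^sup>2 * ln (real n)) n (CG * real k powr - \<alpha>) (\<rho> / (4 * Jm * real (D div (2 * k)))) k" for k
    unfolding sr_def scale_risk_def Jm_def J_def D_def ..
  have scale: "3 * real (D div (2 * k)) * sr k
      \<le> 3 / 2 * real D * (W * \<Lambda> ^ 4 * (G0 * \<Lambda> * Rt))"
    if kS: "k \<in> outer_scales D k0" for k
  proof -
    obtain q where q: "D = 2 * k * q" "q \<ge> 2" "k \<ge> k0" using kS unfolding DJ by (rule outer_scale_dvd[OF k0(1)])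
    have k1: "k \<ge> 1" using q k0 by simp
    have kr: "real k \<ge> 1" "real k \<ge> real k0" using k1 q by auto
    have Dq: "D div (2 * k) = q" using q k1 by simp
    have qq: "real q > 0" using q by simp
    have kd: "k \<le> d"
    proof -
      obtain j where j: "k = 2 ^ j * k0" "j < J - 1" using kS unfolding DJ outer_scales_eq[OF k0(1)] by auto
      have "2 ^ j * k0 \<le> 2 ^ (J - 1) * k0" using j by (intro mult_right_mono power_increasing) auto
      also have "\<dots> < d" using pad_facts(1)[OF k0(1) d] j by (auto simp: J_def)
      finally show ?thesis using j by simp
    qed
    define \<rho>k where "\<rho>k = \<rho> / (4 * Jm * real q)"
    have \<rho>k: "\<rho>k > 0" unfolding \<rho>k_def using \<rho> Jm1 qq by (intro divide_pos_pos mult_pos_pos) auto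
    define y where "y = 2 * Jm * (real D / (\<rho> * (real n)\<^sup>2))"
    have y: "real k / (\<rho>k * (real n)\<^sup>2) = y"
      unfolding y_def \<rho>k_def q(1) using \<rho> Jm1 qq nn by (simp add: field_simps)
    have yx: "y \<le> 4 * \<Lambda> * (cD * x)"
    proof -
      have "y \<le> 2 * (2 * \<Lambda>) * (cD * x)" unfolding y_def using Jm Jm1 Dx \<rho> \<Lambda> by (intro mult_mono) auto
      thus ?thesis by simp
    qed
    have lk: "ln (real k) \<le> \<Lambda>"
    proof -
      have "ln (real k) \<le> ln (real d)" using kr kd by (intro ln_mono) auto
      thus ?thesis using lf(3) by linarith
    qed
    define a where "a = CG * real k powr - \<alpha>"
    have a0: "a \<ge> 0" unfolding a_def using CG by simp
    have ak0: "a \<le> CG * real k0 powr - \<alpha>"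
    proof -
      have "real k powr - \<alpha> \<le> real k0 powr - \<alpha>" using kr kk \<alpha> by (intro powr_mono2') auto
      thus ?thesis unfolding a_def using CG by (intro mult_left_mono) auto
    qed
    have a2: "a\<^sup>2 \<le> CG\<^sup>2"
    proof -
      have "real k powr - \<alpha> \<le> 1 powr - \<alpha>" using kr \<alpha> by (intro powr_mono2') auto
      hence "a \<le> CG * 1" unfolding a_def using CG by (intro mult_left_mono) auto
      thus ?thesis using a0 by (intro power_mono) auto
    qed
    note orl = outer_risk_le[OF k1 n1(2) K C \<rho>k \<Lambda> lf(2) lk a2 y, folded W_def]
    have "outer_risk K (C * K\<^sup>2 * ln (real n)) n a \<rho>k k \<le> real k * (W * \<Lambda> ^ 4 * (G0 * \<Lambda> * Rt))"
      using tr(3)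
    proof
      assume A: "real d / real n + x * (real d)\<^sup>2 \<le> 4 * Rt"
      have "a\<^sup>2 * (1 / real k - 1 / real k) + real k / real n + y * (real k)\<^sup>2 \<le> 4 * \<Lambda> * cD * (real d / real n) + 4 * \<Lambda> * cD * (x * (real d)\<^sup>2)"
      proof -
        have one: "1 \<le> 4 * \<Lambda> * cD"
        proof -
          have "1 * 1 \<le> (4 * \<Lambda>) * cD" using \<Lambda> cD by (intro mult_mono) auto
          thus ?thesis by simp
        qed
        have "real k / real n \<le> real d / real n" using kd nn by (intro divide_right_mono) auto
        also have "\<dots> = 1 * (real d / real n)" by simp
        also have "\<dots> \<le> 4 * \<Lambda> * cD * (real d / real n)" using one by (intro mult_right_mono) auto
        finally have 1: "real k / real n \<le> 4 * \<Lambda> * cD * (real d / real n)" .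
        have "y * (real k)\<^sup>2 \<le> 4 * \<Lambda> * (cD * x) * (real d)\<^sup>2"
          using yx kd x cD \<Lambda> by (intro mult_mono power_mono mult_nonneg_nonneg) auto
        thus ?thesis using 1 by (simp add: mult.assoc)
      qed
      also have "\<dots> = 4 * \<Lambda> * cD * (real d / real n + x * (real d)\<^sup>2)" by (simp add: distrib_left)
      also have "\<dots> \<le> 4 * \<Lambda> * cD * (4 * Rt)" using A \<Lambda> cD by (intro mult_left_mono) auto
      also have "\<dots> = 16 * cD * (\<Lambda> * Rt)" by simp
      also have "\<dots> \<le> G0 * (\<Lambda> * Rt)" unfolding G0_def using cl0 c_up cD \<Lambda> Rt0 by (intro mult_right_mono) auto
      finally have "a\<^sup>2 * (1 / real k - 1 / real k) + real k / real n + y * (real k)\<^sup>2 \<le> G0 * \<Lambda> * Rt" by (simp add: mult.assoc)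
      hence "real k * (W * \<Lambda> ^ 4 * (a\<^sup>2 * (1 / real k - 1 / real k) + real k / real n + y * (real k)\<^sup>2)) \<le> real k * (W * \<Lambda> ^ 4 * (G0 * \<Lambda> * Rt))"
        using W0 \<Lambda> by (intro mult_left_mono) auto
      moreover have "k \<in> {1..k}" using k1 by simp
      ultimately show ?thesis using orl order_trans by blast
    next
      assume B: "t powr (- (2 * \<alpha> + 1)) \<le> Rt"
      have "a\<^sup>2 * (1 / real k0 - 1 / real k) \<le> CG\<^sup>2 * cl * Rt"
      proof -
        have "a\<^sup>2 * (1 / real k0 - 1 / real k) \<le> a\<^sup>2 * (1 / real k0)" using kr by (intro mult_left_mono) auto
        also have "\<dots> \<le> (CG * real k0 powr - \<alpha>)\<^sup>2 * (1 / real k0)" using a0 ak0 by (intro mult_right_mono power_mono) auto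
        also have "\<dots> = CG\<^sup>2 * real k0 powr (- (2 * \<alpha> + 1))"
        proof -
          have "(real k0 powr - \<alpha>)\<^sup>2 * (1 / real k0) = real k0 powr - \<alpha> * real k0 powr - \<alpha> * real k0 powr (- 1)"
            using kk by (simp add: power2_eq_square powr_minus inverse_eq_divide)
          also have "\<dots> = real k0 powr (- (2 * \<alpha> + 1))" unfolding powr_add[symmetric] by simp
          finally have eq: "(real k0 powr - \<alpha>)\<^sup>2 * (1 / real k0) = real k0 powr (- (2 * \<alpha> + 1))" .
          show ?thesis unfolding power_mult_distrib mult.assoc eq ..
        qed
        also have "\<dots> \<le> CG\<^sup>2 * (c_lo * t) powr (- (2 * \<alpha> + 1))"
          using ku c_lo t0 \<alpha> by (intro mult_left_mono powr_mono2') auto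
        also have "\<dots> = CG\<^sup>2 * (cl * t powr (- (2 * \<alpha> + 1)))" unfolding cl_def using c_lo t0 by (subst powr_mult) auto
        also have "\<dots> \<le> CG\<^sup>2 * (cl * Rt)" using B cl0 by (intro mult_left_mono) auto
        finally show ?thesis by (simp add: mult.assoc)
      qed
      moreover have "y * (real k0)\<^sup>2 \<le> 4 * cD * c_up\<^sup>2 * (\<Lambda> * Rt)"
      proof -
        have "y * (real k0)\<^sup>2 \<le> 4 * \<Lambda> * (cD * x) * (real k0)\<^sup>2" using yx by (intro mult_right_mono) auto
        also have "\<dots> = 4 * \<Lambda> * cD * (x * (real k0)\<^sup>2)" by simp
        also have "\<dots> \<le> 4 * \<Lambda> * cD * (c_up\<^sup>2 * Rt)" using kx \<Lambda> cD by (intro mult_left_mono) auto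
        finally show ?thesis by (simp add: mult_ac)
      qed
      ultimately have "a\<^sup>2 * (1 / real k0 - 1 / real k) + real k0 / real n + y * (real k0)\<^sup>2 \<le> CG\<^sup>2 * cl * Rt + c_up * Rt + 4 * cD * c_up\<^sup>2 * (\<Lambda> * Rt)"
        using kn by linarith
      also have "\<dots> \<le> CG\<^sup>2 * cl * (\<Lambda> * Rt) + c_up * (\<Lambda> * Rt) + 4 * cD * c_up\<^sup>2 * (\<Lambda> * Rt)"
      proof -
        have "1 * Rt \<le> \<Lambda> * Rt" using \<Lambda> Rt0 by (intro mult_right_mono) auto
        hence "CG\<^sup>2 * cl * Rt \<le> CG\<^sup>2 * cl * (\<Lambda> * Rt)" "c_up * Rt \<le> c_up * (\<Lambda> * Rt)" using cl0 c_up by (auto intro!: mult_left_mono)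
        thus ?thesis by linarith
      qed
      also have "\<dots> \<le> G0 * (\<Lambda> * Rt)"
      proof -
        have "0 \<le> 16 * cD * (\<Lambda> * Rt)" using cD \<Lambda> Rt0 by simp
        thus ?thesis unfolding G0_def by (simp add: algebra_simps)
      qed
      finally have "a\<^sup>2 * (1 / real k0 - 1 / real k) + real k0 / real n + y * (real k0)\<^sup>2 \<le> G0 * \<Lambda> * Rt" by (simp add: mult.assoc)
      hence "real k * (W * \<Lambda> ^ 4 * (a\<^sup>2 * (1 / real k0 - 1 / real k) + real k0 / real n + y * (real k0)\<^sup>2)) \<le> real k * (W * \<Lambda> ^ 4 * (G0 * \<Lambda> * Rt))"
        using W0 \<Lambda> by (intro mult_left_mono) auto
      moreover have "k0 \<in> {1..k}" using k0(1) q(3) by simp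
      ultimately show ?thesis using orl order_trans by blast
    qed
    hence "3 * real q * outer_risk K (C * K\<^sup>2 * ln (real n)) n a \<rho>k k \<le> 3 * real q * (real k * (W * \<Lambda> ^ 4 * (G0 * \<Lambda> * Rt)))"
      by (intro mult_left_mono) auto
    also have "\<dots> = 3 / 2 * real D * (W * \<Lambda> ^ 4 * (G0 * \<Lambda> * Rt))" unfolding q(1) by simp
    finally show ?thesis unfolding sr Dq \<rho>k_def a_def .
  qed
  define H where "H = W * \<Lambda> ^ 4 * (G0 * \<Lambda> * Rt)"
  have H0: "H \<ge> 0" unfolding H_def using W0 G00 \<Lambda> Rt0 by (intro mult_nonneg_nonneg) auto
  have outer: "2 / real d * (\<Sum>k\<in>outer_scales D k0. 3 * real (D div (2 * k)) * sr k)
     \<le> 6 * cD * W * G0 * \<Lambda> ^ 6 * Rt"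
  proof -
    have "(\<Sum>k\<in>outer_scales D k0. 3 * real (D div (2 * k)) * sr k)
      \<le> (\<Sum>k\<in>outer_scales D k0. 3 / 2 * real D * H)" unfolding H_def by (intro sum_mono scale)
    also have "\<dots> = real (card (outer_scales D k0)) * (3 / 2 * real D * H)" by simp
    also have "\<dots> \<le> 2 * \<Lambda> * (3 / 2 * (cD * real d) * H)"
    proof (intro mult_mono)
      have "card (outer_scales D k0) \<le> J - 1" unfolding DJ outer_scales_eq[OF k0(1)] using card_image_le[of "{..<J - 1}"] by simp
      hence "real (card (outer_scales D k0)) \<le> Jm" unfolding Jm_def by simp
      thus "real (card (outer_scales D k0)) \<le> 2 * \<Lambda>" using Jm by linarith
    qed (use Dd H0 \<Lambda> in auto)
    finally have "2 / real d * (\<Sum>k\<in>outer_scales D k0. 3 * real (D div (2 * k)) * sr k)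
      \<le> 2 / real d * (2 * \<Lambda> * (3 / 2 * (cD * real d) * H))" by (rule mult_left_mono) simp
    also have "\<dots> = 6 * cD * \<Lambda> * H" using dd by simp
    also have "\<dots> = 6 * cD * W * G0 * \<Lambda> ^ 6 * Rt" unfolding H_def by (simp add: eval_nat_numeral mult_ac)
    finally show ?thesis .
  qed
  have rc: "rate_const \<alpha> K C C1 CG c_lo c_up = 4 * cD * (\<kappa> * c_up + 1296 * K ^ 4 * C1\<^sup>2 * (cD * c_up\<^sup>2)) + 6 * cD * W * G0"
    unfolding rate_const_def cD_def \<kappa>_def W_def G0_def cl_def ..
  show ?thesis
    using center outer unfolding total_risk_def Let_def D_def[symmetric] sr_def rc Rt_def[symmetric] by (simp only: distrib_left distrib_right)
qed

theorem theorem3p8: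
  fixes M0 M :: real
  assumes "M0 > 0" and "M > 0"
  shows "\<exists>CG0. \<forall>\<alpha>>0. \<forall>K>0. \<exists>C0 C10. \<forall>CG\<ge>CG0. \<forall>C\<ge>C0. \<forall>C1\<ge>C10.
    \<forall>c_d>0. \<forall>\<rho>_max>0. \<forall>c_lo>0. \<forall>c_up>0. \<exists>C_rate A :: real.
    \<forall>(n :: nat \<Rightarrow> nat) (d :: nat \<Rightarrow> nat) (\<rho> :: nat \<Rightarrow> real) (k0 :: nat \<Rightarrow> nat).
      filterlim n at_top sequentially \<longrightarrow>
      (\<forall>\<^sub>F m in sequentially. c_d * ln (real (n m)) \<le> real (d m)) \<longrightarrow>
      (\<forall>\<^sub>F m in sequentially. 0 < \<rho> m \<and> \<rho> m \<le> \<rho>_max) \<longrightarrow>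
      (\<lambda>m. real (d m) / (\<rho> m * (real (n m))\<^sup>2)) \<longlonglongrightarrow> 0 \<longrightarrow>
      (\<forall>\<^sub>F m in sequentially. 1 \<le> k0 m \<and>
         c_lo * k0_target \<alpha> (n m) (d m) (\<rho> m) \<le> real (k0 m) \<and>
         real (k0 m) \<le> c_up * k0_target \<alpha> (n m) (d m) (\<rho> m)) \<longrightarrow>
      (\<forall>\<^sub>F m in sequentially.
         zCDP (n m) (d m) (\<rho> m) (peel_estimator \<alpha> K M0 C C1 CG (n m) (d m) (\<rho> m) (k0 m)) \<and>
         (SUP P\<in>class_P (d m) \<alpha> K M0 M.
            frob_risk (n m) (d m) (peel_estimator \<alpha> K M0 C C1 CG (n m) (d m) (\<rho> m) (k0 m)) P)
         \<le> ennreal (C_rate * ln (exp 1 * real (d m) * real (n m) / \<rho> m) powr A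
                    * rate \<alpha> (n m) (d m) (\<rho> m)))"
proof -
  have main: "zCDP n d \<rho> (peel_estimator \<alpha> K M0 C C1 CG n d \<rho> k0) \<and>
      (SUP P\<in>class_P d \<alpha> K M0 M. frob_risk n d (peel_estimator \<alpha> K M0 C C1 CG n d \<rho> k0) P)
      \<le> ennreal (rate_const \<alpha> K C C1 CG c_lo c_up * ln (exp 1 * real d * real n / \<rho>) powr 6 * rate \<alpha> n d \<rho>)"
    if par: "\<alpha> > 0" "K > 0" "CG \<ge> M" "C \<ge> 4" "C1 \<ge> 8" "c_lo > 0" "c_up > 0"
      and n_large: "n \<ge> 3" "real n \<ge> \<rho>_max\<^sup>2" and \<rho>: "0 < \<rho>" "\<rho> \<le> \<rho>_max"
      and k0: "1 \<le> k0" "c_lo * k0_target \<alpha> n d \<rho> \<le> real k0" "real k0 \<le> c_up * k0_target \<alpha> n d \<rho>"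
    for \<alpha> K CG C C1 c_lo c_up \<rho>_max \<rho> :: real and n d k0 :: nat
  proof
    \<comment> \<open>The target size is at most \<open>d / 2\<close>, and \<open>k0 \<ge> 1\<close> is at most a multiple of it.\<close>
    have d: "d \<ge> 1"
    proof (rule ccontr)
      assume "\<not> d \<ge> 1"
      hence "k0_target \<alpha> n d \<rho> \<le> 0" by (simp add: k0_target_def)
      hence "c_up * k0_target \<alpha> n d \<rho> \<le> 0" using par by (simp add: mult_le_0_iff)
      thus False using k0 by simp
    qed
    show "zCDP n d \<rho> (peel_estimator \<alpha> K M0 C C1 CG n d \<rho> k0)"
      by (rule peel_estimator_zCDP) (use assms par n_large \<rho> k0 d in auto)
    show "(SUP P\<in>class_P d \<alpha> K M0 M. frob_risk n d (peel_estimator \<alpha> K M0 C C1 CG n d \<rho> k0) P)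
      \<le> ennreal (rate_const \<alpha> K C C1 CG c_lo c_up * ln (exp 1 * real d * real n / \<rho>) powr 6 * rate \<alpha> n d \<rho>)"
    proof (rule SUP_least)
      fix P assume P: "P \<in> class_P d \<alpha> K M0 M"
      interpret prob_space P using P by (simp add: class_P_def)
      interpret peel_model P d K \<alpha> M0 M n
        by unfold_locales (use P par assms n_large d in \<open>auto simp: class_P_def\<close>)
      have \<Lambda>: "ln (exp 1 * real d * real n / \<rho>) \<ge> 1" by (rule log_factor(1)[OF n_large \<rho> d])
      note risk_bound[OF k0(1) \<rho>(1) par(3,4,5)]
      also have "ennreal (total_risk \<alpha> K C C1 CG n d \<rho> k0)
         \<le> ennreal (rate_const \<alpha> K C C1 CG c_lo c_up * ln (exp 1 * real d * real n / \<rho>) ^ 6 * rate \<alpha> n d \<rho>)"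
        by (intro ennreal_leI risk_rate[OF par(1,2) _ _ _ par(6,7) n_large \<rho> d k0]) (use assms par in auto)
      also have "ln (exp 1 * real d * real n / \<rho>) ^ 6 = ln (exp 1 * real d * real n / \<rho>) powr 6"
        using \<Lambda> by (subst powr_numeral) auto
      finally show "frob_risk n d (peel_estimator \<alpha> K M0 C C1 CG n d \<rho> k0) P
        \<le> ennreal (rate_const \<alpha> K C C1 CG c_lo c_up * ln (exp 1 * real d * real n / \<rho>) powr 6 * rate \<alpha> n d \<rho>)" .
    qed
  qed
  show ?thesis
  proof (rule exI[of _ M], intro allI impI, rule exI[of _ 4], rule exI[of _ 8], intro allI impI, goal_cases)
    case (1 \<alpha> K CG C C1 c_d \<rho>_max c_lo c_up)
    show ?case
    proof (rule exI[of _ "rate_const \<alpha> K C C1 CG c_lo c_up"], rule exI[of _ 6], intro allI impI, goal_cases)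
      case (1 n d \<rho> k0)
      \<comment> \<open>Eventually \<open>n \<ge> 3\<close> and \<open>n \<ge> \<rho>_max\<^sup>2\<close>, as required by \<open>log_factor\<close>.\<close>
      have "\<forall>\<^sub>F m in sequentially. n m \<ge> max 3 (nat \<lceil>\<rho>_max\<^sup>2\<rceil>)"
        using 1(1) unfolding filterlim_at_top by (rule spec)
      with 1(3,5) show ?case
      proof eventually_elim
        case (elim m)
        hence "real (n m) \<ge> \<rho>_max\<^sup>2" by linarith
        with elim show ?case using \<open>\<alpha> > 0\<close> \<open>K > 0\<close> \<open>CG \<ge> M\<close> \<open>C \<ge> 4\<close> \<open>C1 \<ge> 8\<close> \<open>c_lo > 0\<close> \<open>c_up > 0\<close>
          by (intro main[where \<rho>_max=\<rho>_max]) auto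
      qed
    qed
  qed
qed

end
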